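(* Let $(B,h_B)$ be a compact $n$-dimensional Ricci-flat Riemannian manifold, and let $N:=B\times S^1$ with $h:=h_B\oplus du^2$ and $\eta:=du$, where $u$ is the coordinate on $S^1$. Choose $\omega\in H^1_{\mathrm{dR}}(B)\cap H^1(B,\mathbb Z)$ and a representative $\alpha\in\omega$, consider the $S^1$-bundle $\pi:M\to N$ with $c_1(M)=[\alpha\wedge\eta]$, and choose $\Psi:=\alpha\wedge\eta$ and $f:=\widehat f\circ\pi\in C^\infty(M)$, where $\widehat f:=f_B\cdot f_{S^1}$ with $f_B\in C^\infty(B)$ and $f_{S^1}\in C^\infty(S^1)$. If $f_B$ is such that the compact Lorentzian manifold $(M^{n+2},g)$ of type $(\Psi,A,\eta,f)$ over $(N,h)$ is Ricci-flat, then $(M^{n+2},g)$ is complete. The completeness even holds for arbitrary $f_B\in C^\infty(B)$.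
   Context: All manifolds are connected, smooth and without boundary; complete means geodesically complete. For 1-forms, $\beta\odot\gamma:=\tfrac12(\beta\otimes\gamma+\gamma\otimes\beta)$. Forms and functions on the factors of $N$ are identified with their pullbacks to $N$. $H^1_{\mathrm{dR}}(B)\cap H^1(B,\mathbb Z)$ denotes the de Rham classes that are integral; a representative $\alpha\in\omega$ is a closed 1-form on $B$ in the class $\omega$. Manifold of type $(\Psi,A,\eta,f)$ over $(N,h)$: let $(N^{n+1},h)$ be an $(n+1)$-dimensional Riemannian manifold, $\omega'\in H^2(N,\mathbb Z)$, and $\pi:M\to N$ the $S^1$-bundle with first Chern class $c_1(M)=\omega'$. Let $\overline\Psi\in\Omega^2(N)$ be a closed 2-form representing $\omega'$ in de Rham cohomology, $\Psi:=\pi\cdot\overline\Psi$ (with $\pi$ the number), and $A\in\Omega^1(M,i\mathbb R)$ a corresponding connection form with curvature $F^A=dA=-2i\,\pi^*\Psi$. Let $\eta\in\Omega^1(N)$ be a nowhere vanishing closed 1-form and $f\in C^\infty(M)$. Then $$g:=2iA\odot\pi^*\eta+f\cdot\pi^*\eta\odot\pi^*\eta+\pi^*h$$ is a Lorentzian metric on $M$, and $(M^{n+2},g)$ is called of type $(\Psi,A,\eta,f)$ over $(N,h)$.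
   Formalization: Since Ψ must be the number π times a representative of c₁(M), having both c₁(M)=[α∧η] and Ψ:=α∧η is inconsistent unless α is exact; here α∧η is the representative of c₁(M) and Ψ:=π·α∧η, with u of period 1. *)

theory Defs
  imports "HOL-Analysis.Analysis"
begin

section \<open>Smooth manifolds\<close>

primrec Ck_on :: "nat \<Rightarrow> 'e::euclidean_space set \<Rightarrow> ('e \<Rightarrow> 'v::real_normed_vector) \<Rightarrow> bool" where
  "Ck_on 0 S f \<longleftrightarrow> continuous_on S f"
| "Ck_on (Suc k) S f \<longleftrightarrow> (\<forall>x\<in>S. f differentiable (at x)) \<and>
     (\<forall>v. Ck_on k S (\<lambda>x. frechet_derivative f (at x) v))"

text \<open>Used for open \<open>S\<close> only, so that the derivatives at points of \<open>S\<close> depend only on \<open>f\<close> on \<open>S\<close>.\<close>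

definition smooth_on :: "'e::euclidean_space set \<Rightarrow> ('e \<Rightarrow> 'v::real_normed_vector) \<Rightarrow> bool" where
  "smooth_on S f \<longleftrightarrow> (\<forall>k. Ck_on k S f)"

text \<open>A manifold is given by an atlas (not necessarily maximal) of charts \<open>(U, \<phi>)\<close> with values in
  the model space \<open>'e\<close>; its dimension is \<open>DIM('e)\<close>. The underlying set and the topology are
  determined by the atlas.\<close>

type_synonym ('a, 'e) chart = "'a set \<times> ('a \<Rightarrow> 'e)"
type_synonym ('a, 'e) atlas = "('a, 'e) chart set"

abbreviation chart_inv :: "('a, 'e) chart \<Rightarrow> 'e \<Rightarrow> 'a" where
  "chart_inv c \<equiv> inv_into (fst c) (snd c)"

abbreviation chart_img :: "('a, 'e) chart \<Rightarrow> 'e set" where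
  "chart_img c \<equiv> snd c ` fst c"

definition carrier :: "('a, 'e) atlas \<Rightarrow> 'a set" where
  "carrier M = (\<Union>c\<in>M. fst c)"

definition smooth_atlas :: "('a, 'e::euclidean_space) atlas \<Rightarrow> bool" where
  "smooth_atlas M \<longleftrightarrow>
     (\<forall>c\<in>M. inj_on (snd c) (fst c) \<and> open (chart_img c)) \<and>
     (\<forall>c\<in>M. \<forall>d\<in>M. open (snd c ` (fst c \<inter> fst d)) \<and>
        smooth_on (snd c ` (fst c \<inter> fst d)) (snd d \<circ> chart_inv c))"

definition mtop :: "('a, 'e::euclidean_space) atlas \<Rightarrow> 'a topology" where
  "mtop M = topology (\<lambda>W. W \<subseteq> carrier M \<and> (\<forall>c\<in>M. open (snd c ` (W \<inter> fst c))))"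

lemma openin_mtop:
  assumes "smooth_atlas M"
  shows "openin (mtop M) W \<longleftrightarrow> W \<subseteq> carrier M \<and> (\<forall>c\<in>M. open (snd c ` (W \<inter> fst c)))"
proof -
  have "istopology (\<lambda>W. W \<subseteq> carrier M \<and> (\<forall>c\<in>M. open (snd c ` (W \<inter> fst c))))"
    unfolding istopology_def
  proof (intro conjI allI impI ballI)
    fix S T assume *: "S \<subseteq> carrier M \<and> (\<forall>c\<in>M. open (snd c ` (S \<inter> fst c)))"
      "T \<subseteq> carrier M \<and> (\<forall>c\<in>M. open (snd c ` (T \<inter> fst c)))"
    show "S \<inter> T \<subseteq> carrier M" using * by blast
    fix c assume c: "c \<in> M"
    have "inj_on (snd c) (fst c)" using assms c by (simp add: smooth_atlas_def)
    then have "snd c ` (S \<inter> T \<inter> fst c) = snd c ` (S \<inter> fst c) \<inter> snd c ` (T \<inter> fst c)"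
      by (auto dest: inj_onD)
    then show "open (snd c ` (S \<inter> T \<inter> fst c))" using * c by (simp add: open_Int)
  next
    fix K assume *: "\<forall>S\<in>K. S \<subseteq> carrier M \<and> (\<forall>c\<in>M. open (snd c ` (S \<inter> fst c)))"
    show "\<Union>K \<subseteq> carrier M" using * by blast
    fix c assume c: "c \<in> M"
    have "snd c ` (\<Union>K \<inter> fst c) = (\<Union>S\<in>K. snd c ` (S \<inter> fst c))" by blast
    then show "open (snd c ` (\<Union>K \<inter> fst c))" using * c by auto
  qed
  then show ?thesis by (simp add: mtop_def)
qed

definition manifold :: "('a, 'e::euclidean_space) atlas \<Rightarrow> bool" where
  "manifold M \<longleftrightarrow> smooth_atlas M \<and> Hausdorff_space (mtop M) \<and> second_countable (mtop M) \<and>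
     connected_space (mtop M)"

definition euclidean_atlas :: "('e, 'e::euclidean_space) atlas" where
  "euclidean_atlas = {(UNIV, \<lambda>x. x)}"

definition restrict_atlas :: "('a, 'e) atlas \<Rightarrow> 'a set \<Rightarrow> ('a, 'e) atlas" where
  "restrict_atlas M W = {(fst c \<inter> W, snd c) |c. c \<in> M}"

definition prod_atlas :: "('a, 'e) atlas \<Rightarrow> ('b, 'f) atlas \<Rightarrow> ('a \<times> 'b, 'e \<times> 'f) atlas" where
  "prod_atlas M N = {(fst c \<times> fst d, map_prod (snd c) (snd d)) |c d. c \<in> M \<and> d \<in> N}"

text \<open>The circle is the unit circle in \<open>\<complex>\<close>. Its coordinate \<open>u\<close> is normalised to have period 1
  (\<open>z = exp (2 \<pi> \<i> u)\<close>), so that \<open>[du]\<close> is an integral class. The branch \<open>circle_coord a\<close> of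
  \<open>u\<close> takes values in the interval from \<open>a\<close> to \<open>a + 1\<close>.\<close>

definition circle_coord :: "real \<Rightarrow> complex \<Rightarrow> real" where
  "circle_coord a z = (THE t. a < t \<and> t < a + 1 \<and> cis (2 * pi * t) = z)"

definition circle :: "(complex, real) atlas" where
  "circle = {((\<lambda>t. cis (2 * pi * t)) ` {a<..<a + 1}, circle_coord a) |a. True}"

definition smooth_map :: "('a, 'e::euclidean_space) atlas \<Rightarrow> ('b, 'f::euclidean_space) atlas \<Rightarrow>
    ('a \<Rightarrow> 'b) \<Rightarrow> bool" where
  "smooth_map M N F \<longleftrightarrow> F ` carrier M \<subseteq> carrier N \<and>
     (\<forall>c\<in>M. \<forall>d\<in>N. open (snd c ` (fst c \<inter> F -` fst d)) \<and>
        smooth_on (snd c ` (fst c \<inter> F -` fst d)) (snd d \<circ> F \<circ> chart_inv c))"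

definition smooth_fun :: "('a, 'e::euclidean_space) atlas \<Rightarrow> ('a \<Rightarrow> real) \<Rightarrow> bool" where
  "smooth_fun M f \<longleftrightarrow> (\<forall>c\<in>M. smooth_on (chart_img c) (f \<circ> chart_inv c))"

definition smooth_near :: "('a, 'e::euclidean_space) atlas \<Rightarrow> 'a \<Rightarrow> ('a \<Rightarrow> real) \<Rightarrow> bool" where
  "smooth_near M p f \<longleftrightarrow> (\<exists>c\<in>M. p \<in> fst c \<and>
     (\<exists>W. open W \<and> snd c p \<in> W \<and> W \<subseteq> chart_img c \<and> smooth_on W (f \<circ> chart_inv c)))"


section \<open>Tangent vectors\<close>

text \<open>A tangent vector at \<open>p\<close> is identified with its action as a directional derivative on the
  functions that are smooth near \<open>p\<close>; it is set to 0 on all other functions. In particular, for a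
  tangent vector \<open>X\<close> at \<open>p\<close> and a smooth function \<open>f\<close>, the differential is \<open>df(X) = X f\<close>.\<close>

type_synonym 'a tvec = "('a \<Rightarrow> real) \<Rightarrow> real"

definition chart_vec :: "('a, 'e::euclidean_space) atlas \<Rightarrow> ('a, 'e) chart \<Rightarrow> 'a \<Rightarrow> 'e \<Rightarrow> 'a tvec" where
  "chart_vec M c p v = (\<lambda>f. if smooth_near M p f
     then frechet_derivative (f \<circ> chart_inv c) (at (snd c p)) v else 0)"

definition tangent_space :: "('a, 'e::euclidean_space) atlas \<Rightarrow> 'a \<Rightarrow> 'a tvec set" where
  "tangent_space M p = {chart_vec M c p v |c v. c \<in> M \<and> p \<in> fst c}"

definition velocity :: "('a, 'e::euclidean_space) atlas \<Rightarrow> (real \<Rightarrow> 'a) \<Rightarrow> real \<Rightarrow> 'a tvec" where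
  "velocity M \<gamma> t = (\<lambda>f. if smooth_near M (\<gamma> t) f then deriv (f \<circ> \<gamma>) t else 0)"

definition push :: "('b, 'f::euclidean_space) atlas \<Rightarrow> ('a \<Rightarrow> 'b) \<Rightarrow> 'a \<Rightarrow> 'a tvec \<Rightarrow> 'b tvec" where
  "push N F p X = (\<lambda>f. if smooth_near N (F p) f then X (f \<circ> F) else 0)"


section \<open>Covariant tensor fields\<close>

text \<open>Tensor fields may take arbitrary values outside the carrier and on functionals that are not
  tangent vectors. Their components in a chart \<open>c\<close> are functions on \<open>chart_img c\<close>.\<close>

type_synonym ('a, 'v) form1 = "'a \<Rightarrow> 'a tvec \<Rightarrow> 'v"
type_synonym ('a, 'v) tensor2 = "'a \<Rightarrow> 'a tvec \<Rightarrow> 'a tvec \<Rightarrow> 'v"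

definition comp1 :: "('a, 'e::euclidean_space) atlas \<Rightarrow> ('a, 'v) form1 \<Rightarrow> ('a, 'e) chart \<Rightarrow>
    'e \<Rightarrow> 'e \<Rightarrow> 'v" where
  "comp1 M \<theta> c x v = \<theta> (chart_inv c x) (chart_vec M c (chart_inv c x) v)"

definition comp2 :: "('a, 'e::euclidean_space) atlas \<Rightarrow> ('a, 'v) tensor2 \<Rightarrow> ('a, 'e) chart \<Rightarrow>
    'e \<Rightarrow> 'e \<Rightarrow> 'e \<Rightarrow> 'v" where
  "comp2 M T c x v w =
     T (chart_inv c x) (chart_vec M c (chart_inv c x) v) (chart_vec M c (chart_inv c x) w)"

definition one_form :: "('a, 'e::euclidean_space) atlas \<Rightarrow> ('a, 'v::real_normed_vector) form1 \<Rightarrow> bool" where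
  "one_form M \<theta> \<longleftrightarrow> (\<forall>c\<in>M. (\<forall>x\<in>chart_img c. linear (comp1 M \<theta> c x)) \<and>
     (\<forall>v. smooth_on (chart_img c) (\<lambda>x. comp1 M \<theta> c x v)))"

definition smooth_tensor2 :: "('a, 'e::euclidean_space) atlas \<Rightarrow> ('a, 'v::real_normed_vector) tensor2 \<Rightarrow> bool" where
  "smooth_tensor2 M T \<longleftrightarrow> (\<forall>c\<in>M. (\<forall>x\<in>chart_img c. bilinear (comp2 M T c x)) \<and>
     (\<forall>v w. smooth_on (chart_img c) (\<lambda>x. comp2 M T c x v w)))"

definition two_form :: "('a, 'e::euclidean_space) atlas \<Rightarrow> ('a, 'v::real_normed_vector) tensor2 \<Rightarrow> bool" where
  "two_form M \<sigma> \<longleftrightarrow> smooth_tensor2 M \<sigma> \<and>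
     (\<forall>p\<in>carrier M. \<forall>X\<in>tangent_space M p. \<sigma> p X X = 0)"

definition pull1 :: "('b, 'f::euclidean_space) atlas \<Rightarrow> ('a \<Rightarrow> 'b) \<Rightarrow> ('b, 'v) form1 \<Rightarrow> ('a, 'v) form1" where
  "pull1 N F \<theta> p X = \<theta> (F p) (push N F p X)"

definition pull2 :: "('b, 'f::euclidean_space) atlas \<Rightarrow> ('a \<Rightarrow> 'b) \<Rightarrow> ('b, 'v) tensor2 \<Rightarrow> ('a, 'v) tensor2" where
  "pull2 N F T p X Y = T (F p) (push N F p X) (push N F p Y)"

definition sym_prod :: "('a, 'v::real_normed_field) form1 \<Rightarrow> ('a, 'v) form1 \<Rightarrow> ('a, 'v) tensor2" where
  "sym_prod \<beta> \<gamma> p X Y = (\<beta> p X * \<gamma> p Y + \<gamma> p X * \<beta> p Y) / 2"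

definition wedge :: "('a, real) form1 \<Rightarrow> ('a, real) form1 \<Rightarrow> ('a, real) tensor2" where
  "wedge \<beta> \<gamma> p X Y = \<beta> p X * \<gamma> p Y - \<gamma> p X * \<beta> p Y"

text \<open>The relation \<open>d\<theta> = \<sigma>\<close>, with
  \<open>d\<theta>(X, Y) = X (\<theta>(Y)) - Y (\<theta>(X)) - \<theta>([X, Y])\<close> evaluated on constant coordinate fields.\<close>

definition has_ext_deriv :: "('a, 'e::euclidean_space) atlas \<Rightarrow> ('a, 'v::real_normed_vector) form1 \<Rightarrow>
    ('a, 'v) tensor2 \<Rightarrow> bool" where
  "has_ext_deriv M \<theta> \<sigma> \<longleftrightarrow> (\<forall>c\<in>M. \<forall>x\<in>chart_img c. \<forall>v w. comp2 M \<sigma> c x v w =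
     frechet_derivative (\<lambda>y. comp1 M \<theta> c y w) (at x) v -
     frechet_derivative (\<lambda>y. comp1 M \<theta> c y v) (at x) w)"

definition closed1 :: "('a, 'e::euclidean_space) atlas \<Rightarrow> ('a, real) form1 \<Rightarrow> bool" where
  "closed1 M \<theta> \<longleftrightarrow> one_form M \<theta> \<and> has_ext_deriv M \<theta> (\<lambda>p X Y. 0)"

definition closed2 :: "('a, 'e::euclidean_space) atlas \<Rightarrow> ('a, real) tensor2 \<Rightarrow> bool" where
  "closed2 M \<sigma> \<longleftrightarrow> two_form M \<sigma> \<and> (\<forall>c\<in>M. \<forall>x\<in>chart_img c. \<forall>u v w.
     frechet_derivative (\<lambda>y. comp2 M \<sigma> c y v w) (at x) u +
     frechet_derivative (\<lambda>y. comp2 M \<sigma> c y w u) (at x) v +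
     frechet_derivative (\<lambda>y. comp2 M \<sigma> c y u v) (at x) w = 0)"


section \<open>De Rham classes\<close>

definition dR_class1 :: "('a, 'e::euclidean_space) atlas \<Rightarrow> ('a, real) form1 \<Rightarrow> ('a, real) form1 set" where
  "dR_class1 M \<alpha> = {\<beta>. closed1 M \<beta> \<and> (\<exists>f. smooth_fun M f \<and>
     (\<forall>p\<in>carrier M. \<forall>X\<in>tangent_space M p. \<beta> p X = \<alpha> p X + X f))}"

definition dR_class2 :: "('a, 'e::euclidean_space) atlas \<Rightarrow> ('a, real) tensor2 \<Rightarrow> ('a, real) tensor2 set" where
  "dR_class2 M \<sigma> = {\<tau>. closed2 M \<tau> \<and> (\<exists>\<theta>. one_form M \<theta> \<and>
     has_ext_deriv M \<theta> (\<lambda>p X Y. \<tau> p X Y - \<sigma> p X Y))}"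

definition H1_dR :: "('a, 'e::euclidean_space) atlas \<Rightarrow> ('a, real) form1 set set" where
  "H1_dR M = {dR_class1 M \<alpha> |\<alpha>. closed1 M \<alpha>}"

text \<open>The integral classes are those with integer periods over all smooth loops
  (which generate the first homology group).\<close>

definition H1_int :: "('a, 'e::euclidean_space) atlas \<Rightarrow> ('a, real) form1 set set" where
  "H1_int M = {\<omega> \<in> H1_dR M. \<forall>\<alpha>\<in>\<omega>. \<forall>\<gamma>. smooth_map euclidean_atlas M \<gamma> \<longrightarrow> (\<forall>t. \<gamma> (t + 1) = \<gamma> t) \<longrightarrow>
     integral {0..1} (\<lambda>t. \<alpha> (\<gamma> t) (velocity M \<gamma> t)) \<in> \<int>}"

text \<open>The form \<open>du\<close> on the circle: at each point \<open>z\<close>, the branch of \<open>u\<close> centred at \<open>z\<close> is used.\<close>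

definition du :: "(complex, real) form1" where
  "du z X = X (circle_coord (Arg z / (2 * pi) - 1 / 2))"


section \<open>Metrics, curvature and geodesics\<close>

definition riemannian_metric :: "('a, 'e::euclidean_space) atlas \<Rightarrow> ('a, real) tensor2 \<Rightarrow> bool" where
  "riemannian_metric M h \<longleftrightarrow> smooth_tensor2 M h \<and>
     (\<forall>c\<in>M. \<forall>x\<in>chart_img c. (\<forall>v w. comp2 M h c x v w = comp2 M h c x w v) \<and>
        (\<forall>v. v \<noteq> 0 \<longrightarrow> comp2 M h c x v v > 0))"

text \<open>\<open>\<Gamma>(v, w)\<close> is the Levi-Civita derivative of the constant field \<open>w\<close> in direction \<open>v\<close>
  (Koszul formula); it is well defined as soon as the metric is nondegenerate.\<close>

definition christoffel :: "('a, 'e::euclidean_space) atlas \<Rightarrow> ('a, real) tensor2 \<Rightarrow> ('a, 'e) chart \<Rightarrow>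
    'e \<Rightarrow> 'e \<Rightarrow> 'e \<Rightarrow> 'e" where
  "christoffel M g c x v w = (THE z. \<forall>y. comp2 M g c x z y =
     (frechet_derivative (\<lambda>x. comp2 M g c x w y) (at x) v +
      frechet_derivative (\<lambda>x. comp2 M g c x v y) (at x) w -
      frechet_derivative (\<lambda>x. comp2 M g c x v w) (at x) y) / 2)"

text \<open>\<open>R(u, v) w = \<nabla>\<^sub>u \<nabla>\<^sub>v w - \<nabla>\<^sub>v \<nabla>\<^sub>u w\<close> for constant fields \<open>u\<close>, \<open>v\<close>, \<open>w\<close>, and
  \<open>Ric(v, w)\<close> is the trace of \<open>u \<mapsto> R(u, v) w\<close>.\<close>

definition curvature :: "('a, 'e::euclidean_space) atlas \<Rightarrow> ('a, real) tensor2 \<Rightarrow> ('a, 'e) chart \<Rightarrow>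
    'e \<Rightarrow> 'e \<Rightarrow> 'e \<Rightarrow> 'e \<Rightarrow> 'e" where
  "curvature M g c x u v w =
     frechet_derivative (\<lambda>x. christoffel M g c x v w) (at x) u -
     frechet_derivative (\<lambda>x. christoffel M g c x u w) (at x) v +
     christoffel M g c x u (christoffel M g c x v w) -
     christoffel M g c x v (christoffel M g c x u w)"

definition ricci :: "('a, 'e::euclidean_space) atlas \<Rightarrow> ('a, real) tensor2 \<Rightarrow> ('a, 'e) chart \<Rightarrow>
    'e \<Rightarrow> 'e \<Rightarrow> 'e \<Rightarrow> real" where
  "ricci M g c x v w = (\<Sum>b\<in>Basis. curvature M g c x b v w \<bullet> b)"

definition ricci_flat :: "('a, 'e::euclidean_space) atlas \<Rightarrow> ('a, real) tensor2 \<Rightarrow> bool" where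
  "ricci_flat M g \<longleftrightarrow> (\<forall>c\<in>M. \<forall>x\<in>chart_img c. \<forall>v w. ricci M g c x v w = 0)"

definition geodesic_on :: "('a, 'e::euclidean_space) atlas \<Rightarrow> ('a, real) tensor2 \<Rightarrow> real set \<Rightarrow>
    (real \<Rightarrow> 'a) \<Rightarrow> bool" where
  "geodesic_on M g J \<gamma> \<longleftrightarrow> smooth_map (restrict_atlas euclidean_atlas J) M \<gamma> \<and>
     (\<forall>c\<in>M. \<forall>t\<in>J. \<gamma> t \<in> fst c \<longrightarrow>
        (let x = snd c \<circ> \<gamma>; x' = (\<lambda>s. vector_derivative x (at s)) in
         vector_derivative x' (at t) + christoffel M g c (x t) (x' t) (x' t) = 0))"

definition geodesically_complete :: "('a, 'e::euclidean_space) atlas \<Rightarrow> ('a, real) tensor2 \<Rightarrow> bool" where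
  "geodesically_complete M g \<longleftrightarrow> (\<forall>J \<gamma>. open J \<longrightarrow> is_interval J \<longrightarrow> J \<noteq> {} \<longrightarrow> geodesic_on M g J \<gamma> \<longrightarrow>
     (\<exists>\<gamma>'. geodesic_on M g UNIV \<gamma>' \<and> (\<forall>t\<in>J. \<gamma>' t = \<gamma> t)))"


section \<open>Circle bundles\<close>

text \<open>\<open>R p z\<close> is the right action of \<open>z\<close> in the structure group \<open>S\<^sup>1 = U(1)\<close>.\<close>

definition circle_bundle :: "('n, 'f::euclidean_space) atlas \<Rightarrow> ('m, 'k::euclidean_space) atlas \<Rightarrow>
    ('m \<Rightarrow> 'n) \<Rightarrow> ('m \<Rightarrow> complex \<Rightarrow> 'm) \<Rightarrow> bool" where
  "circle_bundle N M \<pi> R \<longleftrightarrow> smooth_map M N \<pi> \<and>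
     smooth_map (prod_atlas M circle) M (\<lambda>(p, z). R p z) \<and>
     (\<forall>p\<in>carrier M. R p 1 = p \<and>
        (\<forall>z\<in>carrier circle. \<pi> (R p z) = \<pi> p \<and> (\<forall>w\<in>carrier circle. R (R p z) w = R p (z * w)))) \<and>
     (\<forall>x\<in>carrier N. \<exists>W \<Phi> \<Theta>. openin (mtop N) W \<and> x \<in> W \<and>
        smooth_map (restrict_atlas M (\<pi> -` W)) (prod_atlas (restrict_atlas N W) circle) \<Phi> \<and>
        smooth_map (prod_atlas (restrict_atlas N W) circle) (restrict_atlas M (\<pi> -` W)) \<Theta> \<and>
        (\<forall>p\<in>carrier M. \<pi> p \<in> W \<longrightarrow> \<Theta> (\<Phi> p) = p \<and> fst (\<Phi> p) = \<pi> p \<and>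
           (\<forall>z\<in>carrier circle. snd (\<Phi> (R p z)) = snd (\<Phi> p) * z)) \<and>
        (\<forall>y\<in>W. \<forall>z\<in>carrier circle. \<Phi> (\<Theta> (y, z)) = (y, z)))"

text \<open>A connection form takes values in the Lie algebra \<open>\<i>\<real>\<close> of \<open>U(1)\<close>, reproduces the generator
  \<open>\<i>\<close> on its fundamental vector field, and is invariant under the (abelian) structure group.\<close>

definition connection_form :: "('m, 'k::euclidean_space) atlas \<Rightarrow> ('m \<Rightarrow> complex \<Rightarrow> 'm) \<Rightarrow>
    ('m, complex) form1 \<Rightarrow> bool" where
  "connection_form M R A \<longleftrightarrow> one_form M A \<and>
     (\<forall>p\<in>carrier M.
        (\<forall>X\<in>tangent_space M p. Re (A p X) = 0) \<and>
        A p (velocity M (\<lambda>t. R p (cis t)) 0) = \<i> \<and>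
        (\<forall>z\<in>carrier circle. \<forall>X\<in>tangent_space M p. pull1 M (\<lambda>q. R q z) A p X = A p X))"

text \<open>The first Chern class in de Rham cohomology: the set of closed 2-forms \<open>\<sigma>\<close> on the base such
  that \<open>\<i>/(2\<pi>) dA = \<pi>\<^sup>*\<sigma>\<close> for some connection form \<open>A\<close> (Chern-Weil).\<close>

definition chern_class1 :: "('n, 'f::euclidean_space) atlas \<Rightarrow> ('m, 'k::euclidean_space) atlas \<Rightarrow>
    ('m \<Rightarrow> 'n) \<Rightarrow> ('m \<Rightarrow> complex \<Rightarrow> 'm) \<Rightarrow> ('n, real) tensor2 set" where
  "chern_class1 N M \<pi> R = {\<sigma>. closed2 N \<sigma> \<and> (\<exists>A. connection_form M R A \<and>
     has_ext_deriv M A (\<lambda>p X Y. - 2 * pi * \<i> * complex_of_real (pull2 N \<pi> \<sigma> p X Y)))}"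


section \<open>Manifolds of type \<open>(\<Psi>, A, \<eta>, f)\<close>\<close>

text \<open>The metric \<open>2\<i>A \<odot> \<pi>\<^sup>*\<eta> + f \<pi>\<^sup>*\<eta> \<odot> \<pi>\<^sup>*\<eta> + \<pi>\<^sup>*h\<close>. As \<open>A\<close> is \<open>\<i>\<real>\<close>-valued, the first summand
  is real, and \<open>Re\<close> only serves as the coercion to the reals.\<close>

definition type_metric :: "('n, 'f::euclidean_space) atlas \<Rightarrow> ('n, real) tensor2 \<Rightarrow> ('m \<Rightarrow> 'n) \<Rightarrow>
    ('m, complex) form1 \<Rightarrow> ('n, real) form1 \<Rightarrow> ('m \<Rightarrow> real) \<Rightarrow> ('m, real) tensor2" where
  "type_metric N h \<pi> A \<eta> f p X Y =
     Re (2 * \<i> * sym_prod A (\<lambda>p X. complex_of_real (pull1 N \<pi> \<eta> p X)) p X Y) +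
     f p * sym_prod (pull1 N \<pi> \<eta>) (pull1 N \<pi> \<eta>) p X Y + pull2 N \<pi> h p X Y"

text \<open>The argument \<open>\<sigma>\<close> is the closed 2-form representing \<open>c\<^sub>1(M)\<close>, so that \<open>\<Psi> = pi \<cdot> \<sigma>\<close>.\<close>

definition has_type :: "('n, 'f::euclidean_space) atlas \<Rightarrow> ('n, real) tensor2 \<Rightarrow>
    ('m, 'k::euclidean_space) atlas \<Rightarrow> ('m \<Rightarrow> 'n) \<Rightarrow> ('m \<Rightarrow> complex \<Rightarrow> 'm) \<Rightarrow> ('m, real) tensor2 \<Rightarrow>
    ('n, real) tensor2 \<Rightarrow> ('m, complex) form1 \<Rightarrow> ('n, real) form1 \<Rightarrow> ('m \<Rightarrow> real) \<Rightarrow> bool" where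
  "has_type N h M \<pi> R g \<sigma> A \<eta> f \<longleftrightarrow>
     manifold N \<and> riemannian_metric N h \<and>
     manifold M \<and> DIM('k) = DIM('f) + 1 \<and> circle_bundle N M \<pi> R \<and>
     \<sigma> \<in> chern_class1 N M \<pi> R \<and>
     (let \<Psi> = (\<lambda>y X Y. pi * \<sigma> y X Y) in
      connection_form M R A \<and>
      has_ext_deriv M A (\<lambda>p X Y. - 2 * \<i> * complex_of_real (pull2 N \<pi> \<Psi> p X Y))) \<and>
     closed1 N \<eta> \<and> (\<forall>y\<in>carrier N. \<exists>X\<in>tangent_space N y. \<eta> y X \<noteq> 0) \<and>
     smooth_fun M f \<and>
     g = type_metric N h \<pi> A \<eta> f"

end

theory Submission
  imports Defs
begin

text \<open>Write \<open>\<theta> = Im A\<close> and \<open>F = f + 1\<close>, so that the metric is \<open>g = - \<theta> \<otimes> du - du \<otimes> \<theta> + F du \<otimes> du +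
  h\<^sub>B\<close> with \<open>d\<theta> = - 2 \<pi> \<alpha> \<and> du\<close>. Along a geodesic, testing the Euler-Lagrange equation against the
  vertical direction shows that \<open>c = du(\<gamma>')\<close> is constant, and testing it against the horizontal
  lift of \<open>\<partial>\<^sub>u\<close> gives, for \<open>s = \<theta>(\<gamma>') - F c\<close>, \<open>s' = 2 \<pi> c \<alpha>(\<gamma>') - c\<^sup>2 \<partial>\<^sub>u f / 2\<close>. The energy \<open>E =
  g(\<gamma>', \<gamma>')\<close> is also constant, hence \<open>h\<^sub>B(\<gamma>', \<gamma>') = E + 2 c s + F c\<^sup>2\<close> is bounded by an affine
  function of \<open>\<bar>s\<bar>\<close>. As \<open>B\<close> is compact, \<open>\<bar>\<alpha>(\<gamma>')\<bar>\<close> is then also bounded by such a function, so \<open>s\<close>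
  grows at most exponentially. On a bounded time interval the velocity therefore stays bounded in
  the Riemannian metric \<open>\<theta>\<^sup>2 + du\<^sup>2 + h\<^sub>B\<close>. The geodesic accumulates somewhere because the total
  space is compact, so it converges in a chart together with its velocity and extends by Picard's
  theorem.\<close>

section \<open>Calculus of smooth maps\<close>

text \<open>The metric is indefinite, so neither conservation of energy nor compactness bounds the
  velocity by itself. What saves the estimate is that \<open>du(\<gamma>')\<close> is constant: the
  \<open>B\<close>-part of the speed, read off from the energy, is then affine and not quadratic in
  \<open>s\<close>. Subtracting \<open>F c\<close> in the definition of \<open>s\<close> removes the
  derivative of \<open>F\<close> along the curve; the only derivative of \<open>f\<close> that
  survives is the one along the circle, so no derivative of \<open>fB\<close> has to be estimated.
  The summand 1 in \<open>F\<close> is the square of \<open>du\<close> contained in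
  \<open>h\<close>.

  All these quantities are scalars attached to the curve. Each pointwise identity may thus be
  checked in whatever chart is at hand, and only a scalar inequality is integrated over the time
  interval. A coordinate bound on the velocity is extracted at the very end, in one chart around an
  accumulation point. The charts of the total space know nothing of the fibration, so the base
  coordinates and \<theta> enter as functions and forms on a chart, and the geodesic equation is
  used in its Euler-Lagrange form, which is natural under smooth maps.\<close>

lemma Ck_on_cong:
  assumes "open S" "\<And>x. x \<in> S \<Longrightarrow> f x = g x" "Ck_on k S f"
  shows "Ck_on k S g"
  using assms(2,3)
proof (induction k arbitrary: f g)
  case 0
  then show ?case by (metis Ck_on.simps(1) continuous_on_cong)
next
  case (Suc k)
  have d: "(g has_derivative frechet_derivative f (at x)) (at x)" if "x \<in> S" for x
  proof (rule has_derivative_transform_within_open[OF _ assms(1) that])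
    show "(f has_derivative frechet_derivative f (at x)) (at x)"
      using Suc.prems(2) that by (simp add: frechet_derivative_works)
  qed (rule Suc.prems(1))
  have e: "frechet_derivative f (at x) = frechet_derivative g (at x)" if "x \<in> S" for x
    using frechet_derivative_at[OF d[OF that]] .
  show ?case unfolding Ck_on.simps
  proof (intro conjI ballI allI)
    fix x assume "x \<in> S" then show "g differentiable at x" using d differentiableI by blast
  next
    fix v show "Ck_on k S (\<lambda>x. frechet_derivative g (at x) v)"
      by (rule Suc.IH[of "\<lambda>x. frechet_derivative f (at x) v"]) (use e Suc.prems in auto)
  qed
qed

text \<open>Lets a proof exhibit an explicit derivative \<open>f'\<close> in place of the one chosen
  by \<open>frechet_derivative\<close>.\<close>

lemma Ck_on_SucI:
  assumes "open S" "\<And>x. x \<in> S \<Longrightarrow> (f has_derivative f' x) (at x)" "\<And>v. Ck_on k S (\<lambda>x. f' x v)"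
  shows "Ck_on (Suc k) S f"
  unfolding Ck_on.simps
proof (intro conjI ballI allI)
  fix x assume "x \<in> S" then show "f differentiable at x" using assms(2) differentiableI by blast
next
  fix v show "Ck_on k S (\<lambda>x. frechet_derivative f (at x) v)"
    by (rule Ck_on_cong[OF assms(1) _ assms(3)[of v]]) (use assms(2) frechet_derivative_at in metis)
qed

lemma Ck_on_Suc_has_derivative:
  "Ck_on (Suc k) S f \<Longrightarrow> x \<in> S \<Longrightarrow> (f has_derivative frechet_derivative f (at x)) (at x)"
  by (simp add: frechet_derivative_works)

lemma Ck_on_Suc_imp: "Ck_on (Suc k) S f \<Longrightarrow> Ck_on k S f"
proof (induction k arbitrary: f)
  case 0
  then show ?case
    by (auto intro!: continuous_at_imp_continuous_on differentiable_imp_continuous_within)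
next
  case (Suc k)
  then show ?case by (metis Ck_on.simps(2))
qed

lemma Ck_on_continuous: "Ck_on k S f \<Longrightarrow> continuous_on S f"
  by (induction k) (use Ck_on_Suc_imp in auto)

lemma Ck_on_subset: "Ck_on k S f \<Longrightarrow> T \<subseteq> S \<Longrightarrow> Ck_on k T f"
  by (induction k arbitrary: f) (auto intro: continuous_on_subset)

lemma Ck_on_const: "open S \<Longrightarrow> Ck_on k S (\<lambda>x. c)"
proof (induction k arbitrary: c)
  case (Suc k)
  show ?case by (rule Ck_on_SucI[OF Suc.prems, of _ "\<lambda>x v. 0"]) (use Suc in auto)
qed simp

lemma Ck_on_add:
  "open S \<Longrightarrow> Ck_on k S f \<Longrightarrow> Ck_on k S g \<Longrightarrow> Ck_on k S (\<lambda>x. f x + g x)"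
proof (induction k arbitrary: f g)
  case 0 then show ?case by (simp add: continuous_on_add)
next
  case (Suc k)
  show ?case
    by (rule Ck_on_SucI[OF Suc.prems(1)
          has_derivative_add[OF Ck_on_Suc_has_derivative[OF Suc.prems(2)]
              Ck_on_Suc_has_derivative[OF Suc.prems(3)]]])
      (use Suc in auto)
qed

lemma Ck_on_bounded_linear:
  assumes "bounded_linear L" "open S"
  shows "Ck_on k S f \<Longrightarrow> Ck_on k S (\<lambda>x. L (f x))"
proof (induction k arbitrary: f)
  case 0 then show ?case by (simp add: bounded_linear.continuous_on[OF assms(1)])
next
  case (Suc k)
  show ?case
    by (rule Ck_on_SucI[OF assms(2) bounded_linear.has_derivative[OF assms(1)
        Ck_on_Suc_has_derivative[OF Suc.prems]]])
      (use Suc in auto)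
qed

lemma Ck_on_id: "open S \<Longrightarrow> Ck_on k S (\<lambda>x. x)"
proof (induction k)
  case (Suc k)
  show ?case by (rule Ck_on_SucI[OF Suc.prems, of _ "\<lambda>x v. v"]) (use Suc Ck_on_const in auto)
qed (simp add: continuous_on_id)

lemma Ck_on_bounded_bilinear:
  assumes "bounded_bilinear b" "open S"
  shows "Ck_on k S f \<Longrightarrow> Ck_on k S g \<Longrightarrow> Ck_on k S (\<lambda>x. b (f x) (g x))"
proof (induction k arbitrary: f g)
  case 0 then show ?case by (simp add: bounded_bilinear.continuous_on[OF assms(1)])
next
  case (Suc k)
  have "Ck_on k S f" "Ck_on k S g" using Suc.prems Ck_on_Suc_imp by blast+
  then show ?case
    by (intro Ck_on_SucI[OF assms(2) bounded_bilinear.FDERIV[OF assms(1)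
          Ck_on_Suc_has_derivative[OF Suc.prems(1)] Ck_on_Suc_has_derivative[OF Suc.prems(2)]]]
        Ck_on_add[OF assms(2)] Suc.IH) (use Suc.prems in auto)
qed

lemma Ck_on_sum:
  "open S \<Longrightarrow> (\<And>i. i \<in> I \<Longrightarrow> Ck_on k S (f i)) \<Longrightarrow> Ck_on k S (\<lambda>x. \<Sum>i\<in>I. f i x)"
  by (induction I rule: infinite_finite_induct) (auto intro: Ck_on_const Ck_on_add)

lemma Ck_on_compose:
  assumes S: "open S" and T: "open T"
  shows "Ck_on k T g \<Longrightarrow> Ck_on k S f \<Longrightarrow> f ` S \<subseteq> T \<Longrightarrow> Ck_on k S (\<lambda>x. g (f x))"
proof (induction k arbitrary: f g)
  case 0 then show ?case by (auto intro: continuous_on_compose2)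
next
  case (Suc k)
  have fd: "(f has_derivative frechet_derivative f (at x)) (at x)" if "x \<in> S" for x
    using Ck_on_Suc_has_derivative[OF Suc.prems(2) that] .
  have gd: "(g has_derivative frechet_derivative g (at (f x))) (at (f x))" if "x \<in> S" for x
    using Ck_on_Suc_has_derivative[OF Suc.prems(1), of "f x"] that Suc.prems(3) by auto
  show ?case
  proof (rule Ck_on_SucI[OF S])
    fix x assume x: "x \<in> S"
    \<comment> \<open>\<open>Ck_on\<close> controls derivatives in a fixed direction only, but here
      the direction in which \<open>g\<close> is differentiated moves with \<open>x\<close>.
      Expanding it in \<open>Basis\<close> leaves fixed directions \<open>b\<close> and puts the
      dependence on \<open>x\<close> into scalar coefficients, so that the product rule and the
      induction hypothesis apply.\<close>
    have eq: "frechet_derivative g (at (f x)) (frechet_derivative f (at x) v)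
       = (\<Sum>b\<in>Basis. (frechet_derivative f (at x) v \<bullet> b) *\<^sub>R frechet_derivative g (at (f x)) b)" for
           v
    proof -
      have l: "linear (frechet_derivative g (at (f x)))" using gd[OF x] has_derivative_linear
          by blast
      have "frechet_derivative g (at (f x)) (frechet_derivative f (at x) v)
        = frechet_derivative g (at (f x)) (\<Sum>b\<in>Basis. (frechet_derivative f (at x) v \<bullet> b) *\<^sub>R b)"
        by (simp add: euclidean_representation)
      also have "\<dots> = (\<Sum>b\<in>Basis. (frechet_derivative f (at x) v \<bullet> b) *\<^sub>R frechet_derivative g (at (f
          x)) b)"
        by (simp add: linear_sum[OF l] linear_cmul[OF l])
      finally show ?thesis .
    qed
    show "((\<lambda>x. g (f x)) has_derivative
       (\<lambda>v. (\<Sum>b\<in>Basis. (frechet_derivative f (at x) v \<bullet> b) *\<^sub>R frechet_derivative g (at (f x)) b)))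
           (at x)"
      using has_derivative_compose[OF fd[OF x] gd[OF x]] eq by simp
  next
    fix v
    show "Ck_on k S (\<lambda>x. (\<Sum>b\<in>Basis. (frechet_derivative f (at x) v \<bullet> b) *\<^sub>R frechet_derivative g (at
        (f x)) b))"
    proof (rule Ck_on_sum[OF S])
      fix b :: 'b assume "b \<in> Basis"
      have 1: "Ck_on k S (\<lambda>x. frechet_derivative f (at x) v \<bullet> b)"
        by (rule Ck_on_bounded_linear[OF bounded_linear_inner_left S]) (use Suc.prems in auto)
      have "Ck_on k T (\<lambda>y. frechet_derivative g (at y) b)" using Suc.prems by auto
      then have 2: "Ck_on k S (\<lambda>x. frechet_derivative g (at (f x)) b)"
        using Suc.IH[OF _ Ck_on_Suc_imp[OF Suc.prems(2)] Suc.prems(3)] by blast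
      show "Ck_on k S (\<lambda>x. (frechet_derivative f (at x) v \<bullet> b) *\<^sub>R frechet_derivative g (at (f x))
          b)"
        by (rule Ck_on_bounded_bilinear[OF bounded_bilinear_scaleR S 1 2])
    qed
  qed
qed

lemma Ck_on_local:
  assumes "\<And>x. x \<in> S \<Longrightarrow> \<exists>T. open T \<and> x \<in> T \<and> Ck_on k T f"
  shows "Ck_on k S f"
  using assms
proof (induction k arbitrary: f)
  case 0
  then show ?case
    by (metis Ck_on.simps(1) continuous_at_imp_continuous_on continuous_on_eq_continuous_at)
next
  case (Suc k)
  then show ?case unfolding Ck_on.simps by meson
qed

lemma smooth_on_cong:
  "open S \<Longrightarrow> smooth_on S f \<Longrightarrow> (\<And>x. x \<in> S \<Longrightarrow> f x = g x) \<Longrightarrow> smooth_on S g"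
  using Ck_on_cong unfolding smooth_on_def by blast

lemma smooth_on_continuous: "smooth_on S f \<Longrightarrow> continuous_on S f"
  using Ck_on_continuous unfolding smooth_on_def by blast

lemma smooth_on_subset: "smooth_on S f \<Longrightarrow> T \<subseteq> S \<Longrightarrow> smooth_on T f"
  using Ck_on_subset unfolding smooth_on_def by blast

lemma smooth_on_const: "open S \<Longrightarrow> smooth_on S (\<lambda>x. c)"
  using Ck_on_const unfolding smooth_on_def by blast

lemma smooth_on_id: "open S \<Longrightarrow> smooth_on S (\<lambda>x. x)"
  using Ck_on_id unfolding smooth_on_def by blast

lemma smooth_on_add: "open S \<Longrightarrow> smooth_on S f \<Longrightarrow> smooth_on S g \<Longrightarrow> smooth_on S (\<lambda>x. f x + g x)"
  using Ck_on_add unfolding smooth_on_def by blast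

lemma smooth_on_bounded_linear:
  "bounded_linear L \<Longrightarrow> open S \<Longrightarrow> smooth_on S f \<Longrightarrow> smooth_on S (\<lambda>x. L (f x))"
  using Ck_on_bounded_linear unfolding smooth_on_def by blast

lemma smooth_on_bounded_bilinear:
  "bounded_bilinear b \<Longrightarrow> open S \<Longrightarrow> smooth_on S f \<Longrightarrow> smooth_on S g \<Longrightarrow> smooth_on S (\<lambda>x. b (f x) (g x))"
  using Ck_on_bounded_bilinear unfolding smooth_on_def by blast

lemmas smooth_on_mult = smooth_on_bounded_bilinear[OF bounded_bilinear_mult]
lemmas smooth_on_scaleR = smooth_on_bounded_bilinear[OF bounded_bilinear_scaleR]

lemma smooth_on_sum:
  "open S \<Longrightarrow> (\<And>i. i \<in> I \<Longrightarrow> smooth_on S (f i)) \<Longrightarrow> smooth_on S (\<lambda>x. \<Sum>i\<in>I. f i x)"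
  unfolding smooth_on_def by (intro allI Ck_on_sum) auto

lemma smooth_on_minus: "open S \<Longrightarrow> smooth_on S f \<Longrightarrow> smooth_on S (\<lambda>x. - f x)"
  using smooth_on_bounded_linear[OF bounded_linear_minus[OF bounded_linear_ident]] .

lemma smooth_on_diff:
  "open S \<Longrightarrow> smooth_on S f \<Longrightarrow> smooth_on S g \<Longrightarrow> smooth_on S (\<lambda>x. f x - g x)"
  using smooth_on_add[OF _ _ smooth_on_minus, of S f g] by simp

lemma smooth_on_compose:
  "open S \<Longrightarrow> open T \<Longrightarrow> smooth_on T g \<Longrightarrow> smooth_on S f \<Longrightarrow> f ` S \<subseteq> T \<Longrightarrow> smooth_on S (\<lambda>x. g (f x))"
  using Ck_on_compose unfolding smooth_on_def by blast

lemma smooth_on_Pair: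
  assumes "open S" "smooth_on S f" "smooth_on S g"
  shows "smooth_on S (\<lambda>x. (f x, g x))"
proof -
  have 1: "bounded_linear (\<lambda>y. (y, 0))" and 2: "bounded_linear (\<lambda>y. (0, y))"
    by (auto intro!: bounded_linear_Pair bounded_linear_ident bounded_linear_zero)
  have "smooth_on S (\<lambda>x. (f x, 0) + (0, g x))"
    by (rule smooth_on_add[OF assms(1) smooth_on_bounded_linear[OF 1 assms(1,2)]
        smooth_on_bounded_linear[OF 2 assms(1,3)]])
  then show ?thesis by simp
qed

lemma smooth_on_fst: "open S \<Longrightarrow> smooth_on S f \<Longrightarrow> smooth_on S (\<lambda>x. fst (f x))"
  using smooth_on_bounded_linear[OF bounded_linear_fst] .

lemma smooth_on_snd: "open S \<Longrightarrow> smooth_on S f \<Longrightarrow> smooth_on S (\<lambda>x. snd (f x))"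
  using smooth_on_bounded_linear[OF bounded_linear_snd] .

lemma smooth_on_has_derivative:
  "smooth_on S f \<Longrightarrow> x \<in> S \<Longrightarrow> (f has_derivative frechet_derivative f (at x)) (at x)"
  unfolding smooth_on_def using Ck_on_Suc_has_derivative by blast

lemma smooth_on_derivative: "smooth_on S f \<Longrightarrow> smooth_on S (\<lambda>x. frechet_derivative f (at x) v)"
  unfolding smooth_on_def by (metis Ck_on.simps(2))

lemma smooth_on_local:
  "(\<And>x. x \<in> S \<Longrightarrow> \<exists>T. open T \<and> x \<in> T \<and> smooth_on T f) \<Longrightarrow> smooth_on S f"
  unfolding smooth_on_def using Ck_on_local by (metis (no_types, lifting))

section \<open>Expansions in a basis and the symmetry of second derivatives\<close>

lemma linear_sum_Basis:
  fixes L :: "'a::euclidean_space \<Rightarrow> 'b::real_vector"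
  assumes "linear L"
  shows "L v = (\<Sum>b\<in>Basis. (v \<bullet> b) *\<^sub>R L b)"
proof -
  have "L v = L (\<Sum>b\<in>Basis. (v \<bullet> b) *\<^sub>R b)" by (simp add: euclidean_representation)
  then show ?thesis by (simp add: linear_sum[OF assms] linear_cmul[OF assms])
qed

text \<open>Tensor fields are known to be smooth for constant arguments only; finite dimension
  passes from there to arguments that move with the point.\<close>

lemma smooth_on_linear_apply:
  fixes L :: "'a::euclidean_space \<Rightarrow> 'b::euclidean_space \<Rightarrow> 'c::real_normed_vector"
  assumes "open S" "\<And>x. x \<in> S \<Longrightarrow> linear (L x)" "\<And>v. smooth_on S (\<lambda>x. L x v)" "smooth_on S f"
  shows "smooth_on S (\<lambda>x. L x (f x))"
proof -
  have "smooth_on S (\<lambda>x. \<Sum>b\<in>Basis. (f x \<bullet> b) *\<^sub>R L x b)"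
    by (intro smooth_on_sum smooth_on_scaleR smooth_on_bounded_linear[OF bounded_linear_inner_left]
        assms)
  then show ?thesis
    by (rule smooth_on_cong[OF assms(1)]) (metis assms(2) linear_sum_Basis)
qed

lemma smooth_on_bilinear_apply:
  fixes L :: "'a::euclidean_space \<Rightarrow> 'b::euclidean_space \<Rightarrow> 'c::euclidean_space \<Rightarrow>
      'd::real_normed_vector"
  assumes "open S" "\<And>x. x \<in> S \<Longrightarrow> bilinear (L x)" "\<And>v w. smooth_on S (\<lambda>x. L x v w)"
    "smooth_on S f" "smooth_on S g"
  shows "smooth_on S (\<lambda>x. L x (f x) (g x))"
  by (rule smooth_on_linear_apply[where L="\<lambda>x. L x (f x)"], rule assms(1))
    (use assms smooth_on_linear_apply[where L="\<lambda>x y. L x y w" and f=f and S=S for w] in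
      \<open>auto simp: bilinear_def\<close>)

text \<open>The second difference \<open>\<Delta> v w s\<close> over a parallelogram is symmetric in
  \<open>v\<close> and \<open>w\<close>. Two applications of the mean value theorem show that it is
  \<open>s * s\<close> times a mixed derivative at a point of the parallelogram; dividing and
  letting \<open>s\<close> tend to 0 gives the mixed derivative at \<open>x\<close> itself, in
  either order.\<close>

lemma second_derivative_symmetric_real:
  fixes f :: "'a::euclidean_space \<Rightarrow> real"
  assumes S: "open S" "x \<in> S" and f: "smooth_on S f"
  shows "frechet_derivative (\<lambda>y. frechet_derivative f (at y) v) (at x) w
       = frechet_derivative (\<lambda>y. frechet_derivative f (at y) w) (at x) v"
proof -
  define D where "D v w z = frechet_derivative (\<lambda>y. frechet_derivative f (at y) v) (at z) w"
      for v w z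
  define \<Delta> where "\<Delta> v w s = f (x + s *\<^sub>R v + s *\<^sub>R w) - f (x + s *\<^sub>R v) - f (x + s *\<^sub>R w) + f x"
      for v w s
  obtain e where e: "e > 0" "ball x e \<subseteq> S" using S open_contains_ball by blast
  have mv: "\<exists>a b. 0 < a \<and> a < s \<and> 0 < b \<and> b < s \<and> \<Delta> v w s = s * s * D v w (x + a *\<^sub>R v + b *\<^sub>R w)"
    if s: "0 < s" "s * (norm v + norm w) < e" for s v w
  proof -
    have inS: "x + a *\<^sub>R v + b *\<^sub>R w \<in> S" if "0 \<le> a" "a \<le> s" "0 \<le> b" "b \<le> s" for a b
    proof -
      have "norm (a *\<^sub>R v + b *\<^sub>R w) \<le> a * norm v + b * norm w"
        using norm_triangle_ineq[of "a *\<^sub>R v" "b *\<^sub>R w"] that by simp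
      also have "\<dots> \<le> s * norm v + s * norm w" by (intro add_mono mult_right_mono) (use that in auto)
      finally have "norm (a *\<^sub>R v + b *\<^sub>R w) < e" using s by (simp add: distrib_left)
      moreover have "dist x (x + a *\<^sub>R v + b *\<^sub>R w) = norm (a *\<^sub>R v + b *\<^sub>R w)"
        by (metis add.assoc add_diff_cancel_left' dist_commute dist_norm)
      ultimately show ?thesis using e(2) by auto
    qed
    have d1: "((\<lambda>a. f (x + a *\<^sub>R v + b *\<^sub>R w)) has_real_derivative frechet_derivative f (at (x + a
        *\<^sub>R v + b *\<^sub>R w)) v) (at a)"
      if "0 \<le> a" "a \<le> s" "0 \<le> b" "b \<le> s" for a b
    proof -
      have *: "(f has_derivative frechet_derivative f (at (x + a *\<^sub>R v + b *\<^sub>R w))) (at (x + a *\<^sub>R v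
          + b *\<^sub>R w))"
        using smooth_on_has_derivative[OF f inS[OF that]] .
      have "((\<lambda>a. x + a *\<^sub>R v + b *\<^sub>R w) has_derivative (\<lambda>h. h *\<^sub>R v)) (at a)"
        by (auto intro!: derivative_eq_intros)
      note 2 = has_derivative_compose[OF this *]
      have "frechet_derivative f (at (x + a *\<^sub>R v + b *\<^sub>R w)) (h *\<^sub>R v)
          = frechet_derivative f (at (x + a *\<^sub>R v + b *\<^sub>R w)) v * h" for h
        using linear_cmul[OF has_derivative_linear[OF *], of h v] by simp
      with 2 show ?thesis
        unfolding has_field_derivative_def by simp
    qed
    define F where "F a = f (x + a *\<^sub>R v + s *\<^sub>R w) - f (x + a *\<^sub>R v)" for a
    have F: "(F has_real_derivative frechet_derivative f (at (x + a *\<^sub>R v + s *\<^sub>R w)) v -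
        frechet_derivative f (at (x + a *\<^sub>R v)) v) (at a)"
      if "0 \<le> a" "a \<le> s" for a
      unfolding F_def using DERIV_diff[OF d1[of a s] d1[of a 0]] s that by simp
    obtain a where a: "0 < a" "a < s" and Fa: "F s - F 0 = s * (frechet_derivative f (at (x + a *\<^sub>R
        v + s *\<^sub>R w)) v - frechet_derivative f (at (x + a *\<^sub>R v)) v)"
      using MVT2[of 0 s F, OF s(1) F] by (metis diff_zero)
    have G: "((\<lambda>b. frechet_derivative f (at (x + a *\<^sub>R v + b *\<^sub>R w)) v) has_real_derivative D v w (x
        + a *\<^sub>R v + b *\<^sub>R w)) (at b)"
      if b: "0 \<le> b" "b \<le> s" for b
    proof -
      have *: "((\<lambda>y. frechet_derivative f (at y) v) has_derivative (\<lambda>h. D v h (x + a *\<^sub>R v + b *\<^sub>R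
          w))) (at (x + a *\<^sub>R v + b *\<^sub>R w))"
        unfolding D_def by (rule smooth_on_has_derivative[OF smooth_on_derivative[OF f] inS]) (use a
            b in auto)
      have 2: "((\<lambda>b. x + a *\<^sub>R v + b *\<^sub>R w) has_derivative (\<lambda>h. h *\<^sub>R w)) (at b)"
        by (auto intro!: derivative_eq_intros)
      have "D v (h *\<^sub>R w) (x + a *\<^sub>R v + b *\<^sub>R w) = D v w (x + a *\<^sub>R v + b *\<^sub>R w) * h" for h
        using linear_cmul[OF has_derivative_linear[OF *], of h w] by simp
      with has_derivative_compose[OF 2 *] show ?thesis
        unfolding has_field_derivative_def by simp
    qed
    obtain b where b: "0 < b" "b < s" "frechet_derivative f (at (x + a *\<^sub>R v + s *\<^sub>R w)) v -
        frechet_derivative f (at (x + a *\<^sub>R v)) v = s * D v w (x + a *\<^sub>R v + b *\<^sub>R w)"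
      using MVT2[of 0 s "\<lambda>b. frechet_derivative f (at (x + a *\<^sub>R v + b *\<^sub>R w)) v", OF s(1) G]
          by auto
    have "\<Delta> v w s = F s - F 0" unfolding \<Delta>_def F_def by simp
    then show ?thesis using a b Fa by (metis mult.assoc)
  qed
  have cont: "isCont (D v w) x" for v w
    unfolding D_def using smooth_on_continuous[OF smooth_on_derivative[OF smooth_on_derivative[OF
        f]]] S
    by (simp add: continuous_on_eq_continuous_at)
  have lim: "((\<lambda>s. \<Delta> v w s / (s * s)) \<longlongrightarrow> D v w x) (at_right 0)" for v w
  proof (rule tendstoI)
    fix \<epsilon> :: real assume "\<epsilon> > 0"
    then obtain d where d: "d > 0" "\<And>y. dist y x < d \<Longrightarrow> dist (D v w y) (D v w x) < \<epsilon>"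
      using cont[of v w] unfolding continuous_at_eps_delta by metis
    \<comment> \<open>For \<open>s\<close> below \<open>m\<close> the parallelogram lies in the ball
      of radius \<open>e\<close>, where the mean value argument works, and in that of radius
      \<open>d\<close>, where the mixed derivative is within \<epsilon> of its value at
      \<open>x\<close>. The summand 1 keeps the quotient meaningful for
      \<open>v = w = 0\<close>.\<close>
    define m where "m = min e d / (norm v + norm w + 1)"
    have m: "m > 0" unfolding m_def using e d by (simp add: add_nonneg_pos)
    have "dist (\<Delta> v w s / (s * s)) (D v w x) < \<epsilon>" if s: "0 < s" "s < m" for s
    proof -
      have sm: "s * (norm v + norm w) < min e d"
      proof -
        have "s * (norm v + norm w) \<le> s * (norm v + norm w + 1)" using s by simp
        also have "\<dots> < m * (norm v + norm w + 1)" using s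
            by (intro mult_strict_right_mono) (auto simp: add_nonneg_pos)
        also have "\<dots> = min e d" unfolding m_def by (simp add: add_nonneg_eq_0_iff)
        finally show ?thesis .
      qed
      then obtain a b where ab: "0 < a" "a < s" "0 < b" "b < s" "\<Delta> v w s
          = s * s * D v w (x + a *\<^sub>R v + b *\<^sub>R w)"
        using mv[of s v w] s by auto
      have "norm (a *\<^sub>R v + b *\<^sub>R w) \<le> a * norm v + b * norm w"
        using norm_triangle_ineq[of "a *\<^sub>R v" "b *\<^sub>R w"] ab by simp
      also have "\<dots> \<le> s * norm v + s * norm w" by (intro add_mono mult_right_mono) (use ab in auto)
      finally have "norm (a *\<^sub>R v + b *\<^sub>R w) < d" using sm by (simp add: distrib_left)
      then have "dist (x + a *\<^sub>R v + b *\<^sub>R w) x < d"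
          by (metis add.assoc add_diff_cancel_left' dist_norm)
      with d(2) ab s show ?thesis by simp
    qed
    then show "\<forall>\<^sub>F s in at_right 0. dist (\<Delta> v w s / (s * s)) (D v w x) < \<epsilon>"
      unfolding eventually_at_right_field using m by blast
  qed
  have "\<Delta> v w = \<Delta> w v" unfolding \<Delta>_def by (auto simp: algebra_simps fun_eq_iff)
  then have "D v w x = D w v x"
    using tendsto_unique[OF _ lim[of v w]] lim[of w v] by simp
  then show ?thesis by (simp add: D_def)
qed

lemma frechet_derivative_inner_left:
  fixes f :: "'a::real_normed_vector \<Rightarrow> 'b::real_inner"
  assumes "f differentiable (at x)"
  shows "frechet_derivative (\<lambda>x. f x \<bullet> b) (at x) v = frechet_derivative f (at x) v \<bullet> b"
proof -
  have "((\<lambda>x. f x \<bullet> b) has_derivative (\<lambda>v. frechet_derivative f (at x) v \<bullet> b)) (at x)"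
    using bounded_linear.has_derivative[OF bounded_linear_inner_left] assms frechet_derivative_works
        by blast
  from frechet_derivative_at[OF this] show ?thesis by metis
qed

lemma second_derivative_symmetric:
  fixes f :: "'a::euclidean_space \<Rightarrow> 'b::euclidean_space"
  assumes S: "open S" "x \<in> S" and f: "smooth_on S f"
  shows "frechet_derivative (\<lambda>y. frechet_derivative f (at y) v) (at x) w
       = frechet_derivative (\<lambda>y. frechet_derivative f (at y) w) (at x) v"
proof (rule euclidean_eqI)
  fix b :: 'b assume "b \<in> Basis"
  have df: "f differentiable (at y)" if "y \<in> S" for y
    using smooth_on_has_derivative[OF f that] differentiableI by blast
  have dd: "(\<lambda>y. frechet_derivative f (at y) v) differentiable (at x)" for v
    using smooth_on_has_derivative[OF smooth_on_derivative[OF f] S(2)] differentiableI by blast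
  have e: "frechet_derivative (\<lambda>y. frechet_derivative (\<lambda>x. f x \<bullet> b) (at y) v) (at x) w
      = frechet_derivative (\<lambda>y. frechet_derivative f (at y) v) (at x) w \<bullet> b" for v w
  proof -
    have "((\<lambda>y. frechet_derivative f (at y) v \<bullet> b) has_derivative
       (\<lambda>w. frechet_derivative (\<lambda>y. frechet_derivative f (at y) v) (at x) w \<bullet> b)) (at x)"
      using bounded_linear.has_derivative[OF bounded_linear_inner_left] dd frechet_derivative_works
          by blast
    then have "((\<lambda>y. frechet_derivative (\<lambda>x. f x \<bullet> b) (at y) v) has_derivative
       (\<lambda>w. frechet_derivative (\<lambda>y. frechet_derivative f (at y) v) (at x) w \<bullet> b)) (at x)"
      by (rule has_derivative_transform_within_open[OF _ S]) (simp add: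
          frechet_derivative_inner_left df)
    from frechet_derivative_at[OF this] show ?thesis by metis
  qed
  have s: "smooth_on S (\<lambda>x. f x \<bullet> b)"
    by (rule smooth_on_bounded_linear[OF bounded_linear_inner_left S(1) f])
  show "frechet_derivative (\<lambda>y. frechet_derivative f (at y) v) (at x) w \<bullet> b
       = frechet_derivative (\<lambda>y. frechet_derivative f (at y) w) (at x) v \<bullet> b"
    using second_derivative_symmetric_real[OF S s, of v w] by (simp only: e)
qed

section \<open>Fields of linear and bilinear forms\<close>

definition lin_field :: "'k::euclidean_space set \<Rightarrow> ('k \<Rightarrow> 'c::euclidean_space \<Rightarrow>
    'v::real_normed_vector) \<Rightarrow> bool" where
  "lin_field X L \<longleftrightarrow> open X \<and> (\<forall>x\<in>X. linear (L x)) \<and> (\<forall>v. smooth_on X (\<lambda>x. L x v))"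

definition bil_field :: "'k::euclidean_space set \<Rightarrow> ('k \<Rightarrow> 'k \<Rightarrow> 'k \<Rightarrow> real) \<Rightarrow> bool" where
  "bil_field X G \<longleftrightarrow> open X \<and> (\<forall>x\<in>X. bilinear (G x) \<and> (\<forall>v w. G x v w = G x w v)) \<and>
     (\<forall>v w. smooth_on X (\<lambda>x. G x v w))"

lemma bil_fieldD:
  assumes "bil_field X G"
  shows "open X" "x \<in> X \<Longrightarrow> bilinear (G x)" "x \<in> X \<Longrightarrow> G x v w = G x w v" "smooth_on X (\<lambda>x. G x v w)"
  using assms unfolding bil_field_def by auto

lemma bil_field_lin_field: "bil_field X G \<Longrightarrow> lin_field X (\<lambda>x v. G x v w)"
  unfolding bil_field_def lin_field_def bilinear_def by auto

lemma lin_fieldD: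
  assumes "lin_field X L"
  shows "open X" "x \<in> X \<Longrightarrow> linear (L x)" "smooth_on X (\<lambda>x. L x v)"
  using assms unfolding lin_field_def by auto

lemma frechet_derivative_apply:
  "(f has_derivative f') (at x) \<Longrightarrow> frechet_derivative f (at x) v = f' v"
  using frechet_derivative_at by metis

lemma lin_field_has_derivative:
  "lin_field X L \<Longrightarrow> x \<in> X \<Longrightarrow> ((\<lambda>z. L z v) has_derivative frechet_derivative (\<lambda>z. L z v) (at x)) (at
      x)"
  using lin_fieldD(3) smooth_on_has_derivative by blast

lemma lin_field_derivative_linear:
  assumes "lin_field X L" "x \<in> X"
  shows "linear (\<lambda>v. frechet_derivative (\<lambda>z. L z v) (at x) d)"
proof (rule linearI)
  fix v w
  have "((\<lambda>z. L z (v + w)) has_derivative (\<lambda>d. frechet_derivative (\<lambda>z. L z v) (at x) d +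
      frechet_derivative (\<lambda>z. L z w) (at x) d)) (at x)"
    by (rule has_derivative_transform_within_open[OF has_derivative_add[OF
        lin_field_has_derivative[OF assms] lin_field_has_derivative[OF assms]] lin_fieldD(1)[OF
        assms(1)] assms(2)])
      (simp add: linear_add[OF lin_fieldD(2)[OF assms(1)]])
  from frechet_derivative_apply[OF this]
  show "frechet_derivative (\<lambda>z. L z (v + w)) (at x) d = frechet_derivative (\<lambda>z. L z v) (at x) d +
      frechet_derivative (\<lambda>z. L z w) (at x) d"
    by metis
next
  fix r :: real and v
  have "((\<lambda>z. L z (r *\<^sub>R v)) has_derivative (\<lambda>d. r *\<^sub>R frechet_derivative (\<lambda>z. L z v) (at x) d)) (at
      x)"
    by (rule has_derivative_transform_within_open[OF has_derivative_scaleR_right[OF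
        lin_field_has_derivative[OF assms]] lin_fieldD(1)[OF assms(1)] assms(2)])
      (simp add: linear_cmul[OF lin_fieldD(2)[OF assms(1)]])
  from frechet_derivative_apply[OF this]
  show "frechet_derivative (\<lambda>z. L z (r *\<^sub>R v)) (at x) d = r *\<^sub>R frechet_derivative (\<lambda>z. L z v) (at
      x) d"
    by metis
qed

lemma lin_field_apply_has_derivative:
  assumes L: "lin_field X L" and t: "\<tau> t \<in> X" and \<tau>: "(\<tau> has_derivative \<tau>') (at t)"
    and f: "(f has_derivative f') (at t)"
  shows "((\<lambda>s. L (\<tau> s) (f s)) has_derivative
    (\<lambda>w. frechet_derivative (\<lambda>z. L z (f t)) (at (\<tau> t)) (\<tau>' w) + L (\<tau> t) (f' w))) (at t)"
proof -
  have 1: "((\<lambda>s. L (\<tau> s) b) has_derivative (\<lambda>w. frechet_derivative (\<lambda>z. L z b) (at (\<tau> t)) (\<tau>' w)))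
      (at t)" for b
    using has_derivative_compose[OF \<tau> lin_field_has_derivative[OF L t]] .
  have 2: "((\<lambda>s. f s \<bullet> b) has_derivative (\<lambda>w. f' w \<bullet> b)) (at t)" for b
    using bounded_linear.has_derivative[OF bounded_linear_inner_left f] .
  have "((\<lambda>s. \<Sum>b\<in>Basis. (f s \<bullet> b) *\<^sub>R L (\<tau> s) b) has_derivative
     (\<lambda>w. \<Sum>b\<in>Basis. (f t \<bullet> b) *\<^sub>R frechet_derivative (\<lambda>z. L z b) (at (\<tau> t)) (\<tau>' w) + (f' w \<bullet> b) *\<^sub>R
         L (\<tau> t) b)) (at t)"
    by (rule has_derivative_sum, rule has_derivative_scaleR[OF 2 1])
  also have "(\<lambda>w. \<Sum>b\<in>Basis. (f t \<bullet> b) *\<^sub>R frechet_derivative (\<lambda>z. L z b) (at (\<tau> t)) (\<tau>' w) + (f' w \<bullet>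
      b) *\<^sub>R L (\<tau> t) b)
    = (\<lambda>w. frechet_derivative (\<lambda>z. L z (f t)) (at (\<tau> t)) (\<tau>' w) + L (\<tau> t) (f' w))"
    by (auto simp: sum.distrib linear_sum_Basis[OF lin_field_derivative_linear[OF L t],
        where v="f t"]
        linear_sum_Basis[OF lin_fieldD(2)[OF L t], where v="f' _"])
  finally have *: "((\<lambda>s. \<Sum>b\<in>Basis. (f s \<bullet> b) *\<^sub>R L (\<tau> s) b) has_derivative
     (\<lambda>w. frechet_derivative (\<lambda>z. L z (f t)) (at (\<tau> t)) (\<tau>' w) + L (\<tau> t) (f' w))) (at t)" .
  have "continuous (at t) \<tau>" using \<tau> has_derivative_continuous by blast
  then have "\<forall>\<^sub>F s in at t. \<tau> s \<in> X"
    using lin_fieldD(1)[OF L] t unfolding continuous_at tendsto_def by blast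
  then have "\<forall>\<^sub>F s in at t. (\<Sum>b\<in>Basis. (f s \<bullet> b) *\<^sub>R L (\<tau> s) b) = L (\<tau> s) (f s)"
    by eventually_elim (simp add: linear_sum_Basis[OF lin_fieldD(2)[OF L], of _ "f _"])
  from has_derivative_transform_eventually[OF * this] show ?thesis
    using linear_sum_Basis[OF lin_fieldD(2)[OF L t], of "f t"] by simp
qed

lemma bil_field_apply_has_derivative:
  assumes G: "bil_field X G" and t: "\<tau> t \<in> X" and \<tau>: "(\<tau> has_derivative \<tau>') (at t)"
    and f: "(f has_derivative f') (at t)" and h: "(h has_derivative h') (at t)"
  shows "((\<lambda>s. G (\<tau> s) (f s) (h s)) has_derivative
    (\<lambda>w. frechet_derivative (\<lambda>z. G z (f t) (h t)) (at (\<tau> t)) (\<tau>' w) + G (\<tau> t) (f' w) (h t) + G (\<tau> t)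
        (f t) (h' w))) (at t)"
proof -
  \<comment> \<open>The base point and the first argument of \<open>G\<close> are treated as one
    parameter. This makes \<open>G\<close> a field of linear forms in its second argument, and the
    linear product rule is used twice: for this field and for its own derivative.\<close>
  define L where "L z v = G (fst z) (snd z) v" for z :: "'a \<times> 'a" and v
  have oX: "open X" and oXU: "open (X \<times> (UNIV::'a set))" using bil_fieldD(1)[OF G]
      by (auto intro: open_Times)
  have sG: "smooth_on (X \<times> (UNIV :: 'a set)) (\<lambda>z. G (fst z) v w)" for v w
    using smooth_on_compose[OF oXU oX bil_fieldD(4)[OF G, of v w], of fst] smooth_on_fst[OF oXU
        smooth_on_id[OF oXU]]
    by auto
  have L: "lin_field (X \<times> UNIV) L" unfolding lin_field_def
  proof (intro conjI ballI allI oXU)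
    fix z assume "z \<in> X \<times> (UNIV :: 'a set)"
    then show "linear (L z)" using bil_fieldD(2)[OF G, of "fst z"] unfolding L_def bilinear_def
        by auto
  next
    fix v
    show "smooth_on (X \<times> UNIV) (\<lambda>z. L z v)" unfolding L_def
      by (rule smooth_on_linear_apply[where L="\<lambda>z u. G (fst z) u v", OF oXU _ sG smooth_on_snd[OF
          oXU smooth_on_id[OF oXU]]])
        (use bil_fieldD(2)[OF G] in \<open>auto simp: bilinear_def\<close>)
  qed
  have P: "((\<lambda>s. (\<tau> s, f s)) has_derivative (\<lambda>w. (\<tau>' w, f' w))) (at t)"
    using has_derivative_Pair[OF \<tau> f] .
  note main = lin_field_apply_has_derivative[OF L _ P h]
  have e: "frechet_derivative (\<lambda>z. L z (h t)) (at (\<tau> t, f t)) (d, e)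
     = frechet_derivative (\<lambda>z. G z (f t) (h t)) (at (\<tau> t)) d + G (\<tau> t) e (h t)" for d e
  proof -
    have "((\<lambda>z. L z (h t)) has_derivative (\<lambda>w. frechet_derivative (\<lambda>z. G z (snd (\<tau> t, f t)) (h t))
        (at (fst (\<tau> t, f t))) (fst w) + G (fst (\<tau> t, f t)) (snd w) (h t))) (at (\<tau> t, f t))"
      unfolding L_def
      using lin_field_apply_has_derivative[where L="\<lambda>x u. G x u (h t)" and f=snd and f'=snd
          and \<tau>=fst and \<tau>'=fst and t="(\<tau> t, f t)",
          OF bil_field_lin_field[OF G] _ has_derivative_fst[OF has_derivative_ident]
              has_derivative_snd[OF has_derivative_ident]] t
      by simp
    from frechet_derivative_apply[OF this] show ?thesis by simp
  qed
  show ?thesis using main t unfolding e by (simp add: L_def add.assoc)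
qed

text \<open>The Euler-Lagrange derivative of the energy \<open>G(x', x') / 2\<close> at position \<open>z\<close>, velocity \<open>v\<close>
  and acceleration \<open>a\<close>, tested against \<open>y\<close>.\<close>

definition EL :: "('k::euclidean_space \<Rightarrow> 'k \<Rightarrow> 'k \<Rightarrow> real) \<Rightarrow> 'k \<Rightarrow> 'k \<Rightarrow> 'k \<Rightarrow> 'k \<Rightarrow> real" where
  "EL G z v a y = frechet_derivative (\<lambda>z. G z v y) (at z) v + G z a y
     - frechet_derivative (\<lambda>z. G z v v) (at z) y / 2"

lemma bil_field_has_derivative:
  "bil_field X G \<Longrightarrow> x \<in> X \<Longrightarrow> ((\<lambda>z. G z v w) has_derivative frechet_derivative (\<lambda>z. G z v w) (at x))
      (at x)"
  using bil_fieldD(4) smooth_on_has_derivative by blast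

lemma EL_linear:
  assumes "bil_field X G" "z \<in> X"
  shows "linear (EL G z v a)"
proof -
  \<comment> \<open>Symmetry of \<open>G\<close> moves the test vector into the first slot, where
    linearity of the differentiated form is available.\<close>
  have 1: "(\<lambda>y. frechet_derivative (\<lambda>z. G z v y) (at z) v) = (\<lambda>y. frechet_derivative (\<lambda>z. G z y v)
      (at z) v)"
  proof
    fix y
    have "((\<lambda>z. G z y v) has_derivative frechet_derivative (\<lambda>z. G z v y) (at z)) (at z)"
      by (rule has_derivative_transform_within_open[OF bil_field_has_derivative[OF assms]
          bil_fieldD(1)[OF assms(1)] assms(2)])
        (rule bil_fieldD(3)[OF assms(1)])
    from frechet_derivative_apply[OF this] show "frechet_derivative (\<lambda>z. G z v y) (at z) v
        = frechet_derivative (\<lambda>z. G z y v) (at z) v"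
      by metis
  qed
  have a: "linear (\<lambda>y. frechet_derivative (\<lambda>z. G z v y) (at z) v)"
    unfolding 1 by (rule lin_field_derivative_linear[OF bil_field_lin_field[OF assms(1)] assms(2)])
  have b: "linear (G z a)" using bil_fieldD(2)[OF assms] unfolding bilinear_def by auto
  have c: "linear (frechet_derivative (\<lambda>z. G z v v) (at z))"
    using bil_field_has_derivative[OF assms] has_derivative_linear by blast
  show ?thesis
    by (rule linearI; unfold EL_def)
      (simp_all add: linear_add[OF a] linear_add[OF b] linear_add[OF c] linear_cmul[OF a]
          linear_cmul[OF b] linear_cmul[OF c] algebra_simps)
qed

text \<open>Naturality of the Euler-Lagrange derivative makes the geodesic equation independent of the
  chart, and it lets the part of the metric coming from \<open>B\<close> drop out in the directions that are
  vertical over \<open>B\<close>.\<close>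

lemma EL_pullback:
  fixes \<tau> :: "'k::euclidean_space \<Rightarrow> 'l::euclidean_space"
  defines "D \<equiv> \<lambda>z. frechet_derivative \<tau> (at z)"
  assumes X: "open X" "z \<in> X" and \<tau>: "smooth_on X \<tau>" "\<tau> ` X \<subseteq> Y" and H: "bil_field Y H"
    and G: "\<And>z v w. z \<in> X \<Longrightarrow> G z v w = H (\<tau> z) (D z v) (D z w)"
  shows "EL G z v a y = EL H (\<tau> z) (D z v) (frechet_derivative (\<lambda>z. D z v) (at z) v + D z a) (D z
      y)"
proof -
  define D2 where "D2 v w = frechet_derivative (\<lambda>z. D z v) (at z) w" for v w
  have \<tau>z: "\<tau> z \<in> Y" using X \<tau> by auto
  have d\<tau>: "(\<tau> has_derivative D z) (at z)" unfolding D_def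
      by (rule smooth_on_has_derivative[OF \<tau>(1) X(2)])
  have dD: "((\<lambda>z. D z v) has_derivative D2 v) (at z)" for v
    using smooth_on_has_derivative[OF smooth_on_derivative[OF \<tau>(1)] X(2)] unfolding D_def D2_def .
  \<comment> \<open>The terms containing \<open>D2 y v\<close> and \<open>D2 v y\<close> cancel by
    this symmetry. The surviving second derivative \<open>D2 v v\<close> is the correction to the
    acceleration under the map \<tau>.\<close>
  have sym: "D2 v w = D2 w v" for v w
    unfolding D2_def D_def by (rule second_derivative_symmetric[OF X \<tau>(1)])
  have dG: "frechet_derivative (\<lambda>z. G z v w) (at z) y =
      frechet_derivative (\<lambda>x. H x (D z v) (D z w)) (at (\<tau> z)) (D z y) + H (\<tau> z) (D2 v y) (D z w) + H
          (\<tau> z) (D z v) (D2 w y)" for v w y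
  proof -
    have "((\<lambda>z. G z v w) has_derivative (\<lambda>y. frechet_derivative (\<lambda>x. H x (D z v) (D z w)) (at (\<tau> z))
        (D z y) + H (\<tau> z) (D2 v y) (D z w) + H (\<tau> z) (D z v) (D2 w y))) (at z)"
    proof (rule has_derivative_transform_within_open[OF _ X])
      show "((\<lambda>s. H (\<tau> s) (D s v) (D s w)) has_derivative (\<lambda>y. frechet_derivative (\<lambda>x. H x (D z v)
          (D z w)) (at (\<tau> z)) (D z y) + H (\<tau> z) (D2 v y) (D z w) + H (\<tau> z) (D z v) (D2 w y))) (at
          z)"
        using bil_field_apply_has_derivative[where G=H and f="\<lambda>s. D s v"
            and h="\<lambda>s. D s w", OF H \<tau>z d\<tau> dD dD] .
    qed (simp add: G)
    from frechet_derivative_apply[OF this] show ?thesis .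
  qed
  have Hb: "bilinear (H (\<tau> z))" using bil_fieldD(2)[OF H \<tau>z] .
  have Hs: "H (\<tau> z) v w = H (\<tau> z) w v" for v w using bil_fieldD(3)[OF H \<tau>z] .
  show ?thesis unfolding EL_def dG D2_def[symmetric] G[OF X(2)]
    by (simp add: sym[of y v] bilinear_ladd[OF Hb] Hs[of "D2 v y"] field_simps)
qed

text \<open>Tested against the velocity itself, the Euler-Lagrange expression is half the time
  derivative of \<open>G (x s) (v s) (v s)\<close>.\<close>

lemma EL_energy:
  assumes G: "bil_field X G" and t: "x t \<in> X"
    and x: "(x has_vector_derivative v t) (at t)" and v: "(v has_vector_derivative a) (at t)"
    and el: "EL G (x t) (v t) a (v t) = 0"
  shows "((\<lambda>s. G (x s) (v s) (v s)) has_real_derivative 0) (at t)"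
proof -
  have "((\<lambda>s. G (x s) (v s) (v s)) has_derivative (\<lambda>w.
     frechet_derivative (\<lambda>z. G z (v t) (v t)) (at (x t)) (w *\<^sub>R v t) + G (x t) (w *\<^sub>R a) (v t) + G
         (x t) (v t) (w *\<^sub>R a))) (at t)"
    using bil_field_apply_has_derivative[where G=G and f=v and h=v and \<tau>=x, OF G t
        x[unfolded has_vector_derivative_def] v[unfolded has_vector_derivative_def] v[unfolded
            has_vector_derivative_def]] .
  moreover have "frechet_derivative (\<lambda>z. G z (v t) (v t)) (at (x t)) (w *\<^sub>R v t) + G (x t) (w *\<^sub>R a)
      (v t) + G (x t) (v t) (w *\<^sub>R a) = 0" for w
  proof -
    have "frechet_derivative (\<lambda>z. G z (v t) (v t)) (at (x t)) (w *\<^sub>R v t)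
        = w * frechet_derivative (\<lambda>z. G z (v t) (v t)) (at (x t)) (v t)"
      using linear_cmul[OF has_derivative_linear[OF bil_field_has_derivative[OF G t]]] by simp
    moreover have "G (x t) (w *\<^sub>R a) (v t) = w * G (x t) a (v t)" "G (x t) (v t) (w *\<^sub>R a)
        = w * G (x t) a (v t)"
      using bilinear_lmul[OF bil_fieldD(2)[OF G t]] bil_fieldD(3)[OF G t, of "v t"] by simp_all
    moreover have "frechet_derivative (\<lambda>z. G z (v t) (v t)) (at (x t)) (v t)
        = - 2 * G (x t) a (v t)"
      using el unfolding EL_def by (simp add: field_simps)
    ultimately show ?thesis by simp
  qed
  ultimately show ?thesis by (simp add: has_field_derivative_def lambda_zero)
qed

section \<open>Linear systems depending smoothly on parameters\<close>

text \<open>The product rule with one factor merely continuous: its increment is multiplied by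
  \<psi>, which vanishes at \<open>x\<close> and is therefore of first order nearby. It serves to
  differentiate the solution of a linear system at a stage where that solution is only known to be
  continuous.\<close>

lemma has_derivative_scaleR_vanishing:
  fixes \<phi> :: "'a::real_normed_vector \<Rightarrow> real" and \<psi> :: "'a \<Rightarrow> 'b::real_normed_vector"
  assumes "isCont \<phi> x" "(\<psi> has_derivative \<psi>') (at x)" "\<psi> x = 0"
  shows "((\<lambda>y. \<phi> y *\<^sub>R \<psi> y) has_derivative (\<lambda>h. \<phi> x *\<^sub>R \<psi>' h)) (at x)"
proof -
  obtain e B where B: "e > 0" "B > 0" "\<And>y. dist y x < e \<Longrightarrow> norm (\<psi> y) \<le> B * norm (y - x)"
  proof -
    obtain K where K: "bounded_linear \<psi>'" "K > 0" "\<And>h. norm (\<psi>' h) \<le> norm h * K"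
      using has_derivative_bounded_linear[OF assms(2)] bounded_linear.pos_bounded by metis
    have "\<exists>d>0. \<forall>y. norm (y - x) < d \<longrightarrow> norm (\<psi> y - \<psi> x - \<psi>' (y - x)) \<le> 1 * norm (y - x)"
      using assms(2) unfolding has_derivative_at_alt by (meson zero_less_one)
    then obtain d where d: "d > 0" "\<And>y. norm (y - x) < d \<Longrightarrow> norm (\<psi> y - \<psi>' (y - x)) \<le> norm (y - x)"
      using assms(3) by auto
    have "norm (\<psi> y) \<le> (K + 1) * norm (y - x)" if "dist y x < d" for y
    proof -
      have "norm (\<psi> y) \<le> norm (\<psi> y - \<psi>' (y - x)) + norm (\<psi>' (y - x))"
        using norm_triangle_ineq[of "\<psi> y - \<psi>' (y - x)" "\<psi>' (y - x)"] by simp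
      also have "\<dots> \<le> norm (y - x) + norm (y - x) * K" using d(2)[of y] K(3)[of "y - x"] that
          by (simp add: dist_norm)
      finally show ?thesis by (simp add: algebra_simps)
    qed
    with that d(1) K(2) show ?thesis by (metis add_pos_pos zero_less_one)
  qed
  show ?thesis unfolding has_derivative_at_alt
  proof (intro conjI allI impI)
    show "bounded_linear (\<lambda>h. \<phi> x *\<^sub>R \<psi>' h)"
      using has_derivative_bounded_linear[OF assms(2)] bounded_linear_const_scaleR by blast
  next
    fix \<epsilon> :: real assume \<epsilon>: "\<epsilon> > 0"
    define \<delta> where "\<delta> = \<epsilon> / (2 * (\<bar>\<phi> x\<bar> + 1))"
    have "\<delta> > 0" unfolding \<delta>_def using \<epsilon> by (simp add: add_nonneg_pos)
    then obtain d1 where d1: "d1 > 0" "\<And>y. norm (y - x) < d1 \<Longrightarrow> norm (\<psi> y - \<psi> x - \<psi>' (y - x))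
        \<le> \<delta> * norm (y - x)"
      using assms(2) unfolding has_derivative_at_alt by meson
    have "\<epsilon> / (2 * B) > 0" using \<epsilon> B by simp
    then obtain d2 where d2: "d2 > 0" "\<And>y. dist y x < d2 \<Longrightarrow> dist (\<phi> y) (\<phi> x) < \<epsilon> / (2 * B)"
      using assms(1) unfolding continuous_at_eps_delta by metis
    show "\<exists>d>0. \<forall>y. norm (y - x) < d \<longrightarrow>
       norm (\<phi> y *\<^sub>R \<psi> y - \<phi> x *\<^sub>R \<psi> x - \<phi> x *\<^sub>R \<psi>' (y - x)) \<le> \<epsilon> * norm (y - x)"
    proof (intro exI[of _ "min e (min d1 d2)"] conjI allI impI)
      fix y assume y: "norm (y - x) < min e (min d1 d2)"
      have "\<phi> y *\<^sub>R \<psi> y - \<phi> x *\<^sub>R \<psi> x - \<phi> x *\<^sub>R \<psi>' (y - x) = (\<phi> y - \<phi> x) *\<^sub>R \<psi> y + \<phi> x *\<^sub>R (\<psi> y - \<psi>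
          x - \<psi>' (y - x))"
        using assms(3) by (simp add: algebra_simps)
      also have "norm \<dots> \<le> \<bar>\<phi> y - \<phi> x\<bar> * norm (\<psi> y) + \<bar>\<phi> x\<bar> * norm (\<psi> y - \<psi> x - \<psi>' (y - x))"
        by (metis norm_scaleR norm_triangle_ineq)
      also have "\<dots> \<le> \<epsilon> / (2 * B) * (B * norm (y - x)) + \<bar>\<phi> x\<bar> * (\<delta> * norm (y - x))"
        using d2(2)[of y] B(3)[of y] d1(2)[of y] y
            by (intro add_mono mult_mono) (auto simp: dist_norm intro: less_imp_le)
      also have "\<dots> \<le> \<epsilon> / 2 * norm (y - x) + \<epsilon> / 2 * norm (y - x)"
      proof -
        have "\<bar>\<phi> x\<bar> * \<delta> \<le> \<epsilon> / 2" unfolding \<delta>_def using \<epsilon> by (simp add: field_simps)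
        then have "\<bar>\<phi> x\<bar> * (\<delta> * norm (y - x)) \<le> \<epsilon> / 2 * norm (y - x)"
          by (metis mult.assoc mult_right_mono norm_ge_zero)
        then show ?thesis using B by simp
      qed
      finally show "norm (\<phi> y *\<^sub>R \<psi> y - \<phi> x *\<^sub>R \<psi> x - \<phi> x *\<^sub>R \<psi>' (y - x)) \<le> \<epsilon> * norm (y - x)"
          by simp
    qed (use B d1 d2 in auto)
  qed
qed

definition nondegenerate_on :: "'k::zero set \<Rightarrow> ('k \<Rightarrow> 'k \<Rightarrow> 'k \<Rightarrow> real) \<Rightarrow> bool" where
  "nondegenerate_on X G \<longleftrightarrow> (\<forall>x\<in>X. \<forall>z. (\<forall>y. G x z y = 0) \<longrightarrow> z = 0)"

text \<open>Nondegeneracy makes \<open>T\<close> injective, and an injective linear endomorphism of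
  a finite-dimensional space is onto.\<close>

lemma nondegenerate_solve:
  fixes G :: "'k::euclidean_space \<Rightarrow> 'k \<Rightarrow> 'k \<Rightarrow> real"
  assumes G: "bil_field X G" "nondegenerate_on X G" "x \<in> X" and b: "linear b"
  shows "\<exists>!z. \<forall>y. G x z y = b y"
proof -
  have l: "linear (\<lambda>z. G x z y)" "linear (G x y)" for y using bil_fieldD(2)[OF G(1,3)]
      unfolding bilinear_def by auto
  define T where "T z = (\<Sum>b\<in>Basis. G x z b *\<^sub>R b)" for z
  have Tb: "T z \<bullet> b = G x z b" if "b \<in> Basis" for z b unfolding T_def using that by simp
  have lT: "linear T" unfolding T_def
    by (intro linear_compose_sum ballI) (auto intro!: linearI simp: linear_add[OF l(1)]
        linear_cmul[OF l(1)] scaleR_add_left)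
  have uniq: "z = w" if "\<forall>b\<in>Basis. G x z b = G x w b" for z w
  proof -
    have "G x (z - w) y = 0" for y
    proof -
      have "\<forall>b\<in>Basis. G x (z - w) b = 0" using that linear_diff[OF l(1)] by simp
      then show ?thesis by (subst linear_sum_Basis[OF l(2)]) simp
    qed
    then show ?thesis using G unfolding nondegenerate_on_def by force
  qed
  have "inj T" by (rule injI) (metis Tb uniq)
  then have "surj T" using lT linear_injective_imp_surjective by blast
  then obtain z where z: "T z = (\<Sum>i\<in>Basis. b i *\<^sub>R i)" by (metis surjD)
  have "G x z i = b i" if "i \<in> Basis" for i using Tb[OF that, of z] z that by simp
  then have "G x z y = b y" for y
    by (subst linear_sum_Basis[OF l(2)], subst linear_sum_Basis[OF b]) simp
  moreover have "w = z" if "\<forall>y. G x w y = b y" for w using uniq calculation that by metis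
  ultimately show ?thesis by metis
qed

text \<open>With \<open>T x\<close> the linear map behind \<open>G x\<close> and \<open>S\<close> a
  left inverse of \<open>T x0\<close> alone, the solution satisfies
  \<open>z x = S (\<beta> x - (T x - T x0) (z x))\<close>, with \<beta> the right-hand side as a
  vector. No inverse of \<open>T x\<close> at other points is needed: the identity first gives
  continuity, because \<open>T x - T x0\<close> is small near \<open>x0\<close>, and can then be
  differentiated.\<close>

lemma nondegenerate_solution_has_derivative:
  fixes G :: "'k::euclidean_space \<Rightarrow> 'k \<Rightarrow> 'k \<Rightarrow> real"
  assumes G: "bil_field X G" "nondegenerate_on X G" and b: "\<And>x. x \<in> X \<Longrightarrow> linear (b x)"
    and z: "\<And>x y. x \<in> X \<Longrightarrow> G x (z x) y = b x y" and x0: "x0 \<in> X"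
  shows "(\<And>y. isCont (\<lambda>x. b x y) x0) \<Longrightarrow> isCont z x0"
    and "(\<And>y. ((\<lambda>x. b x y) has_derivative b' y) (at x0)) \<Longrightarrow> \<exists>z'. (z has_derivative z') (at x0)"
proof -
  have l: "linear (\<lambda>z. G x z y)" "linear (G x y)" if "x \<in> X" for x y
      using bil_fieldD(2)[OF G(1) that] unfolding bilinear_def by auto
  define T where "T x z = (\<Sum>b\<in>Basis. G x z b *\<^sub>R b)" for x z
  have lT: "linear (T x)" if "x \<in> X" for x unfolding T_def
    by (intro linear_compose_sum ballI) (auto intro!: linearI simp: linear_add[OF l(1)[OF that]]
        linear_cmul[OF l(1)[OF that]] scaleR_add_left)
  have "inj (T x0)"
  proof (rule injI)
    fix v w assume "T x0 v = T x0 w"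
    moreover have "T x0 u \<bullet> i = G x0 u i" if "i \<in> Basis" for i u unfolding T_def using that by simp
    ultimately have "G x0 v i = G x0 w i" if "i \<in> Basis" for i using that by metis
    then have "G x0 v y = G x0 w y" for y
      by (subst (1 2) linear_sum_Basis[OF l(2)[OF x0]]) simp
    then show "v = w" using nondegenerate_solve[OF G x0 l(2)[OF x0, of w]] by blast
  qed
  then obtain S where S: "linear S" "\<And>v. S (T x0 v) = v"
    using linear_injective_left_inverse[OF lT[OF x0]] by (metis comp_apply id_apply)
  have bS: "bounded_linear S" using S(1) linear_conv_bounded_linear by blast
  define \<beta> where "\<beta> x = (\<Sum>i\<in>Basis. b x i *\<^sub>R i)" for x
  have Tz: "T x (z x) = \<beta> x" if "x \<in> X" for x unfolding T_def \<beta>_def using z[OF that] by simp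
  have dT: "((\<lambda>x. T x v) has_derivative (\<lambda>h. \<Sum>i\<in>Basis. frechet_derivative (\<lambda>x. G x v i) (at x0) h
      *\<^sub>R i)) (at x0)" for v
    unfolding T_def by (intro has_derivative_sum has_derivative_scaleR_left
        bil_field_has_derivative[OF G(1) x0])
  have cT: "isCont (\<lambda>x. T x v) x0" for v using dT has_derivative_continuous by blast
  have evX: "\<forall>\<^sub>F x in at x0. x \<in> X" using bil_fieldD(1)[OF G(1)] x0
      by (simp add: eventually_at_in_open')
  show c: "isCont z x0" if bc: "\<And>y. isCont (\<lambda>x. b x y) x0"
  proof -
    have c\<beta>: "isCont \<beta> x0" unfolding \<beta>_def by (intro continuous_intros bc)
    obtain K where K: "K > 0" "\<And>v. norm (S v) \<le> norm v * K" using bounded_linear.pos_bounded[OF bS]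
        by blast
    \<comment> \<open>A bound for the operator norm of \<open>T x - T x0\<close>, see
      \<open>Tdiff\<close>.\<close>
    define \<rho> where "\<rho> x = (\<Sum>i\<in>Basis. norm (T x i - T x0 i))" for x
    have c\<rho>: "isCont \<rho> x0" unfolding \<rho>_def by (intro continuous_intros cT)
    have \<rho>0: "\<rho> x0 = 0" unfolding \<rho>_def by simp
    have Tdiff: "norm (T x v - T x0 v) \<le> norm v * \<rho> x" if "x \<in> X" for x v
    proof -
      have "T x v - T x0 v = (\<Sum>i\<in>Basis. (v \<bullet> i) *\<^sub>R (T x i - T x0 i))"
        by (subst linear_sum_Basis[OF lT[OF that]], subst linear_sum_Basis[OF lT[OF x0]]) (simp add:
            sum_subtractf scaleR_diff_right)
      also have "norm \<dots> \<le> (\<Sum>i\<in>Basis. norm v * norm (T x i - T x0 i))"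
        by (rule sum_norm_le) (simp add: mult_right_mono Basis_le_norm)
      finally show ?thesis unfolding \<rho>_def by (simp add: sum_distrib_left)
    qed
    have key: "norm (z x - z x0) \<le> K * (norm (\<beta> x - \<beta> x0) + norm (z x) * \<rho> x)" if "x \<in> X" for x
    proof -
      have "z x - z x0 = S (T x0 (z x) - T x0 (z x0))" by (simp add: linear_diff[OF S(1)] S(2))
      also have "T x0 (z x) - T x0 (z x0) = (\<beta> x - \<beta> x0) - (T x (z x) - T x0 (z x))"
          using Tz[OF that] Tz[OF x0] by simp
      finally have "norm (z x - z x0) \<le> K * norm ((\<beta> x - \<beta> x0) - (T x (z x) - T x0 (z x)))" using K
          by (metis mult.commute)
      also have "norm ((\<beta> x - \<beta> x0) - (T x (z x) - T x0 (z x)))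
          \<le> norm (\<beta> x - \<beta> x0) + norm (z x) * \<rho> x"
        using norm_triangle_ineq4[of "\<beta> x - \<beta> x0" "T x (z x) - T x0 (z x)"] Tdiff[OF that, of "z x"]
            by linarith
      finally show ?thesis using K by (simp add: mult_left_mono)
    qed
    \<comment> \<open>Where \<rho> is below this threshold, the right-hand side of
      \<open>key\<close> contains at most half of \<open>norm (z x - z x0)\<close>, which is
      absorbed on the left.\<close>
    have "\<forall>\<^sub>F x in at x0. \<rho> x < 1 / (2 * K)"
      using c\<rho> \<rho>0 K unfolding continuous_at by (intro order_tendstoD(2)[of \<rho> 0]) auto
    then have ev: "\<forall>\<^sub>F x in at x0. norm (z x - z x0) \<le> 2 * K * (norm (\<beta> x - \<beta> x0) + norm (z x0) * \<rho>
        x)"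
      using evX
    proof eventually_elim
      case (elim x)
      have r0: "\<rho> x \<ge> 0" unfolding \<rho>_def by (simp add: sum_nonneg)
      have "norm (z x) \<le> norm (z x - z x0) + norm (z x0)" using norm_triangle_sub[of "z x" "z x0"]
          by simp
      then have "norm (z x) * \<rho> x \<le> norm (z x - z x0) * \<rho> x + norm (z x0) * \<rho> x"
        using r0 by (metis distrib_right mult_right_mono)
      moreover have "norm (z x - z x0) * \<rho> x \<le> norm (z x - z x0) * (1 / (2 * K))" using elim
          by (intro mult_left_mono) auto
      ultimately have "norm (z x) * \<rho> x \<le> norm (z x - z x0) / (2 * K) + norm (z x0) * \<rho> x" by simp
      then have "K * (norm (\<beta> x - \<beta> x0) + norm (z x) * \<rho> x) \<le> K * (norm (\<beta> x - \<beta> x0) + (norm (z x -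
          z x0) / (2 * K) + norm (z x0) * \<rho> x))"
        using K by (intro mult_left_mono add_mono) auto
      also have "\<dots> = K * (norm (\<beta> x - \<beta> x0) + norm (z x0) * \<rho> x) + norm (z x - z x0) / 2" using K
          by (simp add: field_simps)
      finally show ?case using key[OF elim(2)] by linarith
    qed
    have "((\<lambda>x. 2 * K * (norm (\<beta> x - \<beta> x0) + norm (z x0) * \<rho> x)) \<longlongrightarrow> 2 * K * (norm (\<beta> x0 - \<beta> x0) +
        norm (z x0) * 0)) (at x0)"
      using c\<beta> c\<rho> \<rho>0 unfolding continuous_at by (intro tendsto_intros) auto
    then have "((\<lambda>x. z x - z x0) \<longlongrightarrow> 0) (at x0)" using ev by (auto intro: Lim_null_comparison)
    then show ?thesis unfolding continuous_at using LIM_zero_iff by blast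
  qed
  show "\<exists>z'. (z has_derivative z') (at x0)" if bd: "\<And>y. ((\<lambda>x. b x y) has_derivative b' y) (at x0)"
  proof -
    have cz: "isCont z x0" using c bd has_derivative_continuous by blast
    have d\<beta>: "(\<beta> has_derivative (\<lambda>h. \<Sum>i\<in>Basis. b' i h *\<^sub>R i)) (at x0)" unfolding \<beta>_def
      by (intro has_derivative_sum has_derivative_scaleR_left bd)
    have "((\<lambda>x. T x i - T x0 i) has_derivative (\<lambda>h. (\<Sum>j\<in>Basis. frechet_derivative (\<lambda>x. G x i j) (at
        x0) h *\<^sub>R j) - 0)) (at x0)" for i
      by (intro has_derivative_diff dT has_derivative_const)
    \<comment> \<open>Here \<open>z\<close> is only continuous, but the other factor
      \<open>T x i - T x0 i\<close> vanishes at \<open>x0\<close>.\<close>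
    then have "((\<lambda>x. (z x \<bullet> i) *\<^sub>R (T x i - T x0 i)) has_derivative (\<lambda>h. (z x0 \<bullet> i) *\<^sub>R ((\<Sum>j\<in>Basis.
        frechet_derivative (\<lambda>x. G x i j) (at x0) h *\<^sub>R j) - 0))) (at x0)" for i
      by (intro has_derivative_scaleR_vanishing) (auto intro!: continuous_intros cz)
    then have d2: "((\<lambda>x. \<Sum>i\<in>Basis. (z x \<bullet> i) *\<^sub>R (T x i - T x0 i))
        has_derivative (\<lambda>h. \<Sum>i\<in>Basis. (z x0 \<bullet> i) *\<^sub>R ((\<Sum>j\<in>Basis. frechet_derivative (\<lambda>x. G x i j)
        (at x0) h *\<^sub>R j) - 0))) (at x0)"
      by (intro has_derivative_sum)
    have "\<exists>w'. ((\<lambda>x. S (\<beta> x - (\<Sum>i\<in>Basis. (z x \<bullet> i) *\<^sub>R (T x i - T x0 i))))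
        has_derivative w') (at x0)"
      using bounded_linear.has_derivative[OF bS has_derivative_diff[OF d\<beta> d2]] by blast
    then obtain w' where w': "((\<lambda>x. S (\<beta> x - (\<Sum>i\<in>Basis. (z x \<bullet> i) *\<^sub>R (T x i - T x0 i))))
        has_derivative w') (at x0)" ..
    have "S (\<beta> x - (\<Sum>i\<in>Basis. (z x \<bullet> i) *\<^sub>R (T x i - T x0 i))) = z x" if "x \<in> X" for x
    proof -
      have "(\<Sum>i\<in>Basis. (z x \<bullet> i) *\<^sub>R (T x i - T x0 i)) = T x (z x) - T x0 (z x)"
        by (subst linear_sum_Basis[OF lT[OF that], of "z x"], subst linear_sum_Basis[OF lT[OF x0],
            of "z x"]) (simp add: sum_subtractf scaleR_diff_right)
      then show ?thesis using Tz[OF that] S(2) by simp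
    qed
    then show ?thesis
      using has_derivative_transform_within_open[OF w' bil_fieldD(1)[OF G(1)] x0] by blast
  qed
qed

text \<open>Differentiating \<open>G(z, y) = b(y)\<close> gives a system of the same form for the derivatives of
  \<open>z\<close>.\<close>

lemma nondegenerate_solution_Ck:
  fixes G :: "'k::euclidean_space \<Rightarrow> 'k \<Rightarrow> 'k \<Rightarrow> real"
  assumes G: "bil_field X G" "nondegenerate_on X G"
  shows "(\<And>x. x \<in> X \<Longrightarrow> linear (b x)) \<Longrightarrow> (\<And>x y. x \<in> X \<Longrightarrow> G x (z x) y = b x y) \<Longrightarrow>
    (\<And>y. Ck_on k X (\<lambda>x. b x y)) \<Longrightarrow> Ck_on k X z"
proof (induction k arbitrary: b z)
  case 0
  note oX = bil_fieldD(1)[OF G(1)]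
  have "isCont z x" if "x \<in> X" for x
    by (rule nondegenerate_solution_has_derivative(1)[OF G 0(1,2) that])
      (use 0(3) that oX in \<open>auto simp: continuous_on_eq_continuous_at\<close>)
  then show ?case by (simp add: continuous_at_imp_continuous_on)
next
  case (Suc k)
  note oX = bil_fieldD(1)[OF G(1)]
  have db: "((\<lambda>x. b x y) has_derivative frechet_derivative (\<lambda>x. b x y) (at x)) (at x)" if "x \<in> X"
      for x y
    using Ck_on_Suc_has_derivative[OF Suc.prems(3) that] .
  have dz: "(z has_derivative frechet_derivative z (at x)) (at x)" if "x \<in> X" for x
    using nondegenerate_solution_has_derivative(2)[OF G Suc.prems(1,2) that db[OF that]]
      frechet_derivative_works differentiableI by blast
  have zk: "Ck_on k X z" by (rule Suc.IH[OF Suc.prems(1,2) Ck_on_Suc_imp[OF Suc.prems(3)]])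
  show ?case
  proof (rule Ck_on_SucI[OF oX dz])
    fix v
    \<comment> \<open>The right-hand side of the differentiated system. Expanding the derivative of
      \<open>G\<close> in \<open>Basis\<close> shows that it involves \<open>z\<close> itself and
      not the derivative of \<open>z\<close>, so it is as smooth as the induction hypothesis
      requires.\<close>
    define b2 where "b2 x y = frechet_derivative (\<lambda>x. b x y) (at x) v - (\<Sum>i\<in>Basis. (z x \<bullet> i) *\<^sub>R
        frechet_derivative (\<lambda>x. G x i y) (at x) v)" for x y
    have eq: "G x (frechet_derivative z (at x) v) y = b2 x y" if x: "x \<in> X" for x y
    proof -
      have "((\<lambda>x. G x (z x) y) has_derivative
        (\<lambda>w. frechet_derivative (\<lambda>x'. G x' (z x) y) (at x) w + G x (frechet_derivative z (at x) w)
            y)) (at x)"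
        using lin_field_apply_has_derivative[OF bil_field_lin_field[OF G(1)] x has_derivative_ident
            dz[OF x]] .
      then have "((\<lambda>x. b x y) has_derivative
        (\<lambda>w. frechet_derivative (\<lambda>x'. G x' (z x) y) (at x) w + G x (frechet_derivative z (at x) w)
            y)) (at x)"
        by (rule has_derivative_transform_within_open[OF _ oX x]) (use Suc.prems(2) in auto)
      from frechet_derivative_apply[OF this]
      have "frechet_derivative (\<lambda>x. b x y) (at x) v = frechet_derivative (\<lambda>x'. G x' (z x) y) (at x)
          v + G x (frechet_derivative z (at x) v) y"
        by metis
      moreover have "frechet_derivative (\<lambda>x'. G x' (z x) y) (at x) v
          = (\<Sum>i\<in>Basis. (z x \<bullet> i) *\<^sub>R frechet_derivative (\<lambda>x. G x i y) (at x) v)"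
        by (rule linear_sum_Basis[OF lin_field_derivative_linear[OF bil_field_lin_field[OF G(1)]
            x]])
      ultimately show ?thesis unfolding b2_def by simp
    qed
    show "Ck_on k X (\<lambda>x. frechet_derivative z (at x) v)"
    proof (rule Suc.IH[OF _ eq])
      fix x assume "x \<in> X"
      then show "linear (b2 x)" using eq bil_fieldD(2)[OF G(1)] unfolding bilinear_def
          by (metis (no_types, lifting) ext)
    next
      fix y
      have "smooth_on X (\<lambda>x. frechet_derivative (\<lambda>x. G x i y) (at x) v)" for i
        by (intro smooth_on_derivative bil_fieldD(4)[OF G(1)])
      then have c: "Ck_on k X (\<lambda>x. frechet_derivative (\<lambda>x. G x i y) (at x) v)" for i
        unfolding smooth_on_def by blast
      have c2: "Ck_on k X (\<lambda>x. \<Sum>i\<in>Basis. (z x \<bullet> i) *\<^sub>R frechet_derivative (\<lambda>x. G x i y) (at x) v)"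
        by (rule Ck_on_sum[OF oX], rule Ck_on_bounded_bilinear[OF bounded_bilinear_scaleR oX _ c],
            rule Ck_on_bounded_linear[OF bounded_linear_inner_left oX zk])
      have c1: "Ck_on k X (\<lambda>x. frechet_derivative (\<lambda>x. b x y) (at x) v)" using Suc.prems(3) by simp
      show "Ck_on k X (\<lambda>x. b2 x y)" unfolding b2_def diff_conv_add_uminus
        by (rule Ck_on_add[OF oX c1 Ck_on_bounded_linear[OF bounded_linear_minus[OF
            bounded_linear_ident] oX c2]])
    qed
  qed
qed

section \<open>The Koszul formula and Christoffel symbols in coordinates\<close>

definition koszul :: "('k::euclidean_space \<Rightarrow> 'k \<Rightarrow> 'k \<Rightarrow> real) \<Rightarrow> 'k \<Rightarrow> 'k \<Rightarrow> 'k \<Rightarrow> 'k \<Rightarrow> real" where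
  "koszul G x v w y = (frechet_derivative (\<lambda>x. G x w y) (at x) v + frechet_derivative (\<lambda>x. G x v y)
      (at x) w -
      frechet_derivative (\<lambda>x. G x v w) (at x) y) / 2"

text \<open>This is \<open>christoffel\<close> freed from manifold and chart, so that linear algebra
  and differential equations can be treated on an open set of a Euclidean space.\<close>

definition chr :: "('k::euclidean_space \<Rightarrow> 'k \<Rightarrow> 'k \<Rightarrow> real) \<Rightarrow> 'k \<Rightarrow> 'k \<Rightarrow> 'k \<Rightarrow> 'k" where
  "chr G x v w = (THE z. \<forall>y. G x z y = koszul G x v w y)"

lemma christoffel_chr: "christoffel M g c x v w = chr (comp2 M g c) x v w"
  unfolding christoffel_def chr_def koszul_def ..

context
  fixes X :: "'k::euclidean_space set" and G
  assumes G: "bil_field X G" and nd: "nondegenerate_on X G"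
begin

lemma bil_field_derivative_linear:
  assumes "x \<in> X"
  shows "linear (\<lambda>v. frechet_derivative (\<lambda>x. G x v w) (at x) d)"
    "linear (\<lambda>w. frechet_derivative (\<lambda>x. G x v w) (at x) d)"
    "linear (\<lambda>d. frechet_derivative (\<lambda>x. G x v w) (at x) d)"
proof -
  show "linear (\<lambda>v. frechet_derivative (\<lambda>x. G x v w) (at x) d)"
    by (rule lin_field_derivative_linear[OF bil_field_lin_field[OF G] assms])
  have "lin_field X (\<lambda>x. G x v)" using G unfolding bil_field_def lin_field_def bilinear_def by auto
  from lin_field_derivative_linear[OF this assms]
      show "linear (\<lambda>w. frechet_derivative (\<lambda>x. G x v w) (at x) d)" .
  show "linear (\<lambda>d. frechet_derivative (\<lambda>x. G x v w) (at x) d)"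
    using has_derivative_linear[OF bil_field_has_derivative[OF G assms]] .
qed

lemma koszul_linear:
  assumes x: "x \<in> X"
  shows "linear (koszul G x v w)" "linear (\<lambda>w. koszul G x v w y)" "linear (\<lambda>v. koszul G x v w y)"
proof -
  note l = bil_field_derivative_linear[OF x]
  show "linear (koszul G x v w)" "linear (\<lambda>w. koszul G x v w y)" "linear (\<lambda>v. koszul G x v w y)"
    unfolding koszul_def
    by (rule linearI; simp add: linear_add[OF l(1)] linear_cmul[OF l(1)] linear_add[OF l(2)]
        linear_cmul[OF l(2)]
      linear_add[OF l(3)] linear_cmul[OF l(3)] field_simps)+
qed

lemma chr_eq:
  assumes x: "x \<in> X"
  shows "G x (chr G x v w) y = koszul G x v w y"
  using theI'[OF nondegenerate_solve[OF G nd x koszul_linear(1)[OF x]]] unfolding chr_def by blast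

lemma chr_unique:
  assumes x: "x \<in> X" and "\<And>y. G x z y = koszul G x v w y"
  shows "chr G x v w = z"
  using nondegenerate_solve[OF G nd x koszul_linear(1)[OF x]] chr_eq[OF x] assms(2) by blast

lemma chr_bilinear:
  assumes x: "x \<in> X" shows "bilinear (chr G x)"
proof -
  note b = bil_fieldD(2)[OF G x]
  note k = koszul_linear[OF x]
  show ?thesis unfolding bilinear_def
  proof (intro conjI allI)
    fix v show "linear (chr G x v)"
      by (rule linearI; rule chr_unique[OF x])
        (simp_all add: bilinear_ladd[OF b] bilinear_lmul[OF b] chr_eq[OF x] linear_add[OF k(2)]
            linear_cmul[OF k(2)])
  next
    fix w show "linear (\<lambda>v. chr G x v w)"
      by (rule linearI; rule chr_unique[OF x])
        (simp_all add: bilinear_ladd[OF b] bilinear_lmul[OF b] chr_eq[OF x] linear_add[OF k(3)]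
            linear_cmul[OF k(3)])
  qed
qed

lemma chr_smooth: "smooth_on X (\<lambda>x. chr G x v w)"
  unfolding smooth_on_def
proof
  fix k
  have oX: "open X" using bil_fieldD(1)[OF G] .
  have "smooth_on X (\<lambda>x. (1/2) *\<^sub>R (frechet_derivative (\<lambda>x. G x w y) (at x) v + frechet_derivative
      (\<lambda>x. G x v y) (at x) w -
      frechet_derivative (\<lambda>x. G x v w) (at x) y))" for y
    by (intro smooth_on_scaleR smooth_on_const smooth_on_diff smooth_on_add smooth_on_derivative
        bil_fieldD(4)[OF G] oX)
  then have c: "Ck_on k X (\<lambda>x. koszul G x v w y)" for y
    unfolding smooth_on_def koszul_def by simp
  show "Ck_on k X (\<lambda>x. chr G x v w)"
    by (rule nondegenerate_solution_Ck[OF G nd koszul_linear(1) chr_eq c])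
qed

text \<open>For equal arguments the Koszul form becomes the derivative part of \<open>EL\<close>, so
  \<open>EL\<close> is the metric contracted with the geodesic equation. Nondegeneracy permits
  cancelling the metric.\<close>

lemma geodesic_eq_EL:
  assumes x: "x \<in> X"
  shows "a + chr G x v v = 0 \<longleftrightarrow> (\<forall>y. EL G x v a y = 0)"
proof -
  note b = bil_fieldD(2)[OF G x]
  have "EL G x v a y = G x (a + chr G x v v) y" for y
    unfolding EL_def bilinear_ladd[OF b] chr_eq[OF x] koszul_def by (simp add: field_simps)
  then show ?thesis using nd x bilinear_lzero[OF b] unfolding nondegenerate_on_def by metis
qed

end

section \<open>Joint smoothness and bounds over compact sets\<close>

lemma lin_field_smooth_apply:
  assumes "lin_field X L"
  shows "smooth_on (X \<times> UNIV) (\<lambda>z. L (fst z) (snd z))"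
proof -
  have o: "open X" and oXU: "open (X \<times> (UNIV::'b set))" using lin_fieldD(1)[OF assms]
      by (auto intro: open_Times)
  have f: "smooth_on (X \<times> (UNIV :: 'b set)) (\<lambda>z. L (fst z) v)" for v
    using smooth_on_compose[OF oXU o lin_fieldD(3)[OF assms, of v], of fst] smooth_on_fst[OF oXU
        smooth_on_id[OF oXU]] by auto
  show ?thesis
    using smooth_on_linear_apply[where L="\<lambda>z. L (fst z)", OF oXU _ f smooth_on_snd[OF oXU
        smooth_on_id[OF oXU]]] lin_fieldD(2)[OF assms]
    by auto
qed

text \<open>Serves both for the geodesic spray, where \<open>L\<close> is the Christoffel form, and
  for the squared length of a vector.\<close>

lemma smooth_on_quadratic:
  fixes L :: "'k::euclidean_space \<Rightarrow> 'b::euclidean_space \<Rightarrow> 'b \<Rightarrow> 'v::real_normed_vector"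
  assumes o: "open X" and b: "\<And>x. x \<in> X \<Longrightarrow> bilinear (L x)" and s: "\<And>v w. smooth_on X (\<lambda>x. L x v w)"
  shows "smooth_on (X \<times> UNIV) (\<lambda>z. L (fst z) (snd z) (snd z))"
proof -
  have oXU: "open (X \<times> (UNIV::'b set))" using o by (auto intro: open_Times)
  have f: "smooth_on (X \<times> (UNIV :: 'b set)) (\<lambda>z. L (fst z) v w)" for v w
    using smooth_on_compose[OF oXU o s[of v w], of fst] smooth_on_fst[OF oXU smooth_on_id[OF oXU]]
        by auto
  have sn: "smooth_on (X \<times> (UNIV :: 'b set)) (\<lambda>z. snd z)"
      by (rule smooth_on_snd[OF oXU smooth_on_id[OF oXU]])
  show ?thesis
    by (rule smooth_on_bilinear_apply[where L="\<lambda>z. L (fst z)", OF oXU _ f sn sn]) (use b in auto)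
qed

lemma lin_field_bound:
  fixes L :: "'k::euclidean_space \<Rightarrow> 'c::euclidean_space \<Rightarrow> 'v::real_normed_vector"
  assumes L: "lin_field X L" and K: "compact K" "K \<subseteq> X"
  shows "\<exists>C\<ge>0. \<forall>x\<in>K. \<forall>v. norm (L x v) \<le> C * norm v"
proof -
  have "continuous_on K (\<lambda>x. \<Sum>b\<in>Basis. norm (L x b))"
    by (intro continuous_intros continuous_on_subset[OF smooth_on_continuous[OF lin_fieldD(3)[OF L]]
        K(2)])
  then obtain C where C: "C \<ge> 0" "\<And>x. x \<in> K \<Longrightarrow> norm (\<Sum>b\<in>Basis. norm (L x b)) \<le> C"
    using continuous_on_compact_bound[OF K(1)] by metis
  have "norm (L x v) \<le> C * norm v" if x: "x \<in> K" for x v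
  proof -
    have l: "linear (L x)" using lin_fieldD(2)[OF L] x K(2) by blast
    have "norm (L x v) \<le> (\<Sum>b\<in>Basis. norm (L x b) * norm v)"
      unfolding linear_sum_Basis[OF l, of v]
      by (rule sum_norm_le) (simp add: Basis_le_norm mult.commute[of "norm (L x _)"]
          mult_right_mono)
    also have "\<dots> = (\<Sum>b\<in>Basis. norm (L x b)) * norm v" by (simp add: sum_distrib_right)
    also have "\<dots> \<le> C * norm v" using C(2)[OF x] by (intro mult_right_mono) auto
    finally show ?thesis .
  qed
  then show ?thesis using C(1) by blast
qed

text \<open>The minimum of \<open>Q\<close> over the compact set of unit vectors above
  \<open>K\<close> is positive; homogeneity extends the bound to all vectors.\<close>

lemma quadratic_lower_bound:
  fixes Q :: "'k::euclidean_space \<Rightarrow> 'b::euclidean_space \<Rightarrow> real"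
  assumes K: "compact K" and c: "continuous_on (K \<times> UNIV) (\<lambda>z. Q (fst z) (snd z))"
    and pos: "\<And>x v. x \<in> K \<Longrightarrow> v \<noteq> 0 \<Longrightarrow> Q x v > 0"
    and hom: "\<And>x r v. x \<in> K \<Longrightarrow> Q x (r *\<^sub>R v) = r\<^sup>2 * Q x v"
  shows "\<exists>m>0. \<forall>x\<in>K. \<forall>v. m * (norm v)\<^sup>2 \<le> Q x v"
proof (cases "K = {}")
  case True then show ?thesis by (auto intro: exI[of _ 1])
next
  case False
  obtain b :: 'b where b: "norm b = 1" using nonempty_Basis norm_Basis by blast
  have cS: "compact (K \<times> sphere (0::'b) 1)" using K by (intro compact_Times) auto
  have "continuous_on (K \<times> sphere (0::'b) 1) (\<lambda>z. Q (fst z) (snd z))"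
    by (rule continuous_on_subset[OF c]) auto
  moreover have "K \<times> sphere (0::'b) 1 \<noteq> {}" using False b by auto
  ultimately obtain z0 where z0: "z0 \<in> K \<times> sphere (0::'b) 1"
    "\<And>z. z \<in> K \<times> sphere (0::'b) 1 \<Longrightarrow> Q (fst z0) (snd z0) \<le> Q (fst z) (snd z)"
    using continuous_attains_inf[OF cS, of "\<lambda>z. Q (fst z) (snd z)"] by blast
  define m where "m = Q (fst z0) (snd z0)"
  have "snd z0 \<noteq> 0" using z0(1) by (auto simp: mem_Times_iff)
  then have m: "m > 0" unfolding m_def using pos[of "fst z0" "snd z0"] z0(1)
      by (auto simp: mem_Times_iff)
  have "m * (norm v)\<^sup>2 \<le> Q x v" if x: "x \<in> K" for x v
  proof (cases "v = 0")
    case True then show ?thesis using hom[OF x, of 0 v] by simp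
  next
    case False
    have "m \<le> Q x ((1 / norm v) *\<^sub>R v)" unfolding m_def
        using z0(2)[of "(x, (1 / norm v) *\<^sub>R v)"] x False by auto
    also have "\<dots> = (1 / norm v)\<^sup>2 * Q x v" by (rule hom[OF x])
    finally show ?thesis using False by (simp add: field_simps)
  qed
  with m show ?thesis by blast
qed

section \<open>The local form of the metric\<close>

text \<open>The metric in a piece of an arbitrary chart of the total space: \<open>q\<close> and
  \<open>u\<close> are the base coordinates as functions of the chart coordinates, and \<theta> is
  the imaginary part of the connection form. \<open>frame\<close> and \<open>coframe\<close> say
  that the differentials of \<open>q\<close> and \<open>u\<close> together with \<theta> form an
  isomorphism at every point, and \<open>d\<theta>\<close> is the curvature condition.\<close>

locale pp_model =
  fixes X :: "'k::euclidean_space set" and q :: "'k \<Rightarrow> 'e::euclidean_space" and u :: "'k \<Rightarrow> real"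
    and \<theta> :: "'k \<Rightarrow> 'k \<Rightarrow> real" and Y :: "'e set" and hb :: "'e \<Rightarrow> 'e \<Rightarrow> 'e \<Rightarrow> real"
    and al :: "'e \<Rightarrow> 'e \<Rightarrow> real" and fb :: "'e \<Rightarrow> real" and fs :: "real \<Rightarrow> real"
  assumes oX: "open X" and q: "smooth_on X q" "q ` X \<subseteq> Y" and u: "smooth_on X u"
    and \<theta>: "lin_field X \<theta>" and hb: "bil_field Y hb"
    and hb_pos: "\<And>y v. y \<in> Y \<Longrightarrow> v \<noteq> 0 \<Longrightarrow> hb y v v > 0"
    and al: "\<And>y. y \<in> Y \<Longrightarrow> linear (al y)"
    and fb: "smooth_on Y fb" and fs: "smooth_on UNIV fs"
    and d\<theta>: "\<And>x v w. x \<in> X \<Longrightarrow>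
        frechet_derivative (\<lambda>z. \<theta> z w) (at x) v - frechet_derivative (\<lambda>z. \<theta> z v) (at x) w =
        - 2 * pi * (al (q x) (frechet_derivative q (at x) v) * frechet_derivative u (at x) w -
           frechet_derivative u (at x) v * al (q x) (frechet_derivative q (at x) w))"
    and frame: "\<And>x e r s. x \<in> X \<Longrightarrow> \<exists>y. frechet_derivative q (at x) y = e
        \<and> frechet_derivative u (at x) y = r \<and> \<theta> x y = s"
    and coframe: "\<And>x y. x \<in> X \<Longrightarrow> frechet_derivative q (at x) y = 0 \<Longrightarrow> frechet_derivative u (at x) y
        = 0 \<Longrightarrow>
        \<theta> x y = 0 \<Longrightarrow> y = 0"
begin

abbreviation Dq where "Dq x \<equiv> frechet_derivative q (at x)"
abbreviation Du where "Du x \<equiv> frechet_derivative u (at x)"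

text \<open>The coefficient of the square of \<open>du\<close>: the function \<open>f\<close> from
  the type of the metric, plus 1 from the circle factor of \<open>h\<close>.\<close>

definition F where "F x = fb (q x) * fs (u x) + 1"

definition K where "K x v w = hb (q x) (Dq x v) (Dq x w)"

definition G where "G x v w = - \<theta> x v * Du x w - Du x v * \<theta> x w + F x * (Du x v * Du x w) + K x v w"

lemma oY: "open Y" using bil_fieldD(1)[OF hb] .

lemma qY: "x \<in> X \<Longrightarrow> q x \<in> Y" using q by auto

lemma Dq: "x \<in> X \<Longrightarrow> (q has_derivative Dq x) (at x)" by (rule smooth_on_has_derivative[OF q(1)])
lemma Du: "x \<in> X \<Longrightarrow> (u has_derivative Du x) (at x)" by (rule smooth_on_has_derivative[OF u])

lemma linq: "x \<in> X \<Longrightarrow> linear (Dq x)" and linu: "x \<in> X \<Longrightarrow> linear (Du x)" and lint: "x \<in> X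
    \<Longrightarrow> linear (\<theta> x)"
  by (rule has_derivative_linear[OF Dq], assumption, rule has_derivative_linear[OF Du], assumption)
    (rule lin_fieldD(2)[OF \<theta>])

lemma lfu: "lin_field X Du" unfolding lin_field_def using oX linu smooth_on_derivative[OF u] by auto

lemma Ksmooth: "smooth_on X (\<lambda>x. K x v w)"
proof -
  have s: "smooth_on X (\<lambda>x. hb (q x) v w)" for v w
    using smooth_on_compose[OF oX oY bil_fieldD(4)[OF hb] q(1) q(2)] .
  show ?thesis unfolding K_def
    by (rule smooth_on_bilinear_apply[where L="\<lambda>x. hb (q x)", OF oX _ s smooth_on_derivative[OF
        q(1)] smooth_on_derivative[OF q(1)]])
      (rule bil_fieldD(2)[OF hb qY])
qed

lemma Kfield: "bil_field X K"
  unfolding bil_field_def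
proof (intro conjI ballI allI oX Ksmooth)
  fix x assume x: "x \<in> X"
  note b = bil_fieldD(2)[OF hb qY[OF x]]
  show "bilinear (K x)" unfolding bilinear_def K_def
    by (intro conjI allI; rule linearI; simp add: linear_add[OF linq[OF x]] linear_cmul[OF linq[OF
        x]] bilinear_ladd[OF b]
      bilinear_radd[OF b] bilinear_lmul[OF b] bilinear_rmul[OF b])
  show "K x v w = K x w v" for v w unfolding K_def by (rule bil_fieldD(3)[OF hb qY[OF x]])
qed

lemma F_has_derivative:
  assumes x: "x \<in> X"
  shows "(F has_derivative (\<lambda>d. frechet_derivative fb (at (q x)) (Dq x d) * fs (u x) + fb (q x) *
      frechet_derivative fs (at (u x)) (Du x d))) (at x)"
proof -
  have 1: "((\<lambda>x. fb (q x)) has_derivative (\<lambda>d. frechet_derivative fb (at (q x)) (Dq x d))) (at x)"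
    by (rule has_derivative_compose[OF Dq[OF x] smooth_on_has_derivative[OF fb qY[OF x]]])
  have 2: "((\<lambda>x. fs (u x)) has_derivative (\<lambda>d. frechet_derivative fs (at (u x)) (Du x d))) (at x)"
    by (rule has_derivative_compose[OF Du[OF x] smooth_on_has_derivative[OF fs UNIV_I]])
  show ?thesis
    using has_derivative_add[OF has_derivative_mult[OF 1 2] has_derivative_const[of 1]]
        unfolding F_def[abs_def]
    by (simp add: add.commute)
qed

lemma Fsmooth: "smooth_on X F"
proof -
  have 1: "smooth_on X (\<lambda>x. fb (q x))" by (rule smooth_on_compose[OF oX oY fb q])
  have 2: "smooth_on X (\<lambda>x. fs (u x))" by (rule smooth_on_compose[OF oX open_UNIV fs u]) simp
  show ?thesis unfolding F_def[abs_def]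
    by (intro smooth_on_add oX smooth_on_const smooth_on_mult 1 2)
qed

lemma Gfield: "bil_field X G"
  unfolding bil_field_def
proof (intro conjI ballI allI oX)
  fix x assume x: "x \<in> X"
  note b = bil_fieldD(2)[OF Kfield x]
  note l = linu[OF x] lint[OF x]
  show "bilinear (G x)" unfolding bilinear_def G_def
    by (intro conjI allI; rule linearI; simp add: linear_add[OF l(1)] linear_cmul[OF l(1)]
        linear_add[OF l(2)] linear_cmul[OF l(2)] bilinear_ladd[OF b]
      bilinear_radd[OF b] bilinear_lmul[OF b] bilinear_rmul[OF b] algebra_simps)
  show "G x v w = G x w v" for v w unfolding G_def bil_fieldD(3)[OF Kfield x, of v w] by simp
next
  fix v w
  have t: "smooth_on X (\<lambda>x. \<theta> x v)" for v by (rule lin_fieldD(3)[OF \<theta>])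
  have d: "smooth_on X (\<lambda>x. Du x v)" for v by (rule smooth_on_derivative[OF u])
  show "smooth_on X (\<lambda>x. G x v w)" unfolding G_def
    by (intro smooth_on_add smooth_on_diff smooth_on_mult smooth_on_minus oX t d Fsmooth Ksmooth)
qed

text \<open>The vertical vector \<open>y1\<close> pairs with \<open>z\<close> through
  \<open>du\<close> alone, which gives \<open>du z = 0\<close>; then the lift \<open>y2\<close> of
  the circle direction detects \<open>\<theta> z\<close>; what is left of \<open>G x z z\<close> is
  the positive definite part from \<open>B\<close>.\<close>

lemma nondegenerate: "nondegenerate_on X G"
  unfolding nondegenerate_on_def
proof (intro ballI allI impI)
  fix x z assume x: "x \<in> X" and z: "\<forall>y. G x z y = 0"
  note b = bil_fieldD(2)[OF hb qY[OF x]]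
  obtain y1 where y1: "Dq x y1 = 0" "Du x y1 = 0" "\<theta> x y1 = 1" using frame[OF x] by metis
  obtain y2 where y2: "Dq x y2 = 0" "Du x y2 = 1" "\<theta> x y2 = 0" using frame[OF x] by metis
  have u0: "Du x z = 0" using z[rule_format, of y1] y1 unfolding G_def K_def
      by (simp add: bilinear_rzero[OF b])
  have t0: "\<theta> x z = 0" using z[rule_format, of y2] y2 u0 unfolding G_def K_def
      by (simp add: bilinear_rzero[OF b])
  have "hb (q x) (Dq x z) (Dq x z) = 0" using z[rule_format, of z] u0 unfolding G_def K_def by simp
  then have "Dq x z = 0" using hb_pos[OF qY[OF x], of "Dq x z"] by force
  then show "z = 0" using coframe[OF x _ u0 t0] by simp
qed

text \<open>The derivative of \<theta> in direction \<open>y\<close> occurs only in the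
  antisymmetric combination with the one in direction \<open>v\<close>, which the curvature
  condition replaces by \<alpha> and \<open>du\<close>. The first bracket is the rate of change of
  \<open>\<theta>(x')\<close> along a curve with velocity \<open>v\<close> and acceleration
  \<open>a\<close>, the second that of \<open>du(x')\<close>.\<close>

lemma EL_G:
  assumes x: "x \<in> X"
  shows "EL G x v a y =
    - (frechet_derivative (\<lambda>z. \<theta> z v) (at x) v + \<theta> x a) * Du x y
    - (frechet_derivative (\<lambda>z. Du z v) (at x) v + Du x a) * \<theta> x y
    + (frechet_derivative F (at x) v * Du x v + F x * (frechet_derivative (\<lambda>z. Du z v) (at x) v + Du
        x a)) * Du x y
    + EL K x v a y
    + 2 * pi * Du x v * (al (q x) (Dq x v) * Du x y - Du x v * al (q x) (Dq x y))
    - (Du x v)\<^sup>2 * frechet_derivative F (at x) y / 2"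
proof -
  define Dt where "Dt v d = frechet_derivative (\<lambda>z. \<theta> z v) (at x) d" for v d
  define D2 where "D2 v d = frechet_derivative (\<lambda>z. Du z v) (at x) d" for v d
  define DF where "DF = frechet_derivative F (at x)"
  define DK where "DK v w d = frechet_derivative (\<lambda>z. K z v w) (at x) d" for v w d
  have dt: "((\<lambda>z. \<theta> z v) has_derivative Dt v) (at x)" for v
    unfolding Dt_def by (rule lin_field_has_derivative[OF \<theta> x])
  have d2: "((\<lambda>z. Du z v) has_derivative D2 v) (at x)" for v
    unfolding D2_def by (rule lin_field_has_derivative[OF lfu x])
  have dF: "(F has_derivative DF) (at x)" unfolding DF_def
      by (rule smooth_on_has_derivative[OF Fsmooth x])
  have dK: "((\<lambda>z. K z v w) has_derivative DK v w) (at x)" for v w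
    unfolding DK_def by (rule bil_field_has_derivative[OF Kfield x])
  have dG: "frechet_derivative (\<lambda>z. G z v w) (at x) d =
     - (\<theta> x v * D2 w d + Dt v d * Du x w) - (Du x v * Dt w d + D2 v d * \<theta> x w)
     + (F x * (Du x v * D2 w d + D2 v d * Du x w) + DF d * (Du x v * Du x w)) + DK v w d" for v w d
  proof (rule frechet_derivative_apply)
    show "((\<lambda>z. G z v w) has_derivative (\<lambda>d. - (\<theta> x v * D2 w d + Dt v d * Du x w) - (Du x v * Dt w d
        + D2 v d * \<theta> x w)
     + (F x * (Du x v * D2 w d + D2 v d * Du x w) + DF d * (Du x v * Du x w)) + DK v w d)) (at x)"
      unfolding G_def
      by (rule has_derivative_eq_rhs[OF has_derivative_add[OF has_derivative_add[OF
          has_derivative_diff[OF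
        has_derivative_mult[OF has_derivative_minus[OF dt] d2] has_derivative_mult[OF d2 dt]]
        has_derivative_mult[OF dF has_derivative_mult[OF d2 d2]]] dK]]) (auto simp: algebra_simps)
  qed
  \<comment> \<open>Closedness of \<open>du\<close> enters here: of the two 1-forms, only \<theta>
    contributes an exterior derivative.\<close>
  have sym: "D2 y v = D2 v y" for v y
    unfolding D2_def by (rule second_derivative_symmetric[OF oX x u])
  have dth: "Dt y v = Dt v y - 2 * pi * (al (q x) (Dq x v) * Du x y - Du x v * al (q x) (Dq x y))"
    using d\<theta>[OF x, of y v] unfolding Dt_def by simp
  show ?thesis
    unfolding EL_def dG DK_def[symmetric] Dt_def[symmetric] D2_def[symmetric] DF_def[symmetric]
        sym[of y v] dth
    unfolding G_def by (simp add: field_simps power2_eq_square)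
qed

text \<open>The test vectors \<open>y1\<close> (vertical) and \<open>y2\<close> (over the circle
  direction, with \<open>\<theta>\<close> zero) are both annihilated by the differential of
  \<open>q\<close>. Hence \<alpha> on the test vector and the derivative of \<open>fb\<close> along
  it vanish, together with the contribution of \<open>hb\<close>.\<close>

lemma geodesic_conservation:
  assumes t: "x t \<in> X"
    and x: "(x has_vector_derivative v t) (at t)" and v: "(v has_vector_derivative a) (at t)"
    and el: "\<And>y. EL G (x t) (v t) a y = 0"
  shows "((\<lambda>s. Du (x s) (v s)) has_real_derivative 0) (at t)"
    and "((\<lambda>s. \<theta> (x s) (v s) - F (x s) * Du (x s) (v s)) has_real_derivative
      2 * pi * Du (x t) (v t) * al (q (x t)) (Dq (x t) (v t))
      - (Du (x t) (v t))\<^sup>2 * (fb (q (x t)) * frechet_derivative fs (at (u (x t))) 1) / 2) (at t)"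
proof -
  define c' where "c' = frechet_derivative (\<lambda>z. Du z (v t)) (at (x t)) (v t) + Du (x t) a"
  define w' where "w' = frechet_derivative (\<lambda>z. \<theta> z (v t)) (at (x t)) (v t) + \<theta> (x t) a"
  define F' where "F' = frechet_derivative F (at (x t)) (v t)"
  have xd: "(x has_derivative (\<lambda>h. h *\<^sub>R v t)) (at t)" and vd: "(v
      has_derivative (\<lambda>h. h *\<^sub>R a)) (at t)"
    using x v unfolding has_vector_derivative_def by auto
  have app: "((\<lambda>s. L (x s) (v s)) has_real_derivative (frechet_derivative (\<lambda>z. L z (v t)) (at (x t))
      (v t) + L (x t) a)) (at t)"
    if L: "lin_field X L" for L :: "'k \<Rightarrow> 'k \<Rightarrow> real"
  proof -
    note l = linear_cmul[OF has_derivative_linear[OF lin_field_has_derivative[OF L t]]]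
        linear_cmul[OF lin_fieldD(2)[OF L t]]
    show ?thesis using lin_field_apply_has_derivative[where L=L, OF L t xd vd]
      unfolding has_field_derivative_def l
          by (auto elim!: has_derivative_eq_rhs simp: algebra_simps)
  qed
  have c: "((\<lambda>s. Du (x s) (v s)) has_real_derivative c') (at t)" unfolding c'_def
      by (rule app[OF lfu])
  have w: "((\<lambda>s. \<theta> (x s) (v s)) has_real_derivative w') (at t)" unfolding w'_def by (rule app[OF \<theta>])
  have f: "((\<lambda>s. F (x s)) has_real_derivative F') (at t)"
  proof -
    have Fd: "(F has_derivative frechet_derivative F (at (x t))) (at (x t))"
        by (rule smooth_on_has_derivative[OF Fsmooth t])
    show ?thesis using has_derivative_compose[OF xd Fd] unfolding has_field_derivative_def F'_def
      linear_cmul[OF has_derivative_linear[OF Fd]] by (auto elim!: has_derivative_eq_rhs)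
  qed
  have DF: "frechet_derivative F (at (x t)) y = frechet_derivative fb (at (q (x t))) (Dq (x t) y) *
      fs (u (x t)) + fb (q (x t)) * frechet_derivative fs (at (u (x t))) (Du (x t) y)" for y
    using frechet_derivative_apply[OF F_has_derivative[OF t]] .
  have lfb: "frechet_derivative fb (at (q (x t))) 0 = 0"
    using linear_0[OF has_derivative_linear[OF smooth_on_has_derivative[OF fb qY[OF t]]]] .
  have lfs: "frechet_derivative fs (at (u (x t))) 0 = 0"
    using linear_0[OF has_derivative_linear[OF smooth_on_has_derivative[OF fs UNIV_I]]] .
  have al0: "al (q (x t)) 0 = 0" using linear_0[OF al[OF qY[OF t]]] .
  have ELK: "EL K (x t) (v t) a y = 0" if "Dq (x t) y = 0" for y
  proof -
    have "EL K (x t) (v t) a y = EL hb (q (x t)) (Dq (x t) (v t)) (frechet_derivative (\<lambda>z. Dq z (v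
        t)) (at (x t)) (v t) + Dq (x t) a) (Dq (x t) y)"
      by (rule EL_pullback[OF oX t q hb]) (simp add: K_def)
    then show ?thesis using linear_0[OF EL_linear[OF hb qY[OF t]]] that by simp
  qed
  obtain y1 where y1: "Dq (x t) y1 = 0" "Du (x t) y1 = 0" "\<theta> (x t) y1 = 1" using frame[OF t]
      by metis
  obtain y2 where y2: "Dq (x t) y2 = 0" "Du (x t) y2 = 1" "\<theta> (x t) y2 = 0" using frame[OF t]
      by metis
  have c0: "c' = 0"
    using el[of y1] unfolding EL_G[OF t] DF ELK[OF y1(1)] y1 c'_def by (simp add: lfb lfs al0)
  then show "((\<lambda>s. Du (x s) (v s)) has_real_derivative 0) (at t)" using c by simp
  \<comment> \<open>The term \<open>F'\<close>, which contains the derivative of \<open>fb\<close>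
    along the curve, stands on the left, where it will be absorbed into the derivative of the
    corrected quantity. On the right, \<open>F\<close> is differentiated along \<open>y2\<close>
    only, which sees just \<open>fs\<close>.\<close>
  have "w' - F' * Du (x t) (v t) = 2 * pi * Du (x t) (v t) * al (q (x t)) (Dq (x t) (v t))
      - (Du (x t) (v t))\<^sup>2 * (fb (q (x t)) * frechet_derivative fs (at (u (x t))) 1) / 2"
    using el[of y2] c0 unfolding EL_G[OF t] DF[of y2] ELK[OF y2(1)] y2 w'_def F'_def c'_def
        by (simp add: lfb al0)
  then show "((\<lambda>s. \<theta> (x s) (v s) - F (x s) * Du (x s) (v s)) has_real_derivative
      2 * pi * Du (x t) (v t) * al (q (x t)) (Dq (x t) (v t))
      - (Du (x t) (v t))\<^sup>2 * (fb (q (x t)) * frechet_derivative fs (at (u (x t))) 1) / 2) (at t)"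
    using DERIV_diff[OF w DERIV_mult[OF f c]] c0 by simp
qed

text \<open>Converts bounds on \<theta>, \<open>du\<close> and the \<open>B\<close>-part of a
  velocity into a bound on its coordinate norm. Positivity is \<open>coframe\<close> combined with
  \<open>hb_pos\<close>.\<close>

lemma speed_lower_bound:
  assumes C: "compact C" "C \<subseteq> X"
  shows "\<exists>m>0. \<forall>x\<in>C. \<forall>v. m * (norm v)\<^sup>2 \<le> (\<theta> x v)\<^sup>2 + (Du x v)\<^sup>2 + K x v v"
proof (rule quadratic_lower_bound[OF C(1)])
  have oXU: "open (X \<times> (UNIV::'k set))" using oX by (auto intro: open_Times)
  have "continuous_on (X \<times> UNIV) (\<lambda>z. \<theta> (fst z) (snd z))" "continuous_on (X \<times> UNIV) (\<lambda>z. Du (fst z)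
      (snd z))"
    "continuous_on (X \<times> UNIV) (\<lambda>z. K (fst z) (snd z) (snd z))"
    using smooth_on_continuous[OF lin_field_smooth_apply[OF \<theta>]] smooth_on_continuous[OF
        lin_field_smooth_apply[OF lfu]]
      smooth_on_continuous[OF smooth_on_quadratic[OF oX bil_fieldD(2)[OF Kfield] bil_fieldD(4)[OF
          Kfield]]] by auto
  then have "continuous_on (X \<times> UNIV) (\<lambda>z. (\<theta> (fst z) (snd z))\<^sup>2 + (Du (fst z) (snd z))\<^sup>2 + K (fst
      z) (snd z) (snd z))"
    by (intro continuous_intros)
  then show "continuous_on (C \<times> UNIV) (\<lambda>z. (\<theta> (fst z) (snd z))\<^sup>2 + (Du (fst z) (snd z))\<^sup>2 + K (fst
      z) (snd z) (snd z))"
    by (rule continuous_on_subset) (use C in auto)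
next
  fix x v assume "x \<in> C" and v: "v \<noteq> (0::'k)"
  then have x: "x \<in> X" using C by auto
  have K0: "K x v v \<ge> 0" "K x v v = 0 \<Longrightarrow> Dq x v = 0"
    using hb_pos[OF qY[OF x], of "Dq x v"] bilinear_lzero[OF bil_fieldD(2)[OF hb qY[OF x]]]
        unfolding K_def by (cases "Dq x v = 0"; force)+
  show "(\<theta> x v)\<^sup>2 + (Du x v)\<^sup>2 + K x v v > 0"
  proof (rule ccontr)
    assume "\<not> ?thesis"
    then have "(\<theta> x v)\<^sup>2 = 0 \<and> (Du x v)\<^sup>2 = 0 \<and> K x v v = 0"
      using K0 zero_le_power2[of "\<theta> x v"] zero_le_power2[of "Du x v"] by linarith
    then show False using coframe[OF x, of v] K0(2) v by simp
  qed
next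
  fix x r v assume "x \<in> C"
  then have x: "x \<in> X" using C by auto
  note b = bil_fieldD(2)[OF Kfield x]
  show "(\<theta> x (r *\<^sub>R v))\<^sup>2 + (Du x (r *\<^sub>R v))\<^sup>2 + K x (r *\<^sub>R v) (r *\<^sub>R v)
      = r\<^sup>2 * ((\<theta> x v)\<^sup>2 + (Du x v)\<^sup>2 + K x v v)"
    by (simp add: linear_cmul[OF lint[OF x]] linear_cmul[OF linu[OF x]] bilinear_lmul[OF b]
        bilinear_rmul[OF b] algebra_simps power2_eq_square)
qed

end

section \<open>Ordinary differential equations\<close>

text \<open>The Picard operator is a contraction of the space of bounded continuous functions; a
  global Lipschitz constant spares any control of where the iterates run.\<close>

lemma picard_global_lipschitz:
  fixes F :: "'a::euclidean_space \<Rightarrow> 'a" and t0 :: real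
  assumes L: "L \<ge> 0" "\<And>x y. dist (F x) (F y) \<le> L * dist x y"
  shows "\<exists>\<epsilon>>0. \<exists>y. continuous_on {t0..t0+\<epsilon>} y \<and> (\<forall>t\<in>{t0..t0+\<epsilon>}. y t
      = z0 + integral {t0..t} (\<lambda>s. F (y s)))"
proof -
  \<comment> \<open>Chosen so that \<open>\<epsilon> * L\<close> is at most 1/2, the contraction
    factor; the summand 1 covers \<open>L = 0\<close>.\<close>
  define \<epsilon> :: real where "\<epsilon> = 1 / (2 * (L + 1))"
  have \<epsilon>: "\<epsilon> > 0" "\<epsilon> * L \<le> 1 / 2" unfolding \<epsilon>_def using L by (auto simp: field_simps)
  have cF: "continuous_on UNIV F"
  proof (rule lipschitz_on_continuous_on)
    show "L-lipschitz_on UNIV F" by (rule lipschitz_onI) (use L in auto)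
  qed
  have cFy: "continuous_on A (\<lambda>s. F (apply_bcontfun y s))" for A y
    by (rule continuous_on_compose2[OF cF continuous_on_apply_bcontfun]) auto
  define I where "I y t = z0 + integral {t0..t} (\<lambda>s. F (apply_bcontfun y s))" for y t
  have cI: "continuous_on (cbox t0 (t0+\<epsilon>)) (I y)" for y
    unfolding I_def by (intro continuous_intros) (simp add: indefinite_integral_continuous_1
        integrable_continuous_real cFy)
  \<comment> \<open>Bounded continuous functions live on the whole line, so the integral, which
    matters on the short interval only, is continued by constants through
    \<open>clamp\<close>.\<close>
  have "\<exists>g::real \<Rightarrow>\<^sub>C 'a. \<forall>t. apply_bcontfun g t = I y (clamp t0 (t0+\<epsilon>) t)" for y
    using continuous_on_cbox_bcontfunE[OF cI] by metis
  then obtain T :: "(real \<Rightarrow>\<^sub>C 'a) \<Rightarrow> (real \<Rightarrow>\<^sub>C 'a)" where T: "\<And>y t. apply_bcontfun (T y) t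
      = I y (clamp t0 (t0+\<epsilon>) t)"
    by metis
  have "dist (T y) (T w) \<le> 1/2 * dist y w" for y w
  proof (rule dist_bound)
    fix t
    define s where "s = clamp t0 (t0+\<epsilon>) t"
    have s: "s \<in> {t0..t0+\<epsilon>}" using clamp_in_interval[of t0 "t0+\<epsilon>" t] \<epsilon> unfolding s_def by simp
    have "dist (T y t) (T w t) = norm (integral {t0..s} (\<lambda>r. F (y r)) - integral {t0..s} (\<lambda>r. F (w
        r)))"
      unfolding T I_def s_def[symmetric] by (simp add: dist_norm)
    also have "\<dots> = norm (integral {t0..s} (\<lambda>r. F (y r) - F (w r)))"
      by (simp add: integral_diff integrable_continuous_real cFy)
    also have "\<dots> \<le> (L * dist y w) * (s - t0)"
    proof (rule integral_bound)
      fix r show "norm (F (y r) - F (w r)) \<le> L * dist y w"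
        using L(2)[of "y r" "w r"] dist_bounded[of y r w] L(1)
            by (simp add: dist_norm order_trans[OF _ mult_left_mono])
    qed (use s in \<open>auto intro!: continuous_intros cFy\<close>)
    also have "\<dots> \<le> (L * dist y w) * \<epsilon>" using s L by (intro mult_left_mono) auto
    also have "\<dots> \<le> 1/2 * dist y w" using mult_right_mono[OF \<epsilon>(2), of "dist y w"]
        by (simp add: mult_ac)
    finally show "dist (T y t) (T w t) \<le> 1/2 * dist y w" .
  qed
  then obtain y where y: "T y = y" using banach_fix_type[of "1/2" T] by auto
  show ?thesis
  proof (intro exI[of _ \<epsilon>] conjI exI[of _ "apply_bcontfun y"] ballI \<epsilon>(1))
    fix t assume "t \<in> {t0..t0+\<epsilon>}"
    then have "clamp t0 (t0+\<epsilon>) t = t" by (intro clamp_cancel_cbox) simp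
    then show "y t = z0 + integral {t0..t} (\<lambda>s. F (y s))" using T[of y t] unfolding y I_def by simp
  qed simp
qed

text \<open>The closed ball is compact, which bounds the derivative, and convex, which allows the
  mean value inequality.\<close>

lemma smooth_on_lipschitz_cball:
  fixes F :: "'a::euclidean_space \<Rightarrow> 'b::real_normed_vector"
  assumes S: "open S" "smooth_on S F" "cball z0 r \<subseteq> S"
  shows "\<exists>L\<ge>0. \<forall>x\<in>cball z0 r. \<forall>y\<in>cball z0 r. dist (F x) (F y) \<le> L * dist x y"
proof -
  define D where "D x = frechet_derivative F (at x)" for x
  have D: "(F has_derivative D x) (at x)" if "x \<in> S" for x
    unfolding D_def by (rule smooth_on_has_derivative[OF S(2) that])
  have "lin_field S D" unfolding lin_field_def
  proof (intro conjI ballI allI S(1))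
    show "linear (D x)" if "x \<in> S" for x by (rule has_derivative_linear[OF D[OF that]])
    show "smooth_on S (\<lambda>x. D x v)" for v unfolding D_def by (rule smooth_on_derivative[OF S(2)])
  qed
  from lin_field_bound[OF this compact_cball S(3)]
  obtain L where L: "L \<ge> 0" "\<And>x v. x \<in> cball z0 r \<Longrightarrow> norm (D x v) \<le> L * norm v" by blast
  have "onorm (D x) \<le> L" if "x \<in> cball z0 r" for x
    by (rule onorm_le) (rule L(2)[OF that])
  then have "norm (F x - F y) \<le> L * norm (x - y)" if "x \<in> cball z0 r" "y \<in> cball z0 r" for x y
    by (intro differentiable_bound[of "cball z0 r" F D] has_derivative_at_withinI[OF D]) (use that
        S(3) in auto)
  then show ?thesis using L(1) by (auto simp: dist_norm)
qed

text \<open>Times to the right of \<open>t0\<close> suffice, since a solution will be restarted at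
  the right end of its interval.\<close>

lemma ode_forward_solution:
  fixes F :: "'a::euclidean_space \<Rightarrow> 'a" and t0 :: real
  assumes S: "open S" "smooth_on S F" "z0 \<in> S"
  shows "\<exists>\<epsilon>>0. \<exists>y. continuous_on {t0..t0+\<epsilon>} y \<and> y t0 = z0 \<and> (\<forall>t\<in>{t0..t0+\<epsilon>}. y t \<in> S) \<and>
    (\<forall>t\<in>{t0<..<t0+\<epsilon>}. (y has_vector_derivative F (y t)) (at t))"
proof -
  obtain r where r: "r > 0" "cball z0 r \<subseteq> S" using S open_contains_cball by blast
  obtain L where L: "L \<ge> 0" "\<And>x y. x \<in> cball z0 r \<Longrightarrow> y \<in> cball z0 r \<Longrightarrow> dist (F x) (F y)
      \<le> L * dist x y"
    using smooth_on_lipschitz_cball[OF S(1,2) r(2)] by blast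
  \<comment> \<open>Precomposing with the nearest-point projection, which does not increase
    distances, makes the Lipschitz bound on the ball a global one. For a short time the solution
    stays in the ball, where \<open>P\<close> is the identity.\<close>
  define P where "P = closest_point (cball z0 r)"
  have ne: "cball z0 r \<noteq> {}" using r by auto
  have P: "P x \<in> cball z0 r" for x unfolding P_def
      by (rule closest_point_in_set[OF closed_cball ne])
  have "dist (F (P x)) (F (P y)) \<le> L * dist x y" for x y
    using L(2)[OF P P, of x y] closest_point_lipschitz[OF convex_cball closed_cball ne, of x y] L(1)
    unfolding P_def by (meson mult_left_mono order_trans)
  from picard_global_lipschitz[of L "\<lambda>x. F (P x)", OF L(1) this, of t0 z0]
  obtain e y where e: "e > 0" and yc: "continuous_on {t0..t0+e} y"
    and y: "\<And>t. t \<in> {t0..t0+e} \<Longrightarrow> y t = z0 + integral {t0..t} (\<lambda>s. F (P (y s)))" by blast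
  have y0: "y t0 = z0" using y[of t0] e by simp
  obtain d where d: "d > 0" "\<And>t. t \<in> {t0..t0+e} \<Longrightarrow> dist t t0 < d \<Longrightarrow> dist (y t) (y t0) < r"
    using yc r(1) e unfolding continuous_on_iff
        by (metis atLeastAtMost_iff less_add_same_cancel1 less_eq_real_def)
  define \<epsilon> where "\<epsilon> = min e (d / 2)"
  have \<epsilon>: "\<epsilon> > 0" "\<epsilon> \<le> e" "\<epsilon> < d" unfolding \<epsilon>_def using e d by auto
  have yb: "y t \<in> cball z0 r" if "t \<in> {t0..t0+\<epsilon>}" for t
    using d(2)[of t] that \<epsilon> y0 by (auto simp: dist_commute dist_real_def less_imp_le)
  have yc': "continuous_on {t0..t0+\<epsilon>} y" by (rule continuous_on_subset[OF yc]) (use \<epsilon> in auto)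
  have cFy: "continuous_on {t0..t0+\<epsilon>} (\<lambda>s. F (y s))"
    by (rule continuous_on_compose2[OF smooth_on_continuous[OF S(2)] yc']) (use yb r in auto)
  have y': "y t = z0 + integral {t0..t} (\<lambda>s. F (y s))" if t: "t \<in> {t0..t0+\<epsilon>}" for t
  proof -
    have "P (y s) = y s" if "s \<in> {t0..t}" for s
      unfolding P_def by (rule closest_point_self[OF yb]) (use t that in auto)
    then have "integral {t0..t} (\<lambda>s. F (P (y s))) = integral {t0..t} (\<lambda>s. F (y s))"
      by (intro integral_cong) simp
    then show ?thesis using y[of t] t \<epsilon> by auto
  qed
  show ?thesis
  proof (intro exI[of _ \<epsilon>] conjI exI[of _ y] ballI \<epsilon>(1) yc' y0)
    fix t assume "t \<in> {t0..t0+\<epsilon>}" then show "y t \<in> S" using yb r by blast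
  next
    fix t assume t: "t \<in> {t0<..<t0+\<epsilon>}"
    have "((\<lambda>u. z0 + integral {t0..u} (\<lambda>s. F (y s))) has_vector_derivative 0 + F (y t)) (at t within
        {t0..t0+\<epsilon>})"
      by (intro has_vector_derivative_add has_vector_derivative_const integral_has_vector_derivative
          cFy) (use t in auto)
    then have "((\<lambda>u. z0 + integral {t0..u} (\<lambda>s. F (y s))) has_vector_derivative F (y t)) (at t
        within {t0<..<t0+\<epsilon>})"
      by (auto intro: has_vector_derivative_within_subset)
    then have "((\<lambda>u. z0 + integral {t0..u} (\<lambda>s. F (y s))) has_vector_derivative F (y t)) (at t)"
      using at_within_open[OF t open_greaterThanLessThan] by simp
    then show "(y has_vector_derivative F (y t)) (at t)"
      by (rule has_vector_derivative_transform_within_open[OF _ open_greaterThanLessThan t]) (use y'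
          in auto)
  qed
qed

text \<open>Bootstrapping: the derivative of \<open>y\<close> is \<open>F (y t)\<close>, so each
  order of regularity of \<open>y\<close> yields the next.\<close>

lemma ode_solution_smooth:
  fixes F :: "'a::euclidean_space \<Rightarrow> 'a"
  assumes T: "open T" and S: "open S" "smooth_on S F"
    and y: "\<And>t. t \<in> T \<Longrightarrow> y t \<in> S" "\<And>t. t \<in> T \<Longrightarrow> (y has_vector_derivative F (y t)) (at t)"
  shows "smooth_on T y"
  unfolding smooth_on_def
proof
  fix k show "Ck_on k T y"
  proof (induction k)
    case 0
    have "isCont y t" if "t \<in> T" for t using y(2)[OF that] has_vector_derivative_continuous by blast
    then show ?case by (simp add: continuous_at_imp_continuous_on)
  next
    case (Suc k)
    have "Ck_on k S F" using S(2) smooth_on_def by blast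
    then have c: "Ck_on k T (\<lambda>t. F (y t))" by (rule Ck_on_compose[OF T S(1) _ Suc]) (use y in auto)
    show ?case
      by (rule Ck_on_SucI[OF T, of _ "\<lambda>t h. h *\<^sub>R F (y t)"])
        (use y(2) Ck_on_bounded_linear[OF bounded_linear_scaleR_right T c] in \<open>auto simp:
            has_vector_derivative_def\<close>)
  qed
qed

text \<open>In the compact set \<open>C\<close> the right-hand side is bounded, so \<open>z\<close>
  is Lipschitz and has a limit at \<open>b\<close> that lies in \<open>C\<close>. The solution is
  restarted from there, and the two pieces are glued.\<close>

lemma ode_extend:
  fixes F :: "'a::euclidean_space \<Rightarrow> 'a"
  assumes S: "open S" "smooth_on S F" and C: "compact C" "C \<subseteq> S" and ab: "a < b"
    and z: "\<And>t. t \<in> {a<..<b} \<Longrightarrow> z t \<in> C" "\<And>t. t \<in> {a<..<b} \<Longrightarrow> (z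
        has_vector_derivative F (z t)) (at t)"
  shows "\<exists>\<epsilon>>0. \<exists>w. (\<forall>t\<in>{a<..<b}. w t = z t) \<and> (\<forall>t\<in>{a<..<b+\<epsilon>}. w t \<in> S \<and> (w
      has_vector_derivative F (w t)) (at t))"
proof -
  obtain B where B: "B \<ge> 0" "\<And>x. x \<in> C \<Longrightarrow> norm (F x) \<le> B"
    using continuous_on_compact_bound[OF C(1) continuous_on_subset[OF smooth_on_continuous[OF S(2)]
        C(2)]] by metis
  have lip: "B-lipschitz_on {a<..<b} z"
  proof (rule lipschitz_onI[OF _ B(1)])
    fix s t assume st: "s \<in> {a<..<b}" "t \<in> {a<..<b}"
    have "norm (z s - z t) \<le> B * norm (s - t)"
    proof (rule differentiable_bound[of "{a<..<b}" z "\<lambda>t h. h *\<^sub>R F (z t)"])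
      fix r assume r: "r \<in> {a<..<b}"
      show "(z has_derivative (\<lambda>h. h *\<^sub>R F (z r))) (at r within {a<..<b})"
        using z(2)[OF r] unfolding has_vector_derivative_def by (rule has_derivative_at_withinI)
      show "onorm (\<lambda>h. h *\<^sub>R F (z r)) \<le> B"
        by (rule onorm_le) (use B(2)[OF z(1)[OF r]] in \<open>simp add: mult.commute[of B]
            mult_left_mono\<close>)
    qed (use st in auto)
    then show "dist (z s) (z t) \<le> B * dist s t" by (simp add: dist_norm)
  qed
  obtain g where g: "B-lipschitz_on (closure {a<..<b}) g" "\<And>t. t \<in> {a<..<b} \<Longrightarrow> g t = z t"
    using lipschitz_extend_closure[OF lip] by blast
  have cg: "continuous_on {a..b} g" using lipschitz_on_continuous_on[OF g(1)] ab
      by (simp add: closure_greaterThanLessThan)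
  have "g b \<in> C"
  proof -
    have "g ` closure {a<..<b} \<subseteq> C"
      by (rule image_closure_subset) (use cg ab g(2) z(1) C(1) in \<open>auto simp:
          closure_greaterThanLessThan compact_imp_closed\<close>)
    then show ?thesis using ab by (auto simp: closure_greaterThanLessThan)
  qed
  then obtain \<epsilon> y where \<epsilon>: "\<epsilon> > 0" and y: "continuous_on {b..b+\<epsilon>} y" "y b = g b" "\<And>t. t \<in> {b..b+\<epsilon>}
      \<Longrightarrow> y t \<in> S"
    "\<And>t. t \<in> {b<..<b+\<epsilon>} \<Longrightarrow> (y has_vector_derivative F (y t)) (at t)"
    using ode_forward_solution[OF S, of "g b" b] C(2) by blast
  define w where "w t = (if t \<le> b then g t else y t)" for t
  have wz: "w t = z t" if "t \<in> {a<..<b}" for t using that g(2) unfolding w_def by simp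
  have wS: "w t \<in> S" if "t \<in> {a<..<b+\<epsilon>}" for t
  proof -
    consider "t < b" | "t = b" | "t > b" by linarith
    then show ?thesis
    proof cases
      case 1 then show ?thesis using wz z(1) C(2) that by force
    next
      case 2 then show ?thesis using y(3)[of b] y(2) \<epsilon> unfolding w_def by simp
    next
      case 3 then show ?thesis using y(3)[of t] that unfolding w_def by simp
    qed
  qed
  have wd: "(w has_vector_derivative F (w t)) (at t)" if t: "t \<in> {a<..<b+\<epsilon>}" "t \<noteq> b" for t
  proof (cases "t < b")
    case True
    then have t': "t \<in> {a<..<b}" using t by auto
    show ?thesis unfolding wz[OF t']
      by (rule has_vector_derivative_transform_within_open[OF z(2)[OF t'] open_greaterThanLessThan
          t']) (simp add: wz)
  next
    case False
    then have t': "t \<in> {b<..<b+\<epsilon>}" using t by auto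
    have "w t = y t" using t' unfolding w_def by simp
    then show ?thesis
      using has_vector_derivative_transform_within_open[OF y(4)[OF t'] open_greaterThanLessThan t',
          of w] by (simp add: w_def)
  qed
  \<comment> \<open>The integral equation below starts at an interior time, as nothing is known at
    \<open>a\<close>.\<close>
  define a' where "a' = (a + b) / 2"
  have a': "a < a'" "a' < b" unfolding a'_def using ab by auto
  have "continuous_on ({a'..b} \<union> {b..b+\<epsilon>}) w"
  proof (rule continuous_on_closed_Un)
    show "continuous_on {a'..b} w"
      by (rule continuous_on_eq[OF continuous_on_subset[OF cg]]) (use a' in \<open>auto simp: w_def\<close>)
    show "continuous_on {b..b+\<epsilon>} w"
      by (rule continuous_on_eq[OF y(1)]) (auto simp: w_def y(2))
  qed auto
  moreover have "{a'..b} \<union> {b..b+\<epsilon>} = {a'..b+\<epsilon>}" using a' \<epsilon> by auto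
  ultimately have cw: "continuous_on {a'..b+\<epsilon>} w" by simp
  define e2 where "e2 = \<epsilon> / 2"
  have e2: "e2 > 0" "e2 < \<epsilon>" unfolding e2_def using \<epsilon> by auto
  have cw2: "continuous_on {a'..b+e2} w" by (rule continuous_on_subset[OF cw]) (use e2 in auto)
  have cFw: "continuous_on {a'..b+e2} (\<lambda>t. F (w t))"
    by (rule continuous_on_compose2[OF smooth_on_continuous[OF S(2)] cw2]) (use wS a' e2 in auto)
  \<comment> \<open>Differentiability of \<open>w\<close> is still open at the joint
    \<open>b\<close>. This version of the fundamental theorem tolerates the exceptional point, and
    differentiating the resulting integral of a continuous function gives the missing derivative at
    \<open>b\<close>.\<close>
  have int: "w t = w a' + integral {a'..t} (\<lambda>s. F (w s))" if t: "t \<in> {a'..b+e2}" for t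
  proof -
    have "((\<lambda>s. F (w s)) has_integral (w t - w a')) {a'..t}"
      by (rule fundamental_theorem_of_calculus_interior_strong[of "{b}"])
        (use t a' e2 wd continuous_on_subset[OF cw2] in auto)
    from integral_unique[OF this] show ?thesis by simp
  qed
  have wdb: "(w has_vector_derivative F (w b)) (at b)"
  proof -
    have b: "b \<in> {a'<..<b+e2}" using a' e2 by auto
    have "((\<lambda>u. w a' + integral {a'..u} (\<lambda>s. F (w s))) has_vector_derivative 0 + F (w b)) (at b
        within {a'..b+e2})"
      by (intro has_vector_derivative_add has_vector_derivative_const integral_has_vector_derivative
          cFw) (use b in auto)
    then have "((\<lambda>u. w a' + integral {a'..u} (\<lambda>s. F (w s))) has_vector_derivative F (w b)) (at b
        within {a'<..<b+e2})"
      by (auto intro: has_vector_derivative_within_subset)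
    then have "((\<lambda>u. w a' + integral {a'..u} (\<lambda>s. F (w s))) has_vector_derivative F (w b)) (at b)"
      using at_within_open[OF b open_greaterThanLessThan] by simp
    then show ?thesis
      by (rule has_vector_derivative_transform_within_open[OF _ open_greaterThanLessThan b]) (metis
          greaterThanLessThan_iff atLeastAtMost_iff int less_imp_le)
  qed
  show ?thesis
  proof (intro exI[of _ \<epsilon>] conjI exI[of _ w] ballI \<epsilon>)
    fix t assume t: "t \<in> {a<..<b+\<epsilon>}"
    show "(w has_vector_derivative F (w t)) (at t)" using wd[OF t] wdb by (cases "t = b") auto
  qed (use wz wS in auto)
qed

section \<open>Geodesics in a chart\<close>

text \<open>Links \<open>vector_derivative\<close>, in which geodesics are formulated, to
  \<open>frechet_derivative\<close>, on which \<open>smooth_on\<close> rests.\<close>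

lemma smooth_on_real_derivatives:
  fixes x :: "real \<Rightarrow> 'a::euclidean_space"
  assumes "open T" "smooth_on T x"
  shows "t \<in> T \<Longrightarrow> (x has_vector_derivative vector_derivative x (at t)) (at t)"
    and "smooth_on T (\<lambda>s. vector_derivative x (at s))"
proof -
  have e: "(x has_vector_derivative vector_derivative x (at t)) (at t)" "frechet_derivative x (at t)
      1 = vector_derivative x (at t)"
    if "t \<in> T" for t
  proof -
    have d: "(x has_derivative frechet_derivative x (at t)) (at t)"
        by (rule smooth_on_has_derivative[OF assms(2) that])
    then show 1: "(x has_vector_derivative vector_derivative x (at t)) (at t)"
      using vector_derivative_works differentiableI by blast
    then show "frechet_derivative x (at t) 1 = vector_derivative x (at t)"
      using frechet_derivative_apply[of x "\<lambda>h. h *\<^sub>R vector_derivative x (at t)" t 1]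
          by (simp add: has_vector_derivative_def)
  qed
  then show "t \<in> T \<Longrightarrow> (x has_vector_derivative vector_derivative x (at t)) (at t)" by blast
  show "smooth_on T (\<lambda>s. vector_derivative x (at s))"
    by (rule smooth_on_cong[OF assms(1) smooth_on_derivative[OF assms(2), of 1] e(2)])
qed

definition chart_geodesic :: "'k::euclidean_space set \<Rightarrow> ('k \<Rightarrow> 'k \<Rightarrow> 'k \<Rightarrow> real) \<Rightarrow> real set \<Rightarrow> (real \<Rightarrow>
    'k) \<Rightarrow> bool" where
  "chart_geodesic X G T x \<longleftrightarrow> smooth_on T x \<and> (\<forall>t\<in>T. x t \<in> X \<and>
     vector_derivative (\<lambda>s. vector_derivative x (at s)) (at t) +
       chr G (x t) (vector_derivative x (at t)) (vector_derivative x (at t)) = 0)"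

text \<open>The geodesic equation becomes a first-order system for position and velocity. The bound
  on the velocity is what keeps the pair in a compact set,
  \<open>C \<times> cball 0 B\<close>.\<close>

lemma chart_geodesic_extend:
  assumes G: "bil_field X G" "nondegenerate_on X G" and C: "compact C" "C \<subseteq> X" and ab: "a < b"
    and x: "chart_geodesic X G {a<..<b} x" "\<And>t. t \<in> {a<..<b} \<Longrightarrow> x t \<in> C"
    and B: "\<And>t. t \<in> {a<..<b} \<Longrightarrow> norm (vector_derivative x (at t)) \<le> B"
  shows "\<exists>\<epsilon>>0. \<exists>w. (\<forall>t\<in>{a<..<b}. w t = x t) \<and> chart_geodesic X G {a<..<b+\<epsilon>} w"
proof -
  define F where "F z = (snd z, - chr G (fst z) (snd z) (snd z))" for z
  have oX: "open X" using bil_fieldD(1)[OF G(1)] .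
  have oXU: "open (X \<times> (UNIV::'a set))" using oX by (intro open_Times) auto
  have F: "smooth_on (X \<times> UNIV) F" unfolding F_def
    by (intro smooth_on_Pair smooth_on_minus oXU smooth_on_snd smooth_on_id
      smooth_on_quadratic[OF oX chr_bilinear[OF G] chr_smooth[OF G]])
  define x' where "x' t = vector_derivative x (at t)" for t
  have sx: "smooth_on {a<..<b} x" using x(1) unfolding chart_geodesic_def by simp
  have xd: "(x has_vector_derivative x' t) (at t)" if "t \<in> {a<..<b}" for t
    unfolding x'_def by (rule smooth_on_real_derivatives(1)[OF _ sx that]) simp
  have sx': "smooth_on {a<..<b} x'"
    using smooth_on_real_derivatives(2)[OF _ sx] unfolding x'_def by simp
  have xd': "(x' has_vector_derivative - chr G (x t) (x' t) (x' t)) (at t)" if "t \<in> {a<..<b}" for t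
  proof -
    have "(x' has_vector_derivative vector_derivative x' (at t)) (at t)"
      by (rule smooth_on_real_derivatives(1)[OF _ sx' that]) simp
    moreover have "vector_derivative x' (at t) = - chr G (x t) (x' t) (x' t)"
      using x(1) that unfolding chart_geodesic_def x'_def[symmetric]
          by (simp add: eq_neg_iff_add_eq_0)
    ultimately show ?thesis by simp
  qed
  have "compact (C \<times> cball (0::'a) B)" "C \<times> cball (0::'a) B \<subseteq> X \<times> UNIV" using C
      by (auto intro: compact_Times)
  moreover have "(x t, x' t) \<in> C \<times> cball 0 B" if "t \<in> {a<..<b}" for t using x(2)[OF that] B[OF that]
      unfolding x'_def by auto
  moreover have "((\<lambda>t. (x t, x' t)) has_vector_derivative F (x t, x' t)) (at t)" if "t \<in> {a<..<b}"
      for t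
    unfolding F_def by (simp, rule has_vector_derivative_Pair[OF xd[OF that] xd'[OF that]])
  ultimately obtain \<epsilon> w where \<epsilon>: "\<epsilon> > 0" and w: "\<And>t. t \<in> {a<..<b} \<Longrightarrow> w t = (x t, x' t)"
    "\<And>t. t \<in> {a<..<b+\<epsilon>} \<Longrightarrow> w t \<in> X \<times> UNIV" "\<And>t. t \<in> {a<..<b+\<epsilon>} \<Longrightarrow> (w
        has_vector_derivative F (w t)) (at t)"
    using ode_extend[OF oXU F _ _ ab, of "C \<times> cball 0 B" "\<lambda>t. (x t, x' t)"] by blast
  have sw: "smooth_on {a<..<b+\<epsilon>} w" by (rule ode_solution_smooth[OF _ oXU F w(2,3)]) auto
  have d1: "((\<lambda>t. fst (w t)) has_vector_derivative snd (w t)) (at t)" if "t \<in> {a<..<b+\<epsilon>}" for t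
    using bounded_linear.has_vector_derivative[OF bounded_linear_fst w(3)[OF that]] unfolding F_def
        by simp
  have d2: "((\<lambda>t. snd (w t)) has_vector_derivative - chr G (fst (w t)) (snd (w t)) (snd (w t))) (at
      t)" if "t \<in> {a<..<b+\<epsilon>}" for t
    using bounded_linear.has_vector_derivative[OF bounded_linear_snd w(3)[OF that]] unfolding F_def
        by simp
  have v1: "vector_derivative (\<lambda>t. fst (w t)) (at t) = snd (w t)" if "t \<in> {a<..<b+\<epsilon>}" for t
    using vector_derivative_at[OF d1[OF that]] .
  have v2: "vector_derivative (\<lambda>s. vector_derivative (\<lambda>t. fst (w t)) (at s)) (at t)
      = - chr G (fst (w t)) (snd (w t)) (snd (w t))" if t: "t \<in> {a<..<b+\<epsilon>}" for t
    by (rule vector_derivative_at[OF has_vector_derivative_transform_within_open[OF d2[OF t]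
        open_greaterThanLessThan t]]) (simp add: v1)
  have "chart_geodesic X G {a<..<b+\<epsilon>} (\<lambda>t. fst (w t))"
    unfolding chart_geodesic_def using smooth_on_fst[OF _ sw] w(2) v1 v2
        by (force simp: mem_Times_iff)
  then show ?thesis using \<epsilon> w(1) by (intro exI[of _ \<epsilon>] conjI exI[of _ "\<lambda>t. fst (w t)"]) auto
qed

section \<open>Charts and smooth maps\<close>

lemma smooth_atlasD:
  assumes "smooth_atlas M" "c \<in> M"
  shows "inj_on (snd c) (fst c)" "open (chart_img c)"
    "d \<in> M \<Longrightarrow> open (snd c ` (fst c \<inter> fst d))"
    "d \<in> M \<Longrightarrow> smooth_on (snd c ` (fst c \<inter> fst d)) (snd d \<circ> chart_inv c)"
  using assms unfolding smooth_atlas_def by auto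

lemma chart_inv_simps:
  assumes "smooth_atlas M" "c \<in> M"
  shows "p \<in> fst c \<Longrightarrow> chart_inv c (snd c p) = p"
    "x \<in> chart_img c \<Longrightarrow> snd c (chart_inv c x) = x" "x \<in> chart_img c \<Longrightarrow> chart_inv c x \<in> fst c"
  using smooth_atlasD(1)[OF assms] by (auto simp: f_inv_into_f inv_into_into)

lemma chart_image_eq:
  assumes "smooth_atlas M" "c \<in> M"
  shows "snd c ` (fst c \<inter> S) = {x \<in> chart_img c. chart_inv c x \<in> S}"
  using chart_inv_simps[OF assms] by force

lemma smooth_mapD:
  assumes "smooth_map M N F" "c \<in> M" "d \<in> N"
  shows "open (snd c ` (fst c \<inter> F -` fst d))" "smooth_on (snd c ` (fst c \<inter> F -` fst d)) (snd d \<circ> F \<circ>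
      chart_inv c)"
  using assms unfolding smooth_map_def by auto

lemma smooth_map_carrier: "smooth_map M N F \<Longrightarrow> p \<in> carrier M \<Longrightarrow> F p \<in> carrier N"
  unfolding smooth_map_def by blast

lemma chart_in_carrier: "c \<in> M \<Longrightarrow> p \<in> fst c \<Longrightarrow> p \<in> carrier M"
  unfolding carrier_def by blast

lemma open_preimage_smooth:
  assumes "open S" "smooth_on S f" "open T"
  shows "open {x \<in> S. f x \<in> T}"
  using continuous_open_preimage[OF smooth_on_continuous[OF assms(2)] assms(1,3)]
  by (simp add: vimage_def Int_def conj_commute)

text \<open>\<open>smooth_map\<close> quantifies over all pairs of charts; one pair around each
  point is enough, because any other local expression arises from it by composing with transition
  maps on both sides.\<close>

lemma smooth_mapI:
  assumes M: "smooth_atlas M" and N: "smooth_atlas N"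
    and loc: "\<And>p. p \<in> carrier M \<Longrightarrow> \<exists>c\<in>M. \<exists>d\<in>N. \<exists>W. p \<in> fst c \<and> open W \<and> snd c p \<in> W \<and>
       W \<subseteq> snd c ` (fst c \<inter> F -` fst d) \<and> smooth_on W (snd d \<circ> F \<circ> chart_inv c)"
  shows "smooth_map M N F"
proof -
  have key: "\<exists>V. open V \<and> x \<in> V \<and> V \<subseteq> snd c ` (fst c \<inter> F -` fst d)
      \<and> smooth_on V (snd d \<circ> F \<circ> chart_inv c)"
    if c: "c \<in> M" and d: "d \<in> N" and x: "x \<in> snd c ` (fst c \<inter> F -` fst d)" for c d x
  proof -
    obtain p where p: "p \<in> fst c" "F p \<in> fst d" "x = snd c p" using x by auto
    obtain c' d' W where c': "c' \<in> M" and d': "d' \<in> N" and pc': "p \<in> fst c'"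
        and W: "open W" "snd c' p \<in> W"
      "W \<subseteq> snd c' ` (fst c' \<inter> F -` fst d')" "smooth_on W (snd d' \<circ> F \<circ> chart_inv c')"
      using loc[OF chart_in_carrier[OF c p(1)]] by blast
    define A where "A = snd c ` (fst c \<inter> fst c')"
    define D where "D = snd d' ` (fst d' \<inter> fst d)"
    define f where "f = snd c' \<circ> chart_inv c"
    define k where "k = snd d' \<circ> F \<circ> chart_inv c'"
    define h where "h = snd d \<circ> chart_inv d'"
    have A: "open A" "smooth_on A f" unfolding A_def f_def using smooth_atlasD(3,4)[OF M c c']
        by auto
    have D: "open D" "smooth_on D h" unfolding D_def h_def using smooth_atlasD(3,4)[OF N d' d]
        by auto
    define W2 where "W2 = {y \<in> W. k y \<in> D}"
    have W2: "open W2" unfolding W2_def k_def by (rule open_preimage_smooth[OF W(1,4) D(1)])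
    define V where "V = {y \<in> A. f y \<in> W2}"
    have V: "open V" unfolding V_def by (rule open_preimage_smooth[OF A W2])
    have inA: "chart_inv c y \<in> fst c" "chart_inv c y \<in> fst c'" "snd c (chart_inv c y) = y"
      "chart_inv c' (f y) = chart_inv c y" if "y \<in> A" for y
      using that chart_inv_simps[OF M c] chart_inv_simps[OF M c'] unfolding A_def f_def by auto
    have inW: "chart_inv c' y \<in> fst c'" "F (chart_inv c' y) \<in> fst d'" if "y \<in> W" for y
      using W(3) that chart_inv_simps[OF M c'] by auto
    have inD: "chart_inv d' y \<in> fst d" if "y \<in> D" for y
      using that chart_inv_simps[OF N d'] unfolding D_def by auto
    have inV: "F (chart_inv c y) \<in> fst d" "h (k (f y)) = (snd d \<circ> F \<circ> chart_inv c) y" if "y \<in> V"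
        for y
    proof -
      have y: "y \<in> A" "f y \<in> W" "k (f y) \<in> D" using that unfolding V_def W2_def by auto
      have "chart_inv d' (k (f y)) = F (chart_inv c y)"
        unfolding k_def using inA[OF y(1)] inW[OF y(2)] chart_inv_simps(1)[OF N d'] by simp
      then show "F (chart_inv c y) \<in> fst d" "h (k (f y)) = (snd d \<circ> F \<circ> chart_inv c) y"
        using inD[OF y(3)] unfolding h_def by auto
    qed
    have "x \<in> V"
    proof -
      have "chart_inv c x = p" using p chart_inv_simps[OF M c] by auto
      moreover have "chart_inv c' (snd c' p) = p" using pc' chart_inv_simps[OF M c'] by auto
      moreover have "F p \<in> fst d'" using inW(2)[OF W(2)] calculation by simp
      ultimately show ?thesis unfolding V_def A_def W2_def f_def k_def D_def using p pc' W(2)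
          by auto
    qed
    moreover have "V \<subseteq> snd c ` (fst c \<inter> F -` fst d)"
    proof
      fix y assume y: "y \<in> V"
      then have "y \<in> A" unfolding V_def by simp
      then show "y \<in> snd c ` (fst c \<inter> F -` fst d)" using inA[of y] inV(1)[OF y]
          by (metis IntI imageI vimageI)
    qed
    moreover have "smooth_on V (snd d \<circ> F \<circ> chart_inv c)"
    proof (rule smooth_on_cong[OF V _ inV(2)])
      have "smooth_on W2 (\<lambda>y. h (k y))"
        by (rule smooth_on_compose[OF W2 D(1,2) smooth_on_subset[OF W(4)[folded k_def]]]) (auto
            simp: W2_def)
      then show "smooth_on V (\<lambda>y. h (k (f y)))"
        by (rule smooth_on_compose[OF V W2 _ smooth_on_subset[OF A(2)]]) (auto simp: V_def)
    qed
    ultimately show ?thesis using V by blast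
  qed
  show ?thesis unfolding smooth_map_def
  proof (intro conjI ballI)
    show "F ` carrier M \<subseteq> carrier N"
    proof
      fix q assume "q \<in> F ` carrier M"
      then obtain p where p: "p \<in> carrier M" "q = F p" by auto
      obtain c d W where cd: "c \<in> M" "d \<in> N" "p \<in> fst c" "snd c p \<in> W" "W \<subseteq> snd c ` (fst c \<inter> F -`
          fst d)"
        using loc[OF p(1)] by blast
      then obtain p' where "p' \<in> fst c" "F p' \<in> fst d" "snd c p = snd c p'" by blast
      then have "F p \<in> fst d" using inj_onD[OF smooth_atlasD(1)[OF M cd(1)]] cd(3) by metis
      then show "q \<in> carrier N" using p chart_in_carrier[OF cd(2)] by simp
    qed
  next
    fix c d assume "c \<in> M" "d \<in> N"
    then show "open (snd c ` (fst c \<inter> F -` fst d))" using key by (subst open_subopen) meson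
    show "smooth_on (snd c ` (fst c \<inter> F -` fst d)) (snd d \<circ> F \<circ> chart_inv c)"
      by (rule smooth_on_local) (use key[OF \<open>c \<in> M\<close> \<open>d \<in> N\<close>] in blast)
  qed
qed

lemma smooth_map_compose:
  assumes M: "smooth_atlas M" and N: "smooth_atlas N" and P: "smooth_atlas P"
    and F: "smooth_map M N F" and G: "smooth_map N P G"
  shows "smooth_map M P (G \<circ> F)"
proof (rule smooth_mapI[OF M P])
  fix p assume p: "p \<in> carrier M"
  obtain c where c: "c \<in> M" "p \<in> fst c" using p unfolding carrier_def by auto
  obtain e where e: "e \<in> N" "F p \<in> fst e" using smooth_map_carrier[OF F p] unfolding carrier_def
      by auto
  obtain d where d: "d \<in> P" "G (F p) \<in> fst d"
    using smooth_map_carrier[OF G smooth_map_carrier[OF F p]] unfolding carrier_def by auto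
  note f = smooth_mapD[OF F c(1) e(1)] and g = smooth_mapD[OF G e(1) d(1)]
  define W where "W = {y \<in> snd c ` (fst c \<inter> F -` fst e). (snd e \<circ> F \<circ> chart_inv c) y \<in> snd e ` (fst
      e \<inter> G -` fst d)}"
  have W: "open W" unfolding W_def by (rule open_preimage_smooth[OF f g(1)])
  have inW: "chart_inv c y \<in> fst c" "snd c (chart_inv c y) = y" "F (chart_inv c y) \<in> fst e" "G (F
      (chart_inv c y)) \<in> fst d"
    "(snd d \<circ> G \<circ> chart_inv e) ((snd e \<circ> F \<circ> chart_inv c) y) = (snd d \<circ> (G \<circ> F) \<circ> chart_inv c) y"
        if "y \<in> W" for y
  proof -
    from that show 1: "chart_inv c y \<in> fst c" "snd c (chart_inv c y)
        = y" "F (chart_inv c y) \<in> fst e"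
      unfolding W_def using chart_inv_simps[OF M c(1)] by auto
    show "G (F (chart_inv c y)) \<in> fst d"
      using that 1 smooth_atlasD(1)[OF N e(1)] unfolding W_def by (auto dest!: inj_onD)
    show "(snd d \<circ> G \<circ> chart_inv e) ((snd e \<circ> F \<circ> chart_inv c) y)
        = (snd d \<circ> (G \<circ> F) \<circ> chart_inv c) y"
      using 1 chart_inv_simps(1)[OF N e(1)] by simp
  qed
  have "snd c p \<in> W" unfolding W_def using c e d chart_inv_simps(1)[OF M c(1)] by auto
  moreover have "W \<subseteq> snd c ` (fst c \<inter> (G \<circ> F) -` fst d)"
  proof
    fix y assume y: "y \<in> W"
    have "chart_inv c y \<in> fst c \<inter> (G \<circ> F) -` fst d" using inW(1,4)[OF y] by simp
    then show "y \<in> snd c ` (fst c \<inter> (G \<circ> F) -` fst d)" using inW(2)[OF y] by (metis imageI)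
  qed
  moreover have "smooth_on W (snd d \<circ> (G \<circ> F) \<circ> chart_inv c)"
    by (rule smooth_on_cong[OF W smooth_on_compose[OF W g(1,2) smooth_on_subset[OF f(2)]] inW(5)])
        (auto simp: W_def)
  ultimately show "\<exists>c\<in>M. \<exists>d\<in>P. \<exists>W. p \<in> fst c \<and> open W \<and> snd c p \<in> W \<and>
       W \<subseteq> snd c ` (fst c \<inter> (G \<circ> F) -` fst d) \<and> smooth_on W (snd d \<circ> (G \<circ> F) \<circ> chart_inv c)"
    using c d W by blast
qed

lemma smooth_map_id:
  assumes M: "smooth_atlas M" shows "smooth_map M M (\<lambda>x. x)"
  unfolding smooth_map_def using smooth_atlasD[OF M] by (auto simp: vimage_def o_def)

section \<open>Tangent vectors in charts\<close>

lemma smooth_near_compose_chart: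
  assumes M: "smooth_atlas M" and N: "smooth_atlas N" and F: "smooth_map M N F"
    and c: "c \<in> M" "p \<in> fst c" and d: "d \<in> N" "F p \<in> fst d" and \<phi>: "smooth_near N (F p) \<phi>"
  shows "smooth_near M p (\<phi> \<circ> F)"
    and "frechet_derivative (\<phi> \<circ> F \<circ> chart_inv c) (at (snd c p)) v =
      frechet_derivative (\<phi> \<circ> chart_inv d) (at (snd d (F p))) (frechet_derivative (snd d \<circ> F \<circ>
          chart_inv c) (at (snd c p)) v)"
proof -
  \<comment> \<open>Stated for an arbitrary source manifold, because it is used twice: for the
    identity of \<open>N\<close>, to carry the smoothness of \<phi> from the chart supplied by
    \<open>smooth_near\<close> to the given chart \<open>d\<close>, and then for \<open>F\<close>
    itself.\<close>
  have gen: "\<exists>W. open W \<and> snd c p \<in> W \<and> W \<subseteq> chart_img c \<and> smooth_on W (\<phi> \<circ> F \<circ> chart_inv c) \<and>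
      frechet_derivative (\<phi> \<circ> F \<circ> chart_inv c) (at (snd c p)) v =
      frechet_derivative (\<phi> \<circ> chart_inv d) (at (snd d (F p))) (frechet_derivative (snd d \<circ> F \<circ>
          chart_inv c) (at (snd c p)) v)"
    if M: "smooth_atlas M" and c: "c \<in> M" "p \<in> fst c" and F: "smooth_map M N F"
        and d: "d \<in> N" "F p \<in> fst d"
    and V: "open V" "snd d (F p) \<in> V" "smooth_on V (\<phi> \<circ> chart_inv d)"
    for M :: "('p, 'q::euclidean_space) atlas" and F :: "'p \<Rightarrow> 'c" and c and p and d V v
  proof -
    define f where "f = snd d \<circ> F \<circ> chart_inv c"
    note sf = smooth_mapD[OF F c(1) d(1), folded f_def]
    define W where "W = {y \<in> snd c ` (fst c \<inter> F -` fst d). f y \<in> V}"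
    have W: "open W" unfolding W_def by (rule open_preimage_smooth[OF sf V(1)])
    have pc: "chart_inv c (snd c p) = p" using chart_inv_simps(1)[OF M c] .
    have pW: "snd c p \<in> W" unfolding W_def f_def using c d V pc by auto
    have eq: "(\<phi> \<circ> chart_inv d) (f y) = (\<phi> \<circ> F \<circ> chart_inv c) y" if "y \<in> W" for y
      using that chart_inv_simps(1)[OF N d(1)] chart_inv_simps(1)[OF M c(1)] unfolding W_def f_def
          by auto
    have sW: "smooth_on W f" by (rule smooth_on_subset[OF sf(2)]) (auto simp: W_def)
    have "smooth_on W (\<phi> \<circ> F \<circ> chart_inv c)"
      by (rule smooth_on_cong[OF W smooth_on_compose[OF W V(1,3) sW] eq]) (auto simp: W_def)
    moreover have "W \<subseteq> chart_img c" unfolding W_def by auto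
    moreover have "frechet_derivative (\<phi> \<circ> F \<circ> chart_inv c) (at (snd c p)) v =
      frechet_derivative (\<phi> \<circ> chart_inv d) (at (snd d (F p))) (frechet_derivative f (at (snd c p))
          v)"
    proof (rule frechet_derivative_apply)
      have 1: "f (snd c p) = snd d (F p)" unfolding f_def using pc by simp
      have "((\<lambda>y. (\<phi> \<circ> chart_inv d) (f y)) has_derivative (\<lambda>v. frechet_derivative (\<phi> \<circ> chart_inv d)
          (at (f (snd c p))) (frechet_derivative f (at (snd c p)) v))) (at (snd c p))"
        by (rule has_derivative_compose[OF smooth_on_has_derivative[OF sW pW]
            smooth_on_has_derivative[OF V(3)]]) (simp add: 1 V)
      then show "(\<phi> \<circ> F \<circ> chart_inv c has_derivative (\<lambda>v. frechet_derivative (\<phi> \<circ> chart_inv d) (at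
          (snd d (F p))) (frechet_derivative f (at (snd c p)) v))) (at (snd c p))"
        unfolding 1 by (rule has_derivative_transform_within_open[OF _ W pW]) (rule eq)
    qed
    ultimately show ?thesis using W pW unfolding f_def by blast
  qed
  obtain d' V' where d': "d' \<in> N" "F p \<in> fst d'"
      and V': "open V'" "snd d' (F p) \<in> V'" "smooth_on V' (\<phi> \<circ> chart_inv d')"
    using \<phi> unfolding smooth_near_def by blast
  obtain V where V: "open V" "snd d (F p) \<in> V" "smooth_on V (\<phi> \<circ> chart_inv d)"
    using gen[OF N d smooth_map_id[OF N] d' V'] by (auto simp: o_def)
  from gen[OF M c F d V, of v] obtain W where W: "open W" "snd c p \<in> W" "W \<subseteq> chart_img c" "smooth_on
      W (\<phi> \<circ> F \<circ> chart_inv c)"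
    and e: "frechet_derivative (\<phi> \<circ> F \<circ> chart_inv c) (at (snd c p)) v =
      frechet_derivative (\<phi> \<circ> chart_inv d) (at (snd d (F p))) (frechet_derivative (snd d \<circ> F \<circ>
          chart_inv c) (at (snd c p)) v)"
    by blast
  show "smooth_near M p (\<phi> \<circ> F)" unfolding smooth_near_def using W c by blast
  show "frechet_derivative (\<phi> \<circ> F \<circ> chart_inv c) (at (snd c p)) v =
      frechet_derivative (\<phi> \<circ> chart_inv d) (at (snd d (F p))) (frechet_derivative (snd d \<circ> F \<circ>
          chart_inv c) (at (snd c p)) v)"
    by (rule e)
qed

lemma smooth_near_chart:
  assumes N: "smooth_atlas N" and d: "d \<in> N" "q \<in> fst d" and \<phi>: "smooth_near N q \<phi>"
  shows "(\<phi> \<circ> chart_inv d has_derivative frechet_derivative (\<phi> \<circ> chart_inv d) (at (snd d q))) (at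
      (snd d q))"
proof -
  obtain d' V' where d': "d' \<in> N" "q \<in> fst d'"
      and V': "open V'" "snd d' q \<in> V'" "smooth_on V' (\<phi> \<circ> chart_inv d')"
    using \<phi> unfolding smooth_near_def by blast
  define A where "A = snd d ` (fst d \<inter> fst d')"
  define f where "f = snd d' \<circ> chart_inv d"
  have A: "open A" "smooth_on A f" unfolding A_def f_def using smooth_atlasD(3,4)[OF N d(1) d'(1)]
      by auto
  have qA: "snd d q \<in> A" unfolding A_def using d d' by auto
  have 1: "f (snd d q) \<in> V'" unfolding f_def using chart_inv_simps(1)[OF N d] V' by simp
  have "((\<lambda>y. (\<phi> \<circ> chart_inv d') (f y)) has_derivative (\<lambda>v. frechet_derivative (\<phi> \<circ> chart_inv d')
      (at (f (snd d q))) (frechet_derivative f (at (snd d q)) v))) (at (snd d q))"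
    by (rule has_derivative_compose[OF smooth_on_has_derivative[OF A(2) qA]
        smooth_on_has_derivative[OF V'(3) 1]])
  then have "(\<phi> \<circ> chart_inv d has_derivative (\<lambda>v. frechet_derivative (\<phi> \<circ> chart_inv d') (at (f (snd
      d q))) (frechet_derivative f (at (snd d q)) v))) (at (snd d q))"
    by (rule has_derivative_transform_within_open[OF _ A(1) qA])
      (use chart_inv_simps(1)[OF N d'(1)] chart_inv_simps(1)[OF N d(1)] in \<open>auto simp: A_def f_def\<close>)
  then show ?thesis using differentiableI frechet_derivative_works by blast
qed

lemma push_chart_vec:
  assumes "smooth_atlas M" "smooth_atlas N" "smooth_map M N F" "c \<in> M" "p \<in> fst c" "d \<in> N" "F p \<in>
      fst d"
  shows "push N F p (chart_vec M c p v) =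
    chart_vec N d (F p) (frechet_derivative (snd d \<circ> F \<circ> chart_inv c) (at (snd c p)) v)"
  using smooth_near_compose_chart[OF assms] unfolding push_def chart_vec_def by (auto simp: o_assoc)

lemma chart_vec_change:
  assumes "smooth_atlas M" "c \<in> M" "p \<in> fst c" "d \<in> M" "p \<in> fst d"
  shows "chart_vec M c p v = chart_vec M d p (frechet_derivative (snd d \<circ> chart_inv c) (at (snd c
      p)) v)"
proof -
  \<comment> \<open>Pushing along the identity changes nothing, because a \<open>chart_vec\<close>
    already vanishes on functions that are not smooth near \<open>p\<close>. The change of charts
    thus becomes a case of \<open>push_chart_vec\<close>.\<close>
  have "push M (\<lambda>x. x) p (chart_vec M c p v) = chart_vec M c p v"
    unfolding push_def chart_vec_def by (auto simp: o_def)
  then show ?thesis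
    using push_chart_vec[OF assms(1,1) smooth_map_id[OF assms(1)] assms(2,3,4), of v] assms(5)
        by (simp add: o_def)
qed

lemma push_push:
  assumes "smooth_atlas M" "smooth_atlas N" "smooth_atlas P" "smooth_map M N F" "smooth_map N P G"
      "p \<in> carrier M"
  shows "push P G (F p) (push N F p X) = push P (G \<circ> F) p X"
proof
  fix \<phi>
  obtain c where c: "c \<in> N" "F p \<in> fst c" using smooth_map_carrier[OF assms(4,6)]
      unfolding carrier_def by auto
  obtain d where d: "d \<in> P" "G (F p) \<in> fst d"
    using smooth_map_carrier[OF assms(5) smooth_map_carrier[OF assms(4,6)]] unfolding carrier_def
        by auto
  show "push P G (F p) (push N F p X) \<phi> = push P (G \<circ> F) p X \<phi>"
    using smooth_near_compose_chart(1)[OF assms(2,3,5) c d] unfolding push_def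
        by (auto simp: o_assoc)
qed

lemma velocity_chart_vec:
  assumes M: "smooth_atlas M" and c: "c \<in> M" and T: "open T" "t \<in> T" "\<gamma> ` T \<subseteq> fst c"
    and x: "(snd c \<circ> \<gamma> has_vector_derivative v) (at t)"
  shows "velocity M \<gamma> t = chart_vec M c (\<gamma> t) v"
proof
  fix \<phi>
  have ct: "\<gamma> t \<in> fst c" using T by auto
  show "velocity M \<gamma> t \<phi> = chart_vec M c (\<gamma> t) v \<phi>"
  proof (cases "smooth_near M (\<gamma> t) \<phi>")
    case True
    define D where "D = frechet_derivative (\<phi> \<circ> chart_inv c) (at (snd c (\<gamma> t)))"
    have d: "(\<phi> \<circ> chart_inv c has_derivative D) (at (snd c (\<gamma> t)))"
      unfolding D_def by (rule smooth_near_chart[OF M c ct True])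
    have x': "(snd c \<circ> \<gamma> has_derivative (\<lambda>h. h *\<^sub>R v)) (at t)" using x
        by (simp add: has_vector_derivative_def)
    have "((\<lambda>s. (\<phi> \<circ> chart_inv c) ((snd c \<circ> \<gamma>) s)) has_derivative (\<lambda>h. D (h *\<^sub>R v))) (at t)"
      by (rule has_derivative_compose[OF x']) (use d in \<open>simp add: o_def\<close>)
    then have "(\<phi> \<circ> \<gamma> has_derivative (\<lambda>h. D (h *\<^sub>R v))) (at t)"
      by (rule has_derivative_transform_within_open[OF _ T(1,2)]) (use chart_inv_simps(1)[OF M c] T
          in auto)
    then have "(\<phi> \<circ> \<gamma> has_real_derivative D v) (at t)"
      unfolding has_field_derivative_def by (rule has_derivative_eq_rhs) (simp add: linear_cmul[OF
          has_derivative_linear[OF d]] mult.commute fun_eq_iff)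
    then show ?thesis using True DERIV_imp_deriv unfolding velocity_def chart_vec_def D_def by auto
  qed (simp add: velocity_def chart_vec_def)
qed

section \<open>Geodesics of a metric on a manifold\<close>

lemma real_atlas: "restrict_atlas euclidean_atlas J = {(J, \<lambda>x. x)}"
  by (auto simp: restrict_atlas_def euclidean_atlas_def)

lemma carrier_real_atlas: "carrier (restrict_atlas euclidean_atlas J) = J"
  by (simp add: real_atlas carrier_def)

lemma inv_into_ident: "t \<in> J \<Longrightarrow> inv_into J (\<lambda>x. x) t = t"
  using inv_into_f_f[of "\<lambda>x. x" J t] by simp

lemma smooth_atlas_real: "open J \<Longrightarrow> smooth_atlas (restrict_atlas euclidean_atlas J)"
  unfolding smooth_atlas_def real_atlas
  by (auto intro: smooth_on_cong[OF _ smooth_on_id] simp: inv_into_ident)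

lemma curve_smoothD:
  assumes J: "open J" and \<gamma>: "smooth_map (restrict_atlas euclidean_atlas J) M \<gamma>" and c: "c \<in> M"
  shows "open (J \<inter> \<gamma> -` fst c)" "smooth_on (J \<inter> \<gamma> -` fst c) (snd c \<circ> \<gamma>)"
proof -
  have j: "(J, \<lambda>x. x) \<in> restrict_atlas euclidean_atlas J" by (simp add: real_atlas)
  from smooth_mapD[OF \<gamma> j c] have 1: "open (J \<inter> \<gamma> -` fst c)" "smooth_on (J \<inter> \<gamma> -` fst c) (snd c \<circ> \<gamma>
      \<circ> inv_into J (\<lambda>x. x))"
    by auto
  show "open (J \<inter> \<gamma> -` fst c)" by (rule 1)
  show "smooth_on (J \<inter> \<gamma> -` fst c) (snd c \<circ> \<gamma>)"
    by (rule smooth_on_cong[OF 1]) (simp add: inv_into_ident)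
qed

lemma curve_smoothI:
  assumes J: "open J" and M: "smooth_atlas M"
    and loc: "\<And>t. t \<in> J \<Longrightarrow> \<exists>c\<in>M. \<exists>T. open T \<and> t \<in> T \<and> T \<subseteq> J \<and> \<gamma> ` T \<subseteq> fst c
        \<and> smooth_on T (snd c \<circ> \<gamma>)"
  shows "smooth_map (restrict_atlas euclidean_atlas J) M \<gamma>"
proof (rule smooth_mapI[OF smooth_atlas_real[OF J] M])
  fix t assume "t \<in> carrier (restrict_atlas euclidean_atlas J)"
  then have "t \<in> J" by (simp add: carrier_real_atlas)
  from loc[OF this] obtain c T where c: "c \<in> M"
      and T: "open T" "t \<in> T" "T \<subseteq> J" "\<gamma> ` T \<subseteq> fst c" "smooth_on T (snd c \<circ> \<gamma>)" by blast
  have "smooth_on T (snd c \<circ> \<gamma> \<circ> inv_into J (\<lambda>x. x))"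
    by (rule smooth_on_cong[OF T(1,5)]) (use T(3) in \<open>auto simp: inv_into_ident\<close>)
  then show "\<exists>e\<in>restrict_atlas euclidean_atlas J. \<exists>d\<in>M. \<exists>W. t \<in> fst e \<and> open W \<and> snd e t \<in> W \<and>
       W \<subseteq> snd e ` (fst e \<inter> \<gamma> -` fst d) \<and> smooth_on W (snd d \<circ> \<gamma> \<circ> chart_inv e)"
    unfolding real_atlas using c T by (intro bexI[of _ "(J, \<lambda>x. x)"] bexI[of _ c] exI[of _ T]) auto
qed

lemma chart_geodesic_cong:
  assumes T: "open T" and x: "chart_geodesic X G T x" and e: "\<And>t. t \<in> T \<Longrightarrow> x t = y t"
  shows "chart_geodesic X G T y"
proof -
  have sx: "smooth_on T x" using x unfolding chart_geodesic_def by simp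
  have 1: "vector_derivative y (at t) = vector_derivative x (at t)" if "t \<in> T" for t
    by (rule vector_derivative_at[OF has_vector_derivative_transform_within_open[OF
        smooth_on_real_derivatives(1)[OF T sx that] T that]])
      (simp add: e)
  have 2: "vector_derivative (\<lambda>s. vector_derivative y (at s)) (at t)
      = vector_derivative (\<lambda>s. vector_derivative x (at s)) (at t)" if t: "t \<in> T" for t
    by (rule vector_derivative_at[OF has_vector_derivative_transform_within_open[OF
        smooth_on_real_derivatives(1)[OF T smooth_on_real_derivatives(2)[OF T sx] t] T t]])
      (simp add: 1)
  show ?thesis using x smooth_on_cong[OF T sx e] e unfolding chart_geodesic_def by (auto simp: 1 2)
qed

lemma chart_geodesic_subset: "chart_geodesic X G T x \<Longrightarrow> S \<subseteq> T \<Longrightarrow> chart_geodesic X G S x"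
  unfolding chart_geodesic_def using smooth_on_subset by blast

text \<open>Reversing time preserves the acceleration and flips the velocity, in which the
  Christoffel term is even. This reduces extension to the left to extension to the right.\<close>

lemma chart_geodesic_reverse:
  assumes T: "open T" and G: "bil_field X G" "nondegenerate_on X G" and x: "chart_geodesic X G T x"
  shows "chart_geodesic X G (uminus ` T) (\<lambda>t. x (- t))"
proof -
  have oT: "open (uminus ` T)" using open_negations[OF T] by (simp add: image_def)
  have sx: "smooth_on T x" using x unfolding chart_geodesic_def by simp
  define x' where "x' t = vector_derivative x (at t)" for t
  define x'' where "x'' t = vector_derivative x' (at t)" for t
  have r: "((\<lambda>t. f (- t)) has_vector_derivative - d) (at t)" if "(f
      has_vector_derivative d) (at (- t))" for f :: "real \<Rightarrow> 'a" and d t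
  proof -
    have "((\<lambda>t::real. - t) has_vector_derivative - 1) (at t)"
      by (auto intro!: derivative_eq_intros)
    from vector_diff_chain_at[OF this that] show ?thesis by (simp add: o_def)
  qed
  have 0: "(x has_vector_derivative x' t) (at t)" "(x' has_vector_derivative x'' t) (at t)"
      if "t \<in> T" for t
    unfolding x''_def x'_def
    using smooth_on_real_derivatives(1)[OF T sx that] smooth_on_real_derivatives(1)[OF T
        smooth_on_real_derivatives(2)[OF T sx] that] by auto
  have 1: "vector_derivative (\<lambda>t. x (- t)) (at t) = - x' (- t)" if "t \<in> uminus ` T" for t
    by (rule vector_derivative_at, rule r, rule 0) (use that in auto)
  have 2: "vector_derivative (\<lambda>s. vector_derivative (\<lambda>t. x (- t)) (at s)) (at t) = x'' (- t)"
      if t: "t \<in> uminus ` T" for t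
  proof -
    have "- t \<in> T" using t by auto
    then have *: "((\<lambda>s. - x' (- s)) has_vector_derivative x'' (- t)) (at t)"
      using has_vector_derivative_minus[OF r[OF 0(2)]] by simp
    show ?thesis
      by (rule vector_derivative_at[OF has_vector_derivative_transform_within_open[OF * oT t]])
          (simp add: 1)
  qed
  have "smooth_on (uminus ` T) (\<lambda>t. x (- t))"
    by (rule smooth_on_compose[OF oT T sx smooth_on_minus[OF oT smooth_on_id[OF oT]]]) auto
  then show ?thesis
    using x unfolding chart_geodesic_def
    by (auto simp: 1 2 x'_def[symmetric] x''_def[symmetric] bilinear_lneg[OF chr_bilinear[OF G]]
        bilinear_rneg[OF chr_bilinear[OF G]])
qed

section \<open>Charts and curves in the manifold topology\<close>

lemma topspace_mtop:
  assumes "smooth_atlas M" shows "topspace (mtop M) = carrier M"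
proof -
  have "carrier M \<inter> fst c = fst c" if "c \<in> M" for c using that chart_in_carrier by fast
  then have "openin (mtop M) (carrier M)"
    unfolding openin_mtop[OF assms] using smooth_atlasD(2)[OF assms] by simp
  moreover have "topspace (mtop M) \<subseteq> carrier M"
    using openin_mtop[OF assms, of "topspace (mtop M)"] by simp
  ultimately show ?thesis using openin_subset by blast
qed

lemma chart_inv_image_open:
  assumes M: "smooth_atlas M" and c: "c \<in> M" and S: "open S" "S \<subseteq> chart_img c"
  shows "openin (mtop M) (chart_inv c ` S)"
  unfolding openin_mtop[OF M]
proof (intro conjI ballI)
  show "chart_inv c ` S \<subseteq> carrier M" using S chart_inv_simps(3)[OF M c] chart_in_carrier[OF c]
      by blast
  fix d assume d: "d \<in> M"
  note dc = smooth_atlasD(3,4)[OF M d c]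
  have "snd d ` (chart_inv c ` S \<inter> fst d) = {y \<in> snd d ` (fst d \<inter> fst c). (snd c \<circ> chart_inv d) y \<in>
      S}" (is "?L = ?R")
  proof
    show "?L \<subseteq> ?R"
    proof
      fix y assume "y \<in> ?L"
      then obtain x where x: "x \<in> S" "chart_inv c x \<in> fst d" "y = snd d (chart_inv c x)" by auto
      then have "chart_inv c x \<in> fst c" "snd c (chart_inv c x) = x"
          using S(2) chart_inv_simps(2,3)[OF M c, of x] by auto
      then show "y \<in> ?R" using x chart_inv_simps(1)[OF M d x(2)] by auto
    qed
    show "?R \<subseteq> ?L"
    proof
      fix y assume y: "y \<in> ?R"
      then obtain p where p: "p \<in> fst d" "p \<in> fst c" "y = snd d p" by auto
      then have "snd c p \<in> S" "chart_inv c (snd c p) = p"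
        using y chart_inv_simps(1)[OF M d p(1)] chart_inv_simps(1)[OF M c p(2)] by auto
      then show "y \<in> ?L" using p by (metis IntI imageI)
    qed
  qed
  then show "open (snd d ` (chart_inv c ` S \<inter> fst d))"
    using open_preimage_smooth[OF dc S(1)] by simp
qed

text \<open>The inverse chart is continuous, so the image of \<open>C\<close> is compact and, by the
  Hausdorff property, closed.\<close>

lemma chart_inv_image_closed:
  assumes M: "smooth_atlas M" and H: "Hausdorff_space (mtop M)" and c: "c \<in> M"
      and C: "compact C" "C \<subseteq> chart_img c"
  shows "openin (mtop M) (carrier M - chart_inv c ` C)"
proof -
  have "continuous_map (top_of_set (chart_img c)) (mtop M) (chart_inv c)"
    unfolding continuous_map_def topspace_mtop[OF M]
  proof (intro conjI allI impI)
    show "chart_inv c \<in> topspace (top_of_set (chart_img c)) \<rightarrow> carrier M"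
      using chart_inv_simps(3)[OF M c] chart_in_carrier[OF c] by auto
    fix U assume "openin (mtop M) U"
    then have "open (snd c ` (U \<inter> fst c))" unfolding openin_mtop[OF M] using c by blast
    moreover have "snd c ` (U \<inter> fst c) = {x \<in> chart_img c. chart_inv c x \<in> U}"
      using chart_image_eq[OF M c, of U] by (simp add: Int_commute)
    ultimately show "openin (top_of_set (chart_img c)) {x \<in> topspace (top_of_set (chart_img c)).
        chart_inv c x \<in> U}"
      using smooth_atlasD(2)[OF M c] by (simp add: openin_open_eq)
  qed
  moreover have "compactin (top_of_set (chart_img c)) C" using C
      by (simp add: compactin_subtopology)
  ultimately have "compactin (mtop M) (chart_inv c ` C)" by (rule image_compactin[rotated])
  then have "closedin (mtop M) (chart_inv c ` C)" using H compactin_imp_closedin by blast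
  then show ?thesis using topspace_mtop[OF M] by (metis closedin_def)
qed

lemma curve_open_preimage:
  assumes M: "smooth_atlas M" and J: "open J"
      and \<gamma>: "smooth_map (restrict_atlas euclidean_atlas J) M \<gamma>"
    and W: "openin (mtop M) W"
  shows "open {t \<in> J. \<gamma> t \<in> W}"
proof (subst open_subopen, intro ballI)
  fix t assume t: "t \<in> {t \<in> J. \<gamma> t \<in> W}"
  then have "\<gamma> t \<in> carrier M" using W unfolding openin_mtop[OF M] by blast
  then obtain c where c: "c \<in> M" "\<gamma> t \<in> fst c" unfolding carrier_def by auto
  note d = curve_smoothD[OF J \<gamma> c(1)]
  define T where "T = {s \<in> J \<inter> \<gamma> -` fst c. (snd c \<circ> \<gamma>) s \<in> snd c ` (W \<inter> fst c)}"
  have "open T" unfolding T_def by (rule open_preimage_smooth[OF d]) (use W c openin_mtop[OF M] in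
      blast)
  moreover have "t \<in> T" unfolding T_def using t c by auto
  moreover have "T \<subseteq> {t \<in> J. \<gamma> t \<in> W}"
    unfolding T_def using inj_onD[OF smooth_atlasD(1)[OF M c(1)]] by force
  ultimately show "\<exists>T. open T \<and> t \<in> T \<and> T \<subseteq> {t \<in> J. \<gamma> t \<in> W}" by blast
qed

text \<open>The signature is left open, since the metric to which this is applied is Lorentzian;
  nondegeneracy is what Christoffel symbols require.\<close>

locale metric_manifold =
  fixes M :: "('m, 'k::euclidean_space) atlas" and g :: "('m, real) tensor2"
  assumes M: "smooth_atlas M"
    and metric: "\<And>c. c \<in> M \<Longrightarrow> bil_field (chart_img c) (comp2 M g c)"
    and nondeg: "\<And>c. c \<in> M \<Longrightarrow> nondegenerate_on (chart_img c) (comp2 M g c)"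
begin

lemma comp2_change:
  assumes c: "c \<in> M" and d: "d \<in> M" and z: "z \<in> snd c ` (fst c \<inter> fst d)"
  shows "comp2 M g c z v w = comp2 M g d ((snd d \<circ> chart_inv c) z)
    (frechet_derivative (snd d \<circ> chart_inv c) (at z) v) (frechet_derivative (snd d \<circ> chart_inv c)
        (at z) w)"
proof -
  obtain p where p: "p \<in> fst c" "p \<in> fst d" "z = snd c p" using z by auto
  have [simp]: "chart_inv c (snd c p) = p" "chart_inv d (snd d p) = p"
    using chart_inv_simps(1)[OF M c p(1)] chart_inv_simps(1)[OF M d p(2)] by auto
  show ?thesis unfolding comp2_def p(3) by (simp add: chart_vec_change[OF M c p(1) d p(2)])
qed

text \<open>Through the Euler-Lagrange form this is an instance of \<open>EL_pullback\<close> for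
  the transition map, which replaces the transformation law of the Christoffel symbols.\<close>

lemma chart_geodesic_change:
  assumes c: "c \<in> M" and d: "d \<in> M" and T: "open T" "\<gamma> ` T \<subseteq> fst c \<inter> fst d"
    and x: "chart_geodesic (chart_img c) (comp2 M g c) T (snd c \<circ> \<gamma>)"
  shows "chart_geodesic (chart_img d) (comp2 M g d) T (snd d \<circ> \<gamma>)"
proof -
  define A where "A = snd c ` (fst c \<inter> fst d)"
  define \<tau> where "\<tau> = snd d \<circ> chart_inv c"
  define D where "D z = frechet_derivative \<tau> (at z)" for z
  define x where "x = snd c \<circ> \<gamma>"
  define x' where "x' t = vector_derivative x (at t)" for t
  define x'' where "x'' t = vector_derivative x' (at t)" for t
  have A: "open A" "smooth_on A \<tau>" unfolding A_def \<tau>_def using smooth_atlasD(3,4)[OF M c d] by auto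
  have xA: "x t \<in> A" if "t \<in> T" for t unfolding x_def A_def using T that by auto
  have sx: "smooth_on T x" using assms(5) unfolding x_def chart_geodesic_def by simp
  have x1: "(x has_vector_derivative x' t) (at t)" and x2: "(x' has_vector_derivative x'' t) (at t)"
      if "t \<in> T" for t
    unfolding x''_def x'_def
    using smooth_on_real_derivatives(1)[OF T(1) sx that] smooth_on_real_derivatives(1)[OF T(1)
        smooth_on_real_derivatives(2)[OF T(1) sx] that] by auto
  have yx: "\<tau> (x t) = (snd d \<circ> \<gamma>) t" if "t \<in> T" for t
    using T(2) that chart_inv_simps(1)[OF M c] unfolding \<tau>_def x_def by auto
  have sy: "smooth_on T (\<lambda>t. \<tau> (x t))" by (rule smooth_on_compose[OF T(1) A sx]) (use xA in auto)
  have dD: "(\<tau> has_derivative D z) (at z)" if "z \<in> A" for z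
    unfolding D_def by (rule smooth_on_has_derivative[OF A(2) that])
  have lD: "lin_field A D" unfolding lin_field_def
    using A dD has_derivative_linear smooth_on_derivative[OF A(2)] by (auto simp: D_def)
  have y1: "((\<lambda>t. \<tau> (x t)) has_vector_derivative D (x t) (x' t)) (at t)" if t: "t \<in> T" for t
    unfolding has_vector_derivative_def
    using has_derivative_compose[OF x1[OF t, unfolded has_vector_derivative_def] dD[OF xA[OF t]]]
    by (simp add: linear_cmul[OF has_derivative_linear[OF dD[OF xA[OF t]]]])
  define a where "a t = frechet_derivative (\<lambda>z. D z (x' t)) (at (x t)) (x' t) + D (x t) (x'' t)"
      for t
  have y2: "((\<lambda>t. D (x t) (x' t)) has_vector_derivative a t) (at t)" if t: "t \<in> T" for t
  proof -
    have l1: "linear (frechet_derivative (\<lambda>z. D z (x' t)) (at (x t)))"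
      by (rule has_derivative_linear[OF lin_field_has_derivative[OF lD xA[OF t]]])
    show ?thesis unfolding has_vector_derivative_def a_def
      using lin_field_apply_has_derivative[where L=D, OF lD xA[OF t] x1[OF t, unfolded
          has_vector_derivative_def] x2[OF t, unfolded has_vector_derivative_def]]
      by (simp add: linear_cmul[OF l1] linear_cmul[OF lin_fieldD(2)[OF lD xA[OF t]]]
          scaleR_add_right)
  qed
  have v1: "vector_derivative (\<lambda>t. \<tau> (x t)) (at t) = D (x t) (x' t)" if "t \<in> T" for t
    by (rule vector_derivative_at[OF y1[OF that]])
  have v2: "vector_derivative (\<lambda>s. vector_derivative (\<lambda>t. \<tau> (x t)) (at s)) (at t) = a t"
      if t: "t \<in> T" for t
    by (rule vector_derivative_at[OF has_vector_derivative_transform_within_open[OF y2[OF t] T(1)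
        t]]) (simp add: v1)
  have "chart_geodesic (chart_img d) (comp2 M g d) T (\<lambda>t. \<tau> (x t))" unfolding chart_geodesic_def
  proof (intro conjI ballI sy)
    fix t assume t: "t \<in> T"
    show \<tau>d: "\<tau> (x t) \<in> chart_img d" unfolding yx[OF t] using T(2) t by auto
    have xc: "x t \<in> chart_img c" using xA[OF t] unfolding A_def by auto
    have "x'' t + chr (comp2 M g c) (x t) (x' t) (x' t) = 0"
      using assms(5) t unfolding chart_geodesic_def x_def[symmetric] x'_def x''_def by simp
    then have el: "EL (comp2 M g c) (x t) (x' t) (x'' t) y = 0" for y
      using geodesic_eq_EL[OF metric[OF c] nondeg[OF c] xc] by blast
    \<comment> \<open>Pullback yields the equation in the new chart only for test vectors in the
      range of the differential of the transition map. That range is everything, because the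
      opposite transition provides a right inverse.\<close>
    have "\<exists>y. D (x t) y = e" for e
    proof -
      define p where "p = \<gamma> t"
      have p: "p \<in> fst c" "p \<in> fst d" unfolding p_def using T t by auto
      define \<sigma> where "\<sigma> = snd c \<circ> chart_inv d"
      define E where "E = snd d ` (fst d \<inter> fst c)"
      have E: "open E" "smooth_on E \<sigma>" unfolding E_def \<sigma>_def using smooth_atlasD(3,4)[OF M d c]
          by auto
      have pE: "snd d p \<in> E" unfolding E_def using p by auto
      have d\<sigma>: "(\<sigma> has_derivative frechet_derivative \<sigma> (at (snd d p))) (at (snd d p))"
          by (rule smooth_on_has_derivative[OF E(2) pE])
      have xt: "\<sigma> (snd d p) = x t" unfolding \<sigma>_def x_def using chart_inv_simps(1)[OF M d p(2)] p_def
          by simp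
      have "((\<lambda>z. \<tau> (\<sigma> z)) has_derivative (\<lambda>v. D (x t) (frechet_derivative \<sigma> (at (snd d p)) v))) (at
          (snd d p))"
        using has_derivative_compose[OF d\<sigma> dD[of "\<sigma> (snd d p)"]] xA[OF t] xt by simp
      moreover have "((\<lambda>z. \<tau> (\<sigma> z)) has_derivative (\<lambda>v. v)) (at (snd d p))"
        by (rule has_derivative_transform_within_open[OF has_derivative_ident E(1) pE])
          (use chart_inv_simps(1)[OF M d] chart_inv_simps(1)[OF M c] in \<open>auto simp: E_def \<sigma>_def
              \<tau>_def\<close>)
      ultimately have "D (x t) (frechet_derivative \<sigma> (at (snd d p)) e) = e"
        using has_derivative_unique by metis
      then show ?thesis by blast
    qed
    moreover have "EL (comp2 M g c) (x t) (x' t) (x'' t) y = EL (comp2 M g d) (\<tau> (x t)) (D (x t) (x'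
        t)) (a t) (D (x t) y)" for y
      unfolding a_def D_def
      by (rule EL_pullback[OF A(1) xA[OF t] A(2) _ metric[OF d]])
        (use comp2_change[OF c d] chart_inv_simps[OF M c] in \<open>auto simp: A_def \<tau>_def\<close>)
    ultimately have "EL (comp2 M g d) (\<tau> (x t)) (D (x t) (x' t)) (a t) y = 0" for y using el
        by metis
    then show "vector_derivative (\<lambda>s. vector_derivative (\<lambda>t. \<tau> (x t)) (at s)) (at t) +
         chr (comp2 M g d) (\<tau> (x t)) (vector_derivative (\<lambda>t. \<tau> (x t)) (at t)) (vector_derivative
             (\<lambda>t. \<tau> (x t)) (at t)) = 0"
      unfolding v1[OF t] v2[OF t] using geodesic_eq_EL[OF metric[OF d] nondeg[OF d] \<tau>d] by blast
  qed
  then show ?thesis by (rule chart_geodesic_cong[OF T(1)]) (rule yx)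
qed

lemma geodesic_on_smooth: "geodesic_on M g J \<gamma> \<Longrightarrow> smooth_map (restrict_atlas euclidean_atlas J) M \<gamma>"
  unfolding geodesic_on_def by simp

lemma geodesic_onD:
  assumes J: "open J" and \<gamma>: "geodesic_on M g J \<gamma>" and c: "c \<in> M"
  shows "open (J \<inter> \<gamma> -` fst c)" "chart_geodesic (chart_img c) (comp2 M g c) (J \<inter> \<gamma> -` fst c) (snd c
      \<circ> \<gamma>)"
proof -
  note s = curve_smoothD[OF J geodesic_on_smooth[OF \<gamma>] c]
  show "open (J \<inter> \<gamma> -` fst c)" by (rule s)
  show "chart_geodesic (chart_img c) (comp2 M g c) (J \<inter> \<gamma> -` fst c) (snd c \<circ> \<gamma>)"
    unfolding chart_geodesic_def
  proof (intro conjI ballI s)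
    fix t assume t: "t \<in> J \<inter> \<gamma> -` fst c"
    then show "(snd c \<circ> \<gamma>) t \<in> chart_img c" by auto
    show "vector_derivative (\<lambda>s. vector_derivative (snd c \<circ> \<gamma>) (at s)) (at t) +
         chr (comp2 M g c) ((snd c \<circ> \<gamma>) t) (vector_derivative (snd c \<circ> \<gamma>) (at t)) (vector_derivative
             (snd c \<circ> \<gamma>) (at t)) = 0"
      using \<gamma> c t unfolding geodesic_on_def christoffel_chr Let_def by auto
  qed
qed

text \<open>\<open>geodesic_on\<close> demands the equation in every chart that meets the curve; by
  invariance one chart around each time is enough.\<close>

lemma geodesic_onI:
  assumes J: "open J"
    and loc: "\<And>t. t \<in> J \<Longrightarrow> \<exists>c\<in>M. \<exists>T. open T \<and> t \<in> T \<and> T \<subseteq> J \<and> \<gamma> ` T \<subseteq> fst c \<and>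
       chart_geodesic (chart_img c) (comp2 M g c) T (snd c \<circ> \<gamma>)"
  shows "geodesic_on M g J \<gamma>"
proof -
  have s: "smooth_map (restrict_atlas euclidean_atlas J) M \<gamma>"
  proof (rule curve_smoothI[OF J M])
    fix t assume "t \<in> J" from loc[OF this]
    show "\<exists>c\<in>M. \<exists>T. open T \<and> t \<in> T \<and> T \<subseteq> J \<and> \<gamma> ` T \<subseteq> fst c \<and> smooth_on T (snd c \<circ> \<gamma>)"
      unfolding chart_geodesic_def by blast
  qed
  show ?thesis unfolding geodesic_on_def Let_def christoffel_chr
  proof (intro conjI ballI impI s)
    fix d t assume d: "d \<in> M" and t: "t \<in> J" "\<gamma> t \<in> fst d"
    obtain c T where c: "c \<in> M" and T: "open T" "t \<in> T" "T \<subseteq> J" "\<gamma> ` T \<subseteq> fst c"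
      and x: "chart_geodesic (chart_img c) (comp2 M g c) T (snd c \<circ> \<gamma>)" using loc[OF t(1)] by blast
    define S where "S = T \<inter> (J \<inter> \<gamma> -` fst d)"
    have S: "open S" unfolding S_def using T(1) curve_smoothD(1)[OF J s d] by (rule open_Int)
    have "chart_geodesic (chart_img d) (comp2 M g d) S (snd d \<circ> \<gamma>)"
      by (rule chart_geodesic_change[OF c d S _ chart_geodesic_subset[OF x]]) (use T in \<open>auto simp:
          S_def\<close>)
    then show "vector_derivative (\<lambda>s. vector_derivative (snd d \<circ> \<gamma>) (at s)) (at t) +
         chr (comp2 M g d) ((snd d \<circ> \<gamma>) t) (vector_derivative (snd d \<circ> \<gamma>) (at t)) (vector_derivative
             (snd d \<circ> \<gamma>) (at t)) = 0"
      unfolding chart_geodesic_def using t T unfolding S_def by auto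
  qed
qed

lemma geodesic_on_local:
  assumes J: "open J" and loc: "\<And>t. t \<in> J \<Longrightarrow> \<exists>J' \<gamma>'. open J' \<and> t \<in> J' \<and> J' \<subseteq> J
      \<and> geodesic_on M g J' \<gamma>' \<and> (\<forall>s\<in>J'. \<gamma>' s = \<gamma> s)"
  shows "geodesic_on M g J \<gamma>"
proof (rule geodesic_onI[OF J])
  fix t assume "t \<in> J"
  from loc[OF this] obtain J' \<gamma>' where J': "open J'" "t \<in> J'" "J' \<subseteq> J"
      and \<gamma>': "geodesic_on M g J' \<gamma>'" "\<And>s. s \<in> J' \<Longrightarrow> \<gamma>' s = \<gamma> s" by blast
  have "\<gamma>' t \<in> carrier M" using smooth_map_carrier[OF geodesic_on_smooth[OF \<gamma>'(1)]] J'(2)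
      by (simp add: carrier_real_atlas)
  then obtain c where c: "c \<in> M" "\<gamma>' t \<in> fst c" unfolding carrier_def by auto
  note d = geodesic_onD[OF J'(1) \<gamma>'(1) c(1)]
  show "\<exists>c\<in>M. \<exists>T. open T \<and> t \<in> T \<and> T \<subseteq> J \<and> \<gamma> ` T \<subseteq> fst c \<and> chart_geodesic (chart_img c) (comp2 M g
      c) T (snd c \<circ> \<gamma>)"
  proof (intro bexI[of _ c] exI[of _ "J' \<inter> \<gamma>' -` fst c"] conjI c(1) d(1))
    show "chart_geodesic (chart_img c) (comp2 M g c) (J' \<inter> \<gamma>' -` fst c) (snd c \<circ> \<gamma>)"
      by (rule chart_geodesic_cong[OF d]) (use \<gamma>'(2) in auto)
  qed (use J' c \<gamma>'(2) in auto)
qed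

lemma geodesic_on_subset: "geodesic_on M g J \<gamma> \<Longrightarrow> open J \<Longrightarrow> open S \<Longrightarrow> S \<subseteq> J \<Longrightarrow> geodesic_on M g S \<gamma>"
proof (rule geodesic_onI, assumption)
  fix t assume \<gamma>: "geodesic_on M g J \<gamma>" and J: "open J" and S: "open S" "S \<subseteq> J" and t: "t \<in> S"
  have "\<gamma> t \<in> carrier M" using smooth_map_carrier[OF geodesic_on_smooth[OF \<gamma>]] S t
      by (auto simp: carrier_real_atlas)
  then obtain c where c: "c \<in> M" "\<gamma> t \<in> fst c" unfolding carrier_def by auto
  note d = geodesic_onD[OF J \<gamma> c(1)]
  show "\<exists>c\<in>M. \<exists>T. open T \<and> t \<in> T \<and> T \<subseteq> S \<and> \<gamma> ` T \<subseteq> fst c \<and> chart_geodesic (chart_img c) (comp2 M g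
      c) T (snd c \<circ> \<gamma>)"
    by (intro bexI[of _ c] exI[of _ "S \<inter> (J \<inter> \<gamma> -` fst c)"] conjI c(1) open_Int S(1) d(1)
        chart_geodesic_subset[OF d(2)]) (use t c S in auto)
qed

lemma geodesic_on_reverse:
  assumes J: "open J" and \<gamma>: "geodesic_on M g J \<gamma>"
  shows "geodesic_on M g (uminus ` J) (\<lambda>t. \<gamma> (- t))"
proof (rule geodesic_onI)
  show "open (uminus ` J)" using open_negations[OF J] by (simp add: image_def)
  fix t assume t: "t \<in> uminus ` J"
  have "\<gamma> (- t) \<in> carrier M" using smooth_map_carrier[OF geodesic_on_smooth[OF \<gamma>]] t
      by (auto simp: carrier_real_atlas)
  then obtain c where c: "c \<in> M" "\<gamma> (- t) \<in> fst c" unfolding carrier_def by auto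
  note d = geodesic_onD[OF J \<gamma> c(1)]
  have "chart_geodesic (chart_img c) (comp2 M g c) (uminus ` (J \<inter> \<gamma> -` fst c)) (snd c \<circ> (\<lambda>t. \<gamma> (-
      t)))"
    using chart_geodesic_reverse[OF d(1) metric[OF c(1)] nondeg[OF c(1)] d(2)] by (simp add: o_def)
  moreover have "open (uminus ` (J \<inter> \<gamma> -` fst c))" using open_negations[OF d(1)]
      by (simp add: image_def)
  ultimately show "\<exists>c\<in>M. \<exists>T. open T \<and> t \<in> T \<and> T \<subseteq> uminus ` J \<and> (\<lambda>t. \<gamma> (- t)) ` T \<subseteq> fst c \<and>
       chart_geodesic (chart_img c) (comp2 M g c) T (snd c \<circ> (\<lambda>t. \<gamma> (- t)))"
    using c t by (intro bexI[of _ c] exI[of _ "uminus ` (J \<inter> \<gamma> -` fst c)"]) auto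
qed

end

section \<open>Extension of geodesics\<close>

context metric_manifold
begin

text \<open>The chart need only contain the tail of the curve after \<open>a\<close>; the extension
  found there is glued to the earlier part, with which it agrees on the overlap.\<close>

lemma geodesic_extend_chart:
  assumes ab: "a0 \<le> a" "a < b" and \<gamma>: "geodesic_on M g {a0<..<b} \<gamma>" and c: "c \<in> M"
    and C: "compact C" "C \<subseteq> chart_img c"
    and inC: "\<And>t. t \<in> {a<..<b} \<Longrightarrow> \<gamma> t \<in> fst c \<and> snd c (\<gamma> t) \<in> C"
    and B: "\<And>t. t \<in> {a<..<b} \<Longrightarrow> norm (vector_derivative (snd c \<circ> \<gamma>) (at t)) \<le> B"
  shows "\<exists>\<epsilon>>0. \<exists>\<gamma>'. geodesic_on M g {a0<..<b+\<epsilon>} \<gamma>' \<and> (\<forall>t\<in>{a0<..<b}. \<gamma>' t = \<gamma> t)"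
proof -
  have "{a<..<b} \<subseteq> {a0<..<b} \<inter> \<gamma> -` fst c" using inC ab by auto
  then have cg: "chart_geodesic (chart_img c) (comp2 M g c) {a<..<b} (snd c \<circ> \<gamma>)"
    using geodesic_onD(2)[OF _ \<gamma> c] chart_geodesic_subset by (metis open_greaterThanLessThan)
  have "(snd c \<circ> \<gamma>) t \<in> C" if "t \<in> {a<..<b}" for t using inC[OF that] by simp
  from chart_geodesic_extend[OF metric[OF c] nondeg[OF c] C ab(2) cg this B]
  obtain \<epsilon> w where \<epsilon>: "\<epsilon> > 0" and w: "\<And>t. t \<in> {a<..<b} \<Longrightarrow> w t = (snd c \<circ> \<gamma>) t"
    "chart_geodesic (chart_img c) (comp2 M g c) {a<..<b+\<epsilon>} w"
    by blast
  define \<gamma>' where "\<gamma>' t = (if t < b then \<gamma> t else chart_inv c (w t))" for t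
  have wc: "w t \<in> chart_img c" if "t \<in> {a<..<b+\<epsilon>}" for t using w(2) that
      unfolding chart_geodesic_def by blast
  have \<gamma>'w: "\<gamma>' t \<in> fst c" "snd c (\<gamma>' t) = w t" if "t \<in> {a<..<b+\<epsilon>}" for t
    using that inC[of t] w(1)[of t] wc[OF that] chart_inv_simps[OF M c] unfolding \<gamma>'_def by auto
  have 1: "geodesic_on M g {a<..<b+\<epsilon>} \<gamma>'"
  proof (rule geodesic_onI)
    fix t assume t: "t \<in> {a<..<b+\<epsilon>}"
    have "chart_geodesic (chart_img c) (comp2 M g c) {a<..<b+\<epsilon>} (snd c \<circ> \<gamma>')"
      by (rule chart_geodesic_cong[OF _ w(2)]) (use \<gamma>'w in auto)
    then show "\<exists>c\<in>M. \<exists>T. open T \<and> t \<in> T \<and> T \<subseteq> {a<..<b+\<epsilon>} \<and> \<gamma>' ` T \<subseteq> fst c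
        \<and> chart_geodesic (chart_img c) (comp2 M g c) T (snd c \<circ> \<gamma>')"
      using c t \<gamma>'w by (intro bexI[of _ c] exI[of _ "{a<..<b+\<epsilon>}"]) auto
  qed simp
  have "geodesic_on M g {a0<..<b+\<epsilon>} \<gamma>'"
  proof (rule geodesic_on_local)
    fix t assume t: "t \<in> {a0<..<b+\<epsilon>}"
    show "\<exists>J' \<gamma>''. open J' \<and> t \<in> J' \<and> J' \<subseteq> {a0<..<b+\<epsilon>} \<and> geodesic_on M g J' \<gamma>'' \<and> (\<forall>s\<in>J'. \<gamma>'' s
        = \<gamma>' s)"
    proof (cases "t < b")
      case True
      then show ?thesis using \<gamma> t \<epsilon> by (intro exI[of _ "{a0<..<b}"] exI[of _ \<gamma>]) (auto simp: \<gamma>'_def)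
    next
      case False
      then show ?thesis using 1 t ab by (intro exI[of _ "{a<..<b+\<epsilon>}"] exI[of _ \<gamma>']) auto
    qed
  qed simp
  then show ?thesis using \<epsilon> by (intro exI[of _ \<epsilon>] conjI exI[of _ \<gamma>']) (auto simp: \<gamma>'_def)
qed

text \<open>The Hausdorff property excludes that the curve jumps to another point with the same limit in
  the chart.\<close>

lemma curve_stays_in_chart:
  assumes H: "Hausdorff_space (mtop M)" and \<gamma>: "smooth_map (restrict_atlas euclidean_atlas {a<..<b})
      M \<gamma>"
    and c: "c \<in> M" and r: "r > 0" "cball x0 r \<subseteq> chart_img c" and B0: "B \<ge> 0"
    and B: "\<And>t. t \<in> {a<..<b} \<Longrightarrow> \<gamma> t \<in> fst c \<Longrightarrow> snd c (\<gamma> t) \<in> cball x0 r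
        \<Longrightarrow> norm (vector_derivative (snd c \<circ> \<gamma>) (at t)) \<le> B"
    and s: "\<And>e. e > 0 \<Longrightarrow> \<exists>t. t \<in> {a<..<b} \<and> b - t < e \<and> \<gamma> t \<in> fst c \<and> dist (snd c (\<gamma> t)) x0 < e"
  shows "\<exists>a'. a \<le> a' \<and> a' < b \<and> (\<forall>t\<in>{a'<..<b}. \<gamma> t \<in> fst c \<and> snd c (\<gamma> t) \<in> cball x0 r)"
proof -
  \<comment> \<open>The curve enters within \<open>r / 4\<close> of \<open>x0\<close> with less than
    \<open>e\<close> of time left, and at speed at most \<open>B\<close> it travels at most another
    \<open>r / 4\<close>. It therefore stays within \<open>r / 2\<close>, well inside the ball on
    which the speed bound holds.\<close>
  define e where "e = min (r / 4) (r / (4 * (B + 1)))"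
  have e: "e > 0" "e \<le> r / 4" "B * e \<le> r / 4"
  proof -
    show "e > 0" unfolding e_def using r B0 by auto
    show "e \<le> r / 4" unfolding e_def by (rule min.cobounded1)
    have "B * e \<le> B * (r / (4 * (B + 1)))" unfolding e_def using B0 by (intro mult_left_mono) auto
    also have "\<dots> \<le> r / 4" using B0 r by (simp add: field_simps)
    finally show "B * e \<le> r / 4" .
  qed
  obtain t0 where t0: "t0 \<in> {a<..<b}" "b - t0 < e" "\<gamma> t0 \<in> fst c" "dist (snd c (\<gamma> t0)) x0 < e"
      using s[OF e(1)] by blast
  define U where "U = chart_inv c ` ball x0 r"
  define K where "K = chart_inv c ` cball x0 (r/2)"
  have sub: "ball x0 r \<subseteq> chart_img c" "cball x0 (r/2) \<subseteq> chart_img c" using r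
      by (auto intro: subset_trans[OF _ r(2)] simp: subset_iff)
  have oU: "open {t \<in> {a<..<b}. \<gamma> t \<in> U}"
    unfolding U_def by (rule curve_open_preimage[OF M _ \<gamma> chart_inv_image_open[OF M c _ sub(1)]])
        auto
  have oK: "open {t \<in> {a<..<b}. \<gamma> t \<in> carrier M - K}"
    unfolding K_def by (rule curve_open_preimage[OF M _ \<gamma> chart_inv_image_closed[OF M H c _
        sub(2)]]) auto
  have U_iff: "\<gamma> t \<in> U \<longleftrightarrow> \<gamma> t \<in> fst c \<and> dist (snd c (\<gamma> t)) x0 < r" for t
    unfolding U_def using sub(1) chart_inv_simps[OF M c] by (force simp: dist_commute image_iff)
  have K_iff: "\<gamma> t \<in> K \<longleftrightarrow> \<gamma> t \<in> fst c \<and> dist (snd c (\<gamma> t)) x0 \<le> r/2" for t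
    unfolding K_def using sub(2) chart_inv_simps[OF M c] by (force simp: dist_commute image_iff)
  have KU: "\<gamma> t \<in> K \<Longrightarrow> \<gamma> t \<in> U" for t unfolding K_iff U_iff using r by auto
  have carr: "\<gamma> t \<in> carrier M" if "t \<in> {a<..<b}" for t
    using smooth_map_carrier[OF \<gamma>] that by (simp add: carrier_real_atlas)
  have all: "\<gamma> t \<in> U" if t: "t \<in> {t0..<b}" for t
  proof (rule ccontr)
    assume "\<gamma> t \<notin> U"
    \<comment> \<open>The times at which the curve is outside the coordinate ball; the infimum
      \<open>t1\<close> would be the first exit.\<close>
    define Bd where "Bd = {s. t0 \<le> s \<and> s \<le> t \<and> \<gamma> s \<notin> U}"
    define t1 where "t1 = Inf Bd"
    have tBd: "t \<in> Bd" unfolding Bd_def using t \<open>\<gamma> t \<notin> U\<close> by auto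
    have bdd: "bdd_below Bd" unfolding Bd_def by (rule bdd_belowI[of _ t0]) auto
    have "Bd = {t0..t} - {t \<in> {a<..<b}. \<gamma> t \<in> U}" unfolding Bd_def using t0(1) t by auto
    then have "closed Bd" using oU by (simp add: closed_Diff)
    then have t1: "t1 \<in> Bd" unfolding t1_def using closed_contains_Inf[OF _ bdd] tBd by blast
    have "\<gamma> t0 \<in> U" unfolding U_iff using t0 e by auto
    then have t01: "t0 < t1" using t1 unfolding Bd_def by (cases "t0 = t1") auto
    have before: "\<gamma> s \<in> U" if "t0 \<le> s" "s < t1" for s
    proof (rule ccontr)
      assume "\<gamma> s \<notin> U"
      then have "s \<in> Bd" using that t1 unfolding Bd_def by auto
      then show False using cInf_lower[OF _ bdd, of s] that unfolding t1_def by auto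
    qed
    have inJ: "s \<in> {a<..<b}" if "t0 \<le> s" "s \<le> t1" for s using that t0(1) t t1 unfolding Bd_def
        by auto
    note sm = curve_smoothD[OF _ \<gamma> c]
    have "\<gamma> s \<in> K" if s: "t0 \<le> s" "s < t1" for s
    proof -
      define x where "x = snd c \<circ> \<gamma>"
      have "norm (x s - x t0) \<le> B * norm (s - t0)"
      proof (rule differentiable_bound[of "{t0..s}" x "\<lambda>r h. h *\<^sub>R vector_derivative x (at r)"])
        fix q assume q: "q \<in> {t0..s}"
        then have qU: "\<gamma> q \<in> U" and qJ: "q \<in> {a<..<b}" using before s inJ by auto
        then have "q \<in> {a<..<b} \<inter> \<gamma> -` fst c" unfolding U_iff by auto
        then have "(x has_vector_derivative vector_derivative x (at q)) (at q)"
          unfolding x_def by (rule smooth_on_real_derivatives(1)[OF sm[OF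
              open_greaterThanLessThan]])
        then show "(x has_derivative (\<lambda>h. h *\<^sub>R vector_derivative x (at q))) (at q within {t0..s})"
          unfolding has_vector_derivative_def by (rule has_derivative_at_withinI)
        show "onorm (\<lambda>h. h *\<^sub>R vector_derivative x (at q)) \<le> B"
        proof (rule onorm_le)
          fix h :: real
          have "norm (vector_derivative x (at q)) \<le> B"
            unfolding x_def by (rule B[OF qJ]) (use qU in \<open>auto simp: U_iff dist_commute\<close>)
          then show "norm (h *\<^sub>R vector_derivative x (at q)) \<le> B * norm h"
              by (simp add: mult.commute[of B] mult_left_mono)
        qed
      qed (use s in auto)
      also have "\<dots> \<le> B * e" using B0 s t0(2) t t1 unfolding Bd_def by (intro mult_left_mono) auto
      finally have "dist (x s) (x t0) \<le> r / 4" using e by (simp add: dist_norm)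
      then have "dist (x s) x0 \<le> r / 2" using dist_triangle[of "x s" x0 "x t0"] t0(4) e(2)
          unfolding x_def by auto
      then show ?thesis unfolding K_iff using before[OF s] unfolding U_iff x_def by auto
    qed
    \<comment> \<open>Up to \<open>t1\<close> the curve is in \<open>K\<close>, which is closed in
      the manifold, so \<open>\<gamma> t1\<close> is in \<open>K\<close> as well and hence in
      \<open>U\<close>, contradicting the exit.\<close>
    moreover have "\<gamma> t1 \<in> K"
    proof (rule ccontr)
      assume "\<gamma> t1 \<notin> K"
      then have "t1 \<in> {t \<in> {a<..<b}. \<gamma> t \<in> carrier M - K}" using inJ[of t1] carr t01 by auto
      then obtain d where d: "d > 0" "ball t1 d \<subseteq> {t \<in> {a<..<b}. \<gamma> t \<in> carrier M - K}"
        using oK open_contains_ball by blast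
      define s where "s = max t0 (t1 - d / 2)"
      have "s \<in> ball t1 d" "t0 \<le> s" "s < t1" unfolding s_def using d t01
          by (auto simp: dist_real_def max_def)
      then show False using d(2) \<open>\<And>s. t0 \<le> s \<Longrightarrow> s < t1 \<Longrightarrow> \<gamma> s \<in> K\<close> by blast
    qed
    then show False using KU t1 unfolding Bd_def by auto
  qed
  show ?thesis
    by (intro exI[of _ t0]) (use t0 all in \<open>auto simp: U_iff dist_commute intro: less_imp_le\<close>)
qed

lemma geodesic_extend_at_accumulation:
  assumes H: "Hausdorff_space (mtop M)" and \<gamma>: "geodesic_on M g {a<..<b} \<gamma>"
    and c: "c \<in> M" and r: "r > 0" "cball x0 r \<subseteq> chart_img c" and B0: "B \<ge> 0" and a1: "a
        \<le> a1" "a1 < b"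
    and B: "\<And>t. t \<in> {a1<..<b} \<Longrightarrow> \<gamma> t \<in> fst c \<Longrightarrow> snd c (\<gamma> t) \<in> cball x0 r
        \<Longrightarrow> norm (vector_derivative (snd c \<circ> \<gamma>) (at t)) \<le> B"
    and s: "\<And>e. e > 0 \<Longrightarrow> \<exists>t. t \<in> {a1<..<b} \<and> b - t < e \<and> \<gamma> t \<in> fst c \<and> dist (snd c (\<gamma> t)) x0 < e"
  shows "\<exists>\<epsilon>>0. \<exists>\<gamma>'. geodesic_on M g {a<..<b+\<epsilon>} \<gamma>' \<and> (\<forall>t\<in>{a<..<b}. \<gamma>' t = \<gamma> t)"
proof -
  have "geodesic_on M g {a1<..<b} \<gamma>" by (rule geodesic_on_subset[OF \<gamma>]) (use a1 in auto)
  from curve_stays_in_chart[OF H geodesic_on_smooth[OF this] c r B0 B s]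
  obtain a' where a': "a1 \<le> a'" "a' < b" "\<And>t. t \<in> {a'<..<b} \<Longrightarrow> \<gamma> t \<in> fst c
      \<and> snd c (\<gamma> t) \<in> cball x0 r" by blast
  show ?thesis
    by (rule geodesic_extend_chart[OF _ a'(2) \<gamma> c compact_cball r(2) a'(3), of B]) (use a' a1 B in
        auto)
qed

text \<open>Zorn's lemma on graphs of extensions avoids any appeal to the uniqueness of geodesics.\<close>

lemma completeI:
  assumes ext: "\<And>a b \<gamma>. a < b \<Longrightarrow> geodesic_on M g {a<..<b} \<gamma> \<Longrightarrow>
     \<exists>\<epsilon>>0. \<exists>\<gamma>'. geodesic_on M g {a<..<b+\<epsilon>} \<gamma>' \<and> (\<forall>t\<in>{a<..<b}. \<gamma>' t = \<gamma> t)"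
  shows "geodesically_complete M g"
  unfolding geodesically_complete_def
proof (intro allI impI)
  fix J :: "real set" and \<gamma> assume J: "open J" "is_interval J" "J \<noteq> {}" and \<gamma>: "geodesic_on M g J \<gamma>"
  have ext_up: "\<exists>J' \<gamma>'. open J' \<and> is_interval J' \<and> J \<subset> J' \<and> geodesic_on M g J' \<gamma>' \<and> (\<forall>t\<in>J. \<gamma>' t
      = \<gamma> t)"
    if J: "open J" "is_interval J" "J \<noteq> {}" and \<gamma>: "geodesic_on M g J \<gamma>" and bdd: "bdd_above J"
        for J \<gamma>
  proof -
    define b where "b = Sup J"
    \<comment> \<open>\<open>J\<close> may be unbounded to the left while \<open>ext\<close>
      concerns bounded intervals, so only the part beyond a point of \<open>J\<close> is extended
      and then glued to the whole.\<close>
    obtain a where a: "a \<in> J" using J by auto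
    have le: "t < b" if tJ: "t \<in> J" for t
    proof -
      obtain d where d: "d > 0" "ball t d \<subseteq> J" using J(1) tJ by (meson open_contains_ball)
      then have "t + d / 2 \<in> J" by (auto simp: dist_real_def)
      then have "t + d / 2 \<le> b" unfolding b_def by (rule cSup_upper[OF _ bdd])
      then show ?thesis using d by linarith
    qed
    have sub: "{a<..<b} \<subseteq> J"
    proof
      fix t assume t: "t \<in> {a<..<b}"
      then obtain s where "s \<in> J" "t < s" unfolding b_def using less_cSup_iff[OF J(3) bdd] by auto
      then show "t \<in> J" using J(2) a t unfolding is_interval_1
          by (meson greaterThanLessThan_iff less_imp_le)
    qed
    have "geodesic_on M g {a<..<b} \<gamma>" by (rule geodesic_on_subset[OF \<gamma> J(1) _ sub]) simp
    from ext[OF le[OF a] this] obtain \<epsilon> \<gamma>' where \<epsilon>: "\<epsilon> > 0"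
        and \<gamma>': "geodesic_on M g {a<..<b+\<epsilon>} \<gamma>'" "\<And>t. t \<in> {a<..<b} \<Longrightarrow> \<gamma>' t = \<gamma> t"
      by blast
    define \<delta> where "\<delta> t = (if t \<in> J then \<gamma> t else \<gamma>' t)" for t
    have eq': "\<gamma>' t = \<delta> t" if "t \<in> {a<..<b+\<epsilon>}" for t unfolding \<delta>_def using \<gamma>'(2)[of t] le[of t] that
        by auto
    have "geodesic_on M g (J \<union> {a<..<b+\<epsilon>}) \<delta>"
    proof (rule geodesic_on_local)
      fix t assume "t \<in> J \<union> {a<..<b+\<epsilon>}"
      then show "\<exists>J' \<gamma>'. open J' \<and> t \<in> J' \<and> J' \<subseteq> J \<union> {a<..<b+\<epsilon>} \<and> geodesic_on M g J' \<gamma>'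
          \<and> (\<forall>s\<in>J'. \<gamma>' s = \<delta> s)"
      proof
        assume "t \<in> J"
        then show ?thesis using J \<gamma> by (intro exI[of _ J] exI[of _ \<gamma>]) (auto simp: \<delta>_def)
      next
        assume "t \<in> {a<..<b+\<epsilon>}"
        then show ?thesis using \<gamma>' eq' by (intro exI[of _ "{a<..<b+\<epsilon>}"] exI[of _ \<gamma>']) auto
      qed
    qed (use J in auto)
    moreover have "is_interval (J \<union> {a<..<b+\<epsilon>})"
    proof -
      have "(a + b) / 2 \<in> J \<inter> {a<..<b+\<epsilon>}" using sub le[OF a] \<epsilon> by auto
      then have "connected (J \<union> {a<..<b+\<epsilon>})"
        by (intro connected_Un) (use J(2) in \<open>auto simp: is_interval_connected_1\<close>)
      then show ?thesis by (simp add: is_interval_connected_1)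
    qed
    moreover have "b \<in> J \<union> {a<..<b+\<epsilon>}" "b \<notin> J" using \<epsilon> le[OF a] le[of b] by auto
    moreover have "open (J \<union> {a<..<b+\<epsilon>})" using J(1) by (intro open_Un) auto
    moreover have "\<forall>t\<in>J. \<delta> t = \<gamma> t" unfolding \<delta>_def by simp
    ultimately show ?thesis by (intro exI[of _ "J \<union> {a<..<b+\<epsilon>}"] exI[of _ \<delta>] conjI psubsetI) blast+
  qed
  have neg: "open (uminus ` J)" "is_interval (uminus ` J)" if "open J" "is_interval J"
      for J :: "real set"
  proof -
    show "open (uminus ` J)" using open_negations[OF that(1)] by (simp add: image_def)
    show "is_interval (uminus ` J)" using that(2) by simp
  qed
  \<comment> \<open>Time reversal turns this into \<open>ext_up\<close>.\<close>
  have ext_down: "\<exists>J' \<gamma>'. open J' \<and> is_interval J' \<and> J \<subset> J' \<and> geodesic_on M g J' \<gamma>' \<and> (\<forall>t\<in>J. \<gamma>' t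
      = \<gamma> t)"
    if J: "open J" "is_interval J" "J \<noteq> {}" and \<gamma>: "geodesic_on M g J \<gamma>" and bdd: "bdd_below J"
        for J \<gamma>
  proof -
    have "bdd_above (uminus ` J)" using bdd by (simp add: bdd_above_uminus)
    then obtain J' \<gamma>' where J': "open J'" "is_interval J'" "uminus ` J \<subset> J'" "geodesic_on M g J' \<gamma>'"
        "\<forall>t\<in>uminus ` J. \<gamma>' t = \<gamma> (- t)"
      using ext_up[OF neg[OF J(1,2)] _ geodesic_on_reverse[OF J(1) \<gamma>]] J(3) by auto
    have "J \<subseteq> uminus ` J'" using J'(3) by force
    moreover obtain s where "s \<in> J'" "s \<notin> uminus ` J" using J'(3) by blast
    then have "- s \<in> uminus ` J' \<and> - s \<notin> J" by force
    ultimately have "J \<subset> uminus ` J'" by blast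
    moreover have "\<forall>t\<in>J. \<gamma>' (- t) = \<gamma> t" using J'(5) by auto
    ultimately show ?thesis using neg[OF J'(1,2)] geodesic_on_reverse[OF J'(1,4)]
      by (intro exI[of _ "uminus ` J'"] exI[of _ "\<lambda>t. \<gamma>' (- t)"]) auto
  qed
  define P where "P J' \<gamma>' \<longleftrightarrow> open J' \<and> is_interval J' \<and> J \<subseteq> J' \<and> geodesic_on M g J' \<gamma>' \<and> (\<forall>t\<in>J. \<gamma>' t
      = \<gamma> t)" for J' \<gamma>'
  \<comment> \<open>Inclusion of graphs means a larger interval with the same values on the smaller
    one.\<close>
  define gr where "gr J' \<gamma>' = (\<lambda>t. (t, \<gamma>' t :: 'm)) ` J'" for J' :: "real set" and \<gamma>'
  define \<G> where "\<G> = {gr J' \<gamma>' |J' \<gamma>'. P J' \<gamma>'}"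
  have "\<exists>G\<in>\<G>. \<forall>X\<in>\<G>. G \<subseteq> X \<longrightarrow> X = G"
  proof (rule subset_Zorn_nonempty)
    show "\<G> \<noteq> {}" unfolding \<G>_def P_def using J \<gamma> by blast
  next
    fix C assume C: "C \<noteq> {}" "subset.chain \<G> C"
    define JC where "JC = fst ` \<Union>C"
    \<comment> \<open>Any two graphs in the chain are nested, so the choice has exactly one
      candidate at each time in \<open>JC\<close>; \<open>mem\<close> makes this precise.\<close>
    define \<gamma>C where "\<gamma>C t = (SOME y. (t, y) \<in> \<Union>C)" for t
    have mem: "\<exists>J' \<gamma>'. G = gr J' \<gamma>' \<and> P J' \<gamma>' \<and> J' \<subseteq> JC \<and> (\<forall>t\<in>J'. \<gamma>' t = \<gamma>C t)" if G: "G \<in> C" for G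
    proof -
      obtain J' \<gamma>' where J': "G = gr J' \<gamma>'" "P J' \<gamma>'" using C(2) G unfolding subset.chain_def \<G>_def
          by blast
      have "\<gamma>' t = \<gamma>C t" if "t \<in> J'" for t
      proof -
        have tG: "(t, \<gamma>' t) \<in> G" unfolding J' gr_def using that by auto
        then have "\<exists>y. (t, y) \<in> \<Union>C" using G by blast
        from someI_ex[OF this] have "(t, \<gamma>C t) \<in> \<Union>C" unfolding \<gamma>C_def .
        then obtain G2 where G2: "G2 \<in> C" "(t, \<gamma>C t) \<in> G2" by blast
        obtain J2 \<gamma>2 where J2: "G2 = gr J2 \<gamma>2" using C(2) G2(1) unfolding subset.chain_def \<G>_def
            by blast
        have "G \<subseteq> G2 \<or> G2 \<subseteq> G" using C(2) G G2(1) unfolding subset_chain_def by blast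
        then show ?thesis using tG G2(2) unfolding J' J2 gr_def by auto
      qed
      moreover have "J' \<subseteq> JC" unfolding JC_def using G unfolding J' gr_def by force
      ultimately show ?thesis using J' by blast
    qed
    have cov: "\<exists>G\<in>C. \<exists>J' \<gamma>'. G = gr J' \<gamma>' \<and> t \<in> J' \<and> P J' \<gamma>' \<and> J' \<subseteq> JC \<and> (\<forall>t\<in>J'. \<gamma>' t = \<gamma>C t)"
        if t: "t \<in> JC" for t
    proof -
      obtain G y where G: "G \<in> C" "(t, y) \<in> G" using t unfolding JC_def by auto
      from mem[OF G(1)] obtain J' \<gamma>' where J': "G = gr J' \<gamma>'" "P J' \<gamma>'" "J' \<subseteq> JC" "\<forall>t\<in>J'. \<gamma>' t
          = \<gamma>C t" by blast
      moreover have "t \<in> J'" using G(2) unfolding J'(1) gr_def by auto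
      ultimately show ?thesis using G(1) by blast
    qed
    define \<J> where "\<J> = {J'. \<exists>\<gamma>'. P J' \<gamma>' \<and> J' \<subseteq> JC \<and> (\<forall>t\<in>J'. \<gamma>' t = \<gamma>C t)}"
    have JC: "JC = \<Union>\<J>" unfolding \<J>_def using cov by blast
    obtain G where "G \<in> C" using C(1) by blast
    then have ne: "\<J> \<noteq> {}" unfolding \<J>_def using mem by blast
    have oJC: "open JC" unfolding JC by (intro open_Union) (auto simp: \<J>_def P_def)
    \<comment> \<open>The intervals all contain the nonempty \<open>J\<close>, hence their union is
      again an interval.\<close>
    have "connected JC" unfolding JC
    proof (rule connected_Union)
      show "\<And>s. s \<in> \<J> \<Longrightarrow> connected s" unfolding \<J>_def P_def by (auto simp: is_interval_connected_1)
      have "J \<subseteq> \<Inter>\<J>" unfolding \<J>_def P_def by blast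
      then show "\<Inter>\<J> \<noteq> {}" using J(3) by blast
    qed
    moreover have "J \<subseteq> JC" unfolding JC using ne unfolding \<J>_def P_def by blast
    moreover have "geodesic_on M g JC \<gamma>C"
    proof (rule geodesic_on_local[OF oJC])
      fix t assume "t \<in> JC"
      from cov[OF this] show "\<exists>J' \<gamma>'. open J' \<and> t \<in> J' \<and> J' \<subseteq> JC \<and> geodesic_on M g J' \<gamma>'
          \<and> (\<forall>s\<in>J'. \<gamma>' s = \<gamma>C s)"
        unfolding P_def by blast
    qed
    moreover have "\<forall>t\<in>J. \<gamma>C t = \<gamma> t"
    proof -
      obtain J1 \<gamma>1 where J1: "P J1 \<gamma>1" "\<forall>t\<in>J1. \<gamma>1 t = \<gamma>C t" using ne unfolding \<J>_def by blast
      show ?thesis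
      proof
        fix t assume t: "t \<in> J"
        then have "t \<in> J1" "\<gamma>1 t = \<gamma> t" using J1(1) unfolding P_def by auto
        then show "\<gamma>C t = \<gamma> t" using J1(2) by simp
      qed
    qed
    ultimately have P: "P JC \<gamma>C" unfolding P_def using oJC by (simp add: is_interval_connected_1)
    have "\<Union>C = gr JC \<gamma>C"
    proof
      show "\<Union>C \<subseteq> gr JC \<gamma>C"
      proof
        fix z assume "z \<in> \<Union>C"
        then obtain G where G: "G \<in> C" "z \<in> G" by blast
        from mem[OF G(1)] obtain J' \<gamma>' where "G = gr J' \<gamma>'" "J' \<subseteq> JC" "\<forall>t\<in>J'. \<gamma>' t = \<gamma>C t" by blast
        then show "z \<in> gr JC \<gamma>C" using G(2) unfolding gr_def by auto
      qed
      show "gr JC \<gamma>C \<subseteq> \<Union>C"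
      proof
        fix z assume "z \<in> gr JC \<gamma>C"
        then obtain t where t: "t \<in> JC" "z = (t, \<gamma>C t)" unfolding gr_def by auto
        from cov[OF t(1)] obtain G J' \<gamma>' where G: "G \<in> C" "G = gr J' \<gamma>'" "t \<in> J'" "\<forall>t\<in>J'. \<gamma>' t
            = \<gamma>C t" by blast
        have "z \<in> G" unfolding G(2) gr_def t(2) using G(3,4) by auto
        then show "z \<in> \<Union>C" using G(1) by blast
      qed
    qed
    then show "\<Union>C \<in> \<G>" unfolding \<G>_def using P by blast
  qed
  then obtain Gm where Gm: "Gm \<in> \<G>" and max0: "\<And>X. X \<in> \<G> \<Longrightarrow> Gm \<subseteq> X \<Longrightarrow> X = Gm" by blast
  from Gm obtain Jm \<gamma>m where Gmgr: "Gm = gr Jm \<gamma>m" and m: "P Jm \<gamma>m" unfolding \<G>_def by blast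
  note max = max0[unfolded Gmgr]
  have no: False if "\<exists>J' \<gamma>'. open J' \<and> is_interval J' \<and> Jm \<subset> J' \<and> geodesic_on M g J' \<gamma>'
      \<and> (\<forall>t\<in>Jm. \<gamma>' t = \<gamma>m t)"
  proof -
    from that obtain J' \<gamma>' where J': "open J'" "is_interval J'" "Jm \<subset> J'" "geodesic_on M g J' \<gamma>'"
        "\<forall>t\<in>Jm. \<gamma>' t = \<gamma>m t" by blast
    have "P J' \<gamma>'" using m J' unfolding P_def by auto
    then have "gr J' \<gamma>' = gr Jm \<gamma>m" by (intro max) (use J' in \<open>auto simp: \<G>_def gr_def\<close>)
    then have "fst ` gr J' \<gamma>' = fst ` gr Jm \<gamma>m" by simp
    then show False using J'(3) unfolding gr_def by (auto simp: image_image)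
  qed
  have Jm: "open Jm" "is_interval Jm" "Jm \<noteq> {}" "geodesic_on M g Jm \<gamma>m" using m J(3) unfolding P_def
      by auto
  have "\<not> bdd_above Jm" using no ext_up[OF Jm] by blast
  have "\<not> bdd_below Jm" using no ext_down[OF Jm] by blast
  have "Jm = UNIV"
  proof -
    have "t \<in> Jm" for t
    proof -
      obtain s1 s2 where "s1 \<in> Jm" "s1 < t" "s2 \<in> Jm" "t < s2"
        using \<open>\<not> bdd_above Jm\<close> \<open>\<not> bdd_below Jm\<close> unfolding bdd_above_def bdd_below_def
            by (meson not_le)
      then show ?thesis using Jm(2) unfolding is_interval_1 by (meson less_imp_le)
    qed
    then show ?thesis by blast
  qed
  then show "\<exists>\<gamma>'. geodesic_on M g UNIV \<gamma>' \<and> (\<forall>t\<in>J. \<gamma>' t = \<gamma> t)" using m unfolding P_def by blast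
qed

end

section \<open>The circle and product charts\<close>

abbreviation circle_chart :: "real \<Rightarrow> (complex, real) chart" where
  "circle_chart a \<equiv> ((\<lambda>t. cis (2 * pi * t)) ` {a<..<a + 1}, circle_coord a)"

lemma circle_chart_mem: "circle_chart a \<in> circle"
  unfolding circle_def by blast

lemma circleE:
  assumes "c \<in> circle" obtains a where "c = circle_chart a"
  using assms unfolding circle_def by blast

lemma cis_2pi_eq: "cis (2 * pi * s) = cis (2 * pi * t) \<longleftrightarrow> (\<exists>n::int. s = t + n)"
proof -
  have "cis (2 * pi * s) = cis (2 * pi * t) \<longleftrightarrow> sin (2 * pi * s) = sin (2 * pi * t) \<and> cos (2 * pi * s)
      = cos (2 * pi * t)"
    by (auto simp: complex_eq_iff)
  also have "\<dots> \<longleftrightarrow> (\<exists>n::int. 2 * pi * s = 2 * pi * t + 2 * pi * n)" by (rule sin_cos_eq_iff)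
  also have "\<dots> \<longleftrightarrow> (\<exists>n::int. s = t + n)"
  proof -
    have "2 * pi * s = 2 * pi * t + 2 * pi * n \<longleftrightarrow> s = t + n" for n
      by (metis distrib_left mult_cancel_left mult_eq_0_iff pi_neq_zero zero_neq_numeral)
    then show ?thesis by simp
  qed
  finally show ?thesis .
qed

lemma circle_coord_cis:
  assumes "a < t" "t < a + 1" shows "circle_coord a (cis (2 * pi * t)) = t"
  unfolding circle_coord_def
proof (rule the_equality)
  fix s assume s: "a < s \<and> s < a + 1 \<and> cis (2 * pi * s) = cis (2 * pi * t)"
  then obtain n :: int where n: "s = t + n" using cis_2pi_eq by blast
  then have "\<bar>real_of_int n\<bar> < 1" using s assms by linarith
  then have "n = 0" by linarith
  then show "s = t" using n by simp
qed (use assms in auto)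

lemma circle_chart_inj: "inj_on (circle_coord a) ((\<lambda>t. cis (2 * pi * t)) ` {a<..<a + 1})"
  by (rule inj_onI) (auto simp: circle_coord_cis)

lemma circle_chart_img: "circle_coord a ` (\<lambda>t. cis (2 * pi * t)) ` {a<..<a + 1} = {a<..<a + 1}"
  by (force simp: circle_coord_cis image_image)

lemma circle_chart_inv:
  assumes "t \<in> {a<..<a + 1}"
  shows "inv_into ((\<lambda>t. cis (2 * pi * t)) ` {a<..<a + 1}) (circle_coord a) t = cis (2 * pi * t)"
  by (rule inv_into_f_eq[OF circle_chart_inj]) (use assms in \<open>auto simp: circle_coord_cis\<close>)

text \<open>Two branches of the circle coordinate differ locally by a constant. Smoothness of the
  atlas and the independence of \<open>du\<close> from the branch both rest on this.\<close>

lemma circle_chart_shift: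
  assumes t: "t \<in> {a<..<a + 1}" "cis (2 * pi * t) \<in> fst (circle_chart b)"
  shows "\<exists>k V. open V \<and> t \<in> V \<and> V \<subseteq> {a<..<a+1} \<and> (\<forall>s\<in>V. cis (2 * pi * s) \<in> fst (circle_chart b)
      \<and> circle_coord b (cis (2 * pi * s)) = s + k)"
proof -
  obtain s where s: "s \<in> {b<..<b + 1}" "cis (2 * pi * t) = cis (2 * pi * s)" using t(2) by auto
  then obtain n :: int where n: "t = s + n" using cis_2pi_eq by blast
  define V where "V = {a<..<a+1} \<inter> {b + n<..<b + 1 + n}"
  have "cis (2 * pi * r) \<in> fst (circle_chart b) \<and> circle_coord b (cis (2 * pi * r))
      = r + (- real_of_int n)" if "r \<in> V" for r
  proof -
    have 1: "cis (2 * pi * r) = cis (2 * pi * (r - n))" unfolding cis_2pi_eq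
        by (rule exI[of _ n]) simp
    have 2: "r - n \<in> {b<..<b+1}" using that unfolding V_def by auto
    show ?thesis using 2 circle_coord_cis[of b "r - n"] unfolding 1 by auto
  qed
  moreover have "open V" "t \<in> V" "V \<subseteq> {a<..<a+1}" unfolding V_def using s n t by auto
  ultimately show ?thesis by blast
qed

lemma smooth_atlas_circle: "smooth_atlas circle"
  unfolding smooth_atlas_def
proof (intro conjI ballI)
  fix c assume "c \<in> circle" then obtain a where c: "c = circle_chart a" by (rule circleE)
  show "inj_on (snd c) (fst c)" "open (chart_img c)" unfolding c
      by (simp_all add: circle_chart_inj circle_chart_img)
  fix d assume "d \<in> circle" then obtain b where d: "d = circle_chart b" by (rule circleE)
  have eq: "snd c ` (fst c \<inter> fst d) = {t \<in> {a<..<a+1}. cis (2 * pi * t) \<in> fst d}" (is "_ = ?S")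
    unfolding c by (force simp: circle_coord_cis)
  have loc: "\<exists>V. open V \<and> t \<in> V \<and> V \<subseteq> ?S \<and> smooth_on V (snd d \<circ> chart_inv c)" if t: "t \<in> ?S" for t
  proof -
    obtain k V where V: "open V" "t \<in> V" "V \<subseteq> {a<..<a+1}" "\<And>s. s \<in> V \<Longrightarrow> cis (2 * pi * s) \<in> fst d
        \<and> circle_coord b (cis (2 * pi * s)) = s + k"
      using circle_chart_shift[of t a b] t unfolding d by auto
    have "smooth_on V (\<lambda>s. s + k)" by (intro smooth_on_add smooth_on_id smooth_on_const V)
    then have "smooth_on V (snd d \<circ> chart_inv c)"
      by (rule smooth_on_cong[OF V(1)]) (use V in \<open>auto simp: c d circle_chart_inv subset_iff\<close>)
    then show ?thesis using V by (intro exI[of _ V]) auto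
  qed
  show "open (snd c ` (fst c \<inter> fst d))" unfolding eq by (subst open_subopen) (use loc in meson)
  show "smooth_on (snd c ` (fst c \<inter> fst d)) (snd d \<circ> chart_inv c)"
    unfolding eq by (rule smooth_on_local) (use loc in meson)
qed

lemma circle_chart_around:
  assumes "norm z = 1"
  shows "z \<in> fst (circle_chart (Arg z / (2 * pi) - 1 / 2))"
    "circle_coord (Arg z / (2 * pi) - 1 / 2) z = Arg z / (2 * pi)" "cis (2 * pi * (Arg z / (2 *
        pi))) = z"
proof -
  have z: "z \<noteq> 0" using assms by auto
  show *: "cis (2 * pi * (Arg z / (2 * pi))) = z" using cis_Arg[OF z] assms by (simp add: sgn_eq)
  show "z \<in> fst (circle_chart (Arg z / (2 * pi) - 1 / 2))"
    unfolding fst_conv by (rule image_eqI[of _ _ "Arg z / (2 * pi)"]) (use * in auto)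
  show "circle_coord (Arg z / (2 * pi) - 1 / 2) z = Arg z / (2 * pi)"
    using circle_coord_cis[of "Arg z / (2 * pi) - 1 / 2" "Arg z / (2 * pi)"] * by simp
qed

lemma carrier_circle: "carrier circle = {z. norm z = 1}"
proof
  show "carrier circle \<subseteq> {z. norm z = 1}" unfolding carrier_def circle_def by auto
  show "{z. norm z = 1} \<subseteq> carrier circle"
    using circle_chart_around(1) chart_in_carrier[OF circle_chart_mem] by blast
qed

text \<open>The branch of the coordinate in the definition of \<open>du\<close> depends on
  \<open>z\<close>, but it differs from the one of the chart \<open>c\<close> by a local constant,
  which the derivative does not see.\<close>

lemma du_chart_vec:
  assumes c: "c \<in> circle" and z: "z \<in> fst c"
  shows "du z (chart_vec circle c z r) = r"
proof -
  obtain b where b: "c = circle_chart b" using c by (rule circleE)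
  obtain t where t: "t \<in> {b<..<b+1}" "z = cis (2 * pi * t)" using z unfolding b by auto
  define a where "a = Arg z / (2 * pi) - 1 / 2"
  have nz: "norm z = 1" using t by simp
  note za = circle_chart_around[OF nz, folded a_def]
  \<comment> \<open>A tangent vector is 0 on functions that are not smooth near its base point, so
    the branch must be recognised as smooth before the vector may be applied to it.\<close>
  have sn: "smooth_near circle z (circle_coord a)"
    unfolding smooth_near_def
  proof (intro bexI[of _ "circle_chart a"] conjI exI[of _ "{a<..<a+1}"] circle_chart_mem za(1))
    show "smooth_on {a<..<a+1} (circle_coord a \<circ> chart_inv (circle_chart a))"
      by (rule smooth_on_cong[OF _ smooth_on_id]) (auto simp: circle_chart_inv circle_coord_cis)
    show "snd (circle_chart a) z \<in> {a<..<a+1}" unfolding snd_conv za(2) by (simp add: a_def)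
  qed (simp_all add: circle_chart_img)
  obtain k V where V: "open V" "t \<in> V" "V \<subseteq> {b<..<b+1}" "\<And>s. s \<in> V
      \<Longrightarrow> circle_coord a (cis (2 * pi * s)) = s + k"
    using circle_chart_shift[of t b a] t za(1) by auto
  have "circle_coord b z = t" using t circle_coord_cis by auto
  moreover have "((circle_coord a \<circ> chart_inv c) has_derivative (\<lambda>r. r)) (at t)"
  proof (rule has_derivative_transform_within_open[OF _ V(1,2)])
    show "((\<lambda>s. s + k) has_derivative (\<lambda>r. r)) (at t)" by (auto intro!: derivative_eq_intros)
    fix s assume "s \<in> V" then show "s + k = (circle_coord a \<circ> chart_inv c) s"
      using V by (auto simp: b circle_chart_inv subset_iff)
  qed
  ultimately show ?thesis
    using frechet_derivative_apply[of "circle_coord a \<circ> chart_inv c" "\<lambda>r. r" t r] sn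
    unfolding du_def a_def[symmetric] chart_vec_def by (simp add: b)
qed

text \<open>Dividing by \<open>z0\<close> moves the limit to 1, where \<open>Arg\<close> is
  continuous; this works for every \<open>z0\<close>, including -1 on the branch cut.\<close>

lemma circle_coord_tendsto:
  assumes z0: "norm z0 = 1" and z: "\<And>n::nat. norm (z n) = 1" "z \<longlonglongrightarrow> z0"
  defines "a \<equiv> Arg z0 / (2 * pi) - 1 / 2"
  shows "\<forall>\<^sub>F n in sequentially. z n \<in> fst (circle_chart a)"
    and "(\<lambda>n. circle_coord a (z n)) \<longlonglongrightarrow> circle_coord a z0"
proof -
  have z0': "z0 \<noteq> 0" using z0 by auto
  have "(\<lambda>n. z n / z0) \<longlonglongrightarrow> z0 / z0" by (intro tendsto_intros z z0')
  then have l1: "(\<lambda>n. z n / z0) \<longlonglongrightarrow> 1" using z0' by simp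
  have "isCont Arg 1" by (rule continuous_at_Arg) simp
  then have l2: "(\<lambda>n. Arg (z n / z0)) \<longlonglongrightarrow> 0" using isCont_tendsto_compose[OF _ l1, of Arg] by simp
  define t where "t n = Arg z0 / (2 * pi) + Arg (z n / z0) / (2 * pi)" for n
  have l3: "t \<longlonglongrightarrow> Arg z0 / (2 * pi) + 0 / (2 * pi)" unfolding t_def by (intro tendsto_intros l2) auto
  have ct: "cis (2 * pi * t n) = z n" for n
  proof -
    have "cis (2 * pi * t n) = cis (2 * pi * (Arg z0 / (2 * pi))) * cis (2 * pi * (Arg (z n / z0) /
        (2 * pi)))"
      unfolding t_def by (simp add: cis_mult distrib_left)
    also have "\<dots> = z0 * (z n / z0)"
      using circle_chart_around(3)[OF z0] circle_chart_around(3)[of "z n / z0"] z z0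
          by (simp add: norm_divide)
    finally show ?thesis using z0' by simp
  qed
  have ev: "\<forall>\<^sub>F n in sequentially. t n \<in> {a<..<a+1}"
    by (rule topological_tendstoD[OF l3 open_greaterThanLessThan]) (simp add: a_def)
  then show "\<forall>\<^sub>F n in sequentially. z n \<in> fst (circle_chart a)"
    by eventually_elim (use ct in \<open>metis fst_conv imageI\<close>)
  have "\<forall>\<^sub>F n in sequentially. t n = circle_coord a (z n)"
    using ev by eventually_elim (use ct circle_coord_cis in \<open>metis greaterThanLessThan_iff\<close>)
  then have "(\<lambda>n. circle_coord a (z n)) \<longlonglongrightarrow> Arg z0 / (2 * pi) + 0 / (2 * pi)" using l3
      by (rule Lim_transform_eventually[rotated])
  then show "(\<lambda>n. circle_coord a (z n)) \<longlonglongrightarrow> circle_coord a z0"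
    using circle_chart_around(2)[OF z0] unfolding a_def by simp
qed

section \<open>Product charts and projections\<close>

abbreviation prod_chart :: "('a, 'e) chart \<Rightarrow> ('b, 'f) chart \<Rightarrow> ('a \<times> 'b, 'e \<times> 'f) chart" where
  "prod_chart c d \<equiv> (fst c \<times> fst d, map_prod (snd c) (snd d))"

lemma prod_chart_mem: "c \<in> M \<Longrightarrow> d \<in> N \<Longrightarrow> prod_chart c d \<in> prod_atlas M N"
  unfolding prod_atlas_def by blast

lemma prod_chart_img: "chart_img (prod_chart c d) = chart_img c \<times> chart_img d"
  by (auto simp: map_prod_def image_iff)

lemma prod_chart_inv:
  assumes "inj_on (snd c) (fst c)" "inj_on (snd d) (fst d)" "x \<in> chart_img c" "y \<in> chart_img d"
  shows "chart_inv (prod_chart c d) (x, y) = (chart_inv c x, chart_inv d y)"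
proof (rule inv_into_f_eq)
  show "inj_on (snd (prod_chart c d)) (fst (prod_chart c d))"
    using assms(1,2) by (auto intro!: map_prod_inj_on)
qed (use assms(3,4) in \<open>auto simp: f_inv_into_f inv_into_into\<close>)

lemma carrier_prod_atlas: "carrier (prod_atlas M N) = carrier M \<times> carrier N"
proof -
  have "prod_atlas M N = (\<Union>c\<in>M. \<Union>d\<in>N. {prod_chart c d})" unfolding prod_atlas_def by blast
  then have "carrier (prod_atlas M N) = (\<Union>c\<in>M. \<Union>d\<in>N. fst c \<times> fst d)" unfolding carrier_def by simp
  also have "\<dots> = carrier M \<times> carrier N" unfolding carrier_def by blast
  finally show ?thesis .
qed

lemma
  assumes B: "smooth_atlas B" and C: "smooth_atlas C" and P: "smooth_atlas (prod_atlas B C)"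
  shows smooth_map_fst: "smooth_map (prod_atlas B C) B fst"
    and smooth_map_snd: "smooth_map (prod_atlas B C) C snd"
proof -
  have ex: "\<exists>c d. c \<in> B \<and> d \<in> C \<and> fst p \<in> fst c \<and> snd p \<in> fst d" if "p \<in> carrier (prod_atlas B C)"
      for p
  proof -
    have "fst p \<in> carrier B" "snd p \<in> carrier C" using that unfolding carrier_prod_atlas by auto
    then show ?thesis unfolding carrier_def by blast
  qed
  have W: "open (chart_img (prod_chart c d))" if "c \<in> B" "d \<in> C" for c d
    unfolding prod_chart_img using smooth_atlasD(2)[OF B that(1)] smooth_atlasD(2)[OF C that(2)]
        by (rule open_Times)
  have inv: "chart_inv (prod_chart c d) z = (chart_inv c (fst z), chart_inv d (snd z))"
      if "c \<in> B" "d \<in> C" "z \<in> chart_img (prod_chart c d)" for c d z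
    using prod_chart_inv[OF smooth_atlasD(1)[OF B that(1)] smooth_atlasD(1)[OF C that(2)], of "fst
        z" "snd z"] that(3)
    unfolding prod_chart_img by (auto simp: mem_Times_iff)
  show "smooth_map (prod_atlas B C) B fst"
  proof (rule smooth_mapI[OF P B])
    fix p assume "p \<in> carrier (prod_atlas B C)"
    then obtain c d where cd: "c \<in> B" "d \<in> C" "fst p \<in> fst c" "snd p \<in> fst d" using ex by blast
    have "smooth_on (chart_img (prod_chart c d)) (snd c \<circ> fst \<circ> chart_inv (prod_chart c d))"
      by (rule smooth_on_cong[OF W[OF cd(1,2)] smooth_on_fst[OF W[OF cd(1,2)] smooth_on_id[OF W[OF
          cd(1,2)]]]])
        (use inv[OF cd(1,2)] in \<open>simp add: chart_inv_simps(2)[OF B cd(1)] prod_chart_img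
            mem_Times_iff del: fst_conv snd_conv\<close>, use chart_inv_simps(2)[OF B cd(1)] in simp)
    then show "\<exists>ca\<in>prod_atlas B C. \<exists>da\<in>B. \<exists>W. p \<in> fst ca \<and> open W \<and> snd ca p \<in> W
        \<and> W \<subseteq> snd ca ` (fst ca \<inter> fst -` fst da) \<and> smooth_on W (snd da \<circ> fst \<circ> chart_inv ca)"
      using cd W[OF cd(1,2)]
      by (intro bexI[of _ "prod_chart c d"] bexI[of _ c] exI[of _ "chart_img (prod_chart c d)"]
          conjI prod_chart_mem) (auto simp: mem_Times_iff)
  qed
  show "smooth_map (prod_atlas B C) C snd"
  proof (rule smooth_mapI[OF P C])
    fix p assume "p \<in> carrier (prod_atlas B C)"
    then obtain c d where cd: "c \<in> B" "d \<in> C" "fst p \<in> fst c" "snd p \<in> fst d" using ex by blast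
    have "smooth_on (chart_img (prod_chart c d)) (snd d \<circ> snd \<circ> chart_inv (prod_chart c d))"
      by (rule smooth_on_cong[OF W[OF cd(1,2)] smooth_on_snd[OF W[OF cd(1,2)] smooth_on_id[OF W[OF
          cd(1,2)]]]])
        (use inv[OF cd(1,2)] in \<open>simp add: chart_inv_simps(2)[OF C cd(2)] prod_chart_img
            mem_Times_iff del: fst_conv snd_conv\<close>, use chart_inv_simps(2)[OF C cd(2)] in simp)
    then show "\<exists>ca\<in>prod_atlas B C. \<exists>da\<in>C. \<exists>W. p \<in> fst ca \<and> open W \<and> snd ca p \<in> W
        \<and> W \<subseteq> snd ca ` (fst ca \<inter> snd -` fst da) \<and> smooth_on W (snd da \<circ> snd \<circ> chart_inv ca)"
      using cd W[OF cd(1,2)]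
      by (intro bexI[of _ "prod_chart c d"] bexI[of _ d] exI[of _ "chart_img (prod_chart c d)"]
          conjI prod_chart_mem) (auto simp: mem_Times_iff)
  qed
qed

section \<open>Trivialisations in charts\<close>

text \<open>The local triviality in \<open>circle_bundle\<close> with its witnesses exposed, and
  without the equivariance of \<Phi>.\<close>

definition trivialization :: "('n, 'f::euclidean_space) atlas \<Rightarrow> ('m, 'k::euclidean_space) atlas \<Rightarrow>
    ('m \<Rightarrow> 'n) \<Rightarrow> 'n set \<Rightarrow> ('m \<Rightarrow> 'n \<times> complex) \<Rightarrow> ('n \<times> complex \<Rightarrow> 'm) \<Rightarrow> bool" where
  "trivialization N M \<pi> W \<Phi> \<Theta> \<longleftrightarrow> openin (mtop N) W \<and>
     smooth_map (restrict_atlas M (\<pi> -` W)) (prod_atlas (restrict_atlas N W) circle) \<Phi> \<and>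
     smooth_map (prod_atlas (restrict_atlas N W) circle) (restrict_atlas M (\<pi> -` W)) \<Theta> \<and>
     (\<forall>p\<in>carrier M. \<pi> p \<in> W \<longrightarrow> \<Theta> (\<Phi> p) = p \<and> fst (\<Phi> p) = \<pi> p) \<and>
     (\<forall>y\<in>W. \<forall>z\<in>carrier circle. \<Phi> (\<Theta> (y, z)) = (y, z))"

lemma circle_bundle_trivialization:
  "circle_bundle N M \<pi> R \<Longrightarrow> x \<in> carrier N \<Longrightarrow> \<exists>W \<Phi> \<Theta>. x \<in> W \<and> trivialization N M \<pi> W \<Phi> \<Theta>"
proof -
  assume b: "circle_bundle N M \<pi> R" and x: "x \<in> carrier N"
  from b have "\<forall>x\<in>carrier N. \<exists>W \<Phi> \<Theta>. openin (mtop N) W \<and> x \<in> W \<and>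
        smooth_map (restrict_atlas M (\<pi> -` W)) (prod_atlas (restrict_atlas N W) circle) \<Phi> \<and>
        smooth_map (prod_atlas (restrict_atlas N W) circle) (restrict_atlas M (\<pi> -` W)) \<Theta> \<and>
        (\<forall>p\<in>carrier M. \<pi> p \<in> W \<longrightarrow> \<Theta> (\<Phi> p) = p \<and> fst (\<Phi> p) = \<pi> p \<and>
           (\<forall>z\<in>carrier circle. snd (\<Phi> (R p z)) = snd (\<Phi> p) * z)) \<and>
        (\<forall>y\<in>W. \<forall>z\<in>carrier circle. \<Phi> (\<Theta> (y, z)) = (y, z))"
    unfolding circle_bundle_def by (elim conjE)
  from bspec[OF this x] show ?thesis unfolding trivialization_def
      by (elim exE conjE) (rule exI, rule exI, rule exI, intro conjI; (assumption | blast))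
qed

lemma carrier_restrict: "carrier (restrict_atlas M W) = carrier M \<inter> W"
proof -
  have "restrict_atlas M W = (\<lambda>c. (fst c \<inter> W, snd c)) ` M" unfolding restrict_atlas_def by blast
  then show ?thesis unfolding carrier_def by auto
qed

lemma trivialization_fibre:
  assumes N: "smooth_atlas N" and t: "trivialization N M \<pi> W \<Phi> \<Theta>" and p: "p \<in> carrier M" "\<pi> p \<in> W"
  shows "norm (snd (\<Phi> p)) = 1" "\<Theta> (\<pi> p, snd (\<Phi> p)) = p"
proof -
  have "\<Phi> p \<in> carrier (prod_atlas (restrict_atlas N W) circle)"
    using smooth_map_carrier[of "restrict_atlas M (\<pi> -` W)"] t p
        unfolding trivialization_def carrier_restrict by blast
  then show "norm (snd (\<Phi> p)) = 1" unfolding carrier_prod_atlas carrier_circle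
      by (auto simp: mem_Times_iff)
  show "\<Theta> (\<pi> p, snd (\<Phi> p)) = p" using t p unfolding trivialization_def by (metis prod.collapse)
qed

text \<open>The inverse trivialisation in coordinates: \<open>k\<close> takes base coordinates and a
  fibre angle to the chart \<open>c\<close>. It produces tangent vectors over prescribed base
  directions, and it transports limits from base and fibre to the total space. The charts
  \<open>nW\<close> and \<open>cW\<close> are the given ones cut down to \<open>W\<close> and its
  preimage, as the restricted atlases demand.\<close>

lemma trivialization_chart:
  assumes N: "smooth_atlas N" and M: "smooth_atlas M" and t: "trivialization N M \<pi> W \<Phi> \<Theta>"
    and n: "n \<in> N" "y0 \<in> fst n" "y0 \<in> W" and e: "e \<in> circle" "\<zeta>0 \<in> fst e"
        and c: "c \<in> M" "\<Theta> (y0, \<zeta>0) \<in> fst c"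
  shows "\<exists>Q k. open Q \<and> (snd n y0, snd e \<zeta>0) \<in> Q \<and> smooth_on Q k \<and>
    (\<forall>y\<in>fst n. \<forall>\<zeta>\<in>fst e. (snd n y, snd e \<zeta>) \<in> Q \<longrightarrow> y \<in> W \<and> \<Theta> (y, \<zeta>) \<in> fst c \<and> k (snd n y, snd e \<zeta>)
        = snd c (\<Theta> (y, \<zeta>)) \<and> \<pi> (\<Theta> (y, \<zeta>)) = y) \<and>
    Q \<subseteq> chart_img n \<times> chart_img e"
proof -
  define nW where "nW = (fst n \<inter> W, snd n)"
  define cW where "cW = (fst c \<inter> \<pi> -` W, snd c)"
  define ch where "ch = prod_chart nW e"
  define Q where "Q = snd ch ` (fst ch \<inter> \<Theta> -` fst cW)"
  define k where "k = snd cW \<circ> \<Theta> \<circ> chart_inv ch"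
  have \<Theta>: "smooth_map (prod_atlas (restrict_atlas N W) circle) (restrict_atlas M (\<pi> -` W)) \<Theta>"
    using t unfolding trivialization_def by blast
  have nW: "nW \<in> restrict_atlas N W" unfolding nW_def restrict_atlas_def using n by blast
  have cW: "cW \<in> restrict_atlas M (\<pi> -` W)" unfolding cW_def restrict_atlas_def using c by blast
  have chm: "ch \<in> prod_atlas (restrict_atlas N W) circle" unfolding ch_def
      by (rule prod_chart_mem[OF nW e(1)])
  have Q: "open Q" "smooth_on Q k" unfolding Q_def k_def using smooth_mapD[OF \<Theta> chm cW] by auto
  have inj: "inj_on (snd nW) (fst nW)" "inj_on (snd e) (fst e)" "inj_on (snd n) (fst n)"
    using smooth_atlasD(1)[OF N n(1)] smooth_atlasD(1)[OF smooth_atlas_circle e(1)] unfolding nW_def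
        by (auto intro: inj_on_subset)
  have inv: "chart_inv ch (snd n y, snd e \<zeta>) = (y, \<zeta>)" if "y \<in> fst n \<inter> W" "\<zeta> \<in> fst e" for y \<zeta>
  proof -
    have "chart_inv ch (snd nW y, snd e \<zeta>) = (chart_inv nW (snd nW y), chart_inv e (snd e \<zeta>))"
      unfolding ch_def by (rule prod_chart_inv[OF inj(1,2)]) (use that in \<open>auto simp: nW_def\<close>)
    also have "\<dots> = (y, \<zeta>)" using inv_into_f_f[OF inj(1), of y] inv_into_f_f[OF inj(2), of \<zeta>] that
        by (auto simp: nW_def)
    finally show ?thesis by (simp add: nW_def)
  qed
  have \<Theta>\<pi>: "\<pi> (\<Theta> (y, \<zeta>)) = y \<and> \<Theta> (y, \<zeta>) \<in> carrier M" if "y \<in> fst n \<inter> W" "\<zeta> \<in> fst e" for y \<zeta>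
  proof -
    have "(y, \<zeta>) \<in> carrier (prod_atlas (restrict_atlas N W) circle)"
      unfolding carrier_prod_atlas carrier_restrict
          using that chart_in_carrier[OF n(1)] chart_in_carrier[OF e(1)] by auto
    from smooth_map_carrier[OF \<Theta> this] have "\<Theta> (y, \<zeta>) \<in> carrier M" "\<pi> (\<Theta> (y, \<zeta>)) \<in> W"
        unfolding carrier_restrict by auto
    then show ?thesis using t that chart_in_carrier[OF e(1)] unfolding trivialization_def
        by (metis IntD2 fst_conv)
  qed
  have "(snd n y0, snd e \<zeta>0) \<in> Q"
    unfolding Q_def ch_def nW_def cW_def using n e c \<Theta>\<pi>[of y0 \<zeta>0]
        by (auto intro!: image_eqI[of _ _ "(y0, \<zeta>0)"])
  moreover have "y \<in> W \<and> \<Theta> (y, \<zeta>) \<in> fst c \<and> k (snd n y, snd e \<zeta>) = snd c (\<Theta> (y, \<zeta>)) \<and> \<pi> (\<Theta> (y, \<zeta>))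
      = y"
    if y: "y \<in> fst n" "\<zeta> \<in> fst e" "(snd n y, snd e \<zeta>) \<in> Q" for y \<zeta>
  proof -
    obtain y' \<zeta>' where "y' \<in> fst n \<inter> W" "\<zeta>' \<in> fst e" "\<Theta> (y', \<zeta>') \<in> fst c" "snd n y
        = snd n y'" "snd e \<zeta> = snd e \<zeta>'"
      using y(3) unfolding Q_def ch_def nW_def cW_def by auto
    moreover from this have "y = y'" "\<zeta> = \<zeta>'" using y inj_onD[OF inj(3)] inj_onD[OF inj(2)] by auto
    ultimately have yW: "y \<in> fst n \<inter> W" "\<Theta> (y, \<zeta>) \<in> fst c" by auto
    then show ?thesis using inv[OF yW(1) y(2)] \<Theta>\<pi>[OF yW(1) y(2)] unfolding k_def cW_def by simp
  qed
  moreover have "Q \<subseteq> chart_img n \<times> chart_img e" unfolding Q_def ch_def nW_def by auto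
  ultimately show ?thesis using Q by blast
qed

text \<open>Provides the coordinate velocity of the orbit through \<open>p\<close>, the vertical
  vector on which the connection form is normalised.\<close>

lemma action_chart:
  assumes M: "smooth_atlas M" and b: "circle_bundle N M \<pi> R" and c: "c \<in> M" "p \<in> fst c"
  shows "\<exists>v T. open T \<and> 0 \<in> T \<and> (\<forall>t\<in>T. R p (cis t) \<in> fst c) \<and> (snd c \<circ> (\<lambda>t. R p (cis t))
      has_vector_derivative v) (at 0)"
proof -
  define F where "F = (\<lambda>(p, z). R p z)"
  \<comment> \<open>The branch around the neutral element, which has coordinate 0 in it.\<close>
  define e where "e = circle_chart (- 1/2)"
  define ch where "ch = prod_chart c e"
  define Q where "Q = snd ch ` (fst ch \<inter> F -` fst c)"
  define k where "k = snd c \<circ> F \<circ> chart_inv ch"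
  have F: "smooth_map (prod_atlas M circle) M F" using b unfolding circle_bundle_def F_def by blast
  have e: "e \<in> circle" unfolding e_def by (rule circle_chart_mem)
  have Q: "open Q" "smooth_on Q k" unfolding Q_def k_def ch_def
      using smooth_mapD[OF F prod_chart_mem[OF c(1) e] c(1)] by auto
  have pM: "p \<in> carrier M" using c by (rule chart_in_carrier)
  have R1: "R p 1 = p" using b pM unfolding circle_bundle_def by blast
  have inj: "inj_on (snd c) (fst c)" "inj_on (snd e) (fst e)"
      using smooth_atlasD(1)[OF M c(1)] smooth_atlasD(1)[OF smooth_atlas_circle e] by auto
  have e0: "(1::complex) \<in> fst e" "snd e 1 = 0"
    unfolding e_def using circle_coord_cis[of "-1/2" 0] by (auto intro!: image_eqI[of _ _ 0])
  have z0: "(snd c p, 0) \<in> Q"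
    unfolding Q_def ch_def F_def by (rule image_eqI[of _ _ "(p, 1)"]) (use c e0 R1 in auto)
  have img_e: "chart_img e = {- 1/2<..<1/2}" unfolding e_def using circle_chart_img[of "-1/2"]
      by simp
  have inv: "chart_inv ch (snd c p, s) = (p, cis (2 * pi * s))" if "s \<in> chart_img e" for s
  proof -
    have "chart_inv ch (snd c p, s) = (chart_inv c (snd c p), chart_inv e s)"
      unfolding ch_def by (rule prod_chart_inv[OF inj]) (use c that in auto)
    also have "chart_inv c (snd c p) = p" by (rule chart_inv_simps(1)[OF M c])
    also have "chart_inv e s = cis (2 * pi * s)" using that circle_chart_inv[of s "-1/2"]
        unfolding img_e unfolding e_def by simp
    finally show ?thesis .
  qed
  have inQ: "R p (cis (2 * pi * s)) \<in> fst c \<and> k (snd c p, s) = snd c (R p (cis (2 * pi * s)))"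
      if s: "(snd c p, s) \<in> Q" for s
  proof -
    obtain p' z where pz: "p' \<in> fst c" "z \<in> fst e" "R p' z \<in> fst c" "snd c p = snd c p'" "s
        = snd e z"
      using s unfolding Q_def ch_def F_def by auto
    then have "s \<in> chart_img e" by auto
    note i = inv[OF this]
    have "p' = p" using pz c inj_onD[OF inj(1)] by metis
    moreover have "cis (2 * pi * s) = z"
      using i inv_into_f_f[OF inj(2) pz(2)] prod_chart_inv[OF inj, of "snd c p" s] pz c
          unfolding ch_def by auto
    ultimately show ?thesis using pz i unfolding k_def F_def by simp
  qed
  \<comment> \<open>The circle coordinate has period 1, so the group element \<open>cis t\<close>
    has coordinate \<open>t / (2 * pi)\<close>.\<close>
  define j where "j t = (snd c p, t / (2 * pi))" for t :: real
  have jd: "(j has_derivative (\<lambda>h. (0, h / (2 * pi)))) (at t)" for t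
    unfolding j_def by (auto intro!: derivative_eq_intros)
  have cj: "continuous_on UNIV j" unfolding j_def by (intro continuous_intros) auto
  define T where "T = j -` Q"
  have T: "open T" unfolding T_def by (rule open_vimage[OF Q(1) cj])
  have T0: "0 \<in> T" unfolding T_def j_def using z0 by simp
  have k0: "(k has_derivative frechet_derivative k (at (j 0))) (at (j 0))"
    by (rule smooth_on_has_derivative[OF Q(2)]) (use T0 T_def in auto)
  have "((\<lambda>t. k (j t)) has_derivative (\<lambda>h. frechet_derivative k (at (j 0)) (0, h / (2 * pi)))) (at
      0)"
    by (rule has_derivative_compose[OF jd k0])
  then have d: "(snd c \<circ> (\<lambda>t. R p (cis t)) has_derivative (\<lambda>h. frechet_derivative k (at (j 0)) (0, h
      / (2 * pi)))) (at 0)"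
    by (rule has_derivative_transform_within_open[OF _ T T0]) (use inQ in \<open>auto simp: T_def j_def\<close>)
  define v where "v = frechet_derivative k (at (j 0)) (0, 1 / (2 * pi))"
  have lin: "frechet_derivative k (at (j 0)) (0, h / (2 * pi)) = h *\<^sub>R v" for h unfolding v_def
    using linear_cmul[OF has_derivative_linear[OF k0], of h "(0, 1 / (2 * pi))"] by simp
  from d have "(snd c \<circ> (\<lambda>t. R p (cis t)) has_vector_derivative v) (at 0)"
    unfolding has_vector_derivative_def lin .
  moreover have "R p (cis t) \<in> fst c" if "t \<in> T" for t using inQ[of "t / (2 * pi)"] that
      unfolding T_def j_def by simp
  ultimately show ?thesis using T T0 by blast
qed

section \<open>The metric in adapted coordinates\<close>

text \<open>The geometric data of the theorem in the form in which the local computations use them.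
  Compactness of \<open>B\<close> and the Hausdorff property of the total space are global and enter
  as hypotheses of individual lemmas.\<close>

locale pp_bundle =
  fixes B :: "('b, 'e::euclidean_space) atlas"
    and hB :: "('b, real) tensor2" and \<alpha> :: "('b, real) form1"
    and N :: "('b \<times> complex, 'e \<times> real) atlas"
    and h :: "('b \<times> complex, real) tensor2"
    and \<eta> :: "('b \<times> complex, real) form1"
    and \<sigma> :: "('b \<times> complex, real) tensor2"
    and M :: "('m, 'k::euclidean_space) atlas"
    and \<pi> :: "'m \<Rightarrow> 'b \<times> complex"
    and R :: "'m \<Rightarrow> complex \<Rightarrow> 'm"
    and A :: "('m, complex) form1"
    and fB :: "'b \<Rightarrow> real" and fS :: "complex \<Rightarrow> real" and f :: "'m \<Rightarrow> real"
    and g :: "('m, real) tensor2"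
  assumes B: "smooth_atlas B" and hB: "riemannian_metric B hB" and \<alpha>: "one_form B \<alpha>"
    and N: "N = prod_atlas B circle" and smN: "smooth_atlas N"
    and h: "h = (\<lambda>y X Y. pull2 B fst hB y X Y + pull2 circle snd (sym_prod du du) y X Y)"
    and \<eta>: "\<eta> = pull1 circle snd du"
    and \<sigma>: "\<sigma> = wedge (pull1 B fst \<alpha>) \<eta>"
    and fB: "smooth_fun B fB" and fS: "smooth_fun circle fS"
    and f: "f = (\<lambda>y. fB (fst y) * fS (snd y)) \<circ> \<pi>"
    and M: "smooth_atlas M" and dimM: "DIM('k) = DIM('e \<times> real) + 1"
    and bdl: "circle_bundle N M \<pi> R" and conn: "connection_form M R A"
    and dA: "has_ext_deriv M A (\<lambda>p X Y. - 2 * \<i> * complex_of_real (pull2 N \<pi> (\<lambda>y X Y. pi * \<sigma> y X Y)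
        p X Y))"
    and g: "g = type_metric N h \<pi> A \<eta> f"
begin

abbreviation \<pi>B where "\<pi>B \<equiv> fst \<circ> \<pi>"
abbreviation \<pi>S where "\<pi>S \<equiv> snd \<circ> \<pi>"

lemma sm_\<pi>: "smooth_map M N \<pi>"
  using bdl unfolding circle_bundle_def by (elim conjE)

lemma sm_fst: "smooth_map N B fst" and sm_snd: "smooth_map N circle snd"
  using smooth_map_fst[OF B smooth_atlas_circle] smooth_map_snd[OF B smooth_atlas_circle] smN
      unfolding N by blast+

lemma sm_\<pi>B: "smooth_map M B \<pi>B" and sm_\<pi>S: "smooth_map M circle \<pi>S"
  by (rule smooth_map_compose[OF M smN B sm_\<pi> sm_fst]) (rule smooth_map_compose[OF M smN
      smooth_atlas_circle sm_\<pi> sm_snd])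

definition theta :: "('m, 'k) chart \<Rightarrow> 'k \<Rightarrow> 'k \<Rightarrow> real" where
  "theta c x v = Im (comp1 M A c x v)"

text \<open>As charts of \<open>M\<close> need not respect the fibration, base coordinates exist
  only as functions on this open part of the chart \<open>c\<close>.\<close>

definition adapted :: "('m, 'k) chart \<Rightarrow> ('b, 'e) chart \<Rightarrow> (complex, real) chart \<Rightarrow> 'k set" where
  "adapted c d e = snd c ` (fst c \<inter> \<pi>B -` fst d) \<inter> snd c ` (fst c \<inter> \<pi>S -` fst e)"

definition qc where "qc c d = snd d \<circ> \<pi>B \<circ> chart_inv c" for c :: "('m, 'k) chart"
    and d :: "('b, 'e) chart"
definition uc where "uc c e = snd e \<circ> \<pi>S \<circ> chart_inv c" for c :: "('m, 'k) chart"
    and e :: "(complex, real) chart"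

text \<open>The periodic lift of \<open>fS\<close> to the line, one function that serves all
  branches of the circle coordinate.\<close>

definition fs :: "real \<Rightarrow> real" where "fs t = fS (cis (2 * pi * t))"

lemma fs_smooth: "smooth_on UNIV fs"
proof (rule smooth_on_local)
  fix t :: real
  define a where "a = t - 1/2"
  have "smooth_on {a<..<a+1} (fS \<circ> chart_inv (circle_chart a))"
    using fS circle_chart_mem[of a] unfolding smooth_fun_def
        by (metis circle_chart_img fst_conv snd_conv)
  then have "smooth_on {a<..<a+1} fs"
    by (rule smooth_on_cong[rotated]) (auto simp: fs_def circle_chart_inv)
  then show "\<exists>T. open T \<and> t \<in> T \<and> smooth_on T fs"
      by (intro exI[of _ "{a<..<a+1}"]) (auto simp: a_def)
qed

lemma
  assumes d: "d \<in> B"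
  shows hB_field: "bil_field (chart_img d) (comp2 B hB d)"
  and hB_pos: "y \<in> chart_img d \<Longrightarrow> v \<noteq> 0 \<Longrightarrow> comp2 B hB d y v v > 0"
proof -
  have s: "smooth_tensor2 B hB" and sym: "\<And>x v w. x \<in> chart_img d \<Longrightarrow> comp2 B hB d x v w
      = comp2 B hB d x w v"
    and pos: "\<And>x v. x \<in> chart_img d \<Longrightarrow> v \<noteq> 0 \<Longrightarrow> comp2 B hB d x v v > 0"
    using hB d unfolding riemannian_metric_def by blast+
  show "bil_field (chart_img d) (comp2 B hB d)"
    unfolding bil_field_def using s d sym smooth_atlasD(2)[OF B d] unfolding smooth_tensor2_def
        by blast
  show "y \<in> chart_img d \<Longrightarrow> v \<noteq> 0 \<Longrightarrow> comp2 B hB d y v v > 0" using pos .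
qed

lemma alpha_field: "d \<in> B \<Longrightarrow> lin_field (chart_img d) (comp1 B \<alpha> d)"
  using \<alpha> smooth_atlasD(2)[OF B] unfolding one_form_def lin_field_def by blast

context
  fixes c d e
  assumes c: "c \<in> M" and d: "d \<in> B" and e: "e \<in> circle"
begin

lemma adaptedD:
  assumes "x \<in> adapted c d e"
  shows "chart_inv c x \<in> fst c" "snd c (chart_inv c x) = x" "x \<in> chart_img c" "chart_inv c x \<in>
      carrier M"
    "\<pi>B (chart_inv c x) \<in> fst d" "\<pi>S (chart_inv c x) \<in> fst e"
    "qc c d x \<in> chart_img d" "chart_inv d (qc c d x) = \<pi>B (chart_inv c x)" "snd d (\<pi>B (chart_inv c
        x)) = qc c d x"
proof -
  show 1: "x \<in> chart_img c" using assms unfolding adapted_def by auto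
  show 2: "chart_inv c x \<in> fst c" "snd c (chart_inv c x) = x" using chart_inv_simps[OF M c] 1
      by auto
  show "chart_inv c x \<in> carrier M" by (rule chart_in_carrier[OF c 2(1)])
  show 3: "\<pi>B (chart_inv c x) \<in> fst d" "\<pi>S (chart_inv c x) \<in> fst e"
    using assms unfolding adapted_def chart_image_eq[OF M c] by auto
  show "qc c d x \<in> chart_img d" "snd d (\<pi>B (chart_inv c x)) = qc c d x" unfolding qc_def using 3
      by auto
  show "chart_inv d (qc c d x) = \<pi>B (chart_inv c x)" unfolding qc_def
      using chart_inv_simps(1)[OF B d 3(1)] by simp
qed

lemma adapted_open: "open (adapted c d e)"
  unfolding adapted_def using smooth_mapD(1)[OF sm_\<pi>B c d] smooth_mapD(1)[OF sm_\<pi>S c e]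
      by (rule open_Int)

lemma qc_smooth: "smooth_on (adapted c d e) (qc c d)"
    and uc_smooth: "smooth_on (adapted c d e) (uc c e)"
  unfolding qc_def uc_def adapted_def
  using smooth_on_subset[OF smooth_mapD(2)[OF sm_\<pi>B c d]] smooth_on_subset[OF smooth_mapD(2)[OF
      sm_\<pi>S c e]] by auto

abbreviation Dqc where "Dqc x \<equiv> frechet_derivative (qc c d) (at x)"
abbreviation Duc where "Duc x \<equiv> frechet_derivative (uc c e) (at x)"
abbreviation vec where "vec x \<equiv> chart_vec M c (chart_inv c x)"

lemma push_B:
  assumes x: "x \<in> adapted c d e"
  shows "push B fst (\<pi> (chart_inv c x)) (push N \<pi> (chart_inv c x) (vec x v))
      = chart_vec B d (chart_inv d (qc c d x)) (Dqc x v)"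
proof -
  note a = adaptedD[OF x]
  have "push B fst (\<pi> (chart_inv c x)) (push N \<pi> (chart_inv c x) (vec x v))
      = push B \<pi>B (chart_inv c x) (vec x v)"
    by (rule push_push[OF M smN B sm_\<pi> sm_fst a(4)])
  also have "\<dots> = chart_vec B d (\<pi>B (chart_inv c x)) (frechet_derivative (snd d \<circ> \<pi>B \<circ> chart_inv c)
      (at (snd c (chart_inv c x))) v)"
    by (rule push_chart_vec[OF M B sm_\<pi>B c a(1) d a(5)])
  finally show ?thesis unfolding a(2,8) qc_def[symmetric] .
qed

lemma eta_vec:
  assumes x: "x \<in> adapted c d e"
  shows "pull1 N \<pi> \<eta> (chart_inv c x) (vec x v) = Duc x v"
proof -
  note a = adaptedD[OF x]
  have "push circle snd (\<pi> (chart_inv c x)) (push N \<pi> (chart_inv c x) (vec x v))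
      = push circle \<pi>S (chart_inv c x) (vec x v)"
    by (rule push_push[OF M smN smooth_atlas_circle sm_\<pi> sm_snd a(4)])
  also have "\<dots> = chart_vec circle e (\<pi>S (chart_inv c x)) (frechet_derivative (snd e \<circ> \<pi>S \<circ> chart_inv
      c) (at (snd c (chart_inv c x))) v)"
    by (rule push_chart_vec[OF M smooth_atlas_circle sm_\<pi>S c a(1) e a(6)])
  finally have 1: "push circle snd (\<pi> (chart_inv c x)) (push N \<pi> (chart_inv c x) (vec x v))
      = chart_vec circle e (\<pi>S (chart_inv c x)) (Duc x v)"
    unfolding a(2) uc_def[symmetric] .
  show ?thesis unfolding pull1_def \<eta> 1 using du_chart_vec[OF e a(6)] by simp
qed

lemma f_adapted:
  assumes x: "x \<in> adapted c d e"
  shows "f (chart_inv c x) = (fB \<circ> chart_inv d) (qc c d x) * fs (uc c e x)"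
proof -
  note a = adaptedD[OF x]
  obtain s where s: "e = circle_chart s" using e by (rule circleE)
  obtain t where t: "t \<in> {s<..<s+1}" "\<pi>S (chart_inv c x) = cis (2 * pi * t)" using a(6) unfolding s
      by auto
  then have "uc c e x = t" unfolding uc_def s using circle_coord_cis by simp
  then show ?thesis using t(2) unfolding f fs_def comp_def a(8)[unfolded comp_def] by simp
qed

text \<open>Multiplication by \<i> under \<open>Re\<close> turns the connection form into minus its
  imaginary part; this explains the two negative cross terms. The circle factor of \<open>h\<close>
  joins the term with \<open>f\<close>, whence the coefficient with \<open>+ 1\<close>.\<close>

lemma g_adapted:
  assumes x: "x \<in> adapted c d e"
  shows "comp2 M g c x v w = - theta c x v * Duc x w - Duc x v * theta c x w
     + ((fB \<circ> chart_inv d) (qc c d x) * fs (uc c e x) + 1) * (Duc x v * Duc x w)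
     + comp2 B hB d (qc c d x) (Dqc x v) (Dqc x w)"
proof -
  note a = adaptedD[OF x]
  define p where "p = chart_inv c x"
  have eta: "pull1 N \<pi> \<eta> p (vec x v) = Duc x v" for v unfolding p_def by (rule eta_vec[OF x])
  have th: "Im (A p (vec x v)) = theta c x v" for v unfolding theta_def comp1_def p_def ..
  have du: "du (snd (\<pi> p)) (push circle snd (\<pi> p) (push N \<pi> p (vec x v))) = Duc x v" for v
    using eta[of v] unfolding pull1_def \<eta> .
  have "pull2 N \<pi> h p (vec x v) (vec x w) = hB (fst (\<pi> p)) (push B fst (\<pi> p) (push N \<pi> p (vec x v)))
      (push B fst (\<pi> p) (push N \<pi> p (vec x w)))
     + sym_prod du du (snd (\<pi> p)) (push circle snd (\<pi> p) (push N \<pi> p (vec x v))) (push circle snd (\<pi>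
         p) (push N \<pi> p (vec x w)))"
    unfolding h pull2_def ..
  also have "\<dots> = comp2 B hB d (qc c d x) (Dqc x v) (Dqc x w) + Duc x v * Duc x w"
    using push_B[OF x] a(8) unfolding p_def[symmetric] sym_prod_def du[folded p_def]
        by (simp add: comp2_def)
  finally have 1: "pull2 N \<pi> h p (vec x v) (vec x w) = comp2 B hB d (qc c d x) (Dqc x v) (Dqc x w) +
      Duc x v * Duc x w" .
  have "comp2 M g c x v w = type_metric N h \<pi> A \<eta> f p (vec x v) (vec x w)"
    unfolding comp2_def g p_def ..
  also have "\<dots> = Re (2 * \<i> * sym_prod A (\<lambda>p X. complex_of_real (pull1 N \<pi> \<eta> p X)) p (vec x v) (vec x
      w))
     + f p * sym_prod (pull1 N \<pi> \<eta>) (pull1 N \<pi> \<eta>) p (vec x v) (vec x w) + pull2 N \<pi> h p (vec x v)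
         (vec x w)"
    unfolding type_metric_def ..
  also have "\<dots> = - theta c x v * Duc x w - Duc x v * theta c x w + f p * (Duc x v * Duc x w)
     + (comp2 B hB d (qc c d x) (Dqc x v) (Dqc x w) + Duc x v * Duc x w)"
    unfolding sym_prod_def eta 1 by (simp add: th[symmetric] field_simps)
  finally show ?thesis using f_adapted[OF x] unfolding p_def[symmetric] by (simp add: algebra_simps)
qed

lemma theta_field: "lin_field (chart_img c) (theta c)"
proof -
  have A: "one_form M A" using conn unfolding connection_form_def by (elim conjE)
  have l: "linear (comp1 M A c x)" if "x \<in> chart_img c" for x using A c that unfolding one_form_def
      by blast
  have s: "smooth_on (chart_img c) (\<lambda>x. comp1 M A c x v)" for v using A c unfolding one_form_def
      by blast
  show ?thesis unfolding lin_field_def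
  proof (intro conjI ballI allI)
    show "open (chart_img c)" by (rule smooth_atlasD(2)[OF M c])
    fix x assume "x \<in> chart_img c"
    from l[OF this] show "linear (theta c x)"
      by (intro linearI; simp add: theta_def linear_add linear_cmul)
  next
    fix v show "smooth_on (chart_img c) (\<lambda>x. theta c x v)" unfolding theta_def
      by (rule smooth_on_bounded_linear[OF bounded_linear_Im smooth_atlasD(2)[OF M c] s])
  qed
qed

lemma dtheta_adapted:
  assumes x: "x \<in> adapted c d e"
  shows "frechet_derivative (\<lambda>z. theta c z w) (at x) v - frechet_derivative (\<lambda>z. theta c z v) (at x)
      w =
        - 2 * pi * (comp1 B \<alpha> d (qc c d x) (Dqc x v) * Duc x w - Duc x v * comp1 B \<alpha> d (qc c d x)
            (Dqc x w))"
proof -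
  note a = adaptedD[OF x]
  define p where "p = chart_inv c x"
  have A: "one_form M A" using conn unfolding connection_form_def by (elim conjE)
  have s: "smooth_on (chart_img c) (\<lambda>x. comp1 M A c x v)" for v using A c unfolding one_form_def
      by blast
  have im: "frechet_derivative (\<lambda>z. theta c z w) (at x) v = Im (frechet_derivative (\<lambda>z. comp1 M A c
      z w) (at x) v)" for v w
    unfolding theta_def
    by (rule frechet_derivative_apply[OF bounded_linear.has_derivative[OF bounded_linear_Im
        smooth_on_has_derivative[OF s a(3)]]])
  have eta: "\<eta> (\<pi> p) (push N \<pi> p (vec x v)) = Duc x v" for v
    using eta_vec[OF x, of v] unfolding pull1_def p_def .
  have al: "pull1 B fst \<alpha> (\<pi> p) (push N \<pi> p (vec x v)) = comp1 B \<alpha> d (qc c d x) (Dqc x v)" for v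
    unfolding pull1_def comp1_def p_def push_B[OF x] using a(8) by simp
  have "frechet_derivative (\<lambda>z. comp1 M A c z w) (at x) v - frechet_derivative (\<lambda>z. comp1 M A c z v)
      (at x) w
     = comp2 M (\<lambda>p X Y. - 2 * \<i> * complex_of_real (pull2 N \<pi> (\<lambda>y X Y. pi * \<sigma> y X Y) p X Y)) c x v w"
    by (rule sym) (use dA c a(3) in \<open>unfold has_ext_deriv_def, blast\<close>)
  also have "\<dots> = - 2 * \<i> * complex_of_real (pi * (comp1 B \<alpha> d (qc c d x) (Dqc x v) * Duc x w - Duc x
      v * comp1 B \<alpha> d (qc c d x) (Dqc x w)))"
    unfolding comp2_def pull2_def \<sigma> wedge_def eta[unfolded p_def] al[unfolded p_def] ..
  finally have "Im (frechet_derivative (\<lambda>z. comp1 M A c z w) (at x) v - frechet_derivative (\<lambda>z.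
      comp1 M A c z v) (at x) w)
    = Im (- 2 * \<i> * complex_of_real (pi * (comp1 B \<alpha> d (qc c d x) (Dqc x v) * Duc x w - Duc x v *
        comp1 B \<alpha> d (qc c d x) (Dqc x w))))"
    by simp
  then show ?thesis unfolding im by simp
qed

text \<open>The velocity of the orbit under the circle action: the connection form is \<i> on it,
  and the base coordinates are constant along the orbit.\<close>

lemma vertical_vector:
  assumes x: "x \<in> adapted c d e"
  shows "\<exists>y. Dqc x y = 0 \<and> Duc x y = 0 \<and> theta c x y = 1"
proof -
  note a = adaptedD[OF x]
  define p where "p = chart_inv c x"
  have p: "p \<in> fst c" "snd c p = x" "p \<in> carrier M" unfolding p_def using a by auto
  obtain v T where T: "open T" "0 \<in> T" "\<And>t. t \<in> T \<Longrightarrow> R p (cis t) \<in> fst c"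
    and v: "(snd c \<circ> (\<lambda>t. R p (cis t)) has_vector_derivative v) (at 0)"
    using action_chart[OF M bdl c p(1)] by blast
  have R: "R p 1 = p" "\<pi> (R p (cis t)) = \<pi> p" for t
    using bdl p(3) unfolding circle_bundle_def carrier_circle by auto
  have "velocity M (\<lambda>t. R p (cis t)) 0 = chart_vec M c (R p (cis 0)) v"
    by (rule velocity_chart_vec[OF M c T(1,2) _ v]) (use T in auto)
  then have "A p (chart_vec M c p v) = \<i>" using conn p(3) R unfolding connection_form_def by auto
  then have th: "theta c x v = 1" unfolding theta_def comp1_def p_def by simp
  define \<rho> where "\<rho> = snd c \<circ> (\<lambda>t. R p (cis t))"
  have \<rho>0: "\<rho> 0 = x" unfolding \<rho>_def using R p by simp
  have \<rho>d: "(\<rho> has_derivative (\<lambda>h. h *\<^sub>R v)) (at 0)" using v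
      unfolding \<rho>_def has_vector_derivative_def .
  \<comment> \<open>A function that is constant along the orbit \<rho> has vanishing derivative in
    the direction of its velocity \<open>v\<close>. The value type is left general, as this is
    applied to both base coordinates.\<close>
  have const: "frechet_derivative k (at x) v = 0"
    if k: "smooth_on (adapted c d e) k" and kc: "\<And>t. t \<in> T \<Longrightarrow> k (\<rho> t) = k x"
        for k :: "'k \<Rightarrow> 'z::real_normed_vector"
  proof -
    have kd: "(k has_derivative frechet_derivative k (at x)) (at (\<rho> 0))" unfolding \<rho>0
        by (rule smooth_on_has_derivative[OF k x])
    have "((\<lambda>t. k (\<rho> t)) has_derivative (\<lambda>h. frechet_derivative k (at x) (h *\<^sub>R v))) (at 0)"
      by (rule has_derivative_compose[OF \<rho>d kd])
    moreover have "((\<lambda>t. k (\<rho> t)) has_derivative (\<lambda>h. 0)) (at 0)"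
      by (rule has_derivative_transform_within_open[OF has_derivative_const T(1,2)]) (simp add: kc)
    ultimately have "frechet_derivative k (at x) (1 *\<^sub>R v) = 0" using has_derivative_unique by metis
    then show ?thesis by simp
  qed
  have inv: "chart_inv c (\<rho> t) = R p (cis t)" if "t \<in> T" for t
    unfolding \<rho>_def using chart_inv_simps(1)[OF M c T(3)[OF that]] by simp
  have "Dqc x v = 0" by (rule const[OF qc_smooth]) (simp add: qc_def inv R p_def[symmetric])
  moreover have "Duc x v = 0" by (rule const[OF uc_smooth]) (simp add: uc_def inv R
      p_def[symmetric])
  ultimately show ?thesis using th by blast
qed

text \<open>The projection is a submersion: composed with the inverse trivialisation
  \<open>k\<close>, the base coordinates are the first component of the product, whose derivative is
  onto.\<close>

lemma horizontal_vector:
  assumes x: "x \<in> adapted c d e"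
  shows "\<exists>y. Dqc x y = w \<and> Duc x y = r"
proof -
  note a = adaptedD[OF x]
  define p where "p = chart_inv c x"
  define n where "n = prod_chart d e"
  have n: "n \<in> N" unfolding n_def N by (rule prod_chart_mem[OF d e])
  have pn: "\<pi> p \<in> fst n" using a unfolding n_def p_def by (auto simp: mem_Times_iff)
  have pM: "p \<in> carrier M" using a unfolding p_def by simp
  obtain W \<Phi> \<Theta> where W: "\<pi> p \<in> W" and t: "trivialization N M \<pi> W \<Phi> \<Theta>"
    using circle_bundle_trivialization[OF bdl smooth_map_carrier[OF sm_\<pi> pM]] by blast
  define \<zeta> where "\<zeta> = snd (\<Phi> p)"
  note fib = trivialization_fibre[OF smN t pM W, folded \<zeta>_def]
  define e2 where "e2 = circle_chart (Arg \<zeta> / (2 * pi) - 1 / 2)"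
  have e2: "e2 \<in> circle" "\<zeta> \<in> fst e2"
    unfolding e2_def by (rule circle_chart_mem, rule circle_chart_around(1)[OF fib(1)])
  have pc: "\<Theta> (\<pi> p, \<zeta>) \<in> fst c" using fib(2) a(1) unfolding p_def by simp
  obtain Q k where Q: "open Q" "(snd n (\<pi> p), snd e2 \<zeta>) \<in> Q" "smooth_on Q k" "Q \<subseteq> chart_img n \<times>
      chart_img e2"
    and k: "\<And>y \<xi>. y \<in> fst n \<Longrightarrow> \<xi> \<in> fst e2 \<Longrightarrow> (snd n y, snd e2 \<xi>) \<in> Q \<Longrightarrow> \<Theta> (y, \<xi>) \<in> fst c
        \<and> k (snd n y, snd e2 \<xi>) = snd c (\<Theta> (y, \<xi>)) \<and> \<pi> (\<Theta> (y, \<xi>)) = y"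
    using trivialization_chart[OF smN M t n pn W e2 c pc] by blast
  define z0 where "z0 = (snd n (\<pi> p), snd e2 \<zeta>)"
  have z0: "z0 \<in> Q" unfolding z0_def by (rule Q(2))
  have kz0: "k z0 = x" unfolding z0_def using k[OF pn e2(2) Q(2)] fib(2) a(2) unfolding p_def
      by simp
  have kd: "(k has_derivative frechet_derivative k (at z0)) (at z0)"
      by (rule smooth_on_has_derivative[OF Q(3) z0])
  have qu: "(qc c d (k z), uc c e (k z)) = fst z" if z: "z \<in> Q" for z
  proof -
    obtain y \<xi> where y: "y \<in> fst n" "\<xi> \<in> fst e2" "z = (snd n y, snd e2 \<xi>)" using z Q(4) by fastforce
    with k[of y \<xi>] z have "\<Theta> (y, \<xi>) \<in> fst c" "k z = snd c (\<Theta> (y, \<xi>))" "\<pi> (\<Theta> (y, \<xi>)) = y" by auto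
    then have "qc c d (k z) = snd d (fst y)" "uc c e (k z) = snd e (snd y)"
      unfolding qc_def uc_def using chart_inv_simps(1)[OF M c] by auto
    then show ?thesis unfolding y(3) n_def by (simp add: map_prod_def split_beta)
  qed
  have qd: "(qc c d has_derivative Dqc x) (at (k z0))" "(uc c e has_derivative Duc x) (at (k z0))"
    unfolding kz0 using smooth_on_has_derivative[OF qc_smooth x] smooth_on_has_derivative[OF
        uc_smooth x] by auto
  have 1: "((\<lambda>z. (qc c d (k z), uc c e (k z))) has_derivative (\<lambda>h. (Dqc x (frechet_derivative k (at
      z0) h), Duc x (frechet_derivative k (at z0) h)))) (at z0)"
    by (rule has_derivative_Pair[OF has_derivative_compose[OF kd qd(1)] has_derivative_compose[OF kd
        qd(2)]])
  have 2: "((\<lambda>z. (qc c d (k z), uc c e (k z))) has_derivative fst) (at z0)"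
    by (rule has_derivative_transform_within_open[OF has_derivative_fst[OF has_derivative_ident]
        Q(1) z0]) (simp add: qu)
  have "(\<lambda>h. (Dqc x (frechet_derivative k (at z0) h), Duc x (frechet_derivative k (at z0) h)))
      = fst"
    by (rule has_derivative_unique[OF 1 2])
  from fun_cong[OF this, of "((w, r), 0)"] show ?thesis by auto
qed

lemma adapted_linear:
  assumes x: "x \<in> adapted c d e"
  shows "linear (Dqc x)" "linear (Duc x)" "linear (theta c x)"
  using has_derivative_linear[OF smooth_on_has_derivative[OF qc_smooth x]]
    has_derivative_linear[OF smooth_on_has_derivative[OF uc_smooth x]]
    lin_fieldD(2)[OF theta_field adaptedD(3)[OF x]] by blast+

lemma adapted_frame:
  assumes x: "x \<in> adapted c d e"
  shows "\<exists>y. Dqc x y = w \<and> Duc x y = r \<and> theta c x y = s"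
proof -
  note l = adapted_linear[OF x]
  obtain v where v: "Dqc x v = 0" "Duc x v = 0" "theta c x v = 1" using vertical_vector[OF x]
      by blast
  obtain y where y: "Dqc x y = w" "Duc x y = r" using horizontal_vector[OF x] by blast
  show ?thesis
    by (rule exI[of _ "y + (s - theta c x y) *\<^sub>R v"])
      (simp add: linear_add[OF l(1)] linear_add[OF l(2)] linear_add[OF l(3)] linear_cmul[OF l(1)]
          linear_cmul[OF l(2)] linear_cmul[OF l(3)] v y)
qed

text \<open>A dimension count: \<open>L\<close> is onto a space of the dimension of
  \<open>'k\<close>, so the range of a right inverse \<open>S\<close> is the whole of
  \<open>'k\<close>, and \<open>L\<close> is injective.\<close>

lemma adapted_coframe:
  assumes x: "x \<in> adapted c d e" and y: "Dqc x y = 0" "Duc x y = 0" "theta c x y = 0"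
  shows "y = 0"
proof -
  note l = adapted_linear[OF x]
  define L where "L y = ((Dqc x y, Duc x y), theta c x y)" for y
  have lL: "linear L" unfolding L_def
    by (rule linearI) (simp_all add: linear_add[OF l(1)] linear_add[OF l(2)] linear_add[OF l(3)]
        linear_cmul[OF l(1)] linear_cmul[OF l(2)] linear_cmul[OF l(3)])
  have "surj L" unfolding surj_def L_def using adapted_frame[OF x] by (metis prod.collapse)
  then obtain S where S: "linear S" "L \<circ> S = id" using linear_surjective_right_inverse[OF lL]
      by blast
  have LS: "L (S z) = z" for z using S(2) by (metis comp_apply id_apply)
  have "inj S" by (metis LS injI)
  then have "dim (S ` UNIV) = dim (UNIV :: (('e \<times> real) \<times> real) set)"
    by (intro dim_image_eq[OF S(1)]) (simp add: span_UNIV)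
  then have "dim (range S) = DIM('k)" using dimM by simp
  then have "span (range S) = UNIV" by (simp add: dim_eq_full)
  moreover have "span (range S) = range S" using S(1)
      by (simp add: linear_subspace_image span_eq_iff)
  ultimately obtain z where z: "y = S z" by (metis UNIV_I imageE)
  have "z = 0" using LS[of z] y unfolding z[symmetric] L_def by (simp add: zero_prod_def)
  then show ?thesis using z linear_0[OF S(1)] by simp
qed

lemma local_model:
  "pp_model (adapted c d e) (qc c d) (uc c e) (theta c) (chart_img d) (comp2 B hB d) (comp1 B \<alpha> d)
      (fB \<circ> chart_inv d) fs"
proof
  show "open (adapted c d e)" by (rule adapted_open)
  show "smooth_on (adapted c d e) (qc c d)" by (rule qc_smooth)
  show "qc c d ` adapted c d e \<subseteq> chart_img d" using adaptedD(7) by blast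
  show "smooth_on (adapted c d e) (uc c e)" by (rule uc_smooth)
  show "lin_field (adapted c d e) (theta c)"
    using theta_field adapted_open adaptedD(3) unfolding lin_field_def
        by (meson smooth_on_subset subsetI)
  show "bil_field (chart_img d) (comp2 B hB d)" by (rule hB_field[OF d])
  show "smooth_on (chart_img d) (fB \<circ> chart_inv d)" using fB d unfolding smooth_fun_def by blast
  show "smooth_on UNIV fs" by (rule fs_smooth)
  show "0 < comp2 B hB d y v v" if "y \<in> chart_img d" "v \<noteq> 0" for y v by (rule hB_pos[OF d that])
  show "comp1 B \<alpha> d y (v + w) = comp1 B \<alpha> d y v + comp1 B \<alpha> d y w" if "y \<in> chart_img d" for y v w
    by (rule linear_add[OF lin_fieldD(2)[OF alpha_field[OF d] that]])
  show "comp1 B \<alpha> d y (r *\<^sub>R v) = r *\<^sub>R comp1 B \<alpha> d y v" if "y \<in> chart_img d" for y r v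
    by (rule linear_cmul[OF lin_fieldD(2)[OF alpha_field[OF d] that]])
  show "frechet_derivative (\<lambda>z. theta c z w) (at x) v - frechet_derivative (\<lambda>z. theta c z v) (at x)
      w =
        - 2 * pi * (comp1 B \<alpha> d (qc c d x) (Dqc x v) * Duc x w - Duc x v * comp1 B \<alpha> d (qc c d x)
            (Dqc x w))"
    if "x \<in> adapted c d e" for x v w by (rule dtheta_adapted[OF that])
  show "\<exists>y. Dqc x y = w \<and> Duc x y = r \<and> theta c x y = s" if "x \<in> adapted c d e" for x w r s
    by (rule adapted_frame[OF that])
  show "y = 0" if "x \<in> adapted c d e" "Dqc x y = 0" "Duc x y = 0" "theta c x y = 0" for x y
    by (rule adapted_coframe[OF that])
qed

lemma g_model:
  assumes x: "x \<in> adapted c d e"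
  shows "comp2 M g c x v w = pp_model.G (qc c d) (uc c e) (theta c) (comp2 B hB d) (fB \<circ> chart_inv
      d) fs x v w"
  unfolding g_adapted[OF x] pp_model.G_def[OF local_model] pp_model.F_def[OF local_model]
      pp_model.K_def[OF local_model] ..

end

text \<open>The range of \<open>a\<close> keeps the coordinate on the circle in \<open>[-1, 1]\<close>, where \<open>fs\<close> and its
  derivative are bounded.\<close>

lemma adapted_cover:
  assumes c: "c \<in> M" and p: "p \<in> fst c"
  shows "\<exists>d\<in>B. \<exists>a. -1 \<le> a \<and> a \<le> 0 \<and> snd c p \<in> adapted c d (circle_chart a)"
proof -
  have pM: "p \<in> carrier M" by (rule chart_in_carrier[OF c p])
  obtain d where d: "d \<in> B" "\<pi>B p \<in> fst d" using smooth_map_carrier[OF sm_\<pi>B pM]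
      unfolding carrier_def by blast
  have n: "norm (\<pi>S p) = 1" using smooth_map_carrier[OF sm_\<pi>S pM] unfolding carrier_circle by blast
  define a where "a = Arg (\<pi>S p) / (2 * pi) - 1 / 2"
  have "- pi < Arg (\<pi>S p)" "Arg (\<pi>S p) \<le> pi" using Arg_bounded by auto
  then have "-1 \<le> a" "a \<le> 0" unfolding a_def by (auto simp: field_simps)
  moreover have "snd c p \<in> adapted c d (circle_chart a)"
    using circle_chart_around(1)[OF n] d p unfolding adapted_def a_def by blast
  ultimately show ?thesis using d by blast
qed

lemma adapted_cover_img:
  assumes c: "c \<in> M" and x: "x \<in> chart_img c"
  shows "\<exists>d\<in>B. \<exists>a. -1 \<le> a \<and> a \<le> 0 \<and> x \<in> adapted c d (circle_chart a)"
  using adapted_cover[OF c] x by blast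

text \<open>Symmetry and nondegeneracy are pointwise and smoothness is local, so each is inherited
  from the local models on the adapted sets, which cover every chart.\<close>

sublocale metric_manifold M g
proof
  show "smooth_atlas M" by (rule M)
  fix c assume c: "c \<in> M"
  note cov = adapted_cover_img[OF c]
  have loc: "\<exists>X G. x \<in> X \<and> X \<subseteq> chart_img c \<and> bil_field X G \<and> nondegenerate_on X G
      \<and> (\<forall>x\<in>X. \<forall>v w. comp2 M g c x v w = G x v w)"
    if x: "x \<in> chart_img c" for x
  proof -
    obtain d a where d: "d \<in> B" and a: "x \<in> adapted c d (circle_chart a)" using cov[OF x] by blast
    note lm = local_model[OF c d circle_chart_mem[of a]]
    show ?thesis
      using a pp_model.Gfield[OF lm] pp_model.nondegenerate[OF lm] g_model[OF c d circle_chart_mem]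
          adaptedD(3)[OF c d circle_chart_mem]
      by (intro exI[of _ "adapted c d (circle_chart a)"] exI conjI) auto
  qed
  show "bil_field (chart_img c) (comp2 M g c)" unfolding bil_field_def
  proof (intro conjI ballI allI)
    show "open (chart_img c)" by (rule smooth_atlasD(2)[OF M c])
    fix x assume "x \<in> chart_img c"
    from loc[OF this] obtain X G where X: "x \<in> X" "bil_field X G" "\<And>x v w. x \<in> X \<Longrightarrow> comp2 M g c x v w
        = G x v w" by blast
    have "comp2 M g c x = G x" using X(3)[OF X(1)] by (intro ext)
    then show "bilinear (comp2 M g c x)" using bil_fieldD(2)[OF X(2,1)] by simp
    show "comp2 M g c x v w = comp2 M g c x w v" for v w
        using bil_fieldD(3)[OF X(2,1)] X(3)[OF X(1)] by simp
  next
    fix v w show "smooth_on (chart_img c) (\<lambda>x. comp2 M g c x v w)"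
    proof (rule smooth_on_local)
      fix x assume "x \<in> chart_img c"
      from loc[OF this] obtain X G where X: "x \<in> X" "bil_field X G" "\<And>x v w. x \<in> X
          \<Longrightarrow> comp2 M g c x v w = G x v w" by blast
      have "smooth_on X (\<lambda>x. comp2 M g c x v w)"
        by (rule smooth_on_cong[OF bil_fieldD(1,4)[OF X(2)]]) (simp add: X(3))
      then show "\<exists>T. open T \<and> x \<in> T \<and> smooth_on T (\<lambda>x. comp2 M g c x v w)"
          using X(1) bil_fieldD(1)[OF X(2)] by blast
    qed
  qed
  show "nondegenerate_on (chart_img c) (comp2 M g c)" unfolding nondegenerate_on_def
  proof (intro ballI allI impI)
    fix x z assume "x \<in> chart_img c" and z: "\<forall>y. comp2 M g c x z y = 0"
    from loc[OF this(1)] obtain X G where X: "x \<in> X" "nondegenerate_on X G" "\<And>x v w. x \<in> X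
        \<Longrightarrow> comp2 M g c x v w = G x v w" by blast
    then show "z = 0" using z unfolding nondegenerate_on_def by simp
  qed
qed

end

section \<open>Bounds from compactness\<close>

text \<open>Compactness of the base in the form needed below: a locally valid bound that may be
  enlarged holds globally with one constant. It is used for the function on \<open>B\<close>, for
  the form \<alpha>, and, by contradiction, to find an accumulation point.\<close>

lemma compact_local_bound:
  fixes B :: "('b, 'e::euclidean_space) atlas" and P :: "'b \<Rightarrow> real \<Rightarrow> bool"
  assumes B: "smooth_atlas B" and cB: "compact_space (mtop B)"
    and loc: "\<And>b. b \<in> carrier B \<Longrightarrow> \<exists>U C. openin (mtop B) U \<and> b \<in> U \<and> (\<forall>b'\<in>U. P b' C)"
    and mono: "\<And>b C C'. P b C \<Longrightarrow> C \<le> C' \<Longrightarrow> P b C'"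
  shows "\<exists>C\<ge>0. \<forall>b\<in>carrier B. P b C"
proof -
  define \<U> where "\<U> = {U. openin (mtop B) U \<and> (\<exists>C. \<forall>b\<in>U. P b C)}"
  have cov: "carrier B \<subseteq> \<Union>\<U>"
  proof
    fix b assume "b \<in> carrier B"
    from loc[OF this] obtain U C where "openin (mtop B) U" "b \<in> U" "\<forall>b'\<in>U. P b' C" by blast
    then show "b \<in> \<Union>\<U>" unfolding \<U>_def by blast
  qed
  have "compactin (mtop B) (carrier B)" using cB unfolding compact_space_def topspace_mtop[OF B] .
  moreover have "\<forall>U\<in>\<U>. openin (mtop B) U" unfolding \<U>_def by blast
  ultimately obtain \<F> where \<F>: "finite \<F>" "\<F> \<subseteq> \<U>" "carrier B \<subseteq> \<Union>\<F>"
    using cov unfolding compactin_def by meson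
  have "\<forall>U\<in>\<F>. \<exists>C. \<forall>b\<in>U. P b C" using \<F>(2) unfolding \<U>_def by blast
  then obtain C where C: "\<forall>U\<in>\<F>. \<forall>b\<in>U. P b (C U)" by metis
  define D where "D = Max (insert 0 (C ` \<F>))"
  have "0 \<le> D" unfolding D_def using \<F>(1) by simp
  moreover have "P b D" if b: "b \<in> carrier B" for b
  proof -
    obtain U where U: "U \<in> \<F>" "b \<in> U" using b \<F>(3) by blast
    have "C U \<le> D" unfolding D_def using \<F>(1) U(1) by simp
    then show ?thesis using mono[of b "C U" D] C U by simp
  qed
  ultimately show ?thesis by blast
qed

text \<open>The closed coordinate ball is compact, so chart expressions are bounded on it, while
  \<open>U\<close> is an open neighbourhood as \<open>compact_local_bound\<close> demands.\<close>

lemma chart_neighbourhood: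
  assumes B: "smooth_atlas B" and d: "d \<in> B" "b \<in> fst d"
  shows "\<exists>r>0. cball (snd d b) r \<subseteq> chart_img d \<and> (\<exists>U. openin (mtop B) U \<and> b \<in> U \<and> (\<forall>b'\<in>U. b' \<in> fst d
      \<and> snd d b' \<in> cball (snd d b) r))"
proof -
  obtain r where r: "r > 0" "cball (snd d b) r \<subseteq> chart_img d"
    using smooth_atlasD(2)[OF B d(1)] d(2) open_contains_cball by (metis imageI)
  have sub: "ball (snd d b) r \<subseteq> chart_img d" using r(2) by auto
  have "openin (mtop B) (chart_inv d ` ball (snd d b) r)"
      by (rule chart_inv_image_open[OF B d(1) open_ball sub])
  moreover have "b \<in> chart_inv d ` ball (snd d b) r"
    by (rule image_eqI[of _ _ "snd d b"]) (use chart_inv_simps(1)[OF B d] r(1) in auto)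
  moreover have "\<forall>b'\<in>chart_inv d ` ball (snd d b) r. b' \<in> fst d \<and> snd d b' \<in> cball (snd d b) r"
  proof
    fix b' assume "b' \<in> chart_inv d ` ball (snd d b) r"
    then obtain x where x: "x \<in> ball (snd d b) r" "b' = chart_inv d x" by blast
    then have "x \<in> chart_img d" using sub by blast
    then show "b' \<in> fst d \<and> snd d b' \<in> cball (snd d b) r" using chart_inv_simps(2,3)[OF B d(1)] x
        by simp
  qed
  ultimately show ?thesis using r by blast
qed

text \<open>A Gronwall estimate through the logarithm of \<open>1 + (s t)\<^sup>2\<close>, which
  avoids differentiating \<open>\<bar>s t\<bar>\<close>: since \<open>2 * \<bar>s\<bar>\<close> is
  at most \<open>1 + s\<^sup>2\<close>, its derivative is at most \<open>4 * L\<close>.\<close>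

lemma linear_growth_bounded:
  fixes s :: "real \<Rightarrow> real"
  assumes t0: "a < t0" "t0 < b" and L: "L \<ge> 0"
    and s: "\<And>t. t \<in> {a<..<b} \<Longrightarrow> \<exists>D. (s has_real_derivative D) (at t) \<and> \<bar>D\<bar> \<le> L * (1 + \<bar>s t\<bar>)"
  shows "\<exists>C. \<forall>t\<in>{t0..<b}. \<bar>s t\<bar> \<le> C"
proof -
  define \<phi> where "\<phi> t = ln (1 + (s t)\<^sup>2)" for t
  have pos: "1 + (s t)\<^sup>2 > 0" for t by (simp add: add_pos_nonneg)
  have "\<forall>t. \<exists>D. t \<in> {a<..<b} \<longrightarrow> (\<phi> has_real_derivative D) (at t) \<and> D \<le> 4 * L"
  proof
    fix t
    show "\<exists>D. t \<in> {a<..<b} \<longrightarrow> (\<phi> has_real_derivative D) (at t) \<and> D \<le> 4 * L"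
    proof (cases "t \<in> {a<..<b}")
      case True
      then obtain D where D: "(s has_real_derivative D) (at t)" "\<bar>D\<bar> \<le> L * (1 + \<bar>s t\<bar>)" using s
          by blast
      have "(\<phi> has_real_derivative 2 * s t * D / (1 + (s t)\<^sup>2)) (at t)"
        unfolding \<phi>_def using pos[of t] by (auto intro!: derivative_eq_intros D simp:
            power2_eq_square field_simps)
      moreover have "2 * s t * D / (1 + (s t)\<^sup>2) \<le> 4 * L"
      proof -
        have "2 * s t * D \<le> 2 * (\<bar>s t\<bar> * \<bar>D\<bar>)" using abs_ge_self[of "s t * D"]
            by (simp add: abs_mult)
        also have "\<dots> \<le> 2 * (\<bar>s t\<bar> * (L * (1 + \<bar>s t\<bar>)))" using D(2) by (intro mult_left_mono) auto
        also have "\<dots> = L * (2 * \<bar>s t\<bar> + 2 * (s t)\<^sup>2)"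
            by (simp add: algebra_simps power2_eq_square flip: abs_mult)
        also have "\<dots> \<le> L * (4 * (1 + (s t)\<^sup>2))"
        proof (rule mult_left_mono[OF _ L])
          have "0 \<le> (\<bar>s t\<bar> - 1)\<^sup>2" by simp
          then have "2 * \<bar>s t\<bar> \<le> 1 + (s t)\<^sup>2"
              by (simp add: power2_eq_square algebra_simps flip: abs_mult)
          then show "2 * \<bar>s t\<bar> + 2 * (s t)\<^sup>2 \<le> 4 * (1 + (s t)\<^sup>2)" using zero_le_power2[of "s t"]
              by (simp add: algebra_simps)
        qed
        also have "\<dots> = 4 * L * (1 + (s t)\<^sup>2)" by simp
        finally show ?thesis by (simp only: pos_divide_le_eq[OF pos])
      qed
      ultimately show ?thesis by blast
    next
      case False
      then show ?thesis by blast
    qed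
  qed
  then obtain D where D: "\<And>t. t \<in> {a<..<b} \<Longrightarrow> (\<phi> has_real_derivative D t) (at t)" "\<And>t. t \<in> {a<..<b}
      \<Longrightarrow> D t \<le> 4 * L" by metis
  have "\<bar>s t\<bar> \<le> exp (\<phi> t0 + 4 * L * (b - t0))" if t: "t \<in> {t0..<b}" for t
  proof -
    have "\<phi> t \<le> \<phi> t0 + 4 * L * (t - t0)"
    proof (cases "t = t0")
      case False
      then have "t0 < t" using t by auto
      then obtain z where z: "t0 < z" "z < t" "\<phi> t - \<phi> t0 = (t - t0) * D z"
        using MVT2[of t0 t \<phi> D] D(1) t t0 by auto
      have "(t - t0) * D z \<le> (t - t0) * (4 * L)" using D(2)[of z] z t t0
          by (intro mult_left_mono) auto
      then show ?thesis using z(3) by (simp add: mult.commute)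
    qed simp
    also have "\<dots> \<le> \<phi> t0 + 4 * L * (b - t0)" using t L by (simp add: mult_left_mono)
    finally have "exp (\<phi> t) \<le> exp (\<phi> t0 + 4 * L * (b - t0))" by simp
    moreover have "exp (\<phi> t) = 1 + (s t)\<^sup>2" unfolding \<phi>_def using pos by simp
    moreover have "\<bar>s t\<bar> \<le> 1 + (s t)\<^sup>2"
    proof -
      have "0 \<le> (\<bar>s t\<bar> - 1)\<^sup>2" by simp
      then have "2 * \<bar>s t\<bar> \<le> 1 + (s t)\<^sup>2"
          by (simp add: power2_eq_square algebra_simps flip: abs_mult)
      then show ?thesis by linarith
    qed
    ultimately show ?thesis by linarith
  qed
  then show ?thesis by blast
qed

context pp_bundle
begin

lemma fB_bounded:
  assumes cB: "compact_space (mtop B)"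
  shows "\<exists>C\<ge>0. \<forall>b\<in>carrier B. \<bar>fB b\<bar> \<le> C"
proof (rule compact_local_bound[OF B cB])
  fix b assume "b \<in> carrier B"
  then obtain d where d: "d \<in> B" "b \<in> fst d" unfolding carrier_def by blast
  obtain r U where r: "cball (snd d b) r \<subseteq> chart_img d"
      and U: "openin (mtop B) U" "b \<in> U" "\<And>b'. b' \<in> U \<Longrightarrow> b' \<in> fst d \<and> snd d b' \<in> cball (snd d b) r"
    using chart_neighbourhood[OF B d] by blast
  have "smooth_on (chart_img d) (fB \<circ> chart_inv d)" using fB d unfolding smooth_fun_def by blast
  then obtain C where C: "\<And>x. x \<in> cball (snd d b) r \<Longrightarrow> norm ((fB \<circ> chart_inv d) x) \<le> C"
    using continuous_on_compact_bound[OF compact_cball continuous_on_subset[OF smooth_on_continuous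
        r]] by metis
  have "\<bar>fB b'\<bar> \<le> C" if "b' \<in> U" for b'
    using C[of "snd d b'"] U(3)[OF that] chart_inv_simps(1)[OF B d(1)] by simp
  then show "\<exists>U C. openin (mtop B) U \<and> b \<in> U \<and> (\<forall>b'\<in>U. \<bar>fB b'\<bar> \<le> C)" using U by blast
qed simp

text \<open>Both sides are values of tensors on the same vector, so the inequality at a point does
  not depend on the chart. It is proved in one chart around each point, with the constant quantified
  over all charts, and transported by \<open>chart_vec_change\<close>.\<close>

lemma alpha_bounded:
  assumes cB: "compact_space (mtop B)"
  shows "\<exists>C\<ge>0. \<forall>d\<in>B. \<forall>y\<in>chart_img d. \<forall>v. (comp1 B \<alpha> d y v)\<^sup>2 \<le> C * comp2 B hB d y v v"
proof -
  have nn: "comp2 B hB d y v v \<ge> 0" if d: "d \<in> B" and y: "y \<in> chart_img d" for d y v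
    using hB_pos[OF d y, of v] bilinear_lzero[OF bil_fieldD(2)[OF hB_field[OF d] y]]
    by (cases "v = 0") (auto intro: less_imp_le)
  have "\<exists>C\<ge>0. \<forall>b\<in>carrier B. \<forall>d\<in>B. b \<in> fst d \<longrightarrow> (\<forall>v. (comp1 B \<alpha> d (snd d b) v)\<^sup>2
      \<le> C * comp2 B hB d (snd d b) v v)"
  proof (rule compact_local_bound[OF B cB])
    fix b assume "b \<in> carrier B"
    then obtain d0 where d0: "d0 \<in> B" "b \<in> fst d0" unfolding carrier_def by blast
    obtain r U where r: "cball (snd d0 b) r \<subseteq> chart_img d0"
        and U: "openin (mtop B) U" "b \<in> U" "\<And>b'. b' \<in> U \<Longrightarrow> b' \<in> fst d0
        \<and> snd d0 b' \<in> cball (snd d0 b) r"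
      using chart_neighbourhood[OF B d0] by blast
    obtain L where L: "L \<ge> 0" "\<And>x v. x \<in> cball (snd d0 b) r \<Longrightarrow> norm (comp1 B \<alpha> d0 x v) \<le> L * norm v"
      using lin_field_bound[OF alpha_field[OF d0(1)] compact_cball r] by blast
    note hf = hB_field[OF d0(1)]
    have "\<exists>m>0. \<forall>x\<in>cball (snd d0 b) r. \<forall>v. m * (norm v)\<^sup>2 \<le> comp2 B hB d0 x v v"
    proof (rule quadratic_lower_bound[OF compact_cball])
      have "smooth_on (chart_img d0 \<times> UNIV) (\<lambda>z. comp2 B hB d0 (fst z) (snd z) (snd z))"
        by (rule smooth_on_quadratic[OF bil_fieldD(1)[OF hf] bil_fieldD(2)[OF hf] bil_fieldD(4)[OF
            hf]])
      from smooth_on_continuous[OF this]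
      show "continuous_on (cball (snd d0 b) r \<times> UNIV) (\<lambda>z. comp2 B hB d0 (fst z) (snd z) (snd z))"
        by (rule continuous_on_subset) (use r in blast)
      show "0 < comp2 B hB d0 x v v" if "x \<in> cball (snd d0 b) r" "v \<noteq> 0" for x v
        using hB_pos[OF d0(1) _ that(2)] that(1) r by blast
      show "comp2 B hB d0 x (k *\<^sub>R v) (k *\<^sub>R v) = k\<^sup>2 * comp2 B hB d0 x v v"
          if "x \<in> cball (snd d0 b) r" for x k v
      proof -
        have "x \<in> chart_img d0" using that r by blast
        note b = bil_fieldD(2)[OF hf this]
        show ?thesis by (simp add: bilinear_lmul[OF b] bilinear_rmul[OF b] power2_eq_square)
      qed
    qed
    then obtain m where m: "m > 0" "\<And>x v. x \<in> cball (snd d0 b) r \<Longrightarrow> m * (norm v)\<^sup>2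
        \<le> comp2 B hB d0 x v v" by blast
    \<comment> \<open>Here \<open>L\<close> bounds \<alpha> by the Euclidean norm in the chart
      \<open>d0\<close>, and \<open>m\<close> bounds the metric from below by its square.\<close>
    have "(comp1 B \<alpha> d (snd d b') v)\<^sup>2 \<le> L\<^sup>2 / m * comp2 B hB d (snd d b') v v" if b': "b' \<in> U"
        and d: "d \<in> B" "b' \<in> fst d" for b' d v
    proof -
      have b0: "b' \<in> fst d0" "snd d0 b' \<in> cball (snd d0 b) r" using U(3)[OF b'] by auto
      define v' where "v' = frechet_derivative (snd d0 \<circ> chart_inv d) (at (snd d b')) v"
      have cv: "chart_vec B d b' v = chart_vec B d0 b' v'"
        unfolding v'_def by (rule chart_vec_change[OF B d d0(1) b0(1)])
      have e: "comp1 B \<alpha> d (snd d b') v = comp1 B \<alpha> d0 (snd d0 b') v'" "comp2 B hB d (snd d b') v v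
          = comp2 B hB d0 (snd d0 b') v' v'"
        unfolding comp1_def comp2_def chart_inv_simps(1)[OF B d] chart_inv_simps(1)[OF B d0(1)
            b0(1)] cv by auto
      have "(comp1 B \<alpha> d0 (snd d0 b') v')\<^sup>2 \<le> (L * norm v')\<^sup>2"
        using L(2)[OF b0(2), of v'] by (metis abs_ge_zero power2_abs power_mono real_norm_def)
      also have "\<dots> = L\<^sup>2 / m * (m * (norm v')\<^sup>2)" using m(1) by (simp add: power_mult_distrib)
      also have "\<dots> \<le> L\<^sup>2 / m * comp2 B hB d0 (snd d0 b') v' v'" using m b0(2)
          by (intro mult_left_mono) auto
      finally show ?thesis unfolding e .
    qed
    then show "\<exists>U C. openin (mtop B) U \<and> b \<in> U \<and> (\<forall>b'\<in>U. \<forall>d\<in>B. b' \<in> fst d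
        \<longrightarrow> (\<forall>v. (comp1 B \<alpha> d (snd d b') v)\<^sup>2 \<le> C * comp2 B hB d (snd d b') v v))"
      using U(1,2) by blast
  next
    fix b C C' assume P: "\<forall>d\<in>B. b \<in> fst d \<longrightarrow> (\<forall>v. (comp1 B \<alpha> d (snd d b) v)\<^sup>2
        \<le> C * comp2 B hB d (snd d b) v v)" and "C \<le> (C'::real)"
    show "\<forall>d\<in>B. b \<in> fst d \<longrightarrow> (\<forall>v. (comp1 B \<alpha> d (snd d b) v)\<^sup>2 \<le> C' * comp2 B hB d (snd d b) v v)"
    proof (intro ballI impI allI)
      fix d v assume d: "d \<in> B" "b \<in> fst d"
      have "C * comp2 B hB d (snd d b) v v \<le> C' * comp2 B hB d (snd d b) v v"
        using \<open>C \<le> C'\<close> nn[OF d(1), of "snd d b" v] d(2) by (intro mult_right_mono) auto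
      then show "(comp1 B \<alpha> d (snd d b) v)\<^sup>2 \<le> C' * comp2 B hB d (snd d b) v v" using P d
          by (meson order_trans)
    qed
  qed
  then obtain C where "C \<ge> 0" "\<And>b d v. b \<in> carrier B \<Longrightarrow> d \<in> B \<Longrightarrow> b \<in> fst d
      \<Longrightarrow> (comp1 B \<alpha> d (snd d b) v)\<^sup>2 \<le> C * comp2 B hB d (snd d b) v v" by blast
  note C = this
  show ?thesis
  proof (intro exI[of _ C] conjI ballI allI C(1))
    fix d y v assume d: "d \<in> B" and "y \<in> chart_img d"
    then obtain b where b: "b \<in> fst d" "y = snd d b" by blast
    show "(comp1 B \<alpha> d y v)\<^sup>2 \<le> C * comp2 B hB d y v v"
      unfolding b(2) by (rule C(2)[OF chart_in_carrier[OF d b(1)] d b(1)])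
  qed
qed

lemma fs_bounded: "\<exists>C\<ge>0. \<forall>t\<in>{-1..1}. \<bar>fs t\<bar> \<le> C \<and> \<bar>frechet_derivative fs (at t) 1\<bar> \<le> C"
proof -
  have fs: "smooth_on UNIV fs" by (rule fs_smooth)
  obtain C1 where C1: "C1 \<ge> 0" "\<And>t. t \<in> {-1..1} \<Longrightarrow> norm (fs t) \<le> C1"
    using continuous_on_compact_bound[OF compact_Icc continuous_on_subset[OF smooth_on_continuous[OF
        fs] subset_UNIV]] by metis
  obtain C2 where C2: "C2 \<ge> 0" "\<And>t. t \<in> {-1..1} \<Longrightarrow> norm (frechet_derivative fs (at t) 1) \<le> C2"
    using continuous_on_compact_bound[OF compact_Icc continuous_on_subset[OF smooth_on_continuous[OF
        smooth_on_derivative[OF fs]] subset_UNIV]] by metis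
  show ?thesis using C1 C2 by (intro exI[of _ "max C1 C2"]) (auto simp: le_max_iff_disj)
qed

text \<open>The compactness of the total space that is needed, assembled from that of the base, of
  the circle factor and of the fibre. The limit on the fibre is taken in a trivialisation around the
  limit on \<open>N\<close>.\<close>

lemma curve_accumulates:
  assumes cB: "compact_space (mtop B)" and ab: "a < b" and \<gamma>: "\<And>t. t \<in> {a<..<b} \<Longrightarrow> \<gamma> t \<in> carrier M"
  shows "\<exists>c\<in>M. \<exists>x0\<in>chart_img c. \<forall>\<epsilon>>0. \<exists>t. t \<in> {a<..<b} \<and> b - t < \<epsilon> \<and> \<gamma> t \<in> fst c
      \<and> dist (snd c (\<gamma> t)) x0 < \<epsilon>"
proof -
  have "\<exists>b0\<in>carrier B. \<forall>U. openin (mtop B) U \<longrightarrow> b0 \<in> U \<longrightarrow> (\<forall>\<epsilon>>0. \<exists>t\<in>{a<..<b}. b - t < \<epsilon>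
      \<and> \<pi>B (\<gamma> t) \<in> U)"
  proof (rule ccontr)
    assume neg: "\<not> ?thesis"
    \<comment> \<open>If every point of \<open>B\<close> had a neighbourhood that the curve avoids
      at late times, then \<open>1 / (b - t)\<close> would be locally bounded in terms of the
      position, hence bounded; but it grows beyond all limits as \<open>t\<close> tends to
      \<open>b\<close>.\<close>
    have "\<exists>C\<ge>0. \<forall>b0\<in>carrier B. \<forall>t\<in>{a<..<b}. \<pi>B (\<gamma> t) = b0 \<longrightarrow> 1 / (b - t) \<le> C"
    proof (rule compact_local_bound[OF B cB])
      fix b0 assume "b0 \<in> carrier B"
      then obtain U \<epsilon> where U: "openin (mtop B) U" "b0 \<in> U" and \<epsilon>: "\<epsilon> > 0" "\<And>t. t \<in> {a<..<b}
          \<Longrightarrow> b - t < \<epsilon> \<Longrightarrow> \<pi>B (\<gamma> t) \<notin> U"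
        using neg by meson
      have "1 / (b - t) \<le> 1 / \<epsilon>" if "t \<in> {a<..<b}" "\<pi>B (\<gamma> t) \<in> U" for t
      proof -
        have "\<epsilon> \<le> b - t" using \<epsilon>(2)[OF that(1)] that(2) by (meson not_less)
        then show ?thesis using \<epsilon>(1) by (intro divide_left_mono) auto
      qed
      then show "\<exists>U C. openin (mtop B) U \<and> b0 \<in> U \<and> (\<forall>b'\<in>U. \<forall>t\<in>{a<..<b}. \<pi>B (\<gamma> t) = b' \<longrightarrow> 1 / (b - t)
          \<le> C)"
        using U by (intro exI[of _ U] exI[of _ "1 / \<epsilon>"]) auto
    qed (meson order_trans)
    then obtain C where C: "C \<ge> 0" "\<And>t. t \<in> {a<..<b} \<Longrightarrow> 1 / (b - t) \<le> C"
      using smooth_map_carrier[OF sm_\<pi>B \<gamma>] by blast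
    \<comment> \<open>At time \<open>b - m\<close> the curve is defined and
      \<open>1 / (b - t)\<close> is at least \<open>C + 1\<close>.\<close>
    define m where "m = min ((b - a) / 2) (1 / (C + 1))"
    define t where "t = b - m"
    have m: "m > 0" unfolding m_def using ab C(1) by simp
    have "m \<le> (b - a) / 2" unfolding m_def by (rule min.cobounded1)
    also have "\<dots> < b - a" using ab by simp
    finally have "m < b - a" .
    then have t: "t \<in> {a<..<b}" unfolding t_def using m by simp
    have "b - t \<le> 1 / (C + 1)" unfolding t_def m_def by simp
    moreover have "b - t > 0" unfolding t_def using m by simp
    ultimately have "1 / (1 / (C + 1)) \<le> 1 / (b - t)" by (intro divide_left_mono) (use C(1) in auto)
    then show False using C(2)[OF t] C(1) by simp
  qed
  then obtain b0 where b0: "b0 \<in> carrier B" and acc0: "\<forall>U. openin (mtop B) U \<longrightarrow> b0 \<in> U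
      \<longrightarrow> (\<forall>\<epsilon>>0. \<exists>t\<in>{a<..<b}. b - t < \<epsilon> \<and> \<pi>B (\<gamma> t) \<in> U)"
    by (rule bexE)
  note acc = acc0[rule_format]
  obtain d where d: "d \<in> B" "b0 \<in> fst d" using b0 unfolding carrier_def by blast
  have dimg: "snd d b0 \<in> chart_img d" using d by blast
  \<comment> \<open>Shrinking coordinate balls turn accumulation at \<open>b0\<close> into a
    sequence of times, so that the remaining limits can be taken by passing to subsequences.\<close>
  have "\<exists>t\<in>{a<..<b}. b - t < 1 / real (Suc n) \<and> \<pi>B (\<gamma> t) \<in> fst d
      \<and> dist (snd d (\<pi>B (\<gamma> t))) (snd d b0) < 1 / real (Suc n)" for n
  proof -
    define V where "V = ball (snd d b0) (1 / real (Suc n)) \<inter> chart_img d"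
    have V: "open V" "V \<subseteq> chart_img d" unfolding V_def using smooth_atlasD(2)[OF B d(1)] by auto
    have "b0 \<in> chart_inv d ` V"
      by (rule image_eqI[of _ _ "snd d b0"]) (use chart_inv_simps(1)[OF B d] dimg in \<open>auto simp:
          V_def\<close>)
    from acc[OF chart_inv_image_open[OF B d(1) V] this, of "1 / real (Suc n)"]
    obtain t where t: "t \<in> {a<..<b}" "b - t < 1 / real (Suc n)" "\<pi>B (\<gamma> t) \<in> chart_inv d ` V" by auto
    then obtain x where x: "x \<in> V" "\<pi>B (\<gamma> t) = chart_inv d x" by blast
    then have "\<pi>B (\<gamma> t) \<in> fst d" "snd d (\<pi>B (\<gamma> t)) = x"
        using V(2) chart_inv_simps(2,3)[OF B d(1), of x] by auto
    then show ?thesis using t x(1) unfolding V_def by (auto simp: dist_commute)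
  qed
  then obtain \<tau> where \<tau>: "\<And>n::nat. \<tau> n \<in> {a<..<b}" "\<And>n. b - \<tau> n < 1 / real (Suc n)" "\<And>n. \<pi>B (\<gamma> (\<tau>
      n)) \<in> fst d"
    "\<And>n. dist (snd d (\<pi>B (\<gamma> (\<tau> n)))) (snd d b0) < 1 / real (Suc n)" by metis
  have l0: "(\<lambda>n. 1 / real (Suc n)) \<longlonglongrightarrow> 0" using LIMSEQ_inverse_real_of_nat
      by (simp add: inverse_eq_divide)
  have l\<tau>: "(\<lambda>n. b - \<tau> n) \<longlonglongrightarrow> 0"
    by (rule tendsto_sandwich[OF _ _ tendsto_const l0]) (use \<tau>(1,2) in \<open>auto intro!:
        always_eventually less_imp_le\<close>)
  have lB: "(\<lambda>n. snd d (\<pi>B (\<gamma> (\<tau> n)))) \<longlonglongrightarrow> snd d b0"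
    by (subst tendsto_dist_iff, rule tendsto_sandwich[OF _ _ tendsto_const l0]) (use \<tau>(4) in \<open>auto
        intro!: always_eventually less_imp_le\<close>)
  have \<gamma>M: "\<gamma> (\<tau> n) \<in> carrier M" for n by (rule \<gamma>[OF \<tau>(1)])
  have nS: "norm (\<pi>S (\<gamma> (\<tau> n))) = 1" for n
    using smooth_map_carrier[OF sm_\<pi>S \<gamma>M] unfolding carrier_circle by blast
  obtain z0 r1 where z0: "norm (z0::complex) = 1" and r1: "strict_mono r1"
      and lS: "(\<lambda>n. \<pi>S (\<gamma> (\<tau> (r1 n)))) \<longlonglongrightarrow> z0"
  proof -
    have "\<forall>n. \<pi>S (\<gamma> (\<tau> n)) \<in> sphere 0 1" using nS by simp
    with compact_sphere[of "0::complex" 1] obtain l r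
        where "l \<in> sphere 0 1" "strict_mono r" "((\<lambda>n. \<pi>S (\<gamma> (\<tau> n))) \<circ> r) \<longlonglongrightarrow> l"
      unfolding compact_def by meson
    then show ?thesis using that[of l r] by (simp add: o_def)
  qed
  define s1 where "s1 n = \<gamma> (\<tau> (r1 n))" for n
  define e where "e = circle_chart (Arg z0 / (2 * pi) - 1 / 2)"
  have e: "e \<in> circle" "z0 \<in> fst e" unfolding e_def
      by (rule circle_chart_mem, rule circle_chart_around(1)[OF z0])
  have ev_e: "\<forall>\<^sub>F n in sequentially. \<pi>S (s1 n) \<in> fst e" and le: "(\<lambda>n. snd e (\<pi>S (s1 n))) \<longlonglongrightarrow> snd e z0"
    unfolding e_def snd_conv s1_def using circle_coord_tendsto[OF z0 nS lS] by auto
  define y0 where "y0 = (b0, z0)"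
  define n0 where "n0 = prod_chart d e"
  have n0: "n0 \<in> N" unfolding n0_def N by (rule prod_chart_mem[OF d(1) e(1)])
  have y0: "y0 \<in> fst n0" unfolding y0_def n0_def using d e by auto
  obtain W \<Phi> \<Theta> where W: "y0 \<in> W" and t: "trivialization N M \<pi> W \<Phi> \<Theta>"
    using circle_bundle_trivialization[OF bdl chart_in_carrier[OF n0 y0]] by blast
  have ln: "(\<lambda>n. snd n0 (\<pi> (s1 n))) \<longlonglongrightarrow> snd n0 y0"
  proof -
    have "(\<lambda>n. (snd d (\<pi>B (s1 n)), snd e (\<pi>S (s1 n)))) \<longlonglongrightarrow> (snd d b0, snd e z0)"
    proof (rule tendsto_Pair[OF _ le])
      show "(\<lambda>n. snd d (\<pi>B (s1 n))) \<longlonglongrightarrow> snd d b0"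
        unfolding s1_def using LIMSEQ_subseq_LIMSEQ[OF lB r1] by (simp add: o_def)
    qed
    then show ?thesis unfolding n0_def y0_def by (simp add: map_prod_def split_beta)
  qed
  have ev_n: "\<forall>\<^sub>F n in sequentially. \<pi> (s1 n) \<in> fst n0"
    using ev_e by eventually_elim (use \<tau>(3) in \<open>auto simp: n0_def s1_def mem_Times_iff\<close>)
  have "open (snd n0 ` (W \<inter> fst n0))" using t n0 unfolding trivialization_def openin_mtop[OF smN]
      by blast
  from topological_tendstoD[OF ln this] have ev_W: "\<forall>\<^sub>F n in sequentially. \<pi> (s1 n) \<in> W"
  proof (rule eventually_rev_mp)
    show "snd n0 y0 \<in> snd n0 ` (W \<inter> fst n0)" using W y0 by blast
    show "\<forall>\<^sub>F n in sequentially. snd n0 (\<pi> (s1 n)) \<in> snd n0 ` (W \<inter> fst n0) \<longrightarrow> \<pi> (s1 n) \<in> W"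
      using ev_n
    proof eventually_elim
      case (elim n)
      show ?case
      proof
        assume "snd n0 (\<pi> (s1 n)) \<in> snd n0 ` (W \<inter> fst n0)"
        then obtain y where "y \<in> W" "y \<in> fst n0" "snd n0 (\<pi> (s1 n)) = snd n0 y" by blast
        then show "\<pi> (s1 n) \<in> W" using inj_onD[OF smooth_atlasD(1)[OF smN n0] _ elim] by metis
      qed
    qed
  qed
  then obtain n1 where n1: "\<And>n. n \<ge> n1 \<Longrightarrow> \<pi> (s1 n) \<in> W" unfolding eventually_sequentially by blast
  have s1M: "s1 n \<in> carrier M" for n unfolding s1_def by (rule \<gamma>M)
  \<comment> \<open>\<Phi> is meaningful only over \<open>W\<close>. The shift by \<open>n1\<close>
    ensures that every term, and not merely almost every one, has a fibre coordinate of modulus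
    1.\<close>
  define \<zeta> where "\<zeta> n = snd (\<Phi> (s1 (n + n1)))" for n
  have n\<zeta>: "norm (\<zeta> n) = 1" and \<Theta>\<zeta>: "\<Theta> (\<pi> (s1 (n + n1)), \<zeta> n) = s1 (n + n1)" for n
    unfolding \<zeta>_def using trivialization_fibre[OF smN t s1M n1] by auto
  obtain \<zeta>0 r2 where \<zeta>0: "norm (\<zeta>0::complex) = 1" and r2: "strict_mono r2"
      and l\<zeta>: "(\<lambda>n. \<zeta> (r2 n)) \<longlonglongrightarrow> \<zeta>0"
  proof -
    have "\<forall>n. \<zeta> n \<in> sphere 0 1" using n\<zeta> by simp
    with compact_sphere[of "0::complex" 1] obtain l r
        where "l \<in> sphere 0 1" "strict_mono r" "(\<zeta> \<circ> r) \<longlonglongrightarrow> l"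
      unfolding compact_def by meson
    then show ?thesis using that[of l r] by (simp add: o_def)
  qed
  define e2 where "e2 = circle_chart (Arg \<zeta>0 / (2 * pi) - 1 / 2)"
  have e2: "e2 \<in> circle" "\<zeta>0 \<in> fst e2" unfolding e2_def
      by (rule circle_chart_mem, rule circle_chart_around(1)[OF \<zeta>0])
  have ev_e2: "\<forall>\<^sub>F n in sequentially. \<zeta> (r2 n) \<in> fst e2"
      and le2: "(\<lambda>n. snd e2 (\<zeta> (r2 n))) \<longlonglongrightarrow> snd e2 \<zeta>0"
    unfolding e2_def snd_conv using circle_coord_tendsto[OF \<zeta>0 n\<zeta> l\<zeta>] by auto
  have "\<Theta> (y0, \<zeta>0) \<in> carrier M"
  proof -
    have "(y0, \<zeta>0) \<in> carrier (prod_atlas (restrict_atlas N W) circle)"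
      unfolding carrier_prod_atlas carrier_restrict
          using W chart_in_carrier[OF n0 y0] chart_in_carrier[OF e2] by auto
    then show ?thesis
      using smooth_map_carrier[of _ "restrict_atlas M (\<pi> -` W)" \<Theta>] t
          unfolding trivialization_def carrier_restrict by blast
  qed
  then obtain c where c: "c \<in> M" "\<Theta> (y0, \<zeta>0) \<in> fst c" unfolding carrier_def by blast
  obtain Q k where Q: "open Q" "(snd n0 y0, snd e2 \<zeta>0) \<in> Q" "smooth_on Q k"
    and k: "\<And>y \<xi>. y \<in> fst n0 \<Longrightarrow> \<xi> \<in> fst e2 \<Longrightarrow> (snd n0 y, snd e2 \<xi>) \<in> Q \<Longrightarrow> \<Theta> (y, \<xi>) \<in> fst c
        \<and> k (snd n0 y, snd e2 \<xi>) = snd c (\<Theta> (y, \<xi>))"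
    using trivialization_chart[OF smN M t n0 y0 W e2 c] by blast
  define i where "i n = r2 n + n1" for n
  have i: "filterlim i sequentially sequentially"
    unfolding i_def by (rule filterlim_subseq) (use r2 in \<open>auto simp: strict_mono_def\<close>)
  define z where "z n = (snd n0 (\<pi> (s1 (i n))), snd e2 (\<zeta> (r2 n)))" for n
  have lz: "z \<longlonglongrightarrow> (snd n0 y0, snd e2 \<zeta>0)"
    unfolding z_def by (rule tendsto_Pair[OF filterlim_compose[OF ln i] le2])
  have evQ: "\<forall>\<^sub>F n in sequentially. z n \<in> Q" by (rule topological_tendstoD[OF lz Q(1,2)])
  have "isCont k (snd n0 y0, snd e2 \<zeta>0)"
    using smooth_on_continuous[OF Q(3)] Q(1,2) by (simp add: continuous_on_eq_continuous_at)
  then have lk: "(\<lambda>n. k (z n)) \<longlonglongrightarrow> k (snd n0 y0, snd e2 \<zeta>0)" using lz by (rule isCont_tendsto_compose)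
  have k0: "k (snd n0 y0, snd e2 \<zeta>0) = snd c (\<Theta> (y0, \<zeta>0))" using k[OF y0 e2(2) Q(2)] by simp
  define x0 where "x0 = snd c (\<Theta> (y0, \<zeta>0))"
  have ev: "\<forall>\<^sub>F n in sequentially. s1 (i n) \<in> fst c \<and> k (z n) = snd c (s1 (i n))"
    using evQ ev_e2 filterlim_iff[THEN iffD1, OF i, rule_format, OF ev_n]
  proof eventually_elim
    case (elim n)
    from k[OF elim(3,2)] elim(1) show ?case unfolding z_def using \<Theta>\<zeta>[of "r2 n"] unfolding i_def
        by auto
  qed
  show ?thesis
  proof (intro bexI[OF _ c(1)] bexI[of _ x0] allI impI)
    show "x0 \<in> chart_img c" unfolding x0_def using c(2) by blast
    fix \<epsilon> :: real assume \<epsilon>: "\<epsilon> > 0"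
    have "\<forall>\<^sub>F n in sequentially. dist (k (z n)) x0 < \<epsilon>" using lk \<epsilon> unfolding k0 x0_def
        by (rule tendstoD)
    moreover have "\<forall>\<^sub>F n in sequentially. b - \<tau> (r1 (i n)) < \<epsilon>"
      using order_tendstoD(2)[OF filterlim_compose[OF l\<tau> filterlim_compose[OF filterlim_subseq[OF
          r1] i]] \<epsilon>] .
    ultimately have "\<forall>\<^sub>F n in sequentially. b - \<tau> (r1 (i n)) < \<epsilon> \<and> s1 (i n) \<in> fst c
        \<and> dist (snd c (s1 (i n))) x0 < \<epsilon>"
      using ev by eventually_elim auto
    then obtain n where "b - \<tau> (r1 (i n)) < \<epsilon> \<and> s1 (i n) \<in> fst c \<and> dist (snd c (s1 (i n))) x0 < \<epsilon>"
      unfolding eventually_sequentially by blast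
    then show "\<exists>t. t \<in> {a<..<b} \<and> b - t < \<epsilon> \<and> \<gamma> t \<in> fst c \<and> dist (snd c (\<gamma> t)) x0 < \<epsilon>"
      using \<tau>(1) unfolding s1_def by blast
  qed
qed

end

section \<open>Completeness\<close>

context pp_bundle
begin

text \<open>These quantities refer to no chart, so they are defined along the whole curve and can be
  differentiated at each time in any adapted chart.\<close>

definition eta_vel where "eta_vel \<gamma> t = pull1 N \<pi> \<eta> (\<gamma> t) (velocity M \<gamma> t)"
definition A_vel where "A_vel \<gamma> t = Im (A (\<gamma> t) (velocity M \<gamma> t))"
definition energy where "energy \<gamma> t = g (\<gamma> t) (velocity M \<gamma> t) (velocity M \<gamma> t)"

lemma curve_values:
  assumes T: "open T" and \<gamma>: "geodesic_on M g T \<gamma>" and c: "c \<in> M" and d: "d \<in> B" and e: "e \<in> circle"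
    and t: "t \<in> T" "\<gamma> t \<in> fst c" "snd c (\<gamma> t) \<in> adapted c d e"
  defines "x \<equiv> snd c \<circ> \<gamma>"
  defines "x' \<equiv> vector_derivative x (at t)"
  shows "eta_vel \<gamma> t = frechet_derivative (uc c e) (at (x t)) x'"
    and "A_vel \<gamma> t = theta c (x t) x'"
    and "energy \<gamma> t = comp2 M g c (x t) x' x'"
    and "f (\<gamma> t) = (fB \<circ> chart_inv d) (qc c d (x t)) * fs (uc c e (x t))"
proof -
  note D = geodesic_onD[OF T \<gamma> c]
  define S where "S = T \<inter> \<gamma> -` fst c"
  have S: "open S" "t \<in> S" "\<gamma> ` S \<subseteq> fst c" unfolding S_def using D(1) t by auto
  have "smooth_on S x" using D(2) unfolding chart_geodesic_def S_def x_def by simp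
  then have "(snd c \<circ> \<gamma> has_vector_derivative x') (at t)"
    using smooth_on_real_derivatives(1)[OF S(1) _ S(2)] unfolding x_def x'_def by blast
  then have v: "velocity M \<gamma> t = chart_vec M c (\<gamma> t) x'" by (rule velocity_chart_vec[OF M c S])
  have p: "chart_inv c (x t) = \<gamma> t" unfolding x_def using chart_inv_simps(1)[OF M c t(2)] by simp
  have xa: "x t \<in> adapted c d e" unfolding x_def using t(3) by simp
  show "eta_vel \<gamma> t = frechet_derivative (uc c e) (at (x t)) x'"
    using eta_vec[OF c d e xa, of x'] unfolding eta_vel_def v p .
  show "A_vel \<gamma> t = theta c (x t) x'" unfolding A_vel_def v theta_def comp1_def p ..
  show "energy \<gamma> t = comp2 M g c (x t) x' x'" unfolding energy_def v comp2_def p ..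
  show "f (\<gamma> t) = (fB \<circ> chart_inv d) (qc c d (x t)) * fs (uc c e (x t))"
    using f_adapted[OF c d e xa] unfolding p .
qed

text \<open>All claims concern a single time and are verified in one adapted chart there. The
  expression in \<open>energy\<close>, \<open>eta_vel\<close> and \<open>s\<close> that is
  multiplied by \<open>Ca\<close> is the squared \<open>B\<close>-part of the velocity.\<close>

lemma geodesic_estimates:
  assumes T: "open T" and \<gamma>: "geodesic_on M g T \<gamma>" and t: "t \<in> T"
    and Ca: "Ca \<ge> 0" "\<And>d y v. d \<in> B \<Longrightarrow> y \<in> chart_img d \<Longrightarrow> (comp1 B \<alpha> d y v)\<^sup>2
        \<le> Ca * comp2 B hB d y v v"
    and C: "C \<ge> 0" "\<And>b. b \<in> carrier B \<Longrightarrow> \<bar>fB b\<bar> \<le> C"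
      "\<And>t. t \<in> {-1..1} \<Longrightarrow> \<bar>fs t\<bar> \<le> C \<and> \<bar>frechet_derivative fs (at t) 1\<bar> \<le> C"
  defines "F \<equiv> \<lambda>t. f (\<gamma> t) + 1"
  defines "s \<equiv> \<lambda>t. A_vel \<gamma> t - F t * eta_vel \<gamma> t"
  shows "(eta_vel \<gamma> has_real_derivative 0) (at t)"
    and "(energy \<gamma> has_real_derivative 0) (at t)"
    and "\<exists>D. (s has_real_derivative D) (at t) \<and> \<bar>D\<bar> \<le> 2 * pi * \<bar>eta_vel \<gamma> t\<bar> *
      (Ca * (energy \<gamma> t + 2 * eta_vel \<gamma> t * s t + F t * (eta_vel \<gamma> t)\<^sup>2) + 1) + (eta_vel \<gamma> t)\<^sup>2 *
          C\<^sup>2"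
    and "\<bar>F t\<bar> \<le> C\<^sup>2 + 1"
proof -
  have "\<gamma> t \<in> carrier M" using smooth_map_carrier[OF geodesic_on_smooth[OF \<gamma>]] t
      by (simp add: carrier_real_atlas)
  then obtain c where c: "c \<in> M" and tc: "\<gamma> t \<in> fst c" unfolding carrier_def by blast
  obtain d a where d: "d \<in> B" and a: "-1 \<le> a" "a \<le> 0"
      and ta: "snd c (\<gamma> t) \<in> adapted c d (circle_chart a)"
    using adapted_cover[OF c tc] by blast
  define e where "e = circle_chart a"
  have e: "e \<in> circle" unfolding e_def by (rule circle_chart_mem)
  define x where "x = snd c \<circ> \<gamma>"
  define x' where "x' t = vector_derivative x (at t)" for t
  define x'' where "x'' = vector_derivative x' (at t)"
  interpret L: pp_model "adapted c d e" "qc c d" "uc c e" "theta c" "chart_img d" "comp2 B hB d"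
      "comp1 B \<alpha> d" "fB \<circ> chart_inv d" fs
    by (rule local_model[OF c d e])
  note D = geodesic_onD[OF T \<gamma> c]
  define S0 where "S0 = T \<inter> \<gamma> -` fst c"
  have S0: "open S0" unfolding S0_def by (rule D(1))
  have xs: "smooth_on S0 x" using D(2) unfolding chart_geodesic_def S0_def x_def by simp
  define S where "S = {s \<in> S0. x s \<in> adapted c d e}"
  have S: "open S" unfolding S_def by (rule open_preimage_smooth[OF S0 xs L.oX])
  have tS: "t \<in> S" unfolding S_def S0_def x_def e_def using t tc ta by simp
  have vals: "eta_vel \<gamma> r = L.Du (x r) (x' r)" "A_vel \<gamma> r = theta c (x r) (x' r)" "energy \<gamma> r
      = L.G (x r) (x' r) (x' r)"
    "F r = L.F (x r)" if "r \<in> S" for r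
  proof -
    have r: "r \<in> T" "\<gamma> r \<in> fst c" "snd c (\<gamma> r) \<in> adapted c d e" using that
        unfolding S_def S0_def x_def by auto
    note cv = curve_values[OF T \<gamma> c d e r, folded x_def]
    show "eta_vel \<gamma> r = L.Du (x r) (x' r)" "A_vel \<gamma> r = theta c (x r) (x' r)" using cv(1,2)
        unfolding x'_def .
    show "energy \<gamma> r = L.G (x r) (x' r) (x' r)"
      using cv(3) g_model[OF c d e r(3)] unfolding x'_def x_def by simp
    show "F r = L.F (x r)" unfolding F_def L.F_def cv(4) ..
  qed
  have tS0: "t \<in> S0" using tS unfolding S_def by simp
  have xt: "x t \<in> adapted c d e" using tS unfolding S_def by simp
  have xd: "(x has_vector_derivative x' t) (at t)" unfolding x'_def
      by (rule smooth_on_real_derivatives(1)[OF S0 xs tS0])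
  have xd': "(x' has_vector_derivative x'') (at t)"
    unfolding x''_def by (rule smooth_on_real_derivatives(1)[OF S0 smooth_on_real_derivatives(2)[OF
        S0 xs, folded x'_def] tS0])
  have xc: "x t \<in> chart_img c" unfolding x_def using tc by simp
  have el: "EL L.G (x t) (x' t) x'' y = 0" for y
  proof -
    have "x'' + chr (comp2 M g c) (x t) (x' t) (x' t) = 0"
      using D(2) tS0 unfolding chart_geodesic_def S0_def x_def[symmetric] x'_def x''_def by simp
    then have "EL (comp2 M g c) (x t) (x' t) x'' y = 0"
      using geodesic_eq_EL[OF metric[OF c] nondeg[OF c] xc] by blast
    moreover have "frechet_derivative (\<lambda>z. comp2 M g c z v w) (at (x t))
        = frechet_derivative (\<lambda>z. L.G z v w) (at (x t))" for v w
      by (rule frechet_derivative_at[OF has_derivative_transform_within_open[OF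
          bil_field_has_derivative[OF L.Gfield xt] L.oX xt], symmetric])
        (simp add: g_model[OF c d e])
    ultimately show ?thesis unfolding EL_def using g_model[OF c d e xt] by simp
  qed
  note cons = L.geodesic_conservation[OF xt xd xd' el]
  show "(eta_vel \<gamma> has_real_derivative 0) (at t)"
    by (rule has_field_derivative_transform_within_open[OF cons(1) S tS]) (simp add: vals)
  show "(energy \<gamma> has_real_derivative 0) (at t)"
    by (rule has_field_derivative_transform_within_open[OF EL_energy[OF L.Gfield xt xd xd' el] S
        tS]) (simp add: vals)
  define D where "D = 2 * pi * L.Du (x t) (x' t) * comp1 B \<alpha> d (qc c d (x t)) (L.Dq (x t) (x' t))
      - (L.Du (x t) (x' t))\<^sup>2 * ((fB \<circ> chart_inv d) (qc c d (x t)) * frechet_derivative fs (at (uc c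
          e (x t))) 1) / 2"
  have sD: "(s has_real_derivative D) (at t)" unfolding D_def s_def
    by (rule has_field_derivative_transform_within_open[OF cons(2) S tS]) (simp add: vals)
  have qY: "qc c d (x t) \<in> chart_img d" by (rule L.qY[OF xt])
  have fb: "\<bar>(fB \<circ> chart_inv d) (qc c d (x t))\<bar> \<le> C"
    using C(2)[OF chart_in_carrier[OF d chart_inv_simps(3)[OF B d qY]]] by simp
  have "uc c e (x t) \<in> {a<..<a+1}"
    using adaptedD(6)[OF c d e xt] circle_chart_img[of a] unfolding uc_def e_def by auto
  then have ut: "uc c e (x t) \<in> {-1..1}" using a by auto
  note fsb = C(3)[OF ut]
  show "\<bar>F t\<bar> \<le> C\<^sup>2 + 1"
  proof -
    have "\<bar>F t\<bar> \<le> \<bar>(fB \<circ> chart_inv d) (qc c d (x t))\<bar> * \<bar>fs (uc c e (x t))\<bar> + 1"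
      unfolding vals(4)[OF tS] L.F_def by (metis abs_mult abs_one abs_triangle_ineq)
    also have "\<dots> \<le> C * C + 1" using fb fsb C(1) by (intro add_mono mult_mono) auto
    finally show ?thesis by (simp add: power2_eq_square)
  qed
  define K where "K = L.K (x t) (x' t) (x' t)"
  have K: "K = energy \<gamma> t + 2 * eta_vel \<gamma> t * s t + F t * (eta_vel \<gamma> t)\<^sup>2"
    unfolding K_def s_def vals[OF tS] L.G_def by (simp add: algebra_simps power2_eq_square)
  have al: "\<bar>comp1 B \<alpha> d (qc c d (x t)) (L.Dq (x t) (x' t))\<bar> \<le> Ca * K + 1"
  proof -
    define z where "z = comp1 B \<alpha> d (qc c d (x t)) (L.Dq (x t) (x' t))"
    have "z\<^sup>2 \<le> Ca * K" unfolding z_def K_def L.K_def by (rule Ca(2)[OF d qY])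
    \<comment> \<open>A root of the square would be sharper, but as \<open>K\<close> is affine in
      \<open>s\<close>, this already gives linear growth.\<close>
    moreover have "\<bar>z\<bar> \<le> z\<^sup>2 + 1"
    proof -
      have "0 \<le> (\<bar>z\<bar> - 1)\<^sup>2" by simp
      then have "2 * \<bar>z\<bar> \<le> 1 + z\<^sup>2" by (simp add: power2_eq_square algebra_simps flip: abs_mult)
      then show ?thesis by linarith
    qed
    ultimately show ?thesis unfolding z_def by linarith
  qed
  have "\<bar>D\<bar> \<le> 2 * pi * \<bar>eta_vel \<gamma> t\<bar> * (Ca * K + 1) + (eta_vel \<gamma> t)\<^sup>2 * C\<^sup>2"
  proof -
    have "\<bar>D\<bar> \<le> \<bar>2 * pi * L.Du (x t) (x' t) * comp1 B \<alpha> d (qc c d (x t)) (L.Dq (x t) (x' t))\<bar>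
      + \<bar>(L.Du (x t) (x' t))\<^sup>2 * ((fB \<circ> chart_inv d) (qc c d (x t)) * frechet_derivative fs (at (uc
          c e (x t))) 1) / 2\<bar>"
      unfolding D_def by (rule abs_triangle_ineq4)
    also have "\<dots> \<le> 2 * pi * \<bar>eta_vel \<gamma> t\<bar> * (Ca * K + 1) + (eta_vel \<gamma> t)\<^sup>2 * C\<^sup>2"
    proof (rule add_mono)
      show "\<bar>2 * pi * L.Du (x t) (x' t) * comp1 B \<alpha> d (qc c d (x t)) (L.Dq (x t) (x' t))\<bar>
          \<le> 2 * pi * \<bar>eta_vel \<gamma> t\<bar> * (Ca * K + 1)"
        unfolding vals(1)[OF tS] abs_mult using al by (intro mult_mono) auto
      have "\<bar>(fB \<circ> chart_inv d) (qc c d (x t))\<bar> * \<bar>frechet_derivative fs (at (uc c e (x t))) 1\<bar>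
          \<le> C * C"
        using fb fsb C(1) by (intro mult_mono) auto
      then have "(L.Du (x t) (x' t))\<^sup>2 * (\<bar>(fB \<circ> chart_inv d) (qc c d (x t))\<bar> * \<bar>frechet_derivative
          fs (at (uc c e (x t))) 1\<bar>) \<le> (L.Du (x t) (x' t))\<^sup>2 * C\<^sup>2"
        unfolding power2_eq_square[of C] by (rule mult_left_mono) simp
      moreover have "\<bar>(L.Du (x t) (x' t))\<^sup>2 * ((fB \<circ> chart_inv d) (qc c d (x t)) *
          frechet_derivative fs (at (uc c e (x t))) 1) / 2\<bar>
        \<le> (L.Du (x t) (x' t))\<^sup>2 * (\<bar>(fB \<circ> chart_inv d) (qc c d (x t))\<bar> * \<bar>frechet_derivative fs (at
            (uc c e (x t))) 1\<bar>)"
        by (simp add: abs_mult)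
      ultimately show "\<bar>(L.Du (x t) (x' t))\<^sup>2 * ((fB \<circ> chart_inv d) (qc c d (x t)) *
          frechet_derivative fs (at (uc c e (x t))) 1) / 2\<bar> \<le> (eta_vel \<gamma> t)\<^sup>2 * C\<^sup>2"
        unfolding vals(1)[OF tS] by linarith
    qed
    finally show ?thesis .
  qed
  then show "\<exists>D. (s has_real_derivative D) (at t) \<and> \<bar>D\<bar> \<le> 2 * pi * \<bar>eta_vel \<gamma> t\<bar> *
      (Ca * (energy \<gamma> t + 2 * eta_vel \<gamma> t * s t + F t * (eta_vel \<gamma> t)\<^sup>2) + 1) + (eta_vel \<gamma> t)\<^sup>2 *
          C\<^sup>2"
    using sD unfolding K by blast
qed

text \<open>The bounded expression is the squared length of the velocity in the Riemannian metric
  formed from \<theta>, \<open>du\<close> and the metric of \<open>B\<close>: its last summand is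
  the \<open>B\<close>-part, now written with \<open>A_vel\<close> in place of
  \<open>s\<close>.\<close>

lemma geodesic_velocity_bounded:
  assumes cB: "compact_space (mtop B)" and ab: "a < b" and \<gamma>: "geodesic_on M g {a<..<b} \<gamma>"
  shows "\<exists>a1 Z. a \<le> a1 \<and> a1 < b \<and> (\<forall>t\<in>{a1<..<b}.
    (A_vel \<gamma> t)\<^sup>2 + (eta_vel \<gamma> t)\<^sup>2 + (energy \<gamma> t + 2 * eta_vel \<gamma> t * A_vel \<gamma> t - (f (\<gamma> t) + 1) *
        (eta_vel \<gamma> t)\<^sup>2) \<le> Z)"
proof -
  obtain Ca where Ca: "Ca \<ge> 0" "\<And>d y v. d \<in> B \<Longrightarrow> y \<in> chart_img d \<Longrightarrow> (comp1 B \<alpha> d y v)\<^sup>2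
      \<le> Ca * comp2 B hB d y v v"
    using alpha_bounded[OF cB] by blast
  obtain C1 where C1: "C1 \<ge> 0" "\<And>b. b \<in> carrier B \<Longrightarrow> \<bar>fB b\<bar> \<le> C1" using fB_bounded[OF cB] by blast
  obtain C2 where C2: "C2 \<ge> 0" "\<And>t. t \<in> {-1..1} \<Longrightarrow> \<bar>fs t\<bar> \<le> C2 \<and> \<bar>frechet_derivative fs (at t) 1\<bar>
      \<le> C2" using fs_bounded by blast
  define C where "C = max C1 C2"
  have C: "C \<ge> 0" "\<And>b. b \<in> carrier B \<Longrightarrow> \<bar>fB b\<bar> \<le> C"
      "\<And>t. t \<in> {-1..1} \<Longrightarrow> \<bar>fs t\<bar> \<le> C \<and> \<bar>frechet_derivative fs (at t) 1\<bar> \<le> C"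
    unfolding C_def using C1 C2 by (auto simp: le_max_iff_disj)
  define F where "F t = f (\<gamma> t) + 1" for t
  define s where "s t = A_vel \<gamma> t - F t * eta_vel \<gamma> t" for t
  note est = geodesic_estimates[OF open_greaterThanLessThan \<gamma> _ Ca C, folded F_def, folded s_def]
  \<comment> \<open>The constants of motion are read off at an interior time. A bound to the right
    of it is enough for an extension beyond \<open>b\<close>.\<close>
  define t0 where "t0 = (a + b) / 2"
  have t0: "a < t0" "t0 < b" unfolding t0_def using ab by auto
  define c0 where "c0 = eta_vel \<gamma> t0"
  define E0 where "E0 = energy \<gamma> t0"
  have const: "k t = k t0" if "\<And>t. t \<in> {a<..<b} \<Longrightarrow> (k has_real_derivative 0) (at t)" "t \<in> {a<..<b}"
      for k :: "real \<Rightarrow> real" and t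
    by (rule DERIV_isconst3[OF ab that(2) _ that(1)]) (use t0 in auto)
  have ce: "eta_vel \<gamma> t = c0" "energy \<gamma> t = E0" if "t \<in> {a<..<b}" for t
    unfolding c0_def E0_def using const[of "eta_vel \<gamma>" t] const[of "energy \<gamma>" t] est(1,2) that
        by auto
  define H where "H = (C\<^sup>2 + 1) * c0\<^sup>2"
  have Fc: "\<bar>F t * c0\<^sup>2\<bar> \<le> H" if "t \<in> {a<..<b}" for t
    unfolding H_def abs_mult using est(4)[OF that] by (simp add: mult_right_mono)
  have H0: "H \<ge> 0" unfolding H_def by simp
  \<comment> \<open>Collects the estimate of \<open>s'\<close> into a multiple of
    \<open>1 + \<bar>s t\<bar>\<close>: \<open>2 * \<bar>c0\<bar>\<close> comes from the term linear
    in \<open>s\<close>, and all other terms are constants, which the factor at least 1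
    absorbs.\<close>
  define L where "L = 2 * pi * \<bar>c0\<bar> * (Ca * (\<bar>E0\<bar> + 2 * \<bar>c0\<bar> + H) + 1) + c0\<^sup>2 * C\<^sup>2"
  have L: "L \<ge> 0" unfolding L_def using Ca(1) H0 by simp
  have "\<exists>D. (s has_real_derivative D) (at t) \<and> \<bar>D\<bar> \<le> L * (1 + \<bar>s t\<bar>)" if t: "t \<in> {a<..<b}" for t
  proof -
    obtain D where D: "(s has_real_derivative D) (at t)" "\<bar>D\<bar>
        \<le> 2 * pi * \<bar>c0\<bar> * (Ca * (E0 + 2 * c0 * s t + F t * c0\<^sup>2) + 1) + c0\<^sup>2 * C\<^sup>2"
      using est(3)[OF t] unfolding ce[OF t] by blast
    define u where "u = 1 + \<bar>s t\<bar>"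
    have u: "u \<ge> 1" unfolding u_def by simp
    have "E0 + 2 * c0 * s t + F t * c0\<^sup>2 \<le> \<bar>E0\<bar> * u + 2 * \<bar>c0\<bar> * u + H * u"
    proof -
      have "E0 \<le> \<bar>E0\<bar> * u" using u mult_left_mono[of 1 u "\<bar>E0\<bar>"] by simp
      moreover have "2 * c0 * s t \<le> 2 * \<bar>c0\<bar> * u"
      proof -
        have "c0 * s t \<le> \<bar>c0\<bar> * \<bar>s t\<bar>" by (metis abs_ge_self abs_mult)
        also have "\<dots> \<le> \<bar>c0\<bar> * u" unfolding u_def by (intro mult_left_mono) auto
        finally show ?thesis by simp
      qed
      moreover have "F t * c0\<^sup>2 \<le> H * u" using Fc[OF t] u mult_left_mono[of 1 u H] H0 by simp
      ultimately show ?thesis by linarith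
    qed
    then have "Ca * (E0 + 2 * c0 * s t + F t * c0\<^sup>2) \<le> Ca * ((\<bar>E0\<bar> + 2 * \<bar>c0\<bar> + H) * u)"
      using Ca(1) by (intro mult_left_mono) (simp_all add: algebra_simps)
    then have "Ca * (E0 + 2 * c0 * s t + F t * c0\<^sup>2) + 1 \<le> (Ca * (\<bar>E0\<bar> + 2 * \<bar>c0\<bar> + H) + 1) * u"
      using u by (simp add: algebra_simps)
    then have "2 * pi * \<bar>c0\<bar> * (Ca * (E0 + 2 * c0 * s t + F t * c0\<^sup>2) + 1)
        \<le> 2 * pi * \<bar>c0\<bar> * ((Ca * (\<bar>E0\<bar> + 2 * \<bar>c0\<bar> + H) + 1) * u)"
      by (rule mult_left_mono) simp
    moreover have "c0\<^sup>2 * C\<^sup>2 \<le> c0\<^sup>2 * C\<^sup>2 * u" using u mult_left_mono[of 1 u "c0\<^sup>2 * C\<^sup>2"] by simp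
    moreover have "L * u = 2 * pi * \<bar>c0\<bar> * ((Ca * (\<bar>E0\<bar> + 2 * \<bar>c0\<bar> + H) + 1) * u) + c0\<^sup>2 * C\<^sup>2 * u"
      unfolding L_def by (simp add: distrib_right)
    ultimately have "\<bar>D\<bar> \<le> L * u" using D(2) by linarith
    then show ?thesis using D(1) unfolding u_def by blast
  qed
  from linear_growth_bounded[OF t0 L this] obtain S where S: "\<And>t. t \<in> {t0..<b} \<Longrightarrow> \<bar>s t\<bar> \<le> S" by blast
  define w where "w = S + (C\<^sup>2 + 1) * \<bar>c0\<bar>"
  show ?thesis
  proof (rule exI[of _ t0], rule exI[of _ "w\<^sup>2 + c0\<^sup>2 + (\<bar>E0\<bar> + 2 * \<bar>c0\<bar> * w + H)"], intro conjI
      ballI)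
    fix t assume t: "t \<in> {t0<..<b}"
    then have t': "t \<in> {a<..<b}" using t0 by auto
    have Aw: "\<bar>A_vel \<gamma> t\<bar> \<le> w"
    proof -
      have "A_vel \<gamma> t = s t + F t * c0" unfolding s_def ce[OF t'] by simp
      then have "\<bar>A_vel \<gamma> t\<bar> \<le> \<bar>s t\<bar> + \<bar>F t\<bar> * \<bar>c0\<bar>" by (metis abs_mult abs_triangle_ineq)
      also have "\<dots> \<le> w" unfolding w_def using S[of t] t est(4)[OF t']
          by (intro add_mono mult_right_mono) auto
      finally show ?thesis .
    qed
    then have "(A_vel \<gamma> t)\<^sup>2 \<le> w\<^sup>2" by (metis abs_ge_zero power2_abs power_mono)
    moreover have "2 * c0 * A_vel \<gamma> t \<le> 2 * \<bar>c0\<bar> * w"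
    proof -
      have "c0 * A_vel \<gamma> t \<le> \<bar>c0\<bar> * \<bar>A_vel \<gamma> t\<bar>" by (metis abs_ge_self abs_mult)
      also have "\<dots> \<le> \<bar>c0\<bar> * w" using Aw by (intro mult_left_mono) auto
      finally show ?thesis by simp
    qed
    moreover have "- (F t * c0\<^sup>2) \<le> H" using Fc[OF t'] by linarith
    ultimately show "(A_vel \<gamma> t)\<^sup>2 + (eta_vel \<gamma> t)\<^sup>2 + (energy \<gamma> t + 2 * eta_vel \<gamma> t * A_vel \<gamma> t -
        (f (\<gamma> t) + 1) * (eta_vel \<gamma> t)\<^sup>2)
       \<le> w\<^sup>2 + c0\<^sup>2 + (\<bar>E0\<bar> + 2 * \<bar>c0\<bar> * w + H)"
      unfolding ce[OF t'] F_def[symmetric] using abs_ge_self[of E0] by linarith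
  qed (use t0 in auto)
qed

lemma geodesic_extendable:
  assumes H: "Hausdorff_space (mtop M)" and cB: "compact_space (mtop B)" and ab: "a < b"
      and \<gamma>: "geodesic_on M g {a<..<b} \<gamma>"
  shows "\<exists>\<epsilon>>0. \<exists>\<gamma>'. geodesic_on M g {a<..<b+\<epsilon>} \<gamma>' \<and> (\<forall>t\<in>{a<..<b}. \<gamma>' t = \<gamma> t)"
proof -
  obtain a1 Z where a1: "a \<le> a1" "a1 < b" and Z: "\<And>t. t \<in> {a1<..<b} \<Longrightarrow>
    (A_vel \<gamma> t)\<^sup>2 + (eta_vel \<gamma> t)\<^sup>2 + (energy \<gamma> t + 2 * eta_vel \<gamma> t * A_vel \<gamma> t - (f (\<gamma> t) + 1) *
        (eta_vel \<gamma> t)\<^sup>2) \<le> Z"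
    using geodesic_velocity_bounded[OF cB ab \<gamma>] by blast
  have "\<gamma> t \<in> carrier M" if "t \<in> {a1<..<b}" for t
    using smooth_map_carrier[OF geodesic_on_smooth[OF \<gamma>]] that a1 by (simp add: carrier_real_atlas)
  from curve_accumulates[where \<gamma>=\<gamma>, OF cB a1(2) this]
  obtain c x0 where c: "c \<in> M" and x0: "x0 \<in> chart_img c"
    and acc: "\<And>\<epsilon>. \<epsilon> > 0 \<Longrightarrow> \<exists>t. t \<in> {a1<..<b} \<and> b - t < \<epsilon> \<and> \<gamma> t \<in> fst c \<and> dist (snd c (\<gamma> t)) x0 < \<epsilon>"
        by blast
  obtain d a2 where d: "d \<in> B" and xa: "x0 \<in> adapted c d (circle_chart a2)"
      using adapted_cover_img[OF c x0] by blast
  define e where "e = circle_chart a2"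
  have e: "e \<in> circle" unfolding e_def by (rule circle_chart_mem)
  interpret L: pp_model "adapted c d e" "qc c d" "uc c e" "theta c" "chart_img d" "comp2 B hB d"
      "comp1 B \<alpha> d" "fB \<circ> chart_inv d" fs
    by (rule local_model[OF c d e])
  obtain r where r: "r > 0" "cball x0 r \<subseteq> adapted c d e"
    using L.oX xa unfolding e_def[symmetric] open_contains_cball by blast
  have sub: "cball x0 r \<subseteq> chart_img c" using r(2) adaptedD(3)[OF c d e] by blast
  obtain m where m: "m > 0" "\<And>x v. x \<in> cball x0 r \<Longrightarrow> m * (norm v)\<^sup>2
      \<le> (theta c x v)\<^sup>2 + (L.Du x v)\<^sup>2 + L.K x v v"
    using L.speed_lower_bound[OF compact_cball r(2)] by blast
  \<comment> \<open>From \<open>m * (norm v)\<^sup>2 \<le> Z\<close>; the absolute value makes the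
    root meaningful whatever the sign of \<open>Z\<close>.\<close>
  define S where "S = sqrt (\<bar>Z\<bar> / m)"
  have S0: "S \<ge> 0" unfolding S_def using m by simp
  have bound: "norm (vector_derivative (snd c \<circ> \<gamma>) (at t)) \<le> S"
    if t: "t \<in> {a1<..<b}" "\<gamma> t \<in> fst c" "snd c (\<gamma> t) \<in> cball x0 r" for t
  proof -
    have tJ: "t \<in> {a<..<b}" using t(1) a1 by auto
    have ta: "snd c (\<gamma> t) \<in> adapted c d e" using t(3) r(2) by blast
    define v where "v = vector_derivative (snd c \<circ> \<gamma>) (at t)"
    define x where "x = (snd c \<circ> \<gamma>) t"
    note cv = curve_values[OF open_greaterThanLessThan \<gamma> c d e tJ t(2) ta, folded v_def x_def]
    have "L.K x v v = energy \<gamma> t + 2 * eta_vel \<gamma> t * A_vel \<gamma> t - (f (\<gamma> t) + 1) * (eta_vel \<gamma> t)\<^sup>2"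
      using g_model[OF c d e ta, of v v] unfolding cv L.G_def L.F_def
          by (simp add: x_def algebra_simps power2_eq_square)
    then have "m * (norm v)\<^sup>2 \<le> Z"
      using m(2)[OF t(3), of v] Z[OF t(1)] cv(1,2) unfolding x_def by simp
    then have "(norm v)\<^sup>2 \<le> \<bar>Z\<bar> / m" using m(1) by (simp add: pos_le_divide_eq mult.commute)
    then have "norm v \<le> S" unfolding S_def by (rule real_le_rsqrt)
    then show ?thesis unfolding v_def .
  qed
  show ?thesis by (rule geodesic_extend_at_accumulation[OF H \<gamma> c r(1) sub S0 a1 bound acc])
qed

theorem total_space_complete:
  assumes "Hausdorff_space (mtop M)" "compact_space (mtop B)"
  shows "geodesically_complete M g"
  by (rule completeI) (rule geodesic_extendable[OF assms])

end

theorem corollary2: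
  fixes B :: "('b, 'e::euclidean_space) atlas"
    and h\<^sub>B :: "('b, real) tensor2"
    and \<omega> :: "('b, real) form1 set"
    and \<alpha> :: "('b, real) form1"
    and N :: "('b \<times> complex, 'e \<times> real) atlas"
    and h :: "('b \<times> complex, real) tensor2"
    and \<eta> :: "('b \<times> complex, real) form1"
    and \<sigma> :: "('b \<times> complex, real) tensor2"
    and M :: "('m, 'k::euclidean_space) atlas"
    and \<pi> :: "'m \<Rightarrow> 'b \<times> complex"
    and R :: "'m \<Rightarrow> complex \<Rightarrow> 'm"
    and A :: "('m, complex) form1"
    and f\<^sub>B :: "'b \<Rightarrow> real"
    and f\<^sub>S :: "complex \<Rightarrow> real"
    and f :: "'m \<Rightarrow> real"
    and g :: "('m, real) tensor2"
  assumes "manifold B" and "compact_space (mtop B)"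
    and "riemannian_metric B h\<^sub>B" and "ricci_flat B h\<^sub>B"
    and N: "N = prod_atlas B circle"
    and h: "h = (\<lambda>y X Y. pull2 B fst h\<^sub>B y X Y + pull2 circle snd (sym_prod du du) y X Y)"
    and \<eta>: "\<eta> = pull1 circle snd du"
    and "\<omega> \<in> H1_dR B \<inter> H1_int B" and "\<alpha> \<in> \<omega>"
    and \<sigma>: "\<sigma> = wedge (pull1 B fst \<alpha>) \<eta>"
    and "chern_class1 N M \<pi> R = dR_class2 N \<sigma>"
    and "smooth_fun B f\<^sub>B" and "smooth_fun circle f\<^sub>S"
    and f: "f = (\<lambda>y. f\<^sub>B (fst y) * f\<^sub>S (snd y)) \<circ> \<pi>"
    and "has_type N h M \<pi> R g \<sigma> A \<eta> f"
  shows "(ricci_flat M g \<longrightarrow> geodesically_complete M g) \<and> geodesically_complete M g"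
proof -
  note type = \<open>has_type N h M \<pi> R g \<sigma> A \<eta> f\<close>[unfolded has_type_def Let_def]
  have \<alpha>: "one_form B \<alpha>"
    using \<open>\<alpha> \<in> \<omega>\<close> \<open>\<omega> \<in> H1_dR B \<inter> H1_int B\<close> unfolding H1_dR_def dR_class1_def closed1_def by auto
  have "pp_bundle B h\<^sub>B \<alpha> N h \<eta> \<sigma> M \<pi> R A f\<^sub>B f\<^sub>S f g"
    using assms type \<alpha> by (intro pp_bundle.intro) (simp_all add: manifold_def)
  moreover have "Hausdorff_space (mtop M)" using type unfolding manifold_def by blast
  ultimately have "geodesically_complete M g" using pp_bundle.total_space_complete \<open>compact_space (mtop B)\<close> by blast
  then show ?thesis by simp
qed

end
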